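(* Let $k$ be a field, let $T$ be an affine domain over $k$, and let $R$ be a $k$-subalgebra of $T$. Then: (1) $\dim(R)=\mathrm{t.d.}(R)$ and $R$ is a Jaffard domain. (2) $\dim(R)=\mathrm{ht}(P\cap R)+\mathrm{t.d.}\left(\frac{R}{P\cap R}\right)$ for each prime ideal $P$ of $T$. In particular, $\dim(R)=\mathrm{ht}(M)$ for each maximal ideal $M$ of $R$ that survives in $T$.
   Context: All rings and algebras are commutative with identity element and non-zero, and all ring homomorphisms are unital. An affine domain over a ring $A$ is a finitely generated $A$-algebra that is an integral domain. If $D$ is an integral domain that is a $k$-algebra, $\mathrm{t.d.}(D)$ denotes the transcendence degree over $k$ of the quotient field of $D$. $\mathrm{ht}$ denotes the height of a prime ideal. A prime ideal $p$ of $R$ survives in an extension ring $T\supseteq R$ if $pT\neq T$. For an integral domain $D$, $\dim(D)$ denotes the Krull dimension and $\dim_v(D)$ the valuative dimension, i.e. the supremum of the Krull dimensions of the valuation overrings of $D$ (valuation rings between $D$ and its quotient field). A finite-dimensional integral domain $D$ is Jaffard if $\dim(D[X_1,\dots,X_n])=n+\dim(D)$ for all $n\geq 1$; equivalently, $\dim(D)=\dim_v(D)$. *)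

theory Defs
  imports "HOL-Algebra.Algebra" "HOL-Library.Extended_Nat"
begin

section \<open>Algebras over a ring\<close>

text \<open>A \<open>k\<close>-algebra is a record \<open>T\<close> with \<^term>\<open>algebra k T\<close>. It is a module record, so that
  \<open>T\<lparr>carrier := A\<rparr>\<close> keeps the scalar multiplication when \<open>A\<close> is a subalgebra.\<close>

definition scalars :: "('k, 'c) ring_scheme \<Rightarrow> ('k, 'a, 'b) module_scheme \<Rightarrow> 'a set" where
  "scalars k T = (\<lambda>c. c \<odot>\<^bsub>T\<^esub> \<one>\<^bsub>T\<^esub>) ` carrier k"

definition finitely_generated_algebra ::
    "('k, 'c) ring_scheme \<Rightarrow> ('k, 'a, 'b) module_scheme \<Rightarrow> bool" where
  "finitely_generated_algebra k T \<longleftrightarrow>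
     algebra k T \<and>
     (\<exists>S. finite S \<and> S \<subseteq> carrier T \<and> generate_ring T (scalars k T \<union> S) = carrier T)"

definition affine_domain :: "('k, 'c) ring_scheme \<Rightarrow> ('k, 'a, 'b) module_scheme \<Rightarrow> bool" where
  "affine_domain k T \<longleftrightarrow> finitely_generated_algebra k T \<and> domain T"

text \<open>The library's \<^locale>\<open>subalgebra\<close> is about linear subspaces of a ring that contains the
  scalars; it does not ask for closure under multiplication.\<close>

definition is_subalgebra ::
    "('k, 'c) ring_scheme \<Rightarrow> 'a set \<Rightarrow> ('k, 'a, 'b) module_scheme \<Rightarrow> bool" where
  "is_subalgebra k A T \<longleftrightarrow> subring A T \<and> submodule A k T"

text \<open>Scalar multiplication on cosets is defined in the same way as the library's
  \<^const>\<open>rcoset_mult\<close>: for an ideal \<open>I\<close>, all members of the union coincide.\<close>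

definition quotient_algebra :: "('k, 'a, 'b) module_scheme \<Rightarrow> 'a set \<Rightarrow> ('k, 'a set) module" where
  "quotient_algebra R I =
     ring.extend (R Quot I)
       (module.fields (\<lambda>c U. \<Union>u\<in>U. I +>\<^bsub>R\<^esub> (c \<odot>\<^bsub>R\<^esub> u)))"


section \<open>Krull dimension and height\<close>

definition prime_chain :: "('a, 'b) ring_scheme \<Rightarrow> nat \<Rightarrow> (nat \<Rightarrow> 'a set) \<Rightarrow> bool" where
  "prime_chain R n p \<longleftrightarrow> (\<forall>i\<le>n. primeideal (p i) R) \<and> (\<forall>i<n. p i \<subset> p (Suc i))"

definition krull_dim :: "('a, 'b) ring_scheme \<Rightarrow> enat" where
  "krull_dim R = (SUP n\<in>{n. \<exists>p. prime_chain R n p}. enat n)"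

definition height :: "('a, 'b) ring_scheme \<Rightarrow> 'a set \<Rightarrow> enat" where
  "height R P = (SUP n\<in>{n. \<exists>p. prime_chain R n p \<and> p n = P}. enat n)"

definition survives :: "'a set \<Rightarrow> ('a, 'b) ring_scheme \<Rightarrow> bool" where
  "survives P T \<longleftrightarrow> Idl\<^bsub>T\<^esub> P \<noteq> carrier T"


section \<open>Quotient field\<close>

definition fraction_rel :: "('a, 'b) ring_scheme \<Rightarrow> (('a \<times> 'a) \<times> ('a \<times> 'a)) set" where
  "fraction_rel D = {((a, b), (c, d)) | a b c d.
     a \<in> carrier D \<and> b \<in> carrier D - {\<zero>\<^bsub>D\<^esub>} \<and> c \<in> carrier D \<and> d \<in> carrier D - {\<zero>\<^bsub>D\<^esub>} \<and>
     a \<otimes>\<^bsub>D\<^esub> d = c \<otimes>\<^bsub>D\<^esub> b}"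

definition fraction :: "('a, 'b) ring_scheme \<Rightarrow> 'a \<Rightarrow> 'a \<Rightarrow> ('a \<times> 'a) set" where
  "fraction D a b = fraction_rel D `` {(a, b)}"

definition quotient_field :: "('a, 'b) ring_scheme \<Rightarrow> ('a \<times> 'a) set ring" where
  "quotient_field D =
     \<lparr>carrier = (carrier D \<times> (carrier D - {\<zero>\<^bsub>D\<^esub>})) // fraction_rel D,
      monoid.mult = (\<lambda>U V. \<Union>(a, b)\<in>U. \<Union>(c, d)\<in>V. fraction D (a \<otimes>\<^bsub>D\<^esub> c) (b \<otimes>\<^bsub>D\<^esub> d)),
      one = fraction D \<one>\<^bsub>D\<^esub> \<one>\<^bsub>D\<^esub>,
      ring.zero = fraction D \<zero>\<^bsub>D\<^esub> \<one>\<^bsub>D\<^esub>,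
      add = (\<lambda>U V. \<Union>(a, b)\<in>U. \<Union>(c, d)\<in>V.
               fraction D (a \<otimes>\<^bsub>D\<^esub> d \<oplus>\<^bsub>D\<^esub> c \<otimes>\<^bsub>D\<^esub> b) (b \<otimes>\<^bsub>D\<^esub> d))\<rparr>"


section \<open>Transcendence degree\<close>

text \<open>The value at the elements of \<open>S\<close> of a polynomial whose indeterminates are
  indexed by \<open>S\<close> itself (a monomial is a multiset over \<open>S\<close>).\<close>

definition eval_at_indices :: "('a, 'b) ring_scheme \<Rightarrow> ('a multiset \<Rightarrow> 'a) \<Rightarrow> 'a" where
  "eval_at_indices L p =
     (\<Oplus>\<^bsub>L\<^esub>m\<in>{m. p m \<noteq> \<zero>\<^bsub>L\<^esub>}. p m \<otimes>\<^bsub>L\<^esub> (\<Otimes>\<^bsub>L\<^esub>x\<in>set_mset m. x [^]\<^bsub>L\<^esub> count m x))"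

definition algebraically_independent ::
    "('a, 'b) ring_scheme \<Rightarrow> 'a set \<Rightarrow> 'a set \<Rightarrow> bool" where
  "algebraically_independent L K S \<longleftrightarrow>
     S \<subseteq> carrier L \<and>
     (\<forall>p\<in>ring.indexed_pset L S K.
        eval_at_indices L p = \<zero>\<^bsub>L\<^esub> \<longrightarrow> p = ring.indexed_const L \<zero>\<^bsub>L\<^esub>)"

text \<open>Infinite transcendence degrees are not distinguished: they are all \<^term>\<open>\<infinity> :: enat\<close>.\<close>

definition transcendence_degree :: "('a, 'b) ring_scheme \<Rightarrow> 'a set \<Rightarrow> enat" where
  "transcendence_degree L K =
     (SUP S\<in>{S. finite S \<and> algebraically_independent L K S}. enat (card S))"

text \<open>For a domain \<open>D\<close> that is a \<open>k\<close>-algebra, \<open>k\<close> is identified with its image in the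
  quotient field of \<open>D\<close>.\<close>

definition td :: "('k, 'c) ring_scheme \<Rightarrow> ('k, 'a, 'b) module_scheme \<Rightarrow> enat" where
  "td k D = transcendence_degree (quotient_field D) ((\<lambda>x. fraction D x \<one>\<^bsub>D\<^esub>) ` scalars k D)"


section \<open>Polynomial rings and Jaffard domains\<close>

text \<open>The library defines the underlying set, the constants and the addition of indexed
  polynomials, but only the product with a single indeterminate. The product here is the
  convolution over all factorizations of a monomial.\<close>

definition indexed_poly_ring :: "('a, 'b) ring_scheme \<Rightarrow> 'i set \<Rightarrow> ('i multiset \<Rightarrow> 'a) ring" where
  "indexed_poly_ring R I =
     \<lparr>carrier = ring.indexed_pset R I (carrier R),
      monoid.mult = (\<lambda>p q m. \<Oplus>\<^bsub>R\<^esub>u\<in>{u. u \<subseteq># m}. p u \<otimes>\<^bsub>R\<^esub> q (m - u)),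
      one = ring.indexed_const R \<one>\<^bsub>R\<^esub>,
      ring.zero = ring.indexed_const R \<zero>\<^bsub>R\<^esub>,
      add = ring.indexed_padd R\<rparr>"

definition jaffard_domain :: "('a, 'b) ring_scheme \<Rightarrow> bool" where
  "jaffard_domain D \<longleftrightarrow>
     domain D \<and> krull_dim D \<noteq> \<infinity> \<and>
     (\<forall>n\<ge>1. krull_dim (indexed_poly_ring D {..<n}) = enat n + krull_dim D)"

end

(* Call a finite set Y independent modulo a prime p if it is algebraically independent over k and
   k[Y] meets p only in 0; the largest size of such a set is t.d.(R/p). Choosing one element of each
   difference p_(i+1) - p_i along a chain of primes p_0 < ... < p_n enlarges a set that is
   independent modulo p_n to one that is independent modulo p_0. So n <= t.d.(R) - t.d.(R/p_n),
   which bounds the height and the dimension of every k-algebra, and also the dimension of a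
   polynomial ring over R.

   Conversely, let P be a prime of T and let Y be a maximal subset of R that is independent modulo
   P, completed by Z to a transcendence basis of R. Enlarging k to k(Y) makes the residue field of P
   algebraic. By Noether normalization, adapted to P and to an element of P, and going down for a
   principal prime of the normal ring k[x_1, ..., x_d], P contains a prime of T whose contraction to
   R is smaller than that of P and has a residue ring of transcendence degree one. Iterating this
   gives a chain of length |Z| that ends at the contraction of P. In a polynomial ring over R, such a chain is
   prolonged by adjoining the variables one after the other. *)

theory Submission
  imports Defs "HOL-Library.Multiset_Order"
begin

section \<open>Polynomial expressions in one element\<close>

text \<open>The subring need not be Noetherian, and distinct primes of the affine domain may have
  the same contraction. A smaller prime of the affine domain is therefore useless unless it differs
  from P already on the subring. For this an element g of P in the localized subring is fixed, and
  the smaller prime has to avoid it. This shapes the normalization: it must offer two coordinates at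
  once, one in P that the smaller prime will contain and a multiple of g that it will avoid.
  Transcendence degree one makes {g} a maximal independent set modulo the new prime, so that a step
  costs exactly one element of Z.

  Residue fields live in new types, hence passing to them cannot be iterated. They are entered only
  to find one prime, which is pulled back at once, and a minimal choice replaces the repetition. The
  induction itself runs inside one ambient field.

  Normality is used in the form of complete integral closedness: uniform denominators for all powers
  of an element follow from finiteness of a module and can be compared through leading
  coefficients.\<close>

primrec (in ring) pe :: "(nat \<Rightarrow> 'a) \<Rightarrow> nat \<Rightarrow> 'a \<Rightarrow> 'a" where
  "pe c 0 x = \<zero>"
| "pe c (Suc n) x = c n \<otimes> x [^] n \<oplus> pe c n x"

text \<open>The degree filtration of \<open>adj A x\<close>. The bound is strict, so
  \<open>pw A x 0\<close> is zero, and leading coefficients may vanish, so sums and padding need no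
  normalization.\<close>

definition (in ring) pw :: "'a set \<Rightarrow> 'a \<Rightarrow> nat \<Rightarrow> 'a set" where
  "pw A x n = {pe c n x | c. \<forall>i<n. c i \<in> A}"

definition (in ring) adj :: "'a set \<Rightarrow> 'a \<Rightarrow> 'a set" where
  "adj A x = (\<Union>n. pw A x n)"

text \<open>Relations are coefficient functions of a given length, which makes it easy to shift, pad
  and truncate them. \<open>trans_over_iff\<close> identifies this with
  \<open>transcendental\<close>.\<close>

definition (in ring) trans_over :: "'a set \<Rightarrow> 'a \<Rightarrow> bool" where
  "trans_over A x \<longleftrightarrow>
     (\<forall>c n. (\<forall>i<n. c i \<in> A) \<longrightarrow> pe c n x = \<zero> \<longrightarrow> (\<forall>i<n. c i = \<zero>))"

lemma (in ring) trans_overD: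
  assumes "trans_over A x" "pe c n x = \<zero>" "\<And>i. i < n \<Longrightarrow> c i \<in> A" "i < n"
  shows "c i = \<zero>"
  using assms unfolding trans_over_def by blast

lemma (in ring) trans_over_mono:
  assumes "trans_over B x" "A \<subseteq> B"
  shows "trans_over A x"
  using assms unfolding trans_over_def by blast

context cring
begin

lemma pe_closed [simp]:
  assumes "\<And>i. i < n \<Longrightarrow> c i \<in> carrier R" "x \<in> carrier R"
  shows "pe c n x \<in> carrier R"
  using assms by (induction n) auto

lemma pe_cong:
  assumes "\<And>i. i < n \<Longrightarrow> c i = d i"
  shows "pe c n x = pe d n x"
  using assms by (induction n) auto

lemma pe_add:
  assumes "\<And>i. i < n \<Longrightarrow> c i \<in> carrier R" "\<And>i. i < n \<Longrightarrow> d i \<in> carrier R" "x \<in> carrier R"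
  shows "pe (\<lambda>i. c i \<oplus> d i) n x = pe c n x \<oplus> pe d n x"
  using assms
proof (induction n)
  case (Suc n)
  have "c n \<in> carrier R" "d n \<in> carrier R" "x [^] n \<in> carrier R"
    "pe c n x \<in> carrier R" "pe d n x \<in> carrier R"
    using Suc.prems by auto
  moreover have "pe (\<lambda>i. c i \<oplus> d i) n x = pe c n x \<oplus> pe d n x"
    using Suc by auto
  ultimately show ?case by (simp only: pe.simps) algebra
qed simp

lemma pe_smult:
  assumes "\<And>i. i < n \<Longrightarrow> c i \<in> carrier R" "a \<in> carrier R" "x \<in> carrier R"
  shows "pe (\<lambda>i. a \<otimes> c i) n x = a \<otimes> pe c n x"
  using assms by (induction n) (simp_all add: r_distr m_assoc)

lemma pe_uminus:
  assumes "\<And>i. i < n \<Longrightarrow> c i \<in> carrier R" "x \<in> carrier R"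
  shows "pe (\<lambda>i. \<ominus> c i) n x = \<ominus> pe c n x"
  using assms by (induction n) (simp_all add: minus_add l_minus)

lemma pe_zero:
  assumes "x \<in> carrier R"
  shows "pe (\<lambda>i. \<zero>) n x = \<zero>"
  using assms by (induction n) auto

text \<open>Read from left to right it adds a constant term below a polynomial; read from right to
  left it splits the constant term off. The second reading drives all arguments that treat
  coefficients from the bottom.\<close>

lemma pe_shift:
  assumes "\<And>i. i < n \<Longrightarrow> c i \<in> carrier R" "a \<in> carrier R" "x \<in> carrier R"
  shows "pe (\<lambda>i. if i = 0 then a else c (i - 1)) (Suc n) x = pe c n x \<otimes> x \<oplus> a"
  using assms
proof (induction n)
  case (Suc n)
  have cl: "c n \<in> carrier R" "x [^] n \<in> carrier R" "pe c n x \<in> carrier R" "x \<in> carrier R" "a \<in> carrier R"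
    using Suc.prems by auto
  have "pe (\<lambda>i. if i = 0 then a else c (i - 1)) (Suc (Suc n)) x
      = c n \<otimes> x [^] Suc n \<oplus> (pe c n x \<otimes> x \<oplus> a)"
    using Suc by (subst pe.simps(2)) simp
  also have "\<dots> = (c n \<otimes> x [^] n \<oplus> pe c n x) \<otimes> x \<oplus> a"
    using cl by (simp only: nat_pow_Suc) algebra
  finally show ?case by simp
qed simp

lemma pe_pad:
  assumes "\<And>i. i < m \<Longrightarrow> c i \<in> carrier R" "x \<in> carrier R" "m \<le> n" "\<And>i. m \<le> i \<Longrightarrow> i < n \<Longrightarrow> c i = \<zero>"
  shows "pe c n x = pe c m x"
  using assms(3,4)
proof (induction n)
  case (Suc n)
  show ?case
  proof (cases "m = Suc n")
    case False
    then show ?thesis using Suc assms(1,2) by auto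
  qed simp
qed simp

end

locale cring_sub = cring R for R (structure) + fixes A x
  assumes subring_A: "subring A R" and x_closed [simp]: "x \<in> carrier R"
begin

lemma A_carrier [simp]: "a \<in> A \<Longrightarrow> a \<in> carrier R"
  using subringE(1)[OF subring_A] by auto

lemmas A_closed [simp] = subringE(2,3)[OF subring_A] subringE(5-7)[OF subring_A]

lemma pwI: "(\<And>i. i < n \<Longrightarrow> c i \<in> A) \<Longrightarrow> pe c n x \<in> pw A x n"
  unfolding pw_def by auto

lemma pwE:
  assumes "y \<in> pw A x n"
  obtains c where "\<And>i. i < n \<Longrightarrow> c i \<in> A" "y = pe c n x"
  using assms unfolding pw_def by auto

lemma pw_carrier [simp]: "y \<in> pw A x n \<Longrightarrow> y \<in> carrier R"
  by (elim pwE) auto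

lemma pw_mono:
  assumes "y \<in> pw A x m" "m \<le> n"
  shows "y \<in> pw A x n"
proof -
  obtain c where c: "\<And>i. i < m \<Longrightarrow> c i \<in> A" "y = pe c m x" using assms(1) by (rule pwE) blast
  have "pe (\<lambda>i. if i < m then c i else \<zero>) n x = pe (\<lambda>i. if i < m then c i else \<zero>) m x"
    using assms c by (intro pe_pad) auto
  also have "\<dots> = y" unfolding c(2) by (rule pe_cong) auto
  finally have "pe (\<lambda>i. if i < m then c i else \<zero>) n x = y" .
  moreover have "pe (\<lambda>i. if i < m then c i else \<zero>) n x \<in> pw A x n" using c(1) by (intro pwI) auto
  ultimately show ?thesis by simp
qed

lemma pw_0: "pw A x 0 = {\<zero>}"
  unfolding pw_def by auto

lemma pw_Suc: "y \<in> pw A x (Suc n) \<longleftrightarrow> (\<exists>a\<in>A. \<exists>w\<in>pw A x n. y = a \<otimes> x [^] n \<oplus> w)"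
proof
  assume "y \<in> pw A x (Suc n)"
  then obtain c where "\<And>i. i < Suc n \<Longrightarrow> c i \<in> A" "y = pe c (Suc n) x" by (rule pwE) blast
  moreover from this have "c n \<in> A" "pe c n x \<in> pw A x n" by (auto intro: pwI)
  ultimately show "\<exists>a\<in>A. \<exists>w\<in>pw A x n. y = a \<otimes> x [^] n \<oplus> w" by auto
next
  assume "\<exists>a\<in>A. \<exists>w\<in>pw A x n. y = a \<otimes> x [^] n \<oplus> w"
  then obtain a w where a: "a \<in> A" "w \<in> pw A x n" "y = a \<otimes> x [^] n \<oplus> w" by auto
  from a(2) obtain c where c: "\<And>i. i < n \<Longrightarrow> c i \<in> A" "w = pe c n x" by (rule pwE) blast
  have "pe (c(n := a)) n x = pe c n x" by (rule pe_cong) auto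
  then have "y = pe (c(n := a)) (Suc n) x" using a c by simp
  moreover have "pe (c(n := a)) (Suc n) x \<in> pw A x (Suc n)" using a(1) c(1) by (intro pwI) auto
  ultimately show "y \<in> pw A x (Suc n)" by simp
qed

lemma pw_zero [simp]: "\<zero> \<in> pw A x n"
  using pw_mono[of \<zero> 0 n] pw_0 by auto

lemma pw_add [simp]:
  assumes "y \<in> pw A x n" "z \<in> pw A x n" shows "y \<oplus> z \<in> pw A x n"
proof -
  obtain c where c: "\<And>i. i < n \<Longrightarrow> c i \<in> A" "y = pe c n x" using assms(1) by (rule pwE) blast
  obtain d where d: "\<And>i. i < n \<Longrightarrow> d i \<in> A" "z = pe d n x" using assms(2) by (rule pwE) blast
  have "y \<oplus> z = pe (\<lambda>i. c i \<oplus> d i) n x" using c d by (simp add: pe_add)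
  then show ?thesis using c d by (auto intro: pwI)
qed

lemma pw_smult [simp]:
  assumes "a \<in> A" "z \<in> pw A x n" shows "a \<otimes> z \<in> pw A x n"
proof -
  obtain d where d: "\<And>i. i < n \<Longrightarrow> d i \<in> A" "z = pe d n x" using assms(2) by (rule pwE) blast
  have "a \<otimes> z = pe (\<lambda>i. a \<otimes> d i) n x" using assms d by (simp add: pe_smult)
  then show ?thesis using assms d by (auto intro: pwI)
qed

lemma pw_uminus [simp]:
  assumes "z \<in> pw A x n" shows "\<ominus> z \<in> pw A x n"
  using pw_smult[of "\<ominus> \<one>" z n] assms by (simp add: l_minus)

lemma pw_minus [simp]:
  assumes "y \<in> pw A x n" "z \<in> pw A x n" shows "y \<ominus> z \<in> pw A x n"
  using assms by (simp add: minus_eq)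

lemma pw_const [simp]: "a \<in> A \<Longrightarrow> a \<in> pw A x (Suc n)"
  using pw_Suc[of a 0] by (intro pw_mono[of a "Suc 0" "Suc n"]) (auto simp: pw_0)

lemma pw_pow: "i < n \<Longrightarrow> a \<in> A \<Longrightarrow> a \<otimes> x [^] i \<in> pw A x n"
proof -
  assume i: "i < n" and a: "a \<in> A"
  have "a \<otimes> x [^] i = a \<otimes> x [^] i \<oplus> \<zero>" using a by simp
  then have "a \<otimes> x [^] i \<in> pw A x (Suc i)" unfolding pw_Suc using a pw_zero by blast
  then show ?thesis using i by (intro pw_mono[of _ "Suc i" n]) auto
qed

lemma pw_mult_x:
  assumes "y \<in> pw A x n" shows "y \<otimes> x \<in> pw A x (Suc n)"
proof -
  obtain c where c: "\<And>i. i < n \<Longrightarrow> c i \<in> A" "y = pe c n x" using assms(1) by (rule pwE) blast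
  have "y \<otimes> x = pe (\<lambda>i. if i = 0 then \<zero> else c (i - 1)) (Suc n) x"
    using c by (subst pe_shift) auto
  then show ?thesis using c by (auto intro: pwI simp del: pe.simps)
qed

lemma pw_mult_pow:
  assumes "y \<in> pw A x n" shows "y \<otimes> x [^] k \<in> pw A x (n + k)"
proof (induction k)
  case (Suc k)
  then show ?case using pw_mult_x assms by (simp flip: m_assoc)
qed (use assms in auto)

lemma pw_mult:
  assumes "y \<in> pw A x m" "z \<in> pw A x n" shows "y \<otimes> z \<in> pw A x (m + n)"
  using assms(1)
proof (induction m arbitrary: y)
  case 0
  then show ?case using assms(2) by (simp add: pw_0)
next
  case (Suc m)
  then obtain a w where a: "a \<in> A" "w \<in> pw A x m" "y = a \<otimes> x [^] m \<oplus> w" unfolding pw_Suc by blast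
  have "y \<otimes> z = a \<otimes> (z \<otimes> x [^] m) \<oplus> w \<otimes> z"
  proof -
    have "\<And>a w z p. \<lbrakk>a \<in> carrier R; w \<in> carrier R; z \<in> carrier R; p \<in> carrier R\<rbrakk> \<Longrightarrow>
        (a \<otimes> p \<oplus> w) \<otimes> z = a \<otimes> (z \<otimes> p) \<oplus> w \<otimes> z" by algebra
    then show ?thesis using a assms(2) by simp
  qed
  moreover have "a \<otimes> (z \<otimes> x [^] m) \<in> pw A x (Suc m + n)"
    using a assms(2) pw_mono[OF pw_smult[OF a(1) pw_mult_pow[OF assms(2), of m]], of "Suc m + n"] by simp
  moreover have "w \<otimes> z \<in> pw A x (Suc m + n)"
    using Suc.IH[OF a(2)] by (rule pw_mono) auto
  ultimately show ?case by simp
qed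

lemma lead_ex:
  assumes "y \<in> pw A x N" "y \<noteq> \<zero>"
  shows "\<exists>n a w. n < N \<and> a \<in> A \<and> a \<noteq> \<zero> \<and> w \<in> pw A x n \<and> y = a \<otimes> x [^] n \<oplus> w"
  using assms
proof (induction N)
  case 0
  then show ?case by (simp add: pw_0)
next
  case (Suc n)
  then obtain a w where a: "a \<in> A" "w \<in> pw A x n" "y = a \<otimes> x [^] n \<oplus> w" unfolding pw_Suc by blast
  show ?case
  proof (cases "a = \<zero>")
    case True
    then have "y = w" using a by simp
    then show ?thesis using Suc a(2) less_SucI by blast
  next
    case False
    then show ?thesis using a by blast
  qed
qed

text \<open>Moving everything to one side gives a relation of length \<open>Suc n\<close> with top
  coefficient \<open>a\<close>. The uniqueness of degrees and leading coefficients rests on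
  this.\<close>

lemma lead_trans:
  assumes "trans_over A x" "a \<in> A" "w \<in> pw A x n" "a \<otimes> x [^] n \<oplus> w \<in> pw A x n"
  shows "a = \<zero>"
proof -
  have "(a \<otimes> x [^] n \<oplus> w) \<ominus> w \<in> pw A x n" using assms by simp
  moreover have "(a \<otimes> x [^] n \<oplus> w) \<ominus> w = a \<otimes> x [^] n"
  proof -
    have "\<And>u v. u \<in> carrier R \<Longrightarrow> v \<in> carrier R \<Longrightarrow> (u \<oplus> v) \<ominus> v = u" by algebra
    then show ?thesis using assms by auto
  qed
  ultimately have "\<ominus> (a \<otimes> x [^] n) \<in> pw A x n" by auto
  then obtain c where c: "\<And>i. i < n \<Longrightarrow> c i \<in> A" "\<ominus> (a \<otimes> x [^] n) = pe c n x" by (rule pwE) blast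
  have "pe (c(n := a)) n x = pe c n x" by (auto intro: pe_cong)
  then have "pe (c(n := a)) (Suc n) x = a \<otimes> x [^] n \<oplus> pe c n x" by simp
  also have "\<dots> = \<zero>" using c(2)[symmetric] assms by (simp add: r_neg)
  finally have "pe (c(n := a)) (Suc n) x = \<zero>" .
  then have "(c(n := a)) n = \<zero>" by (rule trans_overD[OF assms(1)]) (use c assms less_SucE in auto)
  then show ?thesis by simp
qed

lemma lead_nonzero:
  assumes "trans_over A x" "a \<in> A" "a \<noteq> \<zero>" "w \<in> pw A x n"
  shows "a \<otimes> x [^] n \<oplus> w \<noteq> \<zero>"
  using lead_trans[of a w n] assms by auto

text \<open>The product \<open>a \<otimes> b\<close> is allowed to vanish, so this holds over any
  coefficient ring; degrees add only once that product is known to be nonzero.\<close>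

lemma lead_mult:
  assumes "a \<in> A" "b \<in> A" "v \<in> pw A x m" "w \<in> pw A x n"
  obtains u where "u \<in> pw A x (m + n)"
    "(a \<otimes> x [^] m \<oplus> v) \<otimes> (b \<otimes> x [^] n \<oplus> w) = (a \<otimes> b) \<otimes> x [^] (m + n) \<oplus> u"
proof -
  let ?u = "a \<otimes> (w \<otimes> x [^] m) \<oplus> (b \<otimes> (v \<otimes> x [^] n) \<oplus> v \<otimes> w)"
  have 1: "?u \<in> pw A x (m + n)"
    using pw_mult_pow[OF assms(4), of m] pw_mult_pow[OF assms(3), of n] pw_mult[OF assms(3,4)] assms
    by (auto simp: add.commute)
  have "\<And>a b p q v w. \<lbrakk>a \<in> carrier R; b \<in> carrier R; p \<in> carrier R; q \<in> carrier R; v \<in> carrier R; w \<in> carrier R\<rbrakk> \<Longrightarrow>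
      (a \<otimes> p \<oplus> v) \<otimes> (b \<otimes> q \<oplus> w) = (a \<otimes> b) \<otimes> (p \<otimes> q) \<oplus> (a \<otimes> (w \<otimes> p) \<oplus> (b \<otimes> (v \<otimes> q) \<oplus> v \<otimes> w))"
    by algebra
  then have "(a \<otimes> x [^] m \<oplus> v) \<otimes> (b \<otimes> x [^] n \<oplus> w) = (a \<otimes> b) \<otimes> x [^] (m + n) \<oplus> ?u"
    using assms by (simp add: nat_pow_mult[symmetric])
  with 1 show ?thesis using that by blast
qed

lemma adjE:
  assumes "y \<in> adj A x" obtains n where "y \<in> pw A x n"
  using assms unfolding adj_def by auto

lemma adjI: "y \<in> pw A x n \<Longrightarrow> y \<in> adj A x"
  unfolding adj_def by auto

lemma adj_join:
  assumes "y \<in> adj A x" "z \<in> adj A x"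
  obtains n where "y \<in> pw A x n" "z \<in> pw A x n"
proof -
  obtain m n where "y \<in> pw A x m" "z \<in> pw A x n" using assms by (meson adjE)
  then have "y \<in> pw A x (m + n)" "z \<in> pw A x (m + n)" by (auto elim: pw_mono)
  then show thesis by (rule that)
qed

lemma subring_adj: "subring (adj A x) R"
proof (rule subringI)
  show "adj A x \<subseteq> carrier R" by (auto elim: adjE)
  show "\<one> \<in> adj A x" by (rule adjI[OF pw_const]) simp
  show "\<ominus> h \<in> adj A x" if "h \<in> adj A x" for h
    using that by (elim adjE) (rule adjI[OF pw_uminus])
  show "a \<oplus> b \<in> adj A x" if "a \<in> adj A x" "b \<in> adj A x" for a b
    using adj_join[OF that] by (metis adjI pw_add)
  show "a \<otimes> b \<in> adj A x" if "a \<in> adj A x" "b \<in> adj A x" for a b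
    using adj_join[OF that] by (metis adjI pw_mult)
qed

lemma adj_incl: "a \<in> A \<Longrightarrow> a \<in> adj A x"
  by (rule adjI[OF pw_const]) simp

lemma adj_mem: "x \<in> adj A x"
  using pw_pow[of 1 2 \<one>] by (intro adjI[of _ 2]) simp

lemma pw_subset:
  assumes "subring B R" "A \<subseteq> B" "x \<in> B"
  shows "pw A x n \<subseteq> B"
proof
  fix y assume "y \<in> pw A x n"
  then show "y \<in> B"
  proof (induction n arbitrary: y)
    case 0
    then show ?case using subringE(2)[OF assms(1)] by (simp add: pw_0)
  next
    case (Suc n)
    have "x [^] n \<in> B" using assms(1,3)
      by (induction n) (auto simp: subringE(3) subringE(6))
    then show ?case using Suc assms subringE(6,7)[OF assms(1)] unfolding pw_Suc by blast
  qed
qed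

lemma adj_min:
  assumes "subring B R" "A \<subseteq> B" "x \<in> B"
  shows "adj A x \<subseteq> B"
  using pw_subset[OF assms] unfolding adj_def by auto

lemma trans_over_nonzero:
  assumes "trans_over A x" "\<one> \<noteq> \<zero>" shows "x \<noteq> \<zero>"
  using lead_nonzero[OF assms(1), of \<one> \<zero> 1] assms(2) by auto

end

lemma (in cring) pw_cring_sub: "subring A R \<Longrightarrow> x \<in> carrier R \<Longrightarrow> cring_sub R A x"
  by (simp add: cring_sub_def cring_sub_axioms_def is_cring)

text \<open>Provides normal forms for the inductively generated ring, one generator at a
  time.\<close>

lemma (in cring) adj_generate_ring:
  assumes "H \<subseteq> carrier R" "x \<in> carrier R"
  shows "adj (generate_ring R H) x = generate_ring R (insert x H)"
proof -
  interpret cring_sub R "generate_ring R H" x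
    by (rule pw_cring_sub[OF generate_ring_is_subring[OF assms(1)] assms(2)])
  have H: "insert x H \<subseteq> carrier R" using assms by auto
  show ?thesis
  proof
    show "adj (generate_ring R H) x \<subseteq> generate_ring R (insert x H)"
      by (rule adj_min[OF generate_ring_is_subring[OF H] mono_generate_ring[OF _ H]])
        (auto intro: generate_ring.incl)
    have "insert x H \<subseteq> adj (generate_ring R H) x"
      using adj_mem adj_incl generate_ring.incl[of _ H R] by blast
    then show "generate_ring R (insert x H) \<subseteq> adj (generate_ring R H) x"
      by (rule generate_ring_min_subring1[OF H subring_adj])
  qed
qed

section \<open>Algebraic independence\<close>

definition (in cring) mon :: "'a multiset \<Rightarrow> 'a" where
  "mon m = (\<Otimes>x\<in>set_mset m. x [^] count m x)"

context cring
begin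

lemma mon_empty [simp]: "mon {#} = \<one>"
  by (simp add: mon_def)

lemma mon_closed [simp]: "set_mset m \<subseteq> carrier R \<Longrightarrow> mon m \<in> carrier R"
  unfolding mon_def by (intro finprod_closed) auto

lemma mon_add_mset:
  assumes "x \<in> carrier R" "set_mset m \<subseteq> carrier R"
  shows "mon (add_mset x m) = mon m \<otimes> x"
proof -
  let ?S = "set_mset m - {x}"
  let ?r = "\<Otimes>y\<in>?S. y [^] count m y"
  have S: "finite ?S" "x \<notin> ?S" by auto
  have r: "?r \<in> carrier R" using assms by (intro finprod_closed) auto
  have "mon (add_mset x m) = (\<Otimes>y\<in>insert x ?S. y [^] count (add_mset x m) y)"
    unfolding mon_def by (rule arg_cong2[of _ _ _ _ "finprod R"]) auto
  also have "\<dots> = x [^] count (add_mset x m) x \<otimes> (\<Otimes>y\<in>?S. y [^] count (add_mset x m) y)"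
    using assms by (intro finprod_insert[OF S]) auto
  also have "(\<Otimes>y\<in>?S. y [^] count (add_mset x m) y) = ?r"
    using assms by (intro finprod_cong') auto
  finally have 1: "mon (add_mset x m) = x [^] count m x \<otimes> x \<otimes> ?r" by simp
  have "mon m = x [^] count m x \<otimes> ?r"
  proof (cases "x \<in># m")
    case True
    then have "mon m = (\<Otimes>y\<in>insert x ?S. y [^] count m y)"
      unfolding mon_def by (intro arg_cong2[of _ _ _ _ "finprod R"]) auto
    also have "\<dots> = x [^] count m x \<otimes> ?r"
      using assms by (intro finprod_insert[OF S]) auto
    finally show ?thesis .
  next
    case False
    then have "?S = set_mset m" "count m x = 0" by (auto simp: count_eq_zero_iff)
    then show ?thesis using r by (simp add: mon_def)
  qed
  then show ?thesis using 1 r assms(1) by (simp add: m_ac)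
qed

text \<open>Outside the support a monomial may involve elements that are not in the carrier. Its
  product is replaced by zero there, so that the sum over the larger index set \<open>M\<close>
  makes sense.\<close>

lemma eval_at_indices_eq:
  assumes "finite M" "{m. p m \<noteq> \<zero>} \<subseteq> M" "\<And>m. p m \<in> carrier R"
    and "\<And>m. p m \<noteq> \<zero> \<Longrightarrow> set_mset m \<subseteq> carrier R"
  shows "eval_at_indices R p = (\<Oplus>m\<in>M. p m \<otimes> (if p m = \<zero> then \<zero> else mon m))"
proof -
  have "eval_at_indices R p = (\<Oplus>m\<in>{m. p m \<noteq> \<zero>}. p m \<otimes> mon m)"
    unfolding eval_at_indices_def mon_def ..
  also have "\<dots> = (\<Oplus>m\<in>M. p m \<otimes> (if p m = \<zero> then \<zero> else mon m))"
    using assms by (intro add.finprod_mono_neutral_cong_left) auto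
  finally show ?thesis .
qed

end

locale coeff_sub = cring R for R (structure) + fixes K
  assumes subring_K: "subring K R"
begin

lemma K_carrier [simp]: "a \<in> K \<Longrightarrow> a \<in> carrier R"
  using subringE(1)[OF subring_K] by auto

lemmas K_closed [simp] = subringE(2,3)[OF subring_K] subringE(5-7)[OF subring_K]

text \<open>The inductive set \<open>indexed_pset\<close> turned into conditions on coefficients,
  which can be checked for polynomials that are assembled by hand. \<open>IP_eq\<close> proves the
  agreement.\<close>

definition IP :: "'i set \<Rightarrow> ('i multiset \<Rightarrow> 'a) set" where
  "IP S = {p. finite {m. p m \<noteq> \<zero>} \<and> (\<forall>m. p m \<in> K) \<and> (\<forall>m. p m \<noteq> \<zero> \<longrightarrow> set_mset m \<subseteq> S)}"

lemma finite_pmult_support: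
  assumes "finite {m. p m \<noteq> \<zero>}"
  shows "finite {m. indexed_pmult p i m \<noteq> \<zero>}"
proof -
  have "{m. indexed_pmult p i m \<noteq> \<zero>} \<subseteq> add_mset i ` {m. p m \<noteq> \<zero>}"
  proof
    fix m assume "m \<in> {m. indexed_pmult p i m \<noteq> \<zero>}"
    then have "i \<in># m" "p (m - {#i#}) \<noteq> \<zero>" by (auto simp: indexed_pmult_def split: if_splits)
    then show "m \<in> add_mset i ` {m. p m \<noteq> \<zero>}" by (intro image_eqI[of _ _ "m - {#i#}"]) auto
  qed
  then show ?thesis using assms by (meson finite_imageI finite_subset)
qed

lemma pmult_IP:
  assumes "p \<in> IP S" "i \<in> S" shows "indexed_pmult p i \<in> IP S"
proof -
  have "set_mset m \<subseteq> S" if "indexed_pmult p i m \<noteq> \<zero>" for m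
  proof -
    have "i \<in># m" "p (m - {#i#}) \<noteq> \<zero>" using that by (auto simp: indexed_pmult_def split: if_splits)
    then have "set_mset (m - {#i#}) \<subseteq> S" using assms unfolding IP_def by blast
    moreover have "set_mset m = insert i (set_mset (m - {#i#}))"
      using \<open>i \<in># m\<close> by (metis insert_DiffM set_mset_add_mset_insert)
    ultimately show ?thesis using assms(2) by simp
  qed
  moreover have "\<forall>m. indexed_pmult p i m \<in> K"
    using assms unfolding IP_def indexed_pmult_def by auto
  ultimately show ?thesis using assms finite_pmult_support unfolding IP_def by auto
qed

lemma padd_IP:
  assumes "p \<in> IP S" "q \<in> IP S" shows "indexed_padd p q \<in> IP S"
proof -
  have "{m. indexed_padd p q m \<noteq> \<zero>} \<subseteq> {m. p m \<noteq> \<zero>} \<union> {m. q m \<noteq> \<zero>}"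
    by (auto simp: indexed_padd_def)
  moreover have "set_mset m \<subseteq> S" if "p m \<oplus> q m \<noteq> \<zero>" for m
  proof -
    have "p m \<noteq> \<zero> \<or> q m \<noteq> \<zero>" using that by auto
    then show ?thesis using assms unfolding IP_def by blast
  qed
  ultimately show ?thesis using assms unfolding IP_def
    by (auto simp: indexed_padd_def intro: finite_subset)
qed

lemma const_IP: "k \<in> K \<Longrightarrow> indexed_const k \<in> IP S"
proof -
  assume k: "k \<in> K"
  have "{m. indexed_const k m \<noteq> \<zero>} \<subseteq> {{#}}" by (auto simp: indexed_const_def)
  then show ?thesis using k unfolding IP_def by (auto simp: indexed_const_def intro: finite_subset)
qed

lemma IP_mono: "S \<subseteq> S' \<Longrightarrow> IP S \<subseteq> IP S'"
  unfolding IP_def by auto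

lemma pset_subset_IP: "indexed_pset S K \<subseteq> IP S"
proof
  fix p assume "p \<in> indexed_pset S K"
  then show "p \<in> IP S"
    by induction (auto intro: const_IP padd_IP pmult_IP)
qed

lemma monomial_pset:
  assumes "k \<in> K" "set_mset m \<subseteq> S"
  shows "(\<lambda>n. if n = m then k else \<zero>) \<in> indexed_pset S K"
  using assms(2)
proof (induction m)
  case empty
  then show ?case using indexed_pset.indexed_const[OF assms(1), of S] by (simp add: indexed_const_def)
next
  case (add x m)
  have "(\<lambda>n. if n = add_mset x m then k else \<zero>) = indexed_pmult (\<lambda>n. if n = m then k else \<zero>) x"
    by (auto simp: indexed_pmult_def fun_eq_iff)
  then show ?case using add indexed_pset.indexed_pmult[of "\<lambda>n. if n = m then k else \<zero>" S K x] by auto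
qed

lemma IP_eq: "IP S = indexed_pset S K"
proof (rule antisym[OF subsetI pset_subset_IP])
  fix p assume "p \<in> IP S"
  moreover have "p \<in> indexed_pset S K" if "finite M" "{m. p m \<noteq> \<zero>} = M" "p \<in> IP S" for M p
    using that
  proof (induction M arbitrary: p)
    case empty
    then have "p = indexed_const \<zero>" by (auto simp: indexed_const_def)
    then show ?case by (simp add: indexed_pset.indexed_const)
  next
    case (insert m M)
    let ?q = "p(m := \<zero>)" and ?r = "\<lambda>n. if n = m then p m else \<zero>"
    have "{n. ?q n \<noteq> \<zero>} = M" using insert by auto
    moreover have "?q \<in> IP S" using insert.prems insert.hyps(1) calculation unfolding IP_def by auto
    ultimately have "?q \<in> indexed_pset S K" using insert by blast
    moreover have "?r \<in> indexed_pset S K"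
      using insert.prems unfolding IP_def by (intro monomial_pset) auto
    ultimately have "indexed_padd ?q ?r \<in> indexed_pset S K" by (rule indexed_pset.indexed_padd)
    moreover have "indexed_padd ?q ?r = p"
      using insert.prems unfolding IP_def indexed_padd_def by (auto simp: fun_eq_iff)
    ultimately show ?case by simp
  qed
  ultimately show "p \<in> indexed_pset S K" unfolding IP_def by blast
qed

abbreviation ev where "ev \<equiv> eval_at_indices R"

lemma IP_K [simp]: "p \<in> IP S \<Longrightarrow> p m \<in> K"
  unfolding IP_def by auto

lemma ev_eq:
  assumes "p \<in> IP S" "S \<subseteq> carrier R" "finite M" "{m. p m \<noteq> \<zero>} \<subseteq> M" "\<And>m. m \<in> M \<Longrightarrow> set_mset m \<subseteq> S"
  shows "ev p = (\<Oplus>m\<in>M. p m \<otimes> mon m)"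
proof -
  have "ev p = (\<Oplus>m\<in>M. p m \<otimes> (if p m = \<zero> then \<zero> else mon m))"
    using assms unfolding IP_def by (intro eval_at_indices_eq) auto
  also have "\<dots> = (\<Oplus>m\<in>M. p m \<otimes> mon m)"
  proof (rule finsum_cong')
    have "p m \<in> carrier R" "mon m \<in> carrier R" if "m \<in> M" for m
      using assms(2,5) that IP_K[OF assms(1)] by (auto intro!: mon_closed)
    then show "(\<lambda>m. p m \<otimes> mon m) \<in> M \<rightarrow> carrier R"
      and "\<And>m. m \<in> M \<Longrightarrow> p m \<otimes> (if p m = \<zero> then \<zero> else mon m) = p m \<otimes> mon m" by auto
  qed simp
  finally show ?thesis .
qed

lemma IP_support:
  assumes "p \<in> IP S" shows "finite {m. p m \<noteq> \<zero>}" "\<And>m. m \<in> {m. p m \<noteq> \<zero>} \<Longrightarrow> set_mset m \<subseteq> S"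
  using assms unfolding IP_def by auto

lemma ev_closed:
  assumes "p \<in> IP S" "S \<subseteq> carrier R" shows "ev p \<in> carrier R"
  unfolding ev_eq[OF assms IP_support(1)[OF assms(1)] order_refl IP_support(2)[OF assms(1)], simplified]
  using assms unfolding IP_def by (intro finsum_closed) auto

lemma ev_padd:
  assumes "p \<in> IP S" "q \<in> IP S" "S \<subseteq> carrier R"
  shows "ev (indexed_padd p q) = ev p \<oplus> ev q"
proof -
  let ?M = "{m. p m \<noteq> \<zero>} \<union> {m. q m \<noteq> \<zero>}"
  have M: "finite ?M" "\<And>m. m \<in> ?M \<Longrightarrow> set_mset m \<subseteq> S"
    using assms unfolding IP_def by auto
  have cl: "mon m \<in> carrier R" if "m \<in> ?M" for m
    using M(2)[OF that] assms(3) by (intro mon_closed) auto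
  have clp: "p m \<in> carrier R" "q m \<in> carrier R" for m using assms by auto
  have "ev (indexed_padd p q) = (\<Oplus>m\<in>?M. indexed_padd p q m \<otimes> mon m)"
    by (rule ev_eq[OF padd_IP[OF assms(1,2)] assms(3) M(1) _ M(2)]) (auto simp: indexed_padd_def)
  also have "\<dots> = (\<Oplus>m\<in>?M. p m \<otimes> mon m \<oplus> q m \<otimes> mon m)"
    using cl clp by (intro finsum_cong') (auto simp: indexed_padd_def l_distr)
  also have "\<dots> = (\<Oplus>m\<in>?M. p m \<otimes> mon m) \<oplus> (\<Oplus>m\<in>?M. q m \<otimes> mon m)"
    using cl clp by (intro finsum_addf) auto
  also have "(\<Oplus>m\<in>?M. p m \<otimes> mon m) = ev p"
    using ev_eq[OF assms(1,3) M(1) _ M(2)] by auto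
  also have "(\<Oplus>m\<in>?M. q m \<otimes> mon m) = ev q"
    using ev_eq[OF assms(2,3) M(1) _ M(2)] by auto
  finally show ?thesis .
qed

lemma ev_const:
  assumes "k \<in> K" shows "ev (indexed_const k) = k"
proof -
  have "ev (indexed_const k) = (\<Oplus>m\<in>{{#}}. indexed_const k m \<otimes> mon m)"
    by (rule ev_eq[OF const_IP[OF assms], of "{}"]) (auto simp: indexed_const_def split: if_splits)
  also have "\<dots> = k" using assms by (simp add: indexed_const_def)
  finally show ?thesis .
qed

lemma ev_pmult:
  assumes "p \<in> IP S" "i \<in> S" "S \<subseteq> carrier R"
  shows "ev (indexed_pmult p i) = ev p \<otimes> i"
proof -
  let ?M = "{m. p m \<noteq> \<zero>}"
  have M: "finite ?M" "\<And>m. m \<in> ?M \<Longrightarrow> set_mset m \<subseteq> S" using assms unfolding IP_def by auto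
  have i: "i \<in> carrier R" using assms by auto
  have cls: "set_mset m \<subseteq> carrier R" if "p m \<noteq> \<zero>" for m
    using M(2)[of m] that assms(3) by auto
  have cl: "mon m \<in> carrier R" if "p m \<noteq> \<zero>" for m
    using cls[OF that] by (rule mon_closed)
  have clp: "p m \<in> carrier R" for m using assms by auto
  have "ev (indexed_pmult p i) = (\<Oplus>m\<in>add_mset i ` ?M. indexed_pmult p i m \<otimes> mon m)"
  proof (rule ev_eq[OF pmult_IP[OF assms(1,2)] assms(3)])
    show "{m. indexed_pmult p i m \<noteq> \<zero>} \<subseteq> add_mset i ` ?M"
    proof
      fix m assume "m \<in> {m. indexed_pmult p i m \<noteq> \<zero>}"
      then have "i \<in># m" "p (m - {#i#}) \<noteq> \<zero>" by (auto simp: indexed_pmult_def split: if_splits)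
      then show "m \<in> add_mset i ` {m. p m \<noteq> \<zero>}" by (intro image_eqI[of _ _ "m - {#i#}"]) auto
    qed
  next
    fix m assume "m \<in> add_mset i ` ?M"
    then show "set_mset m \<subseteq> S" using M(2) assms(2) by fastforce
  qed (use M in auto)
  also have "\<dots> = (\<Oplus>m\<in>?M. indexed_pmult p i (add_mset i m) \<otimes> mon (add_mset i m))"
    using cl clp i by (intro finsum_reindex) (auto simp: indexed_pmult_def mon_add_mset[OF i cls] inj_on_def)
  also have "\<dots> = (\<Oplus>m\<in>?M. p m \<otimes> mon m \<otimes> i)"
    using cl clp i by (intro finsum_cong') (auto simp: indexed_pmult_def mon_add_mset[OF i cls] m_assoc)
  also have "\<dots> = (\<Oplus>m\<in>?M. p m \<otimes> mon m) \<otimes> i"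
    using M cl clp i by (intro finsum_ldistr[symmetric]) auto
  also have "(\<Oplus>m\<in>?M. p m \<otimes> mon m) = ev p"
    using ev_eq[OF assms(1,3) M(1) _ M(2)] by auto
  finally show ?thesis .
qed

text \<open>For the inclusion from left to right the values must absorb products, whereas only
  multiplication by a single variable is at hand. The elements that multiply the set of values into
  itself form a subring containing \<open>K\<close> and \<open>S\<close>; as one is a value, this
  subring consists of values.\<close>

lemma ev_image:
  assumes "S \<subseteq> carrier R"
  shows "generate_ring R (K \<union> S) = ev ` IP S"
proof
  have KS: "K \<union> S \<subseteq> carrier R" using assms by auto
  have sub: "subring (generate_ring R (K \<union> S)) R" by (rule generate_ring_is_subring[OF KS])
  show "ev ` IP S \<subseteq> generate_ring R (K \<union> S)"
  proof (intro image_subsetI)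
    fix p assume "p \<in> IP S"
    then have "p \<in> indexed_pset S K" by (simp add: IP_eq)
    then show "ev p \<in> generate_ring R (K \<union> S)"
    proof induction
      case (indexed_const k)
      then show ?case by (simp add: ev_const generate_ring.incl)
    next
      case (indexed_padd P Q)
      then show ?case using ev_padd[OF _ _ assms] by (simp add: IP_eq generate_ring.eng_add)
    next
      case (indexed_pmult P i)
      then show ?case using ev_pmult[OF _ _ assms] by (simp add: IP_eq generate_ring.eng_mult generate_ring.incl)
    qed
  qed
  let ?E = "ev ` IP S"
  have Ec: "e \<in> carrier R" if "e \<in> ?E" for e using that ev_closed assms by auto
  have Eadd: "a \<oplus> b \<in> ?E" if "a \<in> ?E" "b \<in> ?E" for a b
  proof -
    from that obtain p q where "p \<in> IP S" "q \<in> IP S" "a = ev p" "b = ev q" by blast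
    then show ?thesis using ev_padd[of p S q] padd_IP[of p S q] assms by (metis image_eqI)
  qed
  have ES: "a \<otimes> s \<in> ?E" if "a \<in> ?E" "s \<in> S" for a s
  proof -
    from that obtain p where "p \<in> IP S" "a = ev p" by blast
    then show ?thesis using ev_pmult[of p S s] pmult_IP[of p S s] assms that by (metis image_eqI)
  qed
  have EK: "ev p \<otimes> k \<in> ?E" if "p \<in> indexed_pset S K" "k \<in> K" for p k
    using that(1)
  proof induction
    case (indexed_const k')
    then have "ev (indexed_const k') \<otimes> k = ev (indexed_const (k' \<otimes> k))" using that by (simp add: ev_const)
    then show ?case using const_IP[of "k' \<otimes> k"] indexed_const that by auto
  next
    case (indexed_padd P Q)
    then have "P \<in> IP S" "Q \<in> IP S" by (auto simp: IP_eq)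
    then have "ev (indexed_padd P Q) \<otimes> k = ev P \<otimes> k \<oplus> ev Q \<otimes> k"
      using ev_padd[of P S Q] ev_closed[of P S] ev_closed[of Q S] assms that by (simp add: l_distr)
    then show ?case using Eadd[OF indexed_padd.IH] by simp
  next
    case (indexed_pmult P i)
    then have P: "P \<in> IP S" by (auto simp: IP_eq)
    then have "ev (indexed_pmult P i) \<otimes> k = ev P \<otimes> k \<otimes> i"
      using ev_pmult[of P S i] ev_closed[of P S] assms that indexed_pmult(2)
      by (simp add: m_ac subset_eq)
    then show ?case using ES[OF indexed_pmult.IH indexed_pmult(2)] by simp
  qed
  let ?Z = "{z \<in> carrier R. \<forall>e\<in>?E. e \<otimes> z \<in> ?E}"
  have EK': "e \<otimes> k \<in> ?E" if "e \<in> ?E" "k \<in> K" for e k using that EK by (auto simp: IP_eq)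
  have "subring ?Z R"
  proof (rule subringI)
    fix h assume h: "h \<in> ?Z"
    have "e \<otimes> (\<ominus> h) \<in> ?E" if "e \<in> ?E" for e
    proof -
      have "e \<otimes> (\<ominus> h) = (e \<otimes> h) \<otimes> (\<ominus> \<one>)" using h Ec[OF that] by simp algebra
      moreover have "(e \<otimes> h) \<otimes> (\<ominus> \<one>) \<in> ?E" by (rule EK') (use h that in auto)
      ultimately show ?thesis by simp
    qed
    then show "\<ominus> h \<in> ?Z" using h by simp
  next
    fix a b assume ab: "a \<in> ?Z" "b \<in> ?Z"
    have "e \<otimes> (a \<oplus> b) \<in> ?E" if "e \<in> ?E" for e
    proof -
      have "e \<otimes> a \<in> ?E" "e \<otimes> b \<in> ?E" using ab that by blast+
      then have "e \<otimes> a \<oplus> e \<otimes> b \<in> ?E" by (rule Eadd)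
      then show ?thesis using ab Ec[OF that] by (simp add: r_distr)
    qed
    then show "a \<oplus> b \<in> ?Z" using ab by simp
    have "e \<otimes> (a \<otimes> b) \<in> ?E" if "e \<in> ?E" for e
    proof -
      have "e \<otimes> a \<in> ?E" using ab that by blast
      then have "e \<otimes> a \<otimes> b \<in> ?E" using ab(2) by blast
      then show ?thesis using ab Ec[OF that] by (simp add: m_assoc)
    qed
    then show "a \<otimes> b \<in> ?Z" using ab by simp
  qed (use Ec in auto)
  moreover have "K \<union> S \<subseteq> ?Z" using EK' ES assms by auto
  ultimately have "generate_ring R (K \<union> S) \<subseteq> ?Z" by (rule generate_ring_min_subring1[OF KS])
  moreover have "\<one> \<in> ?E" using ev_const[of \<one>] const_IP[of \<one> S] by (metis K_closed(2) image_eqI)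
  ultimately show "generate_ring R (K \<union> S) \<subseteq> ?E" by (auto dest!: subsetD) (metis (no_types, lifting) l_one)
qed

text \<open>The coefficient of the \<open>i\<close>-th power of \<open>x\<close>, as a polynomial in
  the other variables. Monomials containing \<open>x\<close> get zero, so that each monomial of
  \<open>p\<close> is recorded in exactly one slice.\<close>

definition slice :: "'a \<Rightarrow> ('a multiset \<Rightarrow> 'a) \<Rightarrow> nat \<Rightarrow> ('a multiset \<Rightarrow> 'a)" where
  "slice x p i = (\<lambda>m. if x \<in># m then \<zero> else p (m + replicate_mset i x))"

lemma slice_IP:
  assumes "p \<in> IP (insert x S)"
  shows "slice x p i \<in> IP S"
proof -
  have "(\<lambda>m. m + replicate_mset i x) ` {m. slice x p i m \<noteq> \<zero>} \<subseteq> {m. p m \<noteq> \<zero>}"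
    by (auto simp: slice_def)
  then have "finite ((\<lambda>m. m + replicate_mset i x) ` {m. slice x p i m \<noteq> \<zero>})"
    using assms unfolding IP_def by (auto intro: finite_subset)
  then have "finite {m. slice x p i m \<noteq> \<zero>}"
    by (rule finite_imageD) (auto simp: inj_on_def)
  moreover have "set_mset m \<subseteq> S" if "slice x p i m \<noteq> \<zero>" for m
  proof -
    have "x \<notin># m" "p (m + replicate_mset i x) \<noteq> \<zero>" using that by (auto simp: slice_def split: if_splits)
    then have "set_mset (m + replicate_mset i x) \<subseteq> insert x S" using assms unfolding IP_def by blast
    then show ?thesis using \<open>x \<notin># m\<close> by auto
  qed
  moreover have "\<forall>m. slice x p i m \<in> K" using assms by (auto simp: slice_def)
  ultimately show ?thesis unfolding IP_def by blast
qed

lemma slice_padd: "slice x (indexed_padd p q) i = indexed_padd (slice x p i) (slice x q i)"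
  by (auto simp: slice_def indexed_padd_def)

lemma slice_pmult_other:
  assumes "j \<noteq> x"
  shows "slice x (indexed_pmult p j) i = indexed_pmult (slice x p i) j"
proof
  fix m
  have "j \<in># m \<Longrightarrow> m + replicate_mset i x - {#j#} = m - {#j#} + replicate_mset i x" by simp
  moreover have "x \<in># m - {#j#} \<longleftrightarrow> x \<in># m" using assms by (simp add: in_diff_count)
  ultimately show "slice x (indexed_pmult p j) i m = indexed_pmult (slice x p i) j m"
    using assms by (auto simp: slice_def indexed_pmult_def)
qed

lemma slice_pmult_self:
  "slice x (indexed_pmult p x) i = (if i = 0 then indexed_const \<zero> else slice x p (i - 1))"
proof (cases i)
  case (Suc j)
  then show ?thesis by (auto simp: slice_def indexed_pmult_def fun_eq_iff)
qed (auto simp: slice_def indexed_pmult_def indexed_const_def fun_eq_iff)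

lemma slice_const: "slice x (indexed_const k) i = (if i = 0 then indexed_const k else indexed_const \<zero>)"
  by (auto simp: slice_def indexed_const_def fun_eq_iff)

text \<open>Induction along the generation of \<open>p\<close> by constants, sums and products with
  a variable avoids reordering a sum over monomials. The equation holds for all large
  \<open>n\<close>, because the parts of a sum come with different bounds.\<close>

lemma ev_slice:
  assumes "p \<in> IP (insert x S)" "x \<in> carrier R" "S \<subseteq> carrier R"
  shows "\<exists>N. (\<forall>n\<ge>N. slice x p n = indexed_const \<zero>) \<and> (\<forall>n\<ge>N. ev p = pe (\<lambda>i. ev (slice x p i)) n x)"
proof -
  have "p \<in> indexed_pset (insert x S) K" using assms by (simp add: IP_eq)
  then show ?thesis
  proof induction
    case (indexed_const k)
    have "ev (indexed_const k) = pe (\<lambda>i. ev (slice x (indexed_const k) i)) n x" if "n \<ge> 1" for n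
    proof -
      have "pe (\<lambda>i. ev (slice x (indexed_const k) i)) n x = pe (\<lambda>i. ev (slice x (indexed_const k) i)) 1 x"
        using indexed_const assms(2) that by (intro pe_pad) (auto simp: slice_const ev_const)
      then show ?thesis using indexed_const by (simp add: slice_const ev_const)
    qed
    then show ?case by (intro exI[of _ 1]) (auto simp: slice_const)
  next
    case (indexed_padd P Q)
    then obtain M N where M: "\<And>n. n \<ge> M \<Longrightarrow> slice x P n = indexed_const \<zero>"
        "\<And>n. n \<ge> M \<Longrightarrow> ev P = pe (\<lambda>i. ev (slice x P i)) n x"
      and N: "\<And>n. n \<ge> N \<Longrightarrow> slice x Q n = indexed_const \<zero>"
        "\<And>n. n \<ge> N \<Longrightarrow> ev Q = pe (\<lambda>i. ev (slice x Q i)) n x" by blast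
    have PQ: "P \<in> IP (insert x S)" "Q \<in> IP (insert x S)" using indexed_padd by (auto simp: IP_eq)
    have cl: "ev (slice x P i) \<in> carrier R" "ev (slice x Q i) \<in> carrier R" for i
      using ev_closed[OF slice_IP] PQ assms by auto
    have "ev (indexed_padd P Q) = pe (\<lambda>i. ev (slice x (indexed_padd P Q) i)) n x" if "n \<ge> M + N" for n
    proof -
      have "ev (slice x (indexed_padd P Q) i) = ev (slice x P i) \<oplus> ev (slice x Q i)" for i
        unfolding slice_padd by (rule ev_padd[OF slice_IP[OF PQ(1)] slice_IP[OF PQ(2)] assms(3)])
      then have "pe (\<lambda>i. ev (slice x (indexed_padd P Q) i)) n x
          = pe (\<lambda>i. ev (slice x P i)) n x \<oplus> pe (\<lambda>i. ev (slice x Q i)) n x"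
        using cl assms(2) by (simp add: pe_add)
      moreover have "ev (indexed_padd P Q) = ev P \<oplus> ev Q"
        using ev_padd[OF PQ] assms by auto
      ultimately show ?thesis using M(2)[of n] N(2)[of n] that by simp
    qed
    moreover have "slice x (indexed_padd P Q) n = indexed_const \<zero>" if "n \<ge> M + N" for n
      using M(1)[of n] N(1)[of n] that by (simp add: slice_padd indexed_padd_const)
    ultimately show ?case by blast
  next
    case (indexed_pmult P j)
    then obtain M where M: "\<And>n. n \<ge> M \<Longrightarrow> slice x P n = indexed_const \<zero>"
        "\<And>n. n \<ge> M \<Longrightarrow> ev P = pe (\<lambda>i. ev (slice x P i)) n x" by blast
    have P: "P \<in> IP (insert x S)" using indexed_pmult by (auto simp: IP_eq)
    have cl: "ev (slice x P i) \<in> carrier R" for i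
      using ev_closed[OF slice_IP] P assms by auto
    have evj: "ev (indexed_pmult P j) = ev P \<otimes> j"
      using ev_pmult[OF P indexed_pmult(2)] assms by auto
    show ?case
    proof (cases "j = x")
      case True
      have "ev (indexed_pmult P j) = pe (\<lambda>i. ev (slice x (indexed_pmult P j) i)) n x" if "n \<ge> Suc M" for n
      proof -
        obtain n' where n': "n = Suc n'" "n' \<ge> M" using \<open>n \<ge> Suc M\<close> by (cases n) auto
        have "(\<lambda>i. ev (slice x (indexed_pmult P j) i)) = (\<lambda>i. if i = 0 then \<zero> else ev (slice x P (i - 1)))"
          using True by (auto simp: slice_pmult_self ev_const)
        then have "pe (\<lambda>i. ev (slice x (indexed_pmult P j) i)) n x = pe (\<lambda>i. ev (slice x P i)) n' x \<otimes> x \<oplus> \<zero>"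
          using pe_shift[of n' "\<lambda>i. ev (slice x P i)" \<zero> x] cl assms(2) n'(1) by simp
        then show ?thesis using M(2)[OF n'(2)] evj True cl assms by simp
      qed
      moreover have "slice x (indexed_pmult P j) n = indexed_const \<zero>" if "n \<ge> Suc M" for n
        using that M(1)[of "n - 1"] True by (auto simp: slice_pmult_self)
      ultimately show ?thesis by blast
    next
      case False
      then have j: "j \<in> S" "j \<in> carrier R" using indexed_pmult assms by auto
      have "ev (slice x (indexed_pmult P j) i) = j \<otimes> ev (slice x P i)" for i
        using ev_pmult[OF slice_IP[OF P] j(1) assms(3)] cl j by (simp add: slice_pmult_other[OF False] m_comm)
      then have "pe (\<lambda>i. ev (slice x (indexed_pmult P j) i)) n x = j \<otimes> pe (\<lambda>i. ev (slice x P i)) n x" for n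
        using cl j assms by (simp add: pe_smult)
      then have "ev (indexed_pmult P j) = pe (\<lambda>i. ev (slice x (indexed_pmult P j) i)) n x" if "n \<ge> M" for n
        using evj M(2)[OF that] j cl assms by (simp add: m_comm)
      moreover have "slice x (indexed_pmult P j) n = indexed_const \<zero>" if "n \<ge> M" for n
        using M(1)[OF that] by (simp add: slice_pmult_other[OF False])
      ultimately show ?thesis by blast
    qed
  qed
qed

lemma slice_all_zero:
  assumes "\<And>i. slice x p i = indexed_const \<zero>"
  shows "p = indexed_const \<zero>"
proof
  fix m
  let ?m = "filter_mset (\<lambda>y. y \<noteq> x) m"
  have "?m + replicate_mset (count m x) x = m" by (rule multiset_eqI) auto
  then have "p m = slice x p (count m x) ?m" by (simp add: slice_def)
  then show "p m = indexed_const \<zero> m" by (simp add: assms indexed_const_def)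
qed

lemma alg_indep_iff:
  "algebraically_independent R K S \<longleftrightarrow>
     S \<subseteq> carrier R \<and> (\<forall>p\<in>IP S. ev p = \<zero> \<longrightarrow> p = indexed_const \<zero>)"
  unfolding algebraically_independent_def IP_eq ..

lemma alg_indep_subset:
  assumes "algebraically_independent R K S" "S' \<subseteq> S"
  shows "algebraically_independent R K S'"
  using assms IP_mono[OF assms(2)] unfolding alg_indep_iff by blast

lemma alg_indep_empty: "algebraically_independent R K {}"
proof -
  have "p = indexed_const \<zero>" if p: "p \<in> IP {}" "ev p = \<zero>" for p
  proof -
    have "p m = \<zero>" if "m \<noteq> {#}" for m using p that unfolding IP_def by force
    then have "p = indexed_const (p {#})" by (auto simp: indexed_const_def)
    then have "ev p = p {#}" using p ev_const[of "p {#}"] by (metis IP_K)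
    then show ?thesis using p \<open>p = indexed_const (p {#})\<close> by simp
  qed
  then show ?thesis unfolding alg_indep_iff by auto
qed

text \<open>A polynomial in \<open>insert x S\<close> is a polynomial in \<open>x\<close> with the
  slices as coefficients. From here on, independence of a finite set reduces to transcendence of one
  element after the other.\<close>

theorem alg_indep_insert:
  assumes "x \<notin> S" "x \<in> carrier R" "S \<subseteq> carrier R"
  shows "algebraically_independent R K (insert x S) \<longleftrightarrow>
    algebraically_independent R K S \<and> trans_over (generate_ring R (K \<union> S)) x"
proof (intro iffI conjI)
  assume ai: "algebraically_independent R K S \<and> trans_over (generate_ring R (K \<union> S)) x"
  have "p = indexed_const \<zero>" if p: "p \<in> IP (insert x S)" "ev p = \<zero>" for p
  proof -
    obtain N where N: "\<And>n. n \<ge> N \<Longrightarrow> slice x p n = indexed_const \<zero>"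
        "\<And>n. n \<ge> N \<Longrightarrow> ev p = pe (\<lambda>i. ev (slice x p i)) n x"
      using ev_slice[OF p(1) assms(2,3)] by blast
    have "ev (slice x p i) = \<zero>" if "i < N" for i
      using trans_overD[of "generate_ring R (K \<union> S)" x "\<lambda>i. ev (slice x p i)" N i] ai N(2)[of N] p(2) that
      by (simp add: ev_image[OF assms(3)] slice_IP[OF p(1)])
    then have "slice x p i = indexed_const \<zero>" for i
      using N(1)[of i] ai slice_IP[OF p(1)] unfolding alg_indep_iff by (meson not_le)
    then show ?thesis by (rule slice_all_zero)
  qed
  then show "algebraically_independent R K (insert x S)" using assms unfolding alg_indep_iff by auto
next
  assume ai: "algebraically_independent R K (insert x S)"
  then show ai': "algebraically_independent R K S" by (rule alg_indep_subset) auto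
  show "trans_over (generate_ring R (K \<union> S)) x"
    unfolding trans_over_def
  proof (intro allI impI)
    fix c :: "nat \<Rightarrow> 'a" and n i
    assume c: "\<forall>i<n. c i \<in> generate_ring R (K \<union> S)" "pe c n x = \<zero>" and i: "i < n"
    have "\<forall>i. \<exists>q. i < n \<longrightarrow> q \<in> IP S \<and> c i = ev q" using c(1) unfolding ev_image[OF assms(3)] by blast
    then obtain q where q: "\<And>i. i < n \<Longrightarrow> q i \<in> IP S" "\<And>i. i < n \<Longrightarrow> c i = ev (q i)" by metis
    \<comment> \<open>The polynomial whose slices are the \<open>q i\<close>: the multiplicity of
      \<open>x\<close> in a monomial selects the slice, the rest of the monomial selects the
      coefficient in it.\<close>
    define p where "p m = (if count m x < n then q (count m x) (filter_mset (\<lambda>y. y \<noteq> x) m) else \<zero>)" for m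
    have split: "filter_mset (\<lambda>y. y \<noteq> x) m + replicate_mset (count m x) x = m" for m by (rule multiset_eqI) auto
    have "{m. p m \<noteq> \<zero>} \<subseteq> (\<Union>i<n. (\<lambda>m. m + replicate_mset i x) ` {m. q i m \<noteq> \<zero>})"
    proof
      fix m assume "m \<in> {m. p m \<noteq> \<zero>}"
      then have "count m x < n" "q (count m x) (filter_mset (\<lambda>y. y \<noteq> x) m) \<noteq> \<zero>"
        by (auto simp: p_def split: if_splits)
      then show "m \<in> (\<Union>i<n. (\<lambda>m. m + replicate_mset i x) ` {m. q i m \<noteq> \<zero>})"
        using split[of m] by (intro UN_I[of "count m x"] image_eqI[of _ _ "filter_mset (\<lambda>y. y \<noteq> x) m"]) auto
    qed
    moreover have "finite (\<Union>i<n. (\<lambda>m. m + replicate_mset i x) ` {m. q i m \<noteq> \<zero>})"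
      using q(1) unfolding IP_def by auto
    ultimately have fin: "finite {m. p m \<noteq> \<zero>}" by (rule finite_subset)
    have "set_mset m \<subseteq> insert x S" if "p m \<noteq> \<zero>" for m
    proof -
      have "count m x < n" "q (count m x) (filter_mset (\<lambda>y. y \<noteq> x) m) \<noteq> \<zero>"
        using that by (auto simp: p_def split: if_splits)
      then have "set_mset (filter_mset (\<lambda>y. y \<noteq> x) m) \<subseteq> S" using q(1) unfolding IP_def by blast
      then show ?thesis by auto
    qed
    moreover have "p m \<in> K" for m using IP_K[OF q(1)] by (simp add: p_def)
    ultimately have p: "p \<in> IP (insert x S)" using fin unfolding IP_def by auto
    have sl: "slice x p j = q j" if "j < n" for j
    proof
      fix m
      show "slice x p j m = q j m"
      proof (cases "x \<in># m")
        case True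
        then have "q j m = \<zero>" using q(1)[OF that] assms(1) unfolding IP_def by auto
        then show ?thesis using True by (simp add: slice_def)
      next
        case False
        then have "count (m + replicate_mset j x) x = j" "filter_mset (\<lambda>y. y \<noteq> x) (m + replicate_mset j x) = m"
          by (auto simp: count_eq_zero_iff intro!: multiset_eqI)
        then show ?thesis using False that by (simp add: slice_def p_def)
      qed
    qed
    have sl0: "slice x p j = indexed_const \<zero>" if "j \<ge> n" for j
      using that by (auto simp: slice_def p_def indexed_const_def fun_eq_iff)
    obtain N where N: "\<And>n. n \<ge> N \<Longrightarrow> ev p = pe (\<lambda>i. ev (slice x p i)) n x"
      using ev_slice[OF p assms(2,3)] by blast
    have cl: "ev (slice x p j) \<in> carrier R" for j by (rule ev_closed[OF slice_IP[OF p] assms(3)])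
    have "ev p = pe (\<lambda>i. ev (slice x p i)) (N + n) x" by (rule N) simp
    also have "\<dots> = pe (\<lambda>i. ev (slice x p i)) n x"
      using cl assms(2) by (intro pe_pad) (auto simp: sl0 ev_const)
    also have "\<dots> = pe c n x" by (rule pe_cong) (simp add: sl q(2))
    finally have "ev p = \<zero>" using c(2) by simp
    then have p0: "p = indexed_const \<zero>" using ai p unfolding alg_indep_iff by blast
    have "slice x (indexed_const \<zero>) i = indexed_const \<zero>" by (simp add: slice_const)
    then have "q i = indexed_const \<zero>" using sl[OF i] p0 by simp
    then show "c i = \<zero>" using q(2)[OF i] ev_const[of \<zero>] by simp
  qed
qed

end

lemma (in cring) coeff_subI: "subring K R \<Longrightarrow> coeff_sub R K"
  by (simp add: coeff_sub_def coeff_sub_axioms_def is_cring)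

context coeff_sub
begin

abbreviation ai where "ai \<equiv> algebraically_independent R K"
abbreviation gen where "gen S \<equiv> generate_ring R (K \<union> S)"

lemma KS_carrier: "S \<subseteq> carrier R \<Longrightarrow> K \<union> S \<subseteq> carrier R"
  by auto

lemma subring_gen: "S \<subseteq> carrier R \<Longrightarrow> subring (gen S) R"
  by (rule generate_ring_is_subring[OF KS_carrier])

lemma gen_incl: "s \<in> S \<Longrightarrow> s \<in> gen S" "a \<in> K \<Longrightarrow> a \<in> gen S"
  by (auto intro: generate_ring.incl)

lemma gen_carrier: "S \<subseteq> carrier R \<Longrightarrow> a \<in> gen S \<Longrightarrow> a \<in> carrier R"
  using subringE(1)[OF subring_gen] by blast

lemma gen_mono: "S \<subseteq> S' \<Longrightarrow> S' \<subseteq> carrier R \<Longrightarrow> gen S \<subseteq> gen S'"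
  by (rule mono_generate_ring[OF _ KS_carrier]) auto

lemma gen_min:
  assumes "subring B R" "K \<subseteq> B" "S \<subseteq> B" shows "gen S \<subseteq> B"
  using assms subringE(1)[OF assms(1)] by (intro generate_ring_min_subring1) auto

lemma gen_insert:
  assumes "S \<subseteq> carrier R" "x \<in> carrier R"
  shows "gen (insert x S) = adj (gen S) x"
  using adj_generate_ring[OF KS_carrier[OF assms(1)] assms(2)] by simp

lemma gen_empty: "gen {} = K"
proof
  show "gen {} \<subseteq> K" by (rule gen_min[OF subring_K]) auto
qed (auto intro: generate_ring.incl)

lemma ai_carrier: "ai S \<Longrightarrow> S \<subseteq> carrier R"
  unfolding algebraically_independent_def by blast

end

section \<open>Independence along ring homomorphisms\<close>

context ring_hom_cring
begin

lemma hom_a_inv' [simp]: "x \<in> carrier R \<Longrightarrow> h (\<ominus> x) = \<ominus>\<^bsub>S\<^esub> h x"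
  by (rule hom_a_inv)

lemma hom_generate_ring:
  assumes "H \<subseteq> carrier R"
  shows "h ` generate_ring R H = generate_ring S (h ` H)"
proof
  show "h ` generate_ring R H \<subseteq> generate_ring S (h ` H)"
  proof (intro image_subsetI)
    fix x assume "x \<in> generate_ring R H"
    then show "h x \<in> generate_ring S (h ` H)"
    proof induction
      case one
      show ?case using generate_ring.one[of S "h ` H"] by simp
    next
      case (a_inv y)
      then have "y \<in> carrier R" using R.generate_ring_in_carrier[OF assms] by blast
      then show ?case using generate_ring.a_inv[OF a_inv.IH] by simp
    next
      case (eng_add y z)
      then have "y \<in> carrier R" "z \<in> carrier R" using R.generate_ring_in_carrier[OF assms] by blast+
      then show ?case using generate_ring.eng_add[OF eng_add.IH] by simp
    next
      case (eng_mult y z)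
      then have "y \<in> carrier R" "z \<in> carrier R" using R.generate_ring_in_carrier[OF assms] by blast+
      then show ?case using generate_ring.eng_mult[OF eng_mult.IH] by simp
    qed (auto intro: generate_ring.incl)
  qed
  show "generate_ring S (h ` H) \<subseteq> h ` generate_ring R H"
  proof
    fix y assume "y \<in> generate_ring S (h ` H)"
    then show "y \<in> h ` generate_ring R H"
    proof induction
      case one
      then show ?case using generate_ring.one[of R H] by (intro image_eqI[of _ _ \<one>]) auto
    next
      case (incl y)
      then show ?case by (auto intro: generate_ring.incl)
    next
      case (a_inv y)
      then obtain a where a: "a \<in> generate_ring R H" "y = h a" by blast
      then have "a \<in> carrier R" using R.generate_ring_in_carrier[OF assms] by blast
      then show ?case using a generate_ring.a_inv[OF a(1)] by (intro image_eqI[of _ _ "\<ominus> a"]) auto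
    next
      case (eng_add y z)
      then obtain a b where a: "a \<in> generate_ring R H" "y = h a" "b \<in> generate_ring R H" "z = h b" by blast
      then have "a \<in> carrier R" "b \<in> carrier R" using R.generate_ring_in_carrier[OF assms] by blast+
      then show ?case using a generate_ring.eng_add[OF a(1,3)] by (intro image_eqI[of _ _ "a \<oplus> b"]) auto
    next
      case (eng_mult y z)
      then obtain a b where a: "a \<in> generate_ring R H" "y = h a" "b \<in> generate_ring R H" "z = h b" by blast
      then have "a \<in> carrier R" "b \<in> carrier R" using R.generate_ring_in_carrier[OF assms] by blast+
      then show ?case using a generate_ring.eng_mult[OF a(1,3)] by (intro image_eqI[of _ _ "a \<otimes> b"]) auto
    qed
  qed
qed

lemma hom_subring:
  assumes "subring K R" shows "subring (h ` K) S"
proof -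
  have K: "K \<subseteq> carrier R" using subringE(1)[OF assms] .
  have "generate_ring R K = K"
    using R.generate_ring_min_subring1[OF K assms] by (auto intro: generate_ring.incl)
  then have "h ` K = generate_ring S (h ` K)" using hom_generate_ring[OF K] by simp
  moreover have "h ` K \<subseteq> carrier S" using K by auto
  ultimately show ?thesis using S.generate_ring_is_subring by metis
qed

lemma hom_pe:
  assumes "\<And>i. i < n \<Longrightarrow> c i \<in> carrier R" "x \<in> carrier R"
  shows "h (R.pe c n x) = S.pe (\<lambda>i. h (c i)) n (h x)"
  using assms by (induction n) auto

lemma inj_on_subring:
  assumes "subring A R"
  shows "inj_on h A \<longleftrightarrow> (\<forall>a\<in>A. h a = \<zero>\<^bsub>S\<^esub> \<longrightarrow> a = \<zero>)"
proof
  assume "inj_on h A"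
  then show "\<forall>a\<in>A. h a = \<zero>\<^bsub>S\<^esub> \<longrightarrow> a = \<zero>"
    using subringE(2)[OF assms] by (metis hom_zero inj_onD)
next
  assume *: "\<forall>a\<in>A. h a = \<zero>\<^bsub>S\<^esub> \<longrightarrow> a = \<zero>"
  show "inj_on h A"
  proof (rule inj_onI)
    fix x y assume xy: "x \<in> A" "y \<in> A" "h x = h y"
    then have c: "x \<in> carrier R" "y \<in> carrier R" using subringE(1)[OF assms] by auto
    have "x \<ominus> y \<in> A" using xy subringE(5,7)[OF assms] unfolding a_minus_def by auto
    moreover have "h (x \<ominus> y) = \<zero>\<^bsub>S\<^esub>" using c xy(3) by (simp add: R.minus_eq S.r_neg)
    ultimately have "x \<ominus> y = \<zero>" using * by blast
    then show "x = y" using c by simp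
  qed
qed

text \<open>Coefficients lift through \<open>h\<close>, so a relation over the image comes from an
  element of \<open>R.adj A x\<close> that \<open>h\<close> kills. Injectivity there makes the
  element zero, and transcendence of \<open>x\<close> then kills its coefficients. Conversely,
  transcendence of the image detects zero coefficients through \<open>h\<close>.\<close>

lemma hom_trans_over:
  assumes "subring A R" "x \<in> carrier R" "inj_on h A"
  shows "R.trans_over A x \<and> inj_on h (R.adj A x) \<longleftrightarrow> S.trans_over (h ` A) (h x)"
proof -
  interpret A: cring_sub R A x by (rule R.pw_cring_sub[OF assms(1,2)])
  have A0: "a = \<zero>" if "a \<in> A" "h a = \<zero>\<^bsub>S\<^esub>" for a
    using assms(3) that unfolding inj_on_subring[OF assms(1)] by blast
  show ?thesis
  proof (intro iffI conjI)
    assume t: "R.trans_over A x \<and> inj_on h (R.adj A x)"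
    show "S.trans_over (h ` A) (h x)"
      unfolding S.trans_over_def
    proof (intro allI impI)
      fix c :: "nat \<Rightarrow> _" and n i
      assume c: "\<forall>i<n. c i \<in> h ` A" "S.pe c n (h x) = \<zero>\<^bsub>S\<^esub>" and i: "i < n"
      from c(1) have "\<forall>i. \<exists>d. i < n \<longrightarrow> d \<in> A \<and> c i = h d" by blast
      then obtain d where d: "\<And>i. i < n \<Longrightarrow> d i \<in> A" "\<And>i. i < n \<Longrightarrow> c i = h (d i)" by metis
      have "h (R.pe d n x) = S.pe (\<lambda>i. h (d i)) n (h x)" using d(1) by (intro hom_pe) auto
      also have "\<dots> = S.pe c n (h x)" using d(2) by (intro S.pe_cong) auto
      finally have "h (R.pe d n x) = \<zero>\<^bsub>S\<^esub>" using c by simp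
      moreover have "R.pe d n x \<in> R.adj A x" using A.pwI[of n d] d(1) A.adjI by blast
      ultimately have "R.pe d n x = \<zero>" using t unfolding inj_on_subring[OF A.subring_adj] by blast
      then have "d i = \<zero>" using R.trans_overD[of A x d n i] t d(1) i by blast
      then show "c i = \<zero>\<^bsub>S\<^esub>" using d(2)[OF i] by simp
    qed
  next
    assume t: "S.trans_over (h ` A) (h x)"
    have key: "d i = \<zero>" if "\<And>i. i < n \<Longrightarrow> d i \<in> A" "h (R.pe d n x) = \<zero>\<^bsub>S\<^esub>" "i < n" for d n i
    proof -
      have "S.pe (\<lambda>i. h (d i)) n (h x) = \<zero>\<^bsub>S\<^esub>" using hom_pe[of n d x] that by simp
      then have "h (d i) = \<zero>\<^bsub>S\<^esub>"
        using S.trans_overD[OF t, of "\<lambda>i. h (d i)" n i] that by blast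
      then show ?thesis using A0 that by blast
    qed
    show "R.trans_over A x"
      unfolding R.trans_over_def
    proof (intro allI impI)
      fix c n i assume c: "\<forall>i<n. c i \<in> A" "R.pe c n x = \<zero>" "i < (n::nat)"
      show "c i = \<zero>" by (rule key[of n c i]) (use c in auto)
    qed
    have "a = \<zero>" if "a \<in> R.adj A x" "h a = \<zero>\<^bsub>S\<^esub>" for a
    proof -
      from that(1) obtain n where "a \<in> R.pw A x n" by (rule A.adjE)
      then obtain d where d: "\<And>i. i < n \<Longrightarrow> d i \<in> A" "a = R.pe d n x" by (rule A.pwE) blast
      then have "\<And>i. i < n \<Longrightarrow> d i = \<zero>" using key that(2) by blast
      then have "R.pe d n x = R.pe (\<lambda>_. \<zero>) n x" by (intro R.pe_cong) auto
      then show ?thesis using d(2) by (simp add: R.pe_zero)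
    qed
    then show "inj_on h (R.adj A x)" unfolding inj_on_subring[OF A.subring_adj] by blast
  qed
qed

text \<open>Induction over \<open>Y\<close> with \<open>hom_trans_over\<close>. The condition
  \<open>inj_on h Y\<close> is there because the image is a set and hides collisions. It is applied
  to inclusions of subrings, to embeddings into quotient fields and to reduction modulo a
  prime.\<close>

theorem hom_alg_indep:
  assumes "subring K R" "inj_on h K" "finite Y" "Y \<subseteq> carrier R"
  shows "algebraically_independent R K Y \<and> inj_on h (generate_ring R (K \<union> Y)) \<longleftrightarrow>
    algebraically_independent S (h ` K) (h ` Y) \<and> inj_on h Y"
  using assms(3,4)
proof (induction Y)
  interpret K: coeff_sub R K by (rule R.coeff_subI[OF assms(1)])
  interpret hK: coeff_sub S "h ` K" by (rule S.coeff_subI[OF hom_subring[OF assms(1)]])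
  case empty
  then show ?case using K.alg_indep_empty hK.alg_indep_empty assms(2) K.gen_empty by simp
next
  interpret K: coeff_sub R K by (rule R.coeff_subI[OF assms(1)])
  interpret hK: coeff_sub S "h ` K" by (rule S.coeff_subI[OF hom_subring[OF assms(1)]])
  case (insert x Y)
  then have Y: "Y \<subseteq> carrier R" and x: "x \<in> carrier R" by auto
  let ?A = "K.gen Y"
  have hY: "h ` Y \<subseteq> carrier S" using Y by auto
  have hA: "hK.gen (h ` Y) = h ` ?A" using hom_generate_ring[OF K.KS_carrier[OF Y]] by (simp add: image_Un)
  have sub: "?A \<subseteq> R.adj ?A x"
    using cring_sub.adj_incl[OF R.pw_cring_sub[OF K.subring_gen[OF Y] x]] by blast
  show ?case
  proof
    assume l: "K.ai (insert x Y) \<and> inj_on h (K.gen (insert x Y))"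
    then have ix: "inj_on h (insert x Y)"
      by (meson K.gen_incl(1) inj_on_subset subsetI)
    then have nx: "h x \<notin> h ` Y" using insert.hyps(2) by (simp add: inj_on_insert)
    have iA: "inj_on h ?A" using l sub unfolding K.gen_insert[OF Y x] by (meson inj_on_subset)
    have "K.ai Y \<and> R.trans_over ?A x" using l K.alg_indep_insert[OF insert.hyps(2) x Y] by blast
    moreover have "hK.ai (h ` Y)" using insert.IH[OF Y] calculation iA by blast
    moreover have "S.trans_over (h ` ?A) (h x)"
      using hom_trans_over[OF K.subring_gen[OF Y] x iA] l calculation unfolding K.gen_insert[OF Y x] by blast
    ultimately show "hK.ai (h ` insert x Y) \<and> inj_on h (insert x Y)"
      using ix hK.alg_indep_insert[OF nx _ hY] x hA by simp
  next
    assume r: "hK.ai (h ` insert x Y) \<and> inj_on h (insert x Y)"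
    then have nx: "h x \<notin> h ` Y" using insert.hyps(2) by (simp add: inj_on_insert)
    have *: "hK.ai (h ` Y) \<and> S.trans_over (h ` ?A) (h x)"
      using r hK.alg_indep_insert[OF nx _ hY] x hA by simp
    then have **: "K.ai Y \<and> inj_on h ?A" using insert.IH[OF Y] r by (simp add: inj_on_insert)
    then have "R.trans_over ?A x \<and> inj_on h (R.adj ?A x)"
      using hom_trans_over[OF K.subring_gen[OF Y] x] * by blast
    then show "K.ai (insert x Y) \<and> inj_on h (K.gen (insert x Y))"
      using ** K.alg_indep_insert[OF insert.hyps(2) x Y] unfolding K.gen_insert[OF Y x] by blast
  qed
qed

end

section \<open>Fraction fields inside an ambient field\<close>

definition (in ring) frac :: "'a set \<Rightarrow> 'a set" where
  "frac A = {a \<otimes> inv b | a b. a \<in> A \<and> b \<in> A \<and> b \<noteq> \<zero>}"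

context field
begin

lemma inv_nz [simp]:
  assumes "b \<in> carrier R" "b \<noteq> \<zero>"
  shows "inv b \<in> carrier R" "b \<otimes> inv b = \<one>" "inv b \<otimes> b = \<one>" "inv b \<noteq> \<zero>"
proof -
  have u: "b \<in> Units R" using assms field_Units by auto
  then show *: "inv b \<in> carrier R" "b \<otimes> inv b = \<one>" "inv b \<otimes> b = \<one>" by auto
  show "inv b \<noteq> \<zero>" using * assms by force
qed

lemma fracE:
  assumes "y \<in> frac A" "A \<subseteq> carrier R"
  obtains a b where "a \<in> A" "b \<in> A" "b \<noteq> \<zero>" "y = a \<otimes> inv b" "b \<otimes> y = a" "y \<in> carrier R"
proof -
  from assms(1) obtain a b where ab: "a \<in> A" "b \<in> A" "b \<noteq> \<zero>" "y = a \<otimes> inv b" unfolding frac_def by blast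
  then have c: "a \<in> carrier R" "b \<in> carrier R" using assms by auto
  have "b \<otimes> (a \<otimes> inv b) = a \<otimes> (b \<otimes> inv b)" using c ab inv_nz(1)[of b] by algebra
  then have "b \<otimes> y = a" using c ab by simp
  then show thesis using that ab c by auto
qed

lemma fracI:
  assumes "subring A R" "b \<in> A" "b \<noteq> \<zero>" "b \<otimes> y \<in> A" "y \<in> carrier R"
  shows "y \<in> frac A"
proof -
  have b: "b \<in> carrier R" using assms subringE(1) by blast
  have "(b \<otimes> y) \<otimes> inv b = (b \<otimes> inv b) \<otimes> y" using b assms(3,5) inv_nz(1)[of b] by algebra
  then have "y = (b \<otimes> y) \<otimes> inv b" using b assms by simp
  then show ?thesis unfolding frac_def using assms by blast
qed

lemma frac_incl: "subring A R \<Longrightarrow> A \<subseteq> frac A"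
proof
  fix a assume A: "subring A R" "a \<in> A"
  then have "\<one> \<otimes> a \<in> A" "a \<in> carrier R" using subringE(1)[OF A(1)] by (auto simp: subset_eq)
  then show "a \<in> frac A" using fracI[OF A(1) subringE(3)[OF A(1)], of a] by simp
qed

lemma subfield_frac:
  assumes A: "subring A R" shows "subfield (frac A) R"
proof -
  have Ac: "A \<subseteq> carrier R" using subringE(1)[OF A] .
  note cl = subringE(2,3,5,6,7)[OF A]
  show ?thesis
  proof (rule subfieldI'[OF subringI])
    show "frac A \<subseteq> carrier R" using Ac by (auto elim: fracE)
    show "\<one> \<in> frac A" using frac_incl[OF A] cl by auto
  next
    fix h assume h: "h \<in> frac A"
    obtain a b where ab: "a \<in> A" "b \<in> A" "b \<noteq> \<zero>" "b \<otimes> h = a" "h \<in> carrier R" using fracE[OF h Ac] by metis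
    then have "b \<otimes> (\<ominus> h) = \<ominus> a" using Ac by (auto simp: r_minus subset_eq)
    then show "\<ominus> h \<in> frac A" using ab cl by (intro fracI[OF A ab(2,3)]) auto
  next
    fix h g assume h: "h \<in> frac A" "g \<in> frac A"
    obtain a b where ab: "a \<in> A" "b \<in> A" "b \<noteq> \<zero>" "b \<otimes> h = a" "h \<in> carrier R" using fracE[OF h(1) Ac] by metis
    obtain c d where cd: "c \<in> A" "d \<in> A" "d \<noteq> \<zero>" "d \<otimes> g = c" "g \<in> carrier R" using fracE[OF h(2) Ac] by metis
    have car: "a \<in> carrier R" "b \<in> carrier R" "c \<in> carrier R" "d \<in> carrier R" using ab cd Ac by auto
    have bd: "b \<otimes> d \<in> A" "b \<otimes> d \<noteq> \<zero>" using ab cd cl car by (auto simp: integral_iff)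
    have "(b \<otimes> d) \<otimes> (h \<oplus> g) = d \<otimes> (b \<otimes> h) \<oplus> b \<otimes> (d \<otimes> g)" using car ab(5) cd(5) by algebra
    then show "h \<oplus> g \<in> frac A" using ab cd cl by (intro fracI[OF A bd]) auto
    have "(b \<otimes> d) \<otimes> (h \<otimes> g) = (b \<otimes> h) \<otimes> (d \<otimes> g)" using car ab(5) cd(5) by algebra
    then show "h \<otimes> g \<in> frac A" using ab cd cl by (intro fracI[OF A bd]) auto
  next
    fix h assume h: "h \<in> frac A - {\<zero>}"
    then obtain a b where ab: "a \<in> A" "b \<in> A" "b \<noteq> \<zero>" "b \<otimes> h = a" "h \<in> carrier R" using fracE[OF _ Ac] by (metis DiffE)
    have car: "a \<in> carrier R" "b \<in> carrier R" using ab Ac by auto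
    have h0: "h \<noteq> \<zero>" using h by auto
    have "a \<noteq> \<zero>" using ab car h0 integral by metis
    moreover have "a \<otimes> inv h = b"
    proof -
      have "b \<otimes> h \<otimes> inv h = b \<otimes> (h \<otimes> inv h)" using car ab(5) h0 by (simp add: m_assoc)
      then show ?thesis using ab car h0 by simp
    qed
    ultimately show "inv h \<in> frac A" using ab h0 by (intro fracI[OF A ab(1)]) auto
  qed
qed

lemma frac_min:
  assumes "subring A R" "subfield F R" "A \<subseteq> F" shows "frac A \<subseteq> F"
proof
  fix y assume "y \<in> frac A"
  then obtain a b where "a \<in> A" "b \<in> A" "b \<noteq> \<zero>" "y = a \<otimes> inv b"
    unfolding frac_def by blast
  then show "y \<in> F" using assms(3) subfield_m_inv(1)[OF assms(2), of b] subringE(6)[OF subfieldE(1)[OF assms(2)]]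
    by auto
qed

lemma frac_mono: "A \<subseteq> B \<Longrightarrow> frac A \<subseteq> frac B"
  unfolding frac_def by blast

lemma common_denominator:
  assumes A: "subring A R" and "\<And>i. i < (n::nat) \<Longrightarrow> c i \<in> frac A"
  shows "\<exists>b\<in>A. b \<noteq> \<zero> \<and> (\<forall>i<n. b \<otimes> c i \<in> A)"
  using assms(2)
proof (induction n)
  case 0
  then show ?case using subringE(3)[OF A] by (intro bexI[of _ \<one>]) auto
next
  case (Suc n)
  note Ac = subringE(1)[OF A]
  from Suc obtain b where b: "b \<in> A" "b \<noteq> \<zero>" "\<forall>i<n. b \<otimes> c i \<in> A" by (meson less_SucI)
  obtain d where d: "d \<in> A" "d \<noteq> \<zero>" "d \<otimes> c n \<in> A" "c n \<in> carrier R"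
    using fracE[OF Suc.prems[of n] Ac] by (metis lessI)
  have car: "b \<in> carrier R" "d \<in> carrier R" using b d Ac by auto
  have "b \<otimes> d \<otimes> c i \<in> A" if "i < Suc n" for i
  proof (cases "i = n")
    case True
    have "b \<otimes> d \<otimes> c n = b \<otimes> (d \<otimes> c n)" using car d by (simp add: m_assoc)
    then show ?thesis using True subringE(6)[OF A b(1) d(3)] by simp
  next
    case False
    then have i: "i < n" using that by simp
    have "c i \<in> carrier R" using fracE[OF Suc.prems[of i] Ac] that by metis
    then have "b \<otimes> d \<otimes> c i = d \<otimes> (b \<otimes> c i)" using car by algebra
    then show ?thesis using subringE(6)[OF A d(1)] b(3) i by simp
  qed
  moreover have "b \<otimes> d \<in> A" "b \<otimes> d \<noteq> \<zero>" using b d car subringE(6)[OF A] by (auto simp: integral_iff)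
  ultimately show ?case by blast
qed

text \<open>A common denominator turns a relation over the fractions into one over \<open>A\<close>;
  its coefficients vanish only if the original ones do, as there are no zero divisors.\<close>

lemma trans_over_frac:
  assumes A: "subring A R" and x: "x \<in> carrier R"
  shows "trans_over (frac A) x \<longleftrightarrow> trans_over A x"
proof
  assume "trans_over (frac A) x"
  then show "trans_over A x" using trans_over_mono frac_incl[OF A] by blast
next
  assume t: "trans_over A x"
  note Ac = subringE(1)[OF A]
  show "trans_over (frac A) x"
    unfolding trans_over_def
  proof (intro allI impI)
    fix c n i assume c: "\<forall>i<n. c i \<in> frac A" "pe c n x = \<zero>" and i: "i < n"
    obtain b where b: "b \<in> A" "b \<noteq> \<zero>" "\<forall>i<n. b \<otimes> c i \<in> A" using common_denominator[OF A] c(1) by blast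
    have bc: "b \<in> carrier R" using b Ac by auto
    have cc: "c i \<in> carrier R" if "i < n" for i using fracE[OF _ Ac] c(1) that by metis
    have "pe (\<lambda>i. b \<otimes> c i) n x = b \<otimes> pe c n x" using cc bc x by (intro pe_smult) auto
    then have "pe (\<lambda>i. b \<otimes> c i) n x = \<zero>" using c(2) bc by simp
    then have "b \<otimes> c i = \<zero>" using trans_overD[OF t, of "\<lambda>i. b \<otimes> c i" n i] b(3) i by blast
    then show "c i = \<zero>" using b(2) bc cc[OF i] by (simp add: integral_iff)
  qed
qed

end

lemma (in ring) eval_map_pe: "eval (map c (rev [0..<n])) x = pe c n x"
  by (induction n) auto

lemma (in domain) trans_over_iff:
  assumes A: "subring A R" and x: "x \<in> carrier R"
  shows "trans_over A x \<longleftrightarrow> (transcendental over A) x"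
proof
  assume t: "trans_over A x"
  show "(transcendental over A) x"
  proof (rule ccontr)
    assume "\<not> (transcendental over A) x"
    then have "(algebraic over A) x" by (simp add: over_def)
    then obtain p where p: "p \<in> carrier (A[X])" "p \<noteq> []" "eval p x = \<zero>"
      by (rule algebraicE[OF A x]) blast
    have pA: "set p \<subseteq> A" "lead_coeff p \<noteq> \<zero>"
      using p(1,2) by (auto simp: univ_poly_def polynomial_def)
    have "coeff p i \<in> A" if "i < length p" for i
      using coeff_img_restrict[of p] pA that by (metis imageI lessThan_iff subsetD)
    moreover have "pe (coeff p) (length p) x = \<zero>"
      using eval_map_pe[of "coeff p" "length p" x] coeff_list[of p] p(3) by simp
    ultimately have "coeff p (length p - 1) = \<zero>"
      using trans_overD[OF t, of "coeff p" "length p" "length p - 1"] p(2) by simp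
    then show False using lead_coeff_simp[OF p(2)] pA(2) by simp
  qed
next
  assume t: "(transcendental over A) x"
  show "trans_over A x"
    unfolding trans_over_def
  proof (intro allI impI)
    fix c n i assume c: "\<forall>i<n. c i \<in> A" "pe c n x = \<zero>" and i: "i < n"
    let ?q = "map c (rev [0..<n])"
    have q: "set ?q \<subseteq> A" using c(1) by auto
    \<comment> \<open>The list may start with zeros and is no polynomial in the strict sense;
      normalizing it changes neither the value nor the coefficients.\<close>
    have "eval (normalize ?q) x = \<zero>"
      using eval_normalize[of ?q x] q c(2) x subringE(1)[OF A] by (simp add: eval_map_pe subset_iff)
    moreover have "normalize ?q \<in> carrier (A[X])"
      using normalize_gives_polynomial[OF q] by (simp add: univ_poly_def)
    ultimately have "normalize ?q = []" using eval_transcendental[OF t] by blast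
    then have "coeff ?q = coeff []" using normalize_coeff[of ?q] by simp
    moreover have "coeff ?q i = c i"
      using i coeff_nth[of i ?q] by (simp add: rev_nth)
    ultimately show "c i = \<zero>" by simp
  qed
qed

section \<open>Transcendence bases\<close>

text \<open>The coefficients of one relation over \<open>E\<close> generate a finite extension of
  \<open>K\<close>, over which \<open>x\<close> is still algebraic. Two finite steps compose to a
  finite extension that contains \<open>x\<close>.\<close>

lemma (in field) algebraic_trans:
  assumes "subfield K R" "subfield E R" "\<And>e. e \<in> E \<Longrightarrow> (algebraic over K) e"
    "(algebraic over E) x" "x \<in> carrier R"
  shows "(algebraic over K) x"
proof -
  obtain p where p: "p \<in> carrier (E[X])" "p \<noteq> []" "eval p x = \<zero>"
    using algebraicE[OF subfieldE(1)[OF assms(2)] assms(5,4)] .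
  have pE: "set p \<subseteq> E" using p(1) by (auto simp: univ_poly_def polynomial_def)
  then have pc: "set p \<subseteq> carrier R" using subringE(1)[OF subfieldE(1)[OF assms(2)]] by auto
  let ?F = "finite_extension K p"
  have alg: "(algebraic over K) y" if "y \<in> set p" for y using assms(3) pE that by auto
  have F: "subfield ?F R" by (rule finite_extension_is_subfield[OF assms(1) pc alg])
  have "finite_dimension K ?F" by (rule finite_extension_finite_dimension(1)[OF assms(1) pc alg])
  moreover have "(algebraic over ?F) x"
  proof (rule algebraicI[OF _ p(2,3)])
    have "set p \<subseteq> ?F" by (rule finite_extension_mem[OF subfieldE(1)[OF assms(1)] pc])
    then show "p \<in> carrier (?F[X])" using p(1) by (auto simp: univ_poly_def polynomial_def)
  qed
  then have "finite_dimension ?F (simple_extension ?F x)"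
    using finite_dimension_simple_extension[OF F assms(5)] by blast
  ultimately have fd: "finite_dimension K (simple_extension ?F x)"
    by (rule telescopic_base_dim(1)[OF assms(1) F])
  show ?thesis
    by (rule finite_dimension_imp_algebraic[OF assms(1) _ fd])
      (use simple_extension_is_subring[OF subfieldE(1)[OF F] assms(5)]
        simple_extension_mem[OF subfieldE(1)[OF F] assms(5)] in auto)
qed

locale field_sub = field R for R (structure) + fixes K
  assumes subring_K: "subring K R"

sublocale field_sub \<subseteq> coeff_sub R K
  by (rule coeff_subI[OF subring_K])

lemma (in field) field_subI: "subring K R \<Longrightarrow> field_sub R K"
  by (simp add: field_sub_def field_sub_axioms_def field_axioms)

context field_sub
begin

text \<open>The closure operator of the algebraic matroid: the algebraic closure of
  \<open>K(S)\<close> in the ambient field. It is phrased over the ring \<open>gen S\<close>;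
  \<open>cl_eq\<close> passes to its fractions, over which the algebraic elements form a
  subfield.\<close>

definition cl :: "'a set \<Rightarrow> 'a set" where
  "cl S = {x \<in> carrier R. \<not> trans_over (gen S) x}"

lemma cl_eq:
  assumes "S \<subseteq> carrier R"
  shows "cl S = {x \<in> carrier R. (algebraic over (frac (gen S))) x}"
proof -
  have sr: "subring (gen S) R" by (rule subring_gen[OF assms])
  then have "subring (frac (gen S)) R" using subfieldE(1)[OF subfield_frac] by blast
  then show ?thesis unfolding cl_def
    using trans_over_frac[OF sr] trans_over_iff[OF \<open>subring (frac (gen S)) R\<close>] by (auto simp: over_def)
qed

lemma subfield_cl:
  assumes "S \<subseteq> carrier R" shows "subfield (cl S) R"
  unfolding cl_eq[OF assms] by (rule subfield_of_algebraics[OF subfield_frac[OF subring_gen[OF assms]]])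

lemma cl_carrier: "cl S \<subseteq> carrier R"
  unfolding cl_def by auto

lemma gen_subset_cl:
  assumes "S \<subseteq> carrier R" shows "gen S \<subseteq> cl S"
proof
  fix a assume a: "a \<in> gen S"
  have sr: "subring (gen S) R" by (rule subring_gen[OF assms])
  then have "(algebraic over (gen S)) a" using algebraic_self a by blast
  then show "a \<in> cl S" unfolding cl_def using trans_over_iff[OF sr] a gen_carrier[OF assms] by (auto simp: over_def)
qed

lemma cl_incl: "S \<subseteq> carrier R \<Longrightarrow> S \<subseteq> cl S"
  using gen_subset_cl gen_incl by blast

lemma cl_mono: "S \<subseteq> S' \<Longrightarrow> S' \<subseteq> carrier R \<Longrightarrow> cl S \<subseteq> cl S'"
  unfolding cl_def using gen_mono[of S S'] trans_over_mono[of "gen S'" _ "gen S"] by auto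

lemma cl_least:
  assumes "S \<subseteq> carrier R" "S' \<subseteq> cl S" shows "cl S' \<subseteq> cl S"
proof
  fix x assume x: "x \<in> cl S'"
  have S': "S' \<subseteq> carrier R" using assms(2) cl_carrier by blast
  have "gen S' \<subseteq> cl S"
    by (rule gen_min[OF subfieldE(1)[OF subfield_cl[OF assms(1)]]])
      (use gen_subset_cl[OF assms(1)] gen_incl assms(2) in auto)
  then have "frac (gen S') \<subseteq> cl S" by (rule frac_min[OF subring_gen[OF S'] subfield_cl[OF assms(1)]])
  then have alg: "(algebraic over (cl S)) x" using x algebraic_mono unfolding cl_eq[OF S'] by blast
  have "(algebraic over (frac (gen S))) x"
  proof (rule algebraic_trans[OF subfield_frac[OF subring_gen[OF assms(1)]] subfield_cl[OF assms(1)]])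
    show "(algebraic over (frac (gen S))) e" if "e \<in> cl S" for e
      using that cl_eq[OF assms(1)] by blast
    show "(algebraic over (cl S)) x" by (rule alg)
    show "x \<in> carrier R" using x cl_carrier by blast
  qed
  then show "x \<in> cl S" using x cl_carrier cl_eq[OF assms(1)] by blast
qed

text \<open>The left side carries \<open>x \<notin> S\<close>, since otherwise
  \<open>insert x S\<close> would say nothing about \<open>x\<close>.\<close>

lemma ai_insert_iff:
  assumes "x \<in> carrier R" "S \<subseteq> carrier R"
  shows "x \<notin> S \<and> ai (insert x S) \<longleftrightarrow> ai S \<and> x \<notin> cl S"
proof (cases "x \<in> S")
  case True
  then show ?thesis using cl_incl[OF assms(2)] by auto
next
  case False
  then show ?thesis using alg_indep_insert[OF False assms] assms by (auto simp: cl_def)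
qed

text \<open>Steinitz exchange: an element \<open>x\<close> of \<open>S - Y\<close> is traded for
  some \<open>y\<close> of \<open>Y\<close> outside the closure of \<open>S - {x}\<close>. Such a
  \<open>y\<close> exists, because otherwise that closure would contain \<open>cl Y\<close> and
  hence \<open>x\<close>. The trade makes \<open>S - Y\<close> smaller.\<close>

lemma exchange_card:
  assumes "finite Y" "finite S" "Y \<subseteq> carrier R" "ai S" "S \<subseteq> cl Y"
  shows "card S \<le> card Y"
  using assms(2,4,5)
proof (induction "card (S - Y)" arbitrary: S rule: less_induct)
  case (less S)
  show ?case
  proof (cases "S \<subseteq> Y")
    case True
    then show ?thesis using assms(1) by (rule card_mono[rotated])
  next
    case False
    then obtain x where x: "x \<in> S" "x \<notin> Y" by auto
    let ?S = "S - {x}"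
    have Sc: "S \<subseteq> carrier R" using less.prems(2) ai_carrier by blast
    have "insert x ?S = S" using x by auto
    then have nx: "ai ?S" "x \<notin> cl ?S" using ai_insert_iff[of x ?S] less.prems(2) Sc x by auto
    have "\<not> Y \<subseteq> cl ?S"
    proof
      assume "Y \<subseteq> cl ?S"
      then have "cl Y \<subseteq> cl ?S" using Sc by (intro cl_least) auto
      then show False using nx(2) x less.prems(3) by auto
    qed
    then obtain y where y: "y \<in> Y" "y \<notin> cl ?S" by auto
    then have y': "y \<notin> ?S" "ai (insert y ?S)" using ai_insert_iff[of y ?S] nx(1) Sc assms(3) by auto
    have "card (insert y ?S - Y) < card (S - Y)"
      using x y less.prems(1) by (intro psubset_card_mono) auto
    moreover have "y \<in> cl Y" using cl_incl[OF assms(3)] y by auto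
    ultimately have "card (insert y ?S) \<le> card Y"
      using less.prems by (intro less.hyps[OF _ _ y'(2)]) auto
    then show ?thesis using y'(1) x less.prems(1) by simp
  qed
qed

text \<open>The new elements are taken from \<open>Z\<close>, so they stay in every subring that
  contains \<open>Z\<close>; the equation of cardinalities later becomes the length of a
  chain.\<close>

lemma exchange_extend:
  assumes "finite Y" "finite Z" "ai Y" "ai Z" "card Y \<le> card Z"
  shows "\<exists>W\<subseteq>Z. Y \<inter> W = {} \<and> ai (Y \<union> W) \<and> card Y + card W = card Z"
  using assms(1,3,5)
proof (induction "card Z - card Y" arbitrary: Y)
  case 0
  then show ?case by (intro exI[of _ "{}"]) auto
next
  case (Suc n)
  have Yc: "Y \<subseteq> carrier R" and Zc: "Z \<subseteq> carrier R" using Suc.prems(2) assms(4) ai_carrier by auto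
  have "\<not> Z \<subseteq> cl Y" using exchange_card[OF Suc.prems(1) assms(2) Yc assms(4)] Suc.hyps(2) by auto
  then obtain z where z: "z \<in> Z" "z \<notin> cl Y" by auto
  then have z': "z \<notin> Y" "ai (insert z Y)" using ai_insert_iff[of z Y] Suc.prems(2) Yc Zc by auto
  have "\<exists>W\<subseteq>Z. insert z Y \<inter> W = {} \<and> ai (insert z Y \<union> W) \<and> card (insert z Y) + card W = card Z"
    by (rule Suc.hyps(1)) (use z' Suc.hyps(2) Suc.prems in auto)
  then obtain W where W: "W \<subseteq> Z" "insert z Y \<inter> W = {}" "ai (insert z Y \<union> W)" "card (insert z Y) + card W = card Z"
    by blast
  have "finite W" using W(1) assms(2) finite_subset by blast
  then have "card (insert z W) = Suc (card W)" using W(2) by auto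
  moreover have "Y \<union> insert z W = insert z Y \<union> W" by auto
  ultimately show ?case using W z z' Suc.prems(1) by (intro exI[of _ "insert z W"]) auto
qed

lemma basis_in_finite:
  assumes "finite S" "S \<subseteq> carrier R"
  shows "\<exists>Y\<subseteq>S. ai Y \<and> S \<subseteq> cl Y"
  using assms
proof (induction S)
  case empty
  then show ?case using alg_indep_empty by auto
next
  case (insert x S)
  then obtain Y where Y: "Y \<subseteq> S" "ai Y" "S \<subseteq> cl Y" by auto
  have Yc: "Y \<subseteq> carrier R" using Y insert by auto
  show ?case
  proof (cases "x \<in> cl Y")
    case True
    then show ?thesis using Y by (intro exI[of _ Y]) auto
  next
    case False
    then have "ai (insert x Y)" using ai_insert_iff[of x Y] Y insert Yc by auto
    moreover have "cl Y \<subseteq> cl (insert x Y)" "x \<in> cl (insert x Y)"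
      using cl_mono[of Y "insert x Y"] cl_incl[of "insert x Y"] Yc insert by auto
    ultimately show ?thesis using Y by (intro exI[of _ "insert x Y"]) auto
  qed
qed

end

section \<open>The quotient field\<close>

context domain
begin

abbreviation Q where "Q \<equiv> quotient_field R"
abbreviation nz where "nz \<equiv> carrier R - {\<zero>}"

lemma equiv_fraction_rel: "equiv (carrier R \<times> nz) (fraction_rel R)"
proof (rule equivI)
  show "fraction_rel R \<subseteq> (carrier R \<times> nz) \<times> (carrier R \<times> nz)" unfolding fraction_rel_def by auto
  show "refl_on (carrier R \<times> nz) (fraction_rel R)" unfolding fraction_rel_def refl_on_def by auto
  show "sym (fraction_rel R)" unfolding fraction_rel_def sym_def by auto
  show "trans (fraction_rel R)"
  proof (rule transI)
    fix x y z assume "(x, y) \<in> fraction_rel R" "(y, z) \<in> fraction_rel R"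
    then obtain a b c d e f where v: "x = (a, b)" "y = (c, d)" "z = (e, f)"
      and *: "a \<in> carrier R" "b \<in> nz" "c \<in> carrier R" "d \<in> nz" "e \<in> carrier R" "f \<in> nz"
      "a \<otimes> d = c \<otimes> b" "c \<otimes> f = e \<otimes> d"
      unfolding fraction_rel_def by auto
    have car: "b \<in> carrier R" "d \<in> carrier R" "f \<in> carrier R" using * by auto
    have "d \<otimes> (a \<otimes> f) = (a \<otimes> d) \<otimes> f" using *(1,3,5) car by algebra
    also have "\<dots> = (c \<otimes> b) \<otimes> f" using *(7) by simp
    also have "\<dots> = (c \<otimes> f) \<otimes> b" using *(1,3,5) car by algebra
    also have "\<dots> = (e \<otimes> d) \<otimes> b" using *(8) by simp
    also have "\<dots> = d \<otimes> (e \<otimes> b)" using *(1,3,5) car by algebra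
    finally have "a \<otimes> f = e \<otimes> b" using * by (subst (asm) m_lcancel) auto
    then show "(x, z) \<in> fraction_rel R" using * v unfolding fraction_rel_def by auto
  qed
qed

lemma fraction_eq_iff:
  assumes "a \<in> carrier R" "b \<in> nz" "c \<in> carrier R" "d \<in> nz"
  shows "fraction R a b = fraction R c d \<longleftrightarrow> a \<otimes> d = c \<otimes> b"
proof -
  have "fraction R a b = fraction R c d \<longleftrightarrow> ((a, b), (c, d)) \<in> fraction_rel R"
    unfolding fraction_def using assms by (intro eq_equiv_class_iff[OF equiv_fraction_rel]) auto
  then show ?thesis using assms unfolding fraction_rel_def by auto
qed

lemma fraction_mem: "a \<in> carrier R \<Longrightarrow> b \<in> nz \<Longrightarrow> (a, b) \<in> fraction R a b"
  unfolding fraction_def fraction_rel_def by auto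

lemma fraction_memD:
  assumes "(x, y) \<in> fraction R a b"
  shows "x \<in> carrier R" "y \<in> nz" "a \<in> carrier R" "b \<in> nz" "a \<otimes> y = x \<otimes> b"
  using assms unfolding fraction_def fraction_rel_def by auto

lemma Q_carrier: "carrier Q = {fraction R a b | a b. a \<in> carrier R \<and> b \<in> nz}"
  unfolding quotient_field_def quotient_def fraction_def by auto

lemma fraction_closed [simp]: "a \<in> carrier R \<Longrightarrow> b \<in> nz \<Longrightarrow> fraction R a b \<in> carrier Q"
  unfolding Q_carrier by auto

lemma Q_cases:
  assumes "x \<in> carrier Q"
  obtains a b where "a \<in> carrier R" "b \<in> nz" "x = fraction R a b"
  using assms unfolding Q_carrier by auto

text \<open>The operations of the quotient field are unions over representatives; as soon as all
  members of such a union agree, it equals each of them.\<close>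

lemma UN_const_class:
  assumes "U \<noteq> {}" "\<And>x y. (x, y) \<in> U \<Longrightarrow> f x y = c"
  shows "(\<Union>(x, y)\<in>U. f x y) = c"
  using assms by force

lemma nz_mult [simp]: "b \<in> nz \<Longrightarrow> d \<in> nz \<Longrightarrow> b \<otimes> d \<in> nz"
  by (auto simp: integral_iff)

lemma Q_mult:
  assumes "a \<in> carrier R" "b \<in> nz" "c \<in> carrier R" "d \<in> nz"
  shows "fraction R a b \<otimes>\<^bsub>Q\<^esub> fraction R c d = fraction R (a \<otimes> c) (b \<otimes> d)"
proof -
  have "fraction R (x \<otimes> z) (y \<otimes> w) = fraction R (a \<otimes> c) (b \<otimes> d)"
    if "(x, y) \<in> fraction R a b" "(z, w) \<in> fraction R c d" for x y z w
  proof (subst fraction_eq_iff)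
    note 1 = fraction_memD[OF that(1)] and 2 = fraction_memD[OF that(2)]
    show "x \<otimes> z \<in> carrier R" "y \<otimes> w \<in> nz" "a \<otimes> c \<in> carrier R" "b \<otimes> d \<in> nz"
      using 1 2 by (auto simp: integral_iff)
    have car: "x \<in> carrier R" "y \<in> carrier R" "z \<in> carrier R" "w \<in> carrier R"
      "a \<in> carrier R" "b \<in> carrier R" "c \<in> carrier R" "d \<in> carrier R" using 1 2 by auto
    have "x \<otimes> z \<otimes> (b \<otimes> d) = (x \<otimes> b) \<otimes> (z \<otimes> d)" using car by algebra
    also have "\<dots> = (a \<otimes> y) \<otimes> (c \<otimes> w)" using 1(5) 2(5) by simp
    also have "\<dots> = a \<otimes> c \<otimes> (y \<otimes> w)" using car by algebra
    finally show "x \<otimes> z \<otimes> (b \<otimes> d) = a \<otimes> c \<otimes> (y \<otimes> w)" .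
  qed
  moreover have "fraction R a b \<noteq> {}" "fraction R c d \<noteq> {}" using fraction_mem assms by blast+
  ultimately show ?thesis unfolding quotient_field_def
    by (simp add: UN_const_class)
qed

lemma Q_add:
  assumes "a \<in> carrier R" "b \<in> nz" "c \<in> carrier R" "d \<in> nz"
  shows "fraction R a b \<oplus>\<^bsub>Q\<^esub> fraction R c d = fraction R (a \<otimes> d \<oplus> c \<otimes> b) (b \<otimes> d)"
proof -
  have "fraction R (x \<otimes> w \<oplus> z \<otimes> y) (y \<otimes> w) = fraction R (a \<otimes> d \<oplus> c \<otimes> b) (b \<otimes> d)"
    if "(x, y) \<in> fraction R a b" "(z, w) \<in> fraction R c d" for x y z w
  proof (subst fraction_eq_iff)
    note 1 = fraction_memD[OF that(1)] and 2 = fraction_memD[OF that(2)]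
    show "x \<otimes> w \<oplus> z \<otimes> y \<in> carrier R" "y \<otimes> w \<in> nz" "a \<otimes> d \<oplus> c \<otimes> b \<in> carrier R" "b \<otimes> d \<in> nz"
      using 1 2 by (auto simp: integral_iff)
    have car: "x \<in> carrier R" "y \<in> carrier R" "z \<in> carrier R" "w \<in> carrier R" using 1 2 by auto
    have car2: "a \<in> carrier R" "b \<in> carrier R" "c \<in> carrier R" "d \<in> carrier R" using 1 2 by auto
    have "(x \<otimes> w \<oplus> z \<otimes> y) \<otimes> (b \<otimes> d) = (x \<otimes> b) \<otimes> (w \<otimes> d) \<oplus> (z \<otimes> d) \<otimes> (y \<otimes> b)"
      using car car2 by algebra
    also have "\<dots> = (a \<otimes> y) \<otimes> (w \<otimes> d) \<oplus> (c \<otimes> w) \<otimes> (y \<otimes> b)" using 1(5) 2(5) by simp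
    also have "\<dots> = (a \<otimes> d \<oplus> c \<otimes> b) \<otimes> (y \<otimes> w)" using car car2 by algebra
    finally show "(x \<otimes> w \<oplus> z \<otimes> y) \<otimes> (b \<otimes> d) = (a \<otimes> d \<oplus> c \<otimes> b) \<otimes> (y \<otimes> w)" .
  qed
  moreover have "fraction R a b \<noteq> {}" "fraction R c d \<noteq> {}" using fraction_mem assms by blast+
  ultimately show ?thesis unfolding quotient_field_def
    by (simp add: UN_const_class)
qed

lemma Q_one: "\<one>\<^bsub>Q\<^esub> = fraction R \<one> \<one>" and Q_zero: "\<zero>\<^bsub>Q\<^esub> = fraction R \<zero> \<one>"
  unfolding quotient_field_def by auto

lemma one_nz [simp]: "\<one> \<in> nz" by simp

lemma cring_Q: "cring Q"
proof (rule cringI)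
  show "abelian_group Q"
  proof (rule abelian_groupI)
    fix x y assume "x \<in> carrier Q" "y \<in> carrier Q"
    then obtain a b c d where *: "a \<in> carrier R" "b \<in> nz" "x = fraction R a b"
      "c \<in> carrier R" "d \<in> nz" "y = fraction R c d" by (metis Q_cases)
    have "a \<otimes> d \<oplus> c \<otimes> b \<in> carrier R" "b \<otimes> d \<in> nz" using * by (auto simp: integral_iff)
    then show "x \<oplus>\<^bsub>Q\<^esub> y \<in> carrier Q" using Q_add[OF *(1,2,4,5)] * fraction_closed by metis
    show "x \<oplus>\<^bsub>Q\<^esub> y = y \<oplus>\<^bsub>Q\<^esub> x"
      using * Q_add[OF *(1,2,4,5)] Q_add[OF *(4,5,1,2)] by (simp add: a_comm m_comm)
  next
    fix x y z assume "x \<in> carrier Q" "y \<in> carrier Q" "z \<in> carrier Q"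
    then obtain a b c d e f where *: "a \<in> carrier R" "b \<in> nz" "x = fraction R a b"
      "c \<in> carrier R" "d \<in> nz" "y = fraction R c d" "e \<in> carrier R" "f \<in> nz" "z = fraction R e f" by (metis Q_cases)
    have car: "b \<in> carrier R" "d \<in> carrier R" "f \<in> carrier R" using * by auto
    have "x \<oplus>\<^bsub>Q\<^esub> y \<oplus>\<^bsub>Q\<^esub> z = fraction R ((a \<otimes> d \<oplus> c \<otimes> b) \<otimes> f \<oplus> e \<otimes> (b \<otimes> d)) (b \<otimes> d \<otimes> f)"
      using * Q_add[of "a \<otimes> d \<oplus> c \<otimes> b" "b \<otimes> d" e f] by (simp add: Q_add integral_iff)
    also have "\<dots> = fraction R (a \<otimes> (d \<otimes> f) \<oplus> (c \<otimes> f \<oplus> e \<otimes> d) \<otimes> b) (b \<otimes> (d \<otimes> f))"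
    proof -
      have "(a \<otimes> d \<oplus> c \<otimes> b) \<otimes> f \<oplus> e \<otimes> (b \<otimes> d) = a \<otimes> (d \<otimes> f) \<oplus> (c \<otimes> f \<oplus> e \<otimes> d) \<otimes> b"
        using *(1,4,7) car by algebra
      then show ?thesis using car by (simp add: m_assoc)
    qed
    also have "\<dots> = x \<oplus>\<^bsub>Q\<^esub> (y \<oplus>\<^bsub>Q\<^esub> z)"
      using * Q_add[of a b "c \<otimes> f \<oplus> e \<otimes> d" "d \<otimes> f"] by (simp add: Q_add integral_iff)
    finally show "x \<oplus>\<^bsub>Q\<^esub> y \<oplus>\<^bsub>Q\<^esub> z = x \<oplus>\<^bsub>Q\<^esub> (y \<oplus>\<^bsub>Q\<^esub> z)" .
  next
    show "\<zero>\<^bsub>Q\<^esub> \<in> carrier Q" unfolding Q_zero by simp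
  next
    fix x assume "x \<in> carrier Q"
    then obtain a b where *: "a \<in> carrier R" "b \<in> nz" "x = fraction R a b" by (metis Q_cases)
    then show "\<zero>\<^bsub>Q\<^esub> \<oplus>\<^bsub>Q\<^esub> x = x" unfolding Q_zero by (simp add: Q_add)
    have "fraction R (\<ominus> a) b \<oplus>\<^bsub>Q\<^esub> x = \<zero>\<^bsub>Q\<^esub>"
      unfolding Q_zero using * by (simp add: Q_add fraction_eq_iff integral_iff l_minus l_neg)
    then show "\<exists>y\<in>carrier Q. y \<oplus>\<^bsub>Q\<^esub> x = \<zero>\<^bsub>Q\<^esub>" using * by (intro bexI[of _ "fraction R (\<ominus> a) b"]) auto
  qed
  show "comm_monoid Q"
  proof (rule comm_monoidI)
    fix x y assume "x \<in> carrier Q" "y \<in> carrier Q"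
    then obtain a b c d where *: "a \<in> carrier R" "b \<in> nz" "x = fraction R a b"
      "c \<in> carrier R" "d \<in> nz" "y = fraction R c d" by (metis Q_cases)
    have "a \<otimes> c \<in> carrier R" "b \<otimes> d \<in> nz" using * by (auto simp: integral_iff)
    then show "x \<otimes>\<^bsub>Q\<^esub> y \<in> carrier Q" using Q_mult[OF *(1,2,4,5)] * fraction_closed by metis
    show "x \<otimes>\<^bsub>Q\<^esub> y = y \<otimes>\<^bsub>Q\<^esub> x"
      using * Q_mult[OF *(1,2,4,5)] Q_mult[OF *(4,5,1,2)] by (simp add: m_comm)
  next
    fix x y z assume "x \<in> carrier Q" "y \<in> carrier Q" "z \<in> carrier Q"
    then obtain a b c d e f where *: "a \<in> carrier R" "b \<in> nz" "x = fraction R a b"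
      "c \<in> carrier R" "d \<in> nz" "y = fraction R c d" "e \<in> carrier R" "f \<in> nz" "z = fraction R e f" by (metis Q_cases)
    then show "x \<otimes>\<^bsub>Q\<^esub> y \<otimes>\<^bsub>Q\<^esub> z = x \<otimes>\<^bsub>Q\<^esub> (y \<otimes>\<^bsub>Q\<^esub> z)"
      using Q_mult[of "a \<otimes> c" "b \<otimes> d" e f] Q_mult[of a b "c \<otimes> e" "d \<otimes> f"]
      by (simp add: Q_mult integral_iff m_assoc)
  next
    show "\<one>\<^bsub>Q\<^esub> \<in> carrier Q" unfolding Q_one by simp
  next
    fix x assume "x \<in> carrier Q"
    then obtain a b where *: "a \<in> carrier R" "b \<in> nz" "x = fraction R a b" by (metis Q_cases)
    then show "\<one>\<^bsub>Q\<^esub> \<otimes>\<^bsub>Q\<^esub> x = x" unfolding Q_one by (simp add: Q_mult)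
  qed
  fix x y z assume "x \<in> carrier Q" "y \<in> carrier Q" "z \<in> carrier Q"
  then obtain a b c d e f where *: "a \<in> carrier R" "b \<in> nz" "x = fraction R a b"
    "c \<in> carrier R" "d \<in> nz" "y = fraction R c d" "e \<in> carrier R" "f \<in> nz" "z = fraction R e f" by (metis Q_cases)
  have car: "b \<in> carrier R" "d \<in> carrier R" "f \<in> carrier R" using * by auto
  have s: "a \<otimes> d \<oplus> c \<otimes> b \<in> carrier R" "b \<otimes> d \<in> nz" "a \<otimes> e \<in> carrier R" "b \<otimes> f \<in> nz" "c \<otimes> e \<in> carrier R" "d \<otimes> f \<in> nz"
    using * by (auto simp: integral_iff)
  have "(x \<oplus>\<^bsub>Q\<^esub> y) \<otimes>\<^bsub>Q\<^esub> z = fraction R ((a \<otimes> d \<oplus> c \<otimes> b) \<otimes> e) ((b \<otimes> d) \<otimes> f)"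
    using * Q_mult[OF s(1,2) *(7,8)] Q_add[OF *(1,2,4,5)] by metis
  also have "\<dots> = fraction R ((a \<otimes> e) \<otimes> (d \<otimes> f) \<oplus> (c \<otimes> e) \<otimes> (b \<otimes> f)) ((b \<otimes> f) \<otimes> (d \<otimes> f))"
  proof (subst fraction_eq_iff)
    show "(a \<otimes> d \<oplus> c \<otimes> b) \<otimes> e \<otimes> (b \<otimes> f \<otimes> (d \<otimes> f)) = (a \<otimes> e \<otimes> (d \<otimes> f) \<oplus> c \<otimes> e \<otimes> (b \<otimes> f)) \<otimes> (b \<otimes> d \<otimes> f)"
      using *(1,4,7) car by algebra
  qed (use * s in \<open>auto simp: integral_iff\<close>)
  also have "\<dots> = x \<otimes>\<^bsub>Q\<^esub> z \<oplus>\<^bsub>Q\<^esub> y \<otimes>\<^bsub>Q\<^esub> z"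
    using * Q_add[OF s(3-6)] Q_mult[OF *(1,2,7,8)] Q_mult[OF *(4,5,7,8)] by metis
  finally show "(x \<oplus>\<^bsub>Q\<^esub> y) \<otimes>\<^bsub>Q\<^esub> z = x \<otimes>\<^bsub>Q\<^esub> z \<oplus>\<^bsub>Q\<^esub> y \<otimes>\<^bsub>Q\<^esub> z" .
qed

theorem field_Q: "field Q"
proof (rule cring.cring_fieldI2[OF cring_Q])
  show "\<zero>\<^bsub>Q\<^esub> \<noteq> \<one>\<^bsub>Q\<^esub>" unfolding Q_zero Q_one by (simp add: fraction_eq_iff)
  fix x assume x: "x \<in> carrier Q" "x \<noteq> \<zero>\<^bsub>Q\<^esub>"
  then obtain a b where *: "a \<in> carrier R" "b \<in> nz" "x = fraction R a b" by (metis Q_cases)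
  have a: "a \<in> nz" using x * unfolding Q_zero by (auto simp: fraction_eq_iff)
  have "x \<otimes>\<^bsub>Q\<^esub> fraction R b a = \<one>\<^bsub>Q\<^esub>"
    unfolding Q_one using * a by (simp add: Q_mult fraction_eq_iff integral_iff m_comm)
  then show "\<exists>y\<in>carrier Q. x \<otimes>\<^bsub>Q\<^esub> y = \<one>\<^bsub>Q\<^esub>" using * a by (intro bexI[of _ "fraction R b a"]) auto
qed

definition emb :: "'a \<Rightarrow> ('a \<times> 'a) set" where
  "emb a = fraction R a \<one>"

lemma emb_hom: "emb \<in> ring_hom R Q"
  by (rule ring_hom_memI) (auto simp: emb_def Q_mult Q_add Q_one)

lemma emb_inj: "inj_on emb (carrier R)"
  by (rule inj_onI) (simp add: emb_def fraction_eq_iff)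

lemma Q_emb:
  assumes "x \<in> carrier Q"
  obtains a b where "a \<in> carrier R" "b \<in> carrier R" "b \<noteq> \<zero>" "emb b \<otimes>\<^bsub>Q\<^esub> x = emb a"
proof -
  obtain a b where *: "a \<in> carrier R" "b \<in> nz" "x = fraction R a b" using assms by (rule Q_cases)
  then have "emb b \<otimes>\<^bsub>Q\<^esub> x = emb a"
    unfolding emb_def by (simp add: Q_mult fraction_eq_iff m_comm)
  then show thesis using that * by blast
qed

lemma hom_emb: "ring_hom_cring R Q emb"
  by (simp add: ring_hom_cring_def ring_hom_cring_axioms_def is_cring cring_Q emb_hom)

lemma frac_emb: "ring.frac Q (emb ` carrier R) = carrier Q"
proof -
  interpret Q: field Q by (rule field_Q)
  interpret h: ring_hom_cring R Q emb by (rule hom_emb)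
  have sub: "subring (emb ` carrier R) Q" by (rule h.hom_subring[OF carrier_is_subring])
  show ?thesis
  proof
    show "Q.frac (emb ` carrier R) \<subseteq> carrier Q"
      using subringE(1)[OF subfieldE(1)[OF Q.subfield_frac[OF sub]]] .
    show "carrier Q \<subseteq> Q.frac (emb ` carrier R)"
    proof
      fix x assume x: "x \<in> carrier Q"
      obtain a b where ab: "a \<in> carrier R" "b \<in> carrier R" "b \<noteq> \<zero>" "emb b \<otimes>\<^bsub>Q\<^esub> x = emb a" using x by (rule Q_emb)
      have "emb b \<noteq> \<zero>\<^bsub>Q\<^esub>" using ab(2,3) emb_inj h.hom_zero by (metis inj_onD zero_closed)
      then show "x \<in> Q.frac (emb ` carrier R)" using ab x by (intro Q.fracI[OF sub, of "emb b"]) auto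
    qed
  qed
qed

text \<open>A largest independent subset of \<open>R\<close> has all of \<open>R\<close> in its
  closure. The closure is a field, so it contains all fractions, and exchange bounds the independent
  sets of fractions by a set taken from \<open>R\<close>.\<close>

lemma transcendence_degree_Q:
  assumes K: "subring K R"
  shows "transcendence_degree Q (emb ` K) =
    (SUP S\<in>{S. finite S \<and> algebraically_independent R K S}. enat (card S))"
proof -
  interpret Q: field Q by (rule field_Q)
  interpret h: ring_hom_cring R Q emb by (rule hom_emb)
  interpret K: coeff_sub R K by (rule coeff_subI[OF K])
  interpret QK: field_sub Q "emb ` K" by (rule Q.field_subI[OF h.hom_subring[OF K]])
  have iK: "inj_on emb K" using emb_inj subringE(1)[OF K] by (rule inj_on_subset)
  have tr: "QK.ai (emb ` S) \<longleftrightarrow> K.ai S" if S: "finite S" "S \<subseteq> carrier R" for S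
  proof -
    have "inj_on emb S" "inj_on emb (K.gen S)"
      using emb_inj S(2) K.gen_carrier[OF S(2)] by (auto intro: inj_on_subset)
    then show ?thesis using h.hom_alg_indep[OF K iK S] by blast
  qed
  show ?thesis
    unfolding transcendence_degree_def
  proof (rule antisym)
    show "(SUP S\<in>{S. finite S \<and> K.ai S}. enat (card S)) \<le> (SUP S\<in>{S. finite S \<and> QK.ai S}. enat (card S))"
    proof (rule SUP_mono)
      fix S assume "S \<in> {S. finite S \<and> K.ai S}"
      then have S: "finite S" "K.ai S" "S \<subseteq> carrier R" using K.ai_carrier by auto
      then have "card (emb ` S) = card S" using emb_inj by (meson card_image inj_on_subset)
      then show "\<exists>S'\<in>{S. finite S \<and> QK.ai S}. enat (card S) \<le> enat (card S')"
        using S tr by (intro bexI[of _ "emb ` S"]) auto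
    qed
    show "(SUP S\<in>{S. finite S \<and> QK.ai S}. enat (card S)) \<le> (SUP S\<in>{S. finite S \<and> K.ai S}. enat (card S))"
    proof (rule SUP_mono)
      fix S' assume "S' \<in> {S. finite S \<and> QK.ai S}"
      then have S': "finite S'" "QK.ai S'" by auto
      show "\<exists>S\<in>{S. finite S \<and> K.ai S}. enat (card S') \<le> enat (card S)"
      proof (rule ccontr)
        \<comment> \<open>The negated claim itself bounds the independent subsets of
          \<open>R\<close> by \<open>card S'\<close>; so a largest one exists although no finiteness
          is assumed.\<close>
        assume *: "\<not> ?thesis"
        then have b: "card S < card S'" if "finite S" "K.ai S" for S using that by force
        define P where "P n \<longleftrightarrow> (\<exists>S. finite S \<and> K.ai S \<and> card S = n)" for n
        have "P 0" unfolding P_def using K.alg_indep_empty by (intro exI[of _ "{}"]) auto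
        then obtain n where n: "P n" "\<And>m. P m \<Longrightarrow> m \<le> n"
          using Nat.ex_has_greatest_nat[of P 0 "card S'"] b unfolding P_def by (metis less_imp_le)
        then obtain S where S: "finite S" "K.ai S" "card S = n" unfolding P_def by blast
        have Sc: "S \<subseteq> carrier R" using S K.ai_carrier by blast
        then have eSc: "emb ` S \<subseteq> carrier Q" by auto
        have "emb ` carrier R \<subseteq> QK.cl (emb ` S)"
        proof (rule ccontr)
          assume "\<not> ?thesis"
          then obtain r where r: "r \<in> carrier R" "emb r \<notin> QK.cl (emb ` S)" by auto
          then have i: "emb r \<notin> emb ` S \<and> QK.ai (insert (emb r) (emb ` S))"
            using QK.ai_insert_iff[of "emb r" "emb ` S"] eSc tr[OF S(1) Sc] S(2) by auto
          then have "QK.ai (emb ` insert r S)" by simp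
          then have "K.ai (insert r S)" using tr[of "insert r S"] S(1) Sc r(1) by simp
          moreover have "card (insert r S) = Suc n" using i S by (subst card_insert_disjoint) auto
          ultimately have "Suc n \<le> n" using S(1) by (intro n(2)) (auto simp: P_def)
          then show False by simp
        qed
        then have "carrier Q \<subseteq> QK.cl (emb ` S)"
          using Q.frac_min[OF h.hom_subring[OF carrier_is_subring] QK.subfield_cl[OF eSc]] frac_emb by simp
        then have "S' \<subseteq> QK.cl (emb ` S)" using QK.ai_carrier[OF S'(2)] by auto
        then have "card S' \<le> card (emb ` S)" using QK.exchange_card[OF _ S'(1) eSc S'(2)] S(1) by auto
        also have "\<dots> \<le> card S" by (rule card_image_le[OF S(1)])
        finally show False using b[OF S(1,2)] by simp
      qed
    qed
  qed
qed

end

section \<open>Independence modulo a prime ideal\<close>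

text \<open>Relative to a subset \<open>A\<close> of a fixed ring, so that subrings, localizations
  and extensions share one type. When \<open>A\<close> is a subring, negatives are multiples by
  \<open>\<ominus> \<one>\<close>. The record version is reached through
  \<open>primeideal_iff\<close>.\<close>

definition (in ring) ideal_of :: "'a set \<Rightarrow> 'a set \<Rightarrow> bool" where
  "ideal_of A p \<longleftrightarrow> p \<subseteq> A \<and> \<zero> \<in> p \<and> (\<forall>x\<in>p. \<forall>y\<in>p. x \<oplus> y \<in> p) \<and> (\<forall>a\<in>A. \<forall>x\<in>p. a \<otimes> x \<in> p)"

definition (in ring) prime_of :: "'a set \<Rightarrow> 'a set \<Rightarrow> bool" where
  "prime_of A p \<longleftrightarrow> ideal_of A p \<and> \<one> \<notin> p \<and>
     (\<forall>a\<in>A. \<forall>b\<in>A. a \<otimes> b \<in> p \<longrightarrow> a \<in> p \<or> b \<in> p)"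

lemma (in ring) ideal_ofD:
  assumes "ideal_of A p"
  shows "p \<subseteq> A" "\<zero> \<in> p" "\<And>x y. x \<in> p \<Longrightarrow> y \<in> p \<Longrightarrow> x \<oplus> y \<in> p" "\<And>a x. a \<in> A \<Longrightarrow> x \<in> p \<Longrightarrow> a \<otimes> x \<in> p"
  using assms unfolding ideal_of_def by blast+

lemma (in ring) prime_ofD:
  assumes "prime_of A p"
  shows "ideal_of A p" "\<one> \<notin> p" "\<And>a b. a \<in> A \<Longrightarrow> b \<in> A \<Longrightarrow> a \<otimes> b \<in> p \<Longrightarrow> a \<in> p \<or> b \<in> p"
  using assms unfolding prime_of_def by blast+

context cring
begin

lemma ideal_of_minus:
  assumes "subring A R" "ideal_of A p" "x \<in> p" "y \<in> p"
  shows "x \<ominus> y \<in> p" "\<ominus> y \<in> p"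
proof -
  have "y \<in> carrier R" using subringE(1)[OF assms(1)] ideal_ofD(1)[OF assms(2)] assms(4) by auto
  then have "\<ominus> y = (\<ominus> \<one>) \<otimes> y" by algebra
  moreover have "\<ominus> \<one> \<in> A" using subringE(3,5)[OF assms(1)] by blast
  ultimately show "\<ominus> y \<in> p" using ideal_ofD(4)[OF assms(2)] assms(4) by metis
  then show "x \<ominus> y \<in> p" using ideal_ofD(3)[OF assms(2) assms(3)] by (simp add: minus_eq)
qed

lemma primeideal_iff:
  assumes A: "subring A R"
  shows "primeideal p (R\<lparr>carrier := A\<rparr>) \<longleftrightarrow> prime_of A p"
proof -
  have cA: "cring (R\<lparr>carrier := A\<rparr>)"
    using subcring_iff[OF subringE(1)[OF A]] subcringI'[OF A] by blast
  interpret A: cring "R\<lparr>carrier := A\<rparr>" by (rule cA)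
  show ?thesis
  proof
    assume "primeideal p (R\<lparr>carrier := A\<rparr>)"
    then interpret p: primeideal p "R\<lparr>carrier := A\<rparr>" .
    have "ideal_of A p" unfolding ideal_of_def
      using p.a_subset p.zero_closed p.a_closed p.I_l_closed by auto
    moreover have "\<one> \<notin> p" using p.one_imp_carrier p.I_notcarr by auto
    ultimately show "prime_of A p" unfolding prime_of_def using p.I_prime by auto
  next
    assume p: "prime_of A p"
    note i = prime_ofD(1)[OF p]
    have pA: "p \<subseteq> A" using ideal_ofD(1)[OF i] .
    have inv: "\<ominus>\<^bsub>R\<lparr>carrier := A\<rparr>\<^esub> x = \<ominus> x" if "x \<in> A" for x
    proof (rule A.minus_equality)
      show "\<ominus> x \<oplus>\<^bsub>R\<lparr>carrier := A\<rparr>\<^esub> x = \<zero>\<^bsub>R\<lparr>carrier := A\<rparr>\<^esub>" using that subringE(1)[OF A] by (auto simp: l_neg)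
    qed (use that subringE(5)[OF A] in auto)
    have "additive_subgroup p (R\<lparr>carrier := A\<rparr>)"
    proof (rule additive_subgroup.intro, rule group.subgroupI[OF A.a_group])
      show "p \<subseteq> carrier (add_monoid (R\<lparr>carrier := A\<rparr>))" "p \<noteq> {}" using pA ideal_ofD(2)[OF i] by auto
      show "inv\<^bsub>add_monoid (R\<lparr>carrier := A\<rparr>)\<^esub> a \<in> p" if "a \<in> p" for a
        using inv[of a] ideal_of_minus(2)[OF A i that that] pA that by (auto simp: a_inv_def)
      show "a \<otimes>\<^bsub>add_monoid (R\<lparr>carrier := A\<rparr>)\<^esub> b \<in> p" if "a \<in> p" "b \<in> p" for a b
        using ideal_ofD(3)[OF i that] by simp
    qed
    then have "ideal p (R\<lparr>carrier := A\<rparr>)"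
    proof (intro ideal.intro ideal_axioms.intro A.ring_axioms)
      fix a x assume ax: "a \<in> p" "x \<in> carrier (R\<lparr>carrier := A\<rparr>)"
      then show "x \<otimes>\<^bsub>R\<lparr>carrier := A\<rparr>\<^esub> a \<in> p" using ideal_ofD(4)[OF i] by simp
      then show "a \<otimes>\<^bsub>R\<lparr>carrier := A\<rparr>\<^esub> x \<in> p" using A.m_comm[of a x] ax pA by auto
    qed
    moreover have "\<one> \<in> A" by (rule subringE(3)[OF A])
    ultimately show "primeideal p (R\<lparr>carrier := A\<rparr>)"
      using prime_ofD(2,3)[OF p] by (intro primeideal.intro primeideal_axioms.intro cA) auto
  qed
qed

text \<open>An ideal that is maximal among those missing a multiplicative set is prime. The
  maximality is exported as well, because for \<open>S = {\<one>}\<close> the result is a maximal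
  ideal.\<close>

lemma exists_prime_avoiding:
  assumes A: "subring A R" and I: "ideal_of A I" and S: "S \<subseteq> A" "\<one> \<in> S" "\<And>a b. a \<in> S \<Longrightarrow> b \<in> S \<Longrightarrow> a \<otimes> b \<in> S"
    and IS: "I \<inter> S = {}"
  obtains Q where "prime_of A Q" "I \<subseteq> Q" "Q \<inter> S = {}"
    "\<And>J. ideal_of A J \<Longrightarrow> Q \<subseteq> J \<Longrightarrow> J \<inter> S = {} \<Longrightarrow> J = Q"
proof -
  let ?F = "{J. ideal_of A J \<and> I \<subseteq> J \<and> J \<inter> S = {}}"
  have "\<exists>M\<in>?F. \<forall>J\<in>?F. M \<subseteq> J \<longrightarrow> J = M"
  proof (rule subset_Zorn_nonempty)
    show "?F \<noteq> {}" using I IS by auto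
    fix C assume C: "C \<noteq> {}" "subset.chain ?F C"
    then have CF: "C \<subseteq> ?F" and ch: "\<And>J J'. J \<in> C \<Longrightarrow> J' \<in> C \<Longrightarrow> J \<subseteq> J' \<or> J' \<subseteq> J"
      unfolding subset.chain_def by blast+
    have "ideal_of A (\<Union>C)"
      unfolding ideal_of_def
    proof (intro conjI ballI)
      show "\<Union>C \<subseteq> A" using CF ideal_ofD(1) by blast
      show "\<zero> \<in> \<Union>C" using C(1) CF ideal_ofD(2) by blast
      show "x \<oplus> y \<in> \<Union>C" if xy: "x \<in> \<Union>C" "y \<in> \<Union>C" for x y
      proof -
        obtain J J' where J: "J \<in> C" "x \<in> J" "J' \<in> C" "y \<in> J'" using xy by blast
        then consider "J \<subseteq> J'" | "J' \<subseteq> J" using ch by blast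
        then show ?thesis using J CF ideal_ofD(3)[of A J x y] ideal_ofD(3)[of A J' x y] by cases blast+
      qed
      show "a \<otimes> x \<in> \<Union>C" if "a \<in> A" "x \<in> \<Union>C" for a x
        using that CF ideal_ofD(4)[of A _ a x] by blast
    qed
    then show "\<Union>C \<in> ?F" using C(1) CF by blast
  qed
  then obtain M where MF: "M \<in> ?F" and mx0: "\<forall>J\<in>?F. M \<subseteq> J \<longrightarrow> J = M" by (elim bexE)
  from MF have M: "ideal_of A M" "I \<subseteq> M" "M \<inter> S = {}" by auto
  have mx: "J = M" if "ideal_of A J" "M \<subseteq> J" "J \<inter> S = {}" for J
  proof -
    have "J \<in> ?F" using that M(2) by auto
    then show ?thesis using mx0 that(2) by blast
  qed
  have Ac: "A \<subseteq> carrier R" using subringE(1)[OF A] .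
  note cl = subringE(2,3,5,6,7)[OF A]
  have MA: "M \<subseteq> A" using ideal_ofD(1)[OF M(1)] .
  \<comment> \<open>The ideal generated by \<open>M\<close> and \<open>a\<close> is strictly larger
    than \<open>M\<close>, so by maximality it meets \<open>S\<close>.\<close>
  have ext: "\<exists>m\<in>M. \<exists>r\<in>A. m \<oplus> r \<otimes> a \<in> S" if a: "a \<in> A" "a \<notin> M" for a
  proof (rule ccontr)
    assume *: "\<not> ?thesis"
    let ?J = "{m \<oplus> r \<otimes> a | m r. m \<in> M \<and> r \<in> A}"
    have ac: "a \<in> carrier R" using a Ac by auto
    have "ideal_of A ?J"
      unfolding ideal_of_def
    proof (intro conjI ballI)
      show "?J \<subseteq> A" using MA a cl by auto
      have "\<zero> = \<zero> \<oplus> \<zero> \<otimes> a" using ac by simp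
      then show "\<zero> \<in> ?J" using ideal_ofD(2)[OF M(1)] cl by blast
      fix x y assume "x \<in> ?J" "y \<in> ?J"
      then obtain m r m' r' where *: "x = m \<oplus> r \<otimes> a" "y = m' \<oplus> r' \<otimes> a" "m \<in> M" "r \<in> A" "m' \<in> M" "r' \<in> A" by blast
      then have "m \<in> carrier R" "r \<in> carrier R" "m' \<in> carrier R" "r' \<in> carrier R" using MA Ac by auto
      then have "x \<oplus> y = (m \<oplus> m') \<oplus> (r \<oplus> r') \<otimes> a" unfolding * using ac by algebra
      moreover have "m \<oplus> m' \<in> M" "r \<oplus> r' \<in> A" using * ideal_ofD(3)[OF M(1)] cl by auto
      ultimately show "x \<oplus> y \<in> ?J" by blast
    next
      fix b x assume b: "b \<in> A" and "x \<in> ?J"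
      then obtain m r where *: "x = m \<oplus> r \<otimes> a" "m \<in> M" "r \<in> A" by blast
      then have "m \<in> carrier R" "r \<in> carrier R" "b \<in> carrier R" using MA Ac b by auto
      then have "b \<otimes> x = (b \<otimes> m) \<oplus> (b \<otimes> r) \<otimes> a" unfolding * using ac by algebra
      moreover have "b \<otimes> m \<in> M" "b \<otimes> r \<in> A" using * b ideal_ofD(4)[OF M(1)] cl by auto
      ultimately show "b \<otimes> x \<in> ?J" by blast
    qed
    moreover have "M \<subseteq> ?J"
    proof
      fix m assume m: "m \<in> M"
      then have "m = m \<oplus> \<zero> \<otimes> a" using MA Ac ac by auto
      then show "m \<in> ?J" using m cl by blast
    qed
    moreover have "?J \<inter> S = {}" using * by blast
    ultimately have "?J = M" by (rule mx)
    moreover have "a = \<zero> \<oplus> \<one> \<otimes> a" using ac by simp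
    then have "a \<in> ?J" using ideal_ofD(2)[OF M(1)] cl by blast
    ultimately show False using a by blast
  qed
  have "prime_of A M"
    unfolding prime_of_def
  proof (intro conjI ballI impI)
    show "ideal_of A M" "\<one> \<notin> M" using M S(2) by auto
    fix a b assume ab: "a \<in> A" "b \<in> A" "a \<otimes> b \<in> M"
    show "a \<in> M \<or> b \<in> M"
    proof (rule ccontr)
      assume "\<not> ?thesis"
      then have "a \<notin> M" "b \<notin> M" by auto
      then obtain m r m' r' where *: "m \<in> M" "r \<in> A" "m \<oplus> r \<otimes> a \<in> S" "m' \<in> M" "r' \<in> A" "m' \<oplus> r' \<otimes> b \<in> S"
        using ext[OF ab(1)] ext[OF ab(2)] by blast
      then have car: "m \<in> carrier R" "r \<in> carrier R" "m' \<in> carrier R" "r' \<in> carrier R" "a \<in> carrier R" "b \<in> carrier R"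
        using MA Ac ab by auto
      have "(m \<oplus> r \<otimes> a) \<otimes> (m' \<oplus> r' \<otimes> b) = ((m' \<oplus> r' \<otimes> b) \<otimes> m \<oplus> (r \<otimes> a) \<otimes> m') \<oplus> (r \<otimes> r') \<otimes> (a \<otimes> b)"
        using car by algebra
      moreover have "(m' \<oplus> r' \<otimes> b) \<otimes> m \<in> M"
        using * ab MA by (intro ideal_ofD(4)[OF M(1)]) (auto intro!: cl)
      moreover have "(r \<otimes> a) \<otimes> m' \<in> M" "(r \<otimes> r') \<otimes> (a \<otimes> b) \<in> M"
        using * ab by (auto intro!: ideal_ofD(4)[OF M(1)] cl)
      ultimately have "(m \<oplus> r \<otimes> a) \<otimes> (m' \<oplus> r' \<otimes> b) \<in> M" using ideal_ofD(3)[OF M(1)] by simp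
      then show False using S(3)[OF *(3,6)] M(3) by blast
    qed
  qed
  then show thesis by (rule that[OF _ M(2,3) mx])
qed

end

lemma (in domain) zero_prime: "subring T R \<Longrightarrow> prime_of T {\<zero>}"
proof -
  assume T: "subring T R"
  note Tc = subringE(1)[OF T, THEN subsetD]
  show ?thesis unfolding prime_of_def ideal_of_def
    using subringE(2)[OF T] Tc by (auto simp: integral_iff)
qed

context coeff_sub
begin

lemma pe_Suc_shift:
  assumes "\<And>i. i < Suc n \<Longrightarrow> c i \<in> carrier R" "x \<in> carrier R"
  shows "pe c (Suc n) x = pe (\<lambda>i. c (Suc i)) n x \<otimes> x \<oplus> c 0"
proof -
  have "pe c (Suc n) x = pe (\<lambda>i. if i = 0 then c 0 else c (Suc (i - 1))) (Suc n) x"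
    by (rule pe_cong) auto
  also have "\<dots> = pe (\<lambda>i. c (Suc i)) n x \<otimes> x \<oplus> c 0"
    using assms by (intro pe_shift) auto
  finally show ?thesis .
qed

definition indm :: "'a set \<Rightarrow> 'a set \<Rightarrow> bool" where
  "indm p Y \<longleftrightarrow> ai Y \<and> gen Y \<inter> p \<subseteq> {\<zero>}"

text \<open>The coefficients are killed one after the other, starting with the constant term.\<close>

lemma indm_step:
  assumes A: "subring A R" "K \<subseteq> A" and p: "prime_of A p" "ideal_of A p'" "p \<subseteq> p'"
    and Y: "Y \<subseteq> A" "gen Y \<inter> p' \<subseteq> {\<zero>}" and f: "f \<in> p'" "f \<notin> p"
    and c: "\<And>i. i < n \<Longrightarrow> c i \<in> gen Y" "pe c n f \<in> p" "i < n"
  shows "c i = \<zero>"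
  using c
proof (induction n arbitrary: c i)
  case (Suc n)
  have Ac: "A \<subseteq> carrier R" using subringE(1)[OF A(1)] .
  have fA: "f \<in> A" using f(1) ideal_ofD(1)[OF p(2)] by auto
  have gA: "gen Y \<subseteq> A" by (rule gen_min[OF A Y(1)])
  interpret f: cring_sub R A f using A(1) fA Ac by (intro pw_cring_sub) auto
  let ?w = "pe (\<lambda>i. c (Suc i)) n f"
  have wA: "?w \<in> A"
    using f.pwI[of n "\<lambda>i. c (Suc i)"] Suc.prems(1) gA f.pw_subset[OF A(1) order_refl fA] by blast
  have cc: "c i \<in> carrier R" if "i < Suc n" for i using Suc.prems(1)[OF that] gA Ac by auto
  have eq: "pe c (Suc n) f = ?w \<otimes> f \<oplus> c 0" using cc by (intro pe_Suc_shift) auto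
  have wf: "?w \<otimes> f \<in> p'" using ideal_ofD(4)[OF p(2) wA f(1)] .
  have wc: "?w \<otimes> f \<in> carrier R" "?w \<in> carrier R" using wA Ac by auto
  have "(?w \<otimes> f \<oplus> c 0) \<ominus> ?w \<otimes> f \<in> p'"
    using ideal_of_minus(1)[OF A(1) p(2) _ wf] Suc.prems(2) p(3) eq by auto
  moreover have "(?w \<otimes> f \<oplus> c 0) \<ominus> ?w \<otimes> f = c 0"
  proof -
    have cancel: "(u \<oplus> v) \<ominus> u = v" if "u \<in> carrier R" "v \<in> carrier R" for u v
    proof -
      have "(u \<oplus> v) \<ominus> u = (v \<oplus> u) \<ominus> u" using that by (simp add: a_comm)
      also have "\<dots> = v" using that by (simp add: minus_eq a_assoc r_neg)
      finally show ?thesis .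
    qed
    show ?thesis by (rule cancel[OF wc(1) cc]) simp
  qed
  ultimately have c0: "c 0 = \<zero>" using Y(2) Suc.prems(1)[of 0] by auto
  then have "?w \<otimes> f \<in> p" using Suc.prems(2) eq wc by simp
  then have "?w \<in> p" using prime_ofD(3)[OF p(1) wA fA] f(2) by blast
  then have "c (Suc j) = \<zero>" if "j < n" for j
    using Suc.IH[of "\<lambda>i. c (Suc i)" j] Suc.prems(1) that by blast
  then show ?case using c0 Suc.prems(3) by (cases i) auto
qed simp

text \<open>A relation with value zero and an element of \<open>gen (insert f Y)\<close> lying in
  \<open>p\<close> are the same situation, because \<open>\<zero> \<in> p\<close>. Hence
  \<open>indm_step\<close> settles both transcendence and the intersection with
  \<open>p\<close>.\<close>

lemma indm_insert:
  assumes A: "subring A R" "K \<subseteq> A" and p: "prime_of A p" "ideal_of A p'" "p \<subseteq> p'"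
    and Y: "Y \<subseteq> A" "indm p' Y" and f: "f \<in> p'" "f \<notin> p"
  shows "indm p (insert f Y)" "f \<notin> Y"
proof -
  have Ac: "A \<subseteq> carrier R" using subringE(1)[OF A(1)] .
  have fA: "f \<in> A" using f(1) ideal_ofD(1)[OF p(2)] by auto
  have Yc: "Y \<subseteq> carrier R" and fc: "f \<in> carrier R" using Y(1) fA Ac by auto
  have z: "\<zero> \<in> p" using ideal_ofD(2)[OF prime_ofD(1)[OF p(1)]] .
  have gY: "gen Y \<inter> p' \<subseteq> {\<zero>}" using Y(2) unfolding indm_def by blast
  note step = indm_step[OF A p Y(1) gY f]
  show fY: "f \<notin> Y" using gY f z gen_incl(1)[of f Y] by auto
  interpret f: cring_sub R "gen Y" f by (rule pw_cring_sub[OF subring_gen[OF Yc] fc])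
  have "trans_over (gen Y) f"
    unfolding trans_over_def
  proof (intro allI impI)
    fix c n i assume c: "\<forall>i<n. c i \<in> gen Y" "pe c n f = \<zero>" "i < (n::nat)"
    show "c i = \<zero>" by (rule step[of n c]) (use c z in auto)
  qed
  then have "ai (insert f Y)"
    using alg_indep_insert[OF fY fc Yc] Y(2) unfolding indm_def by blast
  moreover have "gen (insert f Y) \<inter> p \<subseteq> {\<zero>}"
  proof
    fix y assume "y \<in> gen (insert f Y) \<inter> p"
    then have y: "y \<in> adj (gen Y) f" "y \<in> p" using gen_insert[OF Yc fc] by auto
    obtain n where "y \<in> pw (gen Y) f n" using y(1) by (rule f.adjE)
    then obtain c where c: "\<And>i. i < n \<Longrightarrow> c i \<in> gen Y" "y = pe c n f" by (rule f.pwE) blast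
    have "c i = \<zero>" if "i < n" for i by (rule step[of n c]) (use c y(2) that in auto)
    then have "pe c n f = pe (\<lambda>_. \<zero>) n f" by (rule pe_cong)
    then show "y \<in> {\<zero>}" using c(2) fc by (simp add: pe_zero)
  qed
  ultimately show "indm p (insert f Y)" unfolding indm_def by blast
qed

text \<open>Starting from a given \<open>Y\<close> instead of the empty set is what turns a bound on
  the length into a bound by a difference of transcendence degrees.\<close>

lemma indm_chain:
  assumes A: "subring A R" "K \<subseteq> A" and p: "\<And>i. i \<le> n \<Longrightarrow> prime_of A (p i)" "\<And>i. i < n \<Longrightarrow> p i \<subset> p (Suc i)"
    and Y: "finite Y" "Y \<subseteq> A" "indm (p n) Y"
  shows "\<exists>Z. finite Z \<and> Z \<subseteq> A \<and> indm (p 0) Z \<and> card Z = card Y + n"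
  using p Y
proof (induction n arbitrary: Y)
  case (Suc n)
  then obtain f where f: "f \<in> p (Suc n)" "f \<notin> p n" using Suc.prems(2)[of n] by blast
  have i: "ideal_of A (p (Suc n))" using prime_ofD(1)[OF Suc.prems(1)[of "Suc n"]] by simp
  have fA: "f \<in> A" using ideal_ofD(1)[OF i] f by auto
  have "p n \<subseteq> p (Suc n)" using Suc.prems(2)[of n] by auto
  note * = indm_insert[OF A Suc.prems(1)[of n] i this Suc.prems(4,5) f]
  have "\<exists>Z. finite Z \<and> Z \<subseteq> A \<and> indm (p 0) Z \<and> card Z = card (insert f Y) + n"
    by (rule Suc.IH) (use Suc.prems fA * in auto)
  then show ?case using *(2) Suc.prems(3) by auto
qed auto

lemma indm_subset: "indm p Y \<Longrightarrow> Y' \<subseteq> Y \<Longrightarrow> indm p Y'"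
  unfolding indm_def using alg_indep_subset gen_mono ai_carrier by blast

lemma indm_ai: "indm p Y \<Longrightarrow> ai Y"
  unfolding indm_def by blast

end

section \<open>Noether normalization\<close>

text \<open>The digits are the exponents of a monomial in the substitution below, and the sum is its
  weight; uniqueness separates monomials by weight.\<close>

lemma digits_unique:
  fixes a b :: "nat \<Rightarrow> nat"
  assumes "\<And>i. i < n \<Longrightarrow> a i < N" "\<And>i. i < n \<Longrightarrow> b i < N"
    and "(\<Sum>i<n. a i * N ^ i) = (\<Sum>i<n. b i * N ^ i)" "i < n"
  shows "a i = b i"
  using assms
proof (induction n arbitrary: a b i)
  case (Suc n)
  have sh: "(\<Sum>i<Suc n. f i * N ^ i) = f 0 + N * (\<Sum>i<n. f (Suc i) * N ^ i)" for f :: "nat \<Rightarrow> nat"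
    unfolding sum.lessThan_Suc_shift by (simp add: sum_distrib_left mult_ac)
  have ab0: "a 0 < N" "b 0 < N" using Suc.prems by auto
  have eq: "a 0 + N * (\<Sum>i<n. a (Suc i) * N ^ i) = b 0 + N * (\<Sum>i<n. b (Suc i) * N ^ i)"
    using Suc.prems(3) unfolding sh .
  then have "(a 0 + N * (\<Sum>i<n. a (Suc i) * N ^ i)) mod N = (b 0 + N * (\<Sum>i<n. b (Suc i) * N ^ i)) mod N" by simp
  then have 0: "a 0 = b 0" using ab0 by simp
  then have "(\<Sum>i<n. a (Suc i) * N ^ i) = (\<Sum>i<n. b (Suc i) * N ^ i)" using eq ab0 by simp
  then have "a (Suc j) = b (Suc j)" if "j < n" for j
    using Suc.IH[of "\<lambda>i. a (Suc i)" "\<lambda>i. b (Suc i)" j] Suc.prems(1,2) that by simp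
  then show ?case using 0 Suc.prems(4) by (cases i) auto
qed simp

lemma sum_mset_count_on:
  fixes w :: "'b \<Rightarrow> nat"
  assumes "finite S" "set_mset m \<subseteq> S"
  shows "(\<Sum>s\<in>#m. w s) = (\<Sum>s\<in>S. count m s * w s)"
  using assms(2)
proof (induction m)
  case (add x m)
  have "(\<Sum>s\<in>S. count (add_mset x m) s * w s) = (\<Sum>s\<in>S. count m s * w s + (if s = x then w s else 0))"
    by (rule sum.cong) auto
  also have "\<dots> = (\<Sum>s\<in>S. count m s * w s) + w x"
    using add.prems assms(1) by (simp add: sum.distrib)
  finally show ?case using add by simp
qed simp

section \<open>Finite modules over a subring\<close>

primrec (in ring) msp :: "'a set \<Rightarrow> 'a list \<Rightarrow> 'a set" where
  "msp A [] = {\<zero>}"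
| "msp A (w # ws) = {a \<otimes> w \<oplus> v | a v. a \<in> A \<and> v \<in> msp A ws}"

locale subring_in = cring R for R (structure) + fixes A
  assumes subring_A: "subring A R"
begin

lemma A_carrier: "A \<subseteq> carrier R"
  using subringE(1)[OF subring_A] .

lemmas A_closed = subringE(2,3)[OF subring_A] subringE(5-7)[OF subring_A]

lemma msp_carrier: "set ws \<subseteq> carrier R \<Longrightarrow> msp A ws \<subseteq> carrier R"
  using A_carrier by (induction ws) auto

lemma msp_zero: "set ws \<subseteq> carrier R \<Longrightarrow> \<zero> \<in> msp A ws"
proof (induction ws)
  case (Cons w ws)
  then have "\<zero> = \<zero> \<otimes> w \<oplus> \<zero>" "\<zero> \<in> msp A ws" by auto
  then show ?case using A_closed(1) by (simp only: msp.simps) blast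
qed simp

lemma msp_add: "set ws \<subseteq> carrier R \<Longrightarrow> x \<in> msp A ws \<Longrightarrow> y \<in> msp A ws \<Longrightarrow> x \<oplus> y \<in> msp A ws"
proof (induction ws arbitrary: x y)
  case (Cons w ws)
  then obtain a v b u where *: "a \<in> A" "v \<in> msp A ws" "x = a \<otimes> w \<oplus> v" "b \<in> A" "u \<in> msp A ws" "y = b \<otimes> w \<oplus> u" by auto
  have "w \<in> carrier R" "a \<in> carrier R" "b \<in> carrier R" "v \<in> carrier R" "u \<in> carrier R"
    using * Cons.prems(1) A_carrier msp_carrier[of ws] by auto
  then have "x \<oplus> y = (a \<oplus> b) \<otimes> w \<oplus> (v \<oplus> u)" unfolding *(3,6) by algebra
  moreover have "a \<oplus> b \<in> A" "v \<oplus> u \<in> msp A ws" using * Cons A_closed by auto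
  ultimately show ?case by auto
qed simp

lemma msp_smult: "set ws \<subseteq> carrier R \<Longrightarrow> x \<in> msp A ws \<Longrightarrow> b \<in> A \<Longrightarrow> b \<otimes> x \<in> msp A ws"
proof (induction ws arbitrary: x)
  case (Cons w ws)
  then obtain a v where *: "a \<in> A" "v \<in> msp A ws" "x = a \<otimes> w \<oplus> v" by auto
  have "w \<in> carrier R" "a \<in> carrier R" "b \<in> carrier R" "v \<in> carrier R"
    using * Cons.prems A_carrier msp_carrier[of ws] by auto
  then have "b \<otimes> x = (b \<otimes> a) \<otimes> w \<oplus> b \<otimes> v" unfolding *(3) by algebra
  moreover have "b \<otimes> a \<in> A" "b \<otimes> v \<in> msp A ws" using * Cons A_closed by auto
  ultimately show ?case by auto
qed (use A_carrier in auto)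

lemma msp_append: "set ws \<subseteq> carrier R \<Longrightarrow> set us \<subseteq> carrier R \<Longrightarrow> x \<in> msp A ws \<Longrightarrow> y \<in> msp A us \<Longrightarrow> x \<oplus> y \<in> msp A (ws @ us)"
proof (induction ws arbitrary: x)
  case (Cons w ws)
  then obtain a v where *: "a \<in> A" "v \<in> msp A ws" "x = a \<otimes> w \<oplus> v" by auto
  have "w \<in> carrier R" "a \<in> carrier R" "v \<in> carrier R" "y \<in> carrier R"
    using * Cons.prems A_carrier msp_carrier[of ws] msp_carrier[of us] by auto
  then have "x \<oplus> y = a \<otimes> w \<oplus> (v \<oplus> y)" unfolding *(3) by algebra
  moreover have "v \<oplus> y \<in> msp A (ws @ us)" using * Cons by auto
  ultimately show ?case using *(1) by auto
next
  case Nil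
  then have "y \<in> carrier R" using msp_carrier[of us] by blast
  then show ?case using Nil by simp
qed

lemma msp_mult_elem:
  assumes "set ws \<subseteq> carrier R" "u \<in> carrier R" "x \<in> msp A ws"
  shows "x \<otimes> u \<in> msp A (map (\<lambda>w. w \<otimes> u) ws)"
  using assms
proof (induction ws arbitrary: x)
  case (Cons w ws)
  then obtain a v where *: "a \<in> A" "v \<in> msp A ws" "x = a \<otimes> w \<oplus> v" by auto
  have "w \<in> carrier R" "a \<in> carrier R" "v \<in> carrier R" "u \<in> carrier R"
    using * Cons.prems A_carrier msp_carrier[of ws] by auto
  then have "x \<otimes> u = a \<otimes> (w \<otimes> u) \<oplus> v \<otimes> u" unfolding *(3) by algebra
  moreover have "v \<otimes> u \<in> msp A (map (\<lambda>w. w \<otimes> u) ws)" using * Cons by auto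
  ultimately show ?case using *(1) by auto
qed (use assms in auto)

lemma msp_trans:
  assumes "B \<subseteq> msp A vs" "set vs \<subseteq> carrier R" "set ws \<subseteq> carrier R"
  shows "msp B ws \<subseteq> msp A (concat (map (\<lambda>w. map (\<lambda>v. v \<otimes> w) vs) ws))"
  using assms(3)
proof (induction ws)
  case (Cons w ws)
  let ?rest = "concat (map (\<lambda>w. map (\<lambda>v. v \<otimes> w) vs) ws)"
  have c: "set ?rest \<subseteq> carrier R" "set (map (\<lambda>v. v \<otimes> w) vs) \<subseteq> carrier R"
    using Cons.prems assms(2) by auto
  have "b \<otimes> w \<oplus> v \<in> msp A (map (\<lambda>v. v \<otimes> w) vs @ ?rest)" if "b \<in> B" "v \<in> msp B ws" for b v
    using that Cons assms by (intro msp_append[OF c(2,1)] msp_mult_elem) auto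
  then show ?case by auto
qed simp

lemma msp_one: "A \<subseteq> msp A [\<one>]"
proof
  fix a assume "a \<in> A"
  moreover from this have "a = a \<otimes> \<one> \<oplus> \<zero>" using A_carrier by auto
  ultimately show "a \<in> msp A [\<one>]" by auto
qed

lemma pw_msp:
  assumes "x \<in> carrier R"
  shows "pw A x n = msp A (map (\<lambda>i. x [^] i) (rev [0..<n]))"
proof (induction n)
  case 0
  then show ?case by (simp add: pw_def)
next
  case (Suc n)
  interpret x: cring_sub R A x by (rule pw_cring_sub[OF subring_A assms])
  have "y \<in> pw A x (Suc n) \<longleftrightarrow> y \<in> msp A (map (\<lambda>i. x [^] i) (rev [0..<Suc n]))" for y
    unfolding x.pw_Suc Suc by (simp del: map_eq_conv) blast
  then show ?case by blast
qed

end

lemma (in cring) subring_inI: "subring A R \<Longrightarrow> subring_in R A"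
  by (simp add: subring_in_def subring_in_axioms_def is_cring)

text \<open>Containment in a finitely generated module instead of equality: this passes to subsets
  at once and is exactly what the argument with uniform denominators consumes.\<close>

definition (in ring) fin_over :: "'a set \<Rightarrow> 'a set \<Rightarrow> bool" where
  "fin_over A T \<longleftrightarrow> (\<exists>ws. set ws \<subseteq> carrier R \<and> T \<subseteq> msp A ws)"

lemma (in cring) fin_over_refl: "subring A R \<Longrightarrow> fin_over A A"
  unfolding fin_over_def using subring_in.msp_one[OF subring_inI] by (intro exI[of _ "[\<one>]"]) auto

lemma (in cring) fin_over_trans:
  assumes "subring A R" "subring B R" "fin_over A B" "fin_over B T"
  shows "fin_over A T"
proof -
  obtain vs where vs: "set vs \<subseteq> carrier R" "B \<subseteq> msp A vs" using assms(3) unfolding fin_over_def by blast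
  obtain ws where ws: "set ws \<subseteq> carrier R" "T \<subseteq> msp B ws" using assms(4) unfolding fin_over_def by blast
  have "T \<subseteq> msp A (concat (map (\<lambda>w. map (\<lambda>v. v \<otimes> w) vs) ws))"
    using subring_in.msp_trans[OF subring_inI[OF assms(1)] vs(2,1) ws(1)] ws(2) by blast
  moreover have "set (concat (map (\<lambda>w. map (\<lambda>v. v \<otimes> w) vs) ws)) \<subseteq> carrier R" using vs ws by auto
  ultimately show ?thesis unfolding fin_over_def by blast
qed

text \<open>The hypothesis is a monic equation of degree \<open>D\<close>. It makes
  \<open>pw A x D\<close> stable under multiplication by \<open>x\<close>. This set also contains
  one; for \<open>D = 0\<close> because the equation then says
  \<open>\<one> = \<zero>\<close>.\<close>

lemma (in cring_sub) adj_monic: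
  assumes "x [^] D \<in> pw A x D"
  shows "adj A x \<subseteq> pw A x D"
proof -
  have step: "y \<otimes> x \<in> pw A x D" if "y \<in> pw A x D" for y
  proof -
    have "y \<otimes> x \<in> pw A x (Suc D)" by (rule pw_mult_x[OF that])
    then obtain a w where "a \<in> A" "w \<in> pw A x D" "y \<otimes> x = a \<otimes> x [^] D \<oplus> w" unfolding pw_Suc by blast
    then show ?thesis using assms by simp
  qed
  have one: "\<one> \<in> pw A x D"
  proof (cases D)
    case 0
    then have "\<one> = \<zero>" using assms by (simp add: pw_0)
    then show ?thesis by (metis pw_zero)
  qed simp
  have pow: "x [^] n \<in> pw A x D" for n :: nat
    by (induction n) (use one step in auto)
  have "y \<in> pw A x D" if "y \<in> pw A x n" for y n
    using that
  proof (induction n arbitrary: y)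
    case (Suc n)
    then show ?case using pow unfolding pw_Suc by auto
  qed (auto simp: pw_0)
  then show ?thesis unfolding adj_def by blast
qed

lemma (in cring_sub) adj_fin_over:
  assumes "x [^] D \<in> pw A x D"
  shows "fin_over A (adj A x)"
proof -
  have "adj A x \<subseteq> msp A (map (\<lambda>i. x [^] i) (rev [0..<D]))"
    using adj_monic[OF assms] subring_in.pw_msp[OF subring_inI[OF subring_A] x_closed] by blast
  moreover have "set (map (\<lambda>i. x [^] i) (rev [0..<D])) \<subseteq> carrier R" by auto
  ultimately show ?thesis unfolding fin_over_def by blast
qed

locale affine_field = field_sub R K for R (structure) and K +
  assumes subfield_K: "subfield K R"
begin

lemma K_inv: "a \<in> K \<Longrightarrow> a \<noteq> \<zero> \<Longrightarrow> inv a \<in> K"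
  using subfield_m_inv(1)[OF subfield_K] by auto

text \<open>Nagata's change of variables \<open>s \<mapsto> s - z ^ N ^ i\<close>, which makes the polynomial \<open>p\<close> monic in \<open>z\<close>.\<close>

lemma nagata:
  assumes S: "finite S" "S \<subseteq> carrier R" and p: "p \<in> IP S" "m0 \<noteq> {#}" "p m0 \<noteq> \<zero>"
  obtains S' where "finite S'" "S' \<subseteq> gen S" "card S' < card S"
    "fin_over (gen (insert (ev p) S')) (gen S)" "S \<subseteq> cl (insert (ev p) S')"
proof -
  have supp: "finite {m. p m \<noteq> \<zero>}" "\<And>m. p m \<noteq> \<zero> \<Longrightarrow> set_mset m \<subseteq> S" and pK: "\<And>m. p m \<in> K"
    using p(1) unfolding IP_def by auto
  have "S \<noteq> {}" using supp(2)[OF p(3)] p(2) by auto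
  \<comment> \<open>An arbitrary numbering of the variables. The one with number 0 gets weight
    \<open>N ^ 0 = 1\<close>; it is the \<open>z\<close> that becomes integral over the
    others.\<close>
  obtain e where e: "bij_betw e S {0..<card S}" using S(1) ex_bij_betw_finite_nat by blast
  have "0 \<in> e ` S" using e \<open>S \<noteq> {}\<close> S(1) by (auto simp: bij_betw_def card_gt_0_iff)
  then obtain z where z: "z \<in> S" "e z = 0" by auto
  have zc: "z \<in> carrier R" using z S by auto
  \<comment> \<open>Larger than the total degree of every monomial in the support, so that exponents
    are digits in base \<open>N\<close>.\<close>
  define N where "N = Suc (Max (insert 0 (size ` {m. p m \<noteq> \<zero>})))"
  have Nb: "count m s < N" if "p m \<noteq> \<zero>" for m s
  proof -
    have "count m s \<le> size m" by (rule count_le_size)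
    also have "size m \<le> Max (insert 0 (size ` {m. p m \<noteq> \<zero>}))" using that supp(1) by (intro Max_ge) auto
    finally show ?thesis by (simp add: N_def)
  qed
  have N0: "N > 0" by (simp add: N_def)
  define w where "w s = N ^ e s" for s
  have w1: "w s \<ge> 1" for s using N0 by (simp add: w_def)
  have wz: "w z = 1" using z by (simp add: w_def)
  define wt where "wt m = (\<Sum>s\<in>#m. w s)" for m
  have wt_eq: "wt m = (\<Sum>i<card S. count m (the_inv_into S e i) * N ^ i)" if "set_mset m \<subseteq> S" for m
  proof -
    have "wt m = (\<Sum>s\<in>S. count m s * w s)"
      unfolding wt_def using S(1) that by (rule sum_mset_count_on)
    also have "\<dots> = (\<Sum>i\<in>e ` S. count m (the_inv_into S e i) * N ^ i)"
      using e by (subst sum.reindex) (auto simp: bij_betw_def the_inv_into_f_f w_def)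
    finally show ?thesis using e by (simp add: bij_betw_def lessThan_atLeast0)
  qed
  have wt_inj: "m = m'" if "p m \<noteq> \<zero>" "p m' \<noteq> \<zero>" "wt m = wt m'" for m m'
  proof (rule multiset_eqI)
    fix s
    show "count m s = count m' s"
    proof (cases "s \<in> S")
      case True
      then have "e s < card S" "the_inv_into S e (e s) = s"
        using e by (auto simp: bij_betw_def the_inv_into_f_f)
      moreover have "count m (the_inv_into S e (e s)) = count m' (the_inv_into S e (e s))"
        using wt_eq[OF supp(2)] that Nb calculation(1)
        by (intro digits_unique[of "card S" "\<lambda>i. count m (the_inv_into S e i)" N "\<lambda>i. count m' (the_inv_into S e i)"]) auto
      ultimately show ?thesis by simp
    next
      case False
      then have "s \<notin># m" "s \<notin># m'" using supp(2) that by blast+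
      then show ?thesis by (simp add: not_in_iff)
    qed
  qed
  define b where "b s = s \<ominus> z [^] w s" for s
  have bc: "b s \<in> carrier R" if "s \<in> S" for s using that S zc by (auto simp: b_def)
  define S' where "S' = b ` (S - {z})"
  have S': "finite S'" "S' \<subseteq> carrier R" using S(1) bc by (auto simp: S'_def)
  have "card S' \<le> card (S - {z})" unfolding S'_def using S(1) by (intro card_image_le) auto
  then have cS': "card S' < card S" using z S(1) card_Diff1_less[of S z] by linarith
  have sgS: "subring (gen S) R" by (rule subring_gen[OF S(2)])
  note gcl = subringE(2,3,5,6,7)[OF sgS]
  have zpow: "z [^] n \<in> gen S" for n :: nat
    using gen_incl(1)[OF z(1)] by (induction n) (auto intro: gcl)
  have S'gen: "S' \<subseteq> gen S"
    using zpow gen_incl(1) gcl by (auto simp: S'_def b_def minus_eq)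
  have evc: "ev p \<in> carrier R" by (rule ev_closed[OF p(1) S(2)])
  \<comment> \<open>The value of \<open>p\<close> is kept as a generator and not assumed to vanish.
    With value zero this eliminates a variable; with a nonzero value it makes that value a
    coordinate.\<close>
  let ?I = "insert (ev p) S'"
  have Ic: "?I \<subseteq> carrier R" using S' evc by auto
  define B where "B = gen ?I"
  have B: "subring B R" unfolding B_def by (rule subring_gen[OF Ic])
  interpret z: cring_sub R B z by (rule pw_cring_sub[OF B zc])
  have KB: "a \<in> B" if "a \<in> K" for a unfolding B_def by (rule gen_incl(2)[OF that])
  have bB: "b s \<in> B" if "s \<in> S" "s \<noteq> z" for s
    unfolding B_def using that by (intro gen_incl(1)) (auto simp: S'_def)
  have s_eq: "s = \<one> \<otimes> z [^] w s \<oplus> b s" if "s \<in> S" for s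
  proof -
    have "s \<in> carrier R" "z [^] w s \<in> carrier R" using that S zc by auto
    then have "s = z [^] w s \<oplus> (s \<ominus> z [^] w s)" by algebra
    then show ?thesis using zc by (simp add: b_def)
  qed
  have b_pw: "b s \<in> pw B z (w s)" if "s \<in> S" for s
  proof (cases "s = z")
    case True
    then have "b s = \<zero>" using wz zc by (simp add: b_def minus_eq r_neg)
    then show ?thesis by simp
  next
    case False
    then have "b s \<in> pw B z (Suc 0)" using bB that by simp
    then show ?thesis by (rule z.pw_mono) (use w1[of s] in simp)
  qed
  \<comment> \<open>Substituting the \<open>w s\<close>-th power of \<open>z\<close> plus
    \<open>b s\<close> for \<open>s\<close>, where \<open>b s\<close> is constant in
    \<open>z\<close>, makes each monomial monic in \<open>z\<close> with its weight as
    degree.\<close>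
  have mon_lead: "\<exists>u\<in>pw B z (wt m). mon m = \<one> \<otimes> z [^] wt m \<oplus> u" if "set_mset m \<subseteq> S" for m
    using that
  proof (induction m)
    case empty
    then show ?case by (auto simp: wt_def intro!: bexI[of _ \<zero>])
  next
    case (add s m)
    then obtain u where u: "u \<in> pw B z (wt m)" "mon m = \<one> \<otimes> z [^] wt m \<oplus> u" by auto
    have sS: "s \<in> S" using add.prems by auto
    obtain v where v: "v \<in> pw B z (wt m + w s)"
      "(\<one> \<otimes> z [^] wt m \<oplus> u) \<otimes> (\<one> \<otimes> z [^] w s \<oplus> b s) = (\<one> \<otimes> \<one>) \<otimes> z [^] (wt m + w s) \<oplus> v"
      using z.lead_mult[of \<one> \<one> u "wt m" "b s" "w s"] u(1) b_pw[OF sS] by auto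
    have "mon (add_mset s m) = mon m \<otimes> s" using add.prems S(2) by (intro mon_add_mset) auto
    also have "\<dots> = (\<one> \<otimes> z [^] wt m \<oplus> u) \<otimes> (\<one> \<otimes> z [^] w s \<oplus> b s)"
      using u(2) s_eq[OF sS] by simp
    also have "\<dots> = (\<one> \<otimes> \<one>) \<otimes> z [^] (wt m + w s) \<oplus> v" by (rule v(2))
    finally have "mon (add_mset s m) = \<one> \<otimes> z [^] wt (add_mset s m) \<oplus> v"
      by (simp add: wt_def add.commute)
    then show ?case using v(1) by (auto simp: wt_def add.commute)
  qed
  let ?M = "{m. p m \<noteq> \<zero>}"
  have "wt ` ?M \<noteq> {}" "finite (wt ` ?M)" using p(3) supp(1) by auto
  then have "Max (wt ` ?M) \<in> wt ` ?M" by (rule Max_in[rotated])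
  \<comment> \<open>Weights are distinct on the support, so a single monomial attains the largest
    degree in \<open>z\<close>. Its coefficient cannot be cancelled and is invertible in
    \<open>K\<close>.\<close>
  then obtain m where m: "m \<in> ?M" "wt m = Max (wt ` ?M)" by (elim imageE) simp
  have mmax: "wt n < wt m" if "n \<in> ?M" "n \<noteq> m" for n
  proof -
    have "wt n \<le> wt m" using that m(2) supp(1) by simp
    moreover have "wt n \<noteq> wt m" using wt_inj[of n m] that m(1) by auto
    ultimately show ?thesis by simp
  qed
  let ?D = "wt m"
  \<comment> \<open>The nonconstant monomial \<open>m0\<close> makes the degree \<open>?D\<close>
    positive; the constant \<open>ev p\<close> then lies below it.\<close>
  have "wt m0 \<ge> 1"
  proof -
    obtain s m1 where "m0 = add_mset s m1" using p(2) by (metis multiset_cases)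
    then show ?thesis using w1[of s] by (simp add: wt_def)
  qed
  moreover have "wt m0 \<le> ?D" using m(2) supp(1) p(3) by simp
  ultimately have D1: "?D \<ge> 1" by simp
  obtain u where u: "u \<in> pw B z ?D" "mon m = \<one> \<otimes> z [^] ?D \<oplus> u" using mon_lead supp(2) m(1) by blast
  have rest: "(\<Oplus>n\<in>M'. p n \<otimes> mon n) \<in> pw B z ?D" if "finite M'" "M' \<subseteq> ?M - {m}" for M'
    using that
  proof (induction M')
    case (insert n M')
    then have n: "p n \<noteq> \<zero>" "n \<noteq> m" by auto
    obtain v where v: "v \<in> pw B z (wt n)" "mon n = \<one> \<otimes> z [^] wt n \<oplus> v" using mon_lead supp(2)[OF n(1)] by blast
    have lt: "wt n < ?D" using mmax n by auto
    have "mon n \<in> pw B z ?D"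
      unfolding v(2) using z.pw_pow[OF lt, of \<one>] z.pw_mono[OF v(1), of ?D] lt by simp
    then have "p n \<otimes> mon n \<in> pw B z ?D" using KB[OF pK] by simp
    moreover have "(\<Oplus>n\<in>insert n M'. p n \<otimes> mon n) = p n \<otimes> mon n \<oplus> (\<Oplus>n\<in>M'. p n \<otimes> mon n)"
    proof (rule finsum_insert[OF insert.hyps(1,2)])
      have "mon k \<in> carrier R" if "p k \<noteq> \<zero>" for k using supp(2)[OF that] S(2) by (intro mon_closed) auto
      then show "(\<lambda>n. p n \<otimes> mon n) \<in> M' \<rightarrow> carrier R" "p n \<otimes> mon n \<in> carrier R"
        using insert.prems K_carrier[OF pK] n(1) by auto
    qed
    ultimately show ?case using insert by simp
  qed simp
  let ?r = "\<Oplus>n\<in>?M - {m}. p n \<otimes> mon n"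
  have r: "?r \<in> pw B z ?D" using supp(1) by (intro rest) auto
  have "ev p = (\<Oplus>n\<in>?M. p n \<otimes> mon n)"
    by (rule ev_eq[OF p(1) S(2) supp(1) order_refl]) (use supp(2) in auto)
  also have "\<dots> = (\<Oplus>n\<in>insert m (?M - {m}). p n \<otimes> mon n)" using m(1) by (simp add: insert_absorb)
  also have "\<dots> = p m \<otimes> mon m \<oplus> ?r"
  proof (rule finsum_insert)
    have "mon k \<in> carrier R" if "p k \<noteq> \<zero>" for k using supp(2)[OF that] S(2) by (intro mon_closed) auto
    then show "(\<lambda>n. p n \<otimes> mon n) \<in> ?M - {m} \<rightarrow> carrier R" "p m \<otimes> mon m \<in> carrier R"
      using K_carrier[OF pK] m(1) by auto
  qed (use supp(1) in auto)
  finally have evp: "ev p = p m \<otimes> (\<one> \<otimes> z [^] ?D \<oplus> u) \<oplus> ?r" using u(2) by simp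
  let ?k = "inv (p m)"
  have k: "p m \<in> carrier R" "?k \<in> carrier R" "?k \<otimes> p m = \<one>" "?k \<in> B"
    using m(1) K_carrier[OF pK] KB[OF K_inv[OF pK]] by auto
  have uc: "u \<in> carrier R" "?r \<in> carrier R" "z [^] ?D \<in> carrier R" using u(1) r zc by auto
  \<comment> \<open>The expansion of \<open>ev p\<close> is solved for the top power of
    \<open>z\<close>, which yields a monic equation over \<open>B\<close>.\<close>
  have "?k \<otimes> (ev p \<ominus> ?r) \<ominus> u = z [^] ?D"
  proof -
    have "ev p \<ominus> ?r = p m \<otimes> (z [^] ?D \<oplus> u)"
      unfolding evp using k uc by (simp add: minus_eq a_assoc r_neg)
    then have "?k \<otimes> (ev p \<ominus> ?r) = z [^] ?D \<oplus> u" using k uc by (simp add: m_assoc[symmetric])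
    then show ?thesis using uc by (simp add: minus_eq a_assoc r_neg)
  qed
  moreover have "ev p \<in> pw B z ?D"
  proof -
    have "ev p \<in> B" unfolding B_def by (rule gen_incl(1)) simp
    then have "ev p \<in> pw B z (Suc 0)" by simp
    then show ?thesis by (rule z.pw_mono) (use D1 in simp)
  qed
  then have "?k \<otimes> (ev p \<ominus> ?r) \<ominus> u \<in> pw B z ?D" using k(4) r u(1) by simp
  ultimately have zD: "z [^] ?D \<in> pw B z ?D" by simp
  have gS: "gen S \<subseteq> adj B z"
  proof (rule gen_min[OF z.subring_adj])
    show "K \<subseteq> adj B z" using KB z.adj_incl by blast
    show "S \<subseteq> adj B z"
    proof
      fix s assume s: "s \<in> S"
      have "\<one> \<otimes> z [^] w s \<in> pw B z (Suc (w s))" by (rule z.pw_pow) auto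
      moreover have "b s \<in> pw B z (Suc (w s))" using b_pw[OF s] z.pw_mono by simp
      ultimately have "s \<in> pw B z (Suc (w s))" using s_eq[OF s] z.pw_add by metis
      then show "s \<in> adj B z" by (rule z.adjI)
    qed
  qed
  have "fin_over B (gen S)" using z.adj_fin_over[OF zD] gS unfolding fin_over_def by blast
  moreover have "S \<subseteq> cl ?I"
  proof -
    have "\<not> trans_over B z"
    proof
      assume t: "trans_over B z"
      have "\<one> \<otimes> z [^] ?D \<oplus> \<zero> \<in> pw B z ?D" using zD zc by simp
      then show False using z.lead_trans[OF t, of \<one> \<zero> ?D] by simp
    qed
    then have "z \<in> cl ?I" unfolding cl_def B_def using zc by simp
    moreover have "B \<subseteq> cl ?I" unfolding B_def by (rule gen_subset_cl[OF Ic])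
    ultimately have "adj B z \<subseteq> cl ?I" by (intro z.adj_min subfieldE(1)[OF subfield_cl[OF Ic]])
    then show ?thesis using gS gen_incl(1) by blast
  qed
  ultimately show thesis using that S'(1) S'gen cS' unfolding B_def by blast
qed

text \<open>A dependence between the generators is a polynomial with value zero, for which the
  substitution leaves fewer generators. Finiteness and algebraic closure are both transitive, so the
  induction composes.\<close>

theorem noether_normalization:
  assumes "finite S" "S \<subseteq> carrier R"
  shows "\<exists>Y. finite Y \<and> Y \<subseteq> gen S \<and> ai Y \<and> card Y \<le> card S \<and> fin_over (gen Y) (gen S) \<and> S \<subseteq> cl Y"
  using assms
proof (induction "card S" arbitrary: S rule: less_induct)
  case less
  show ?case
  proof (cases "ai S")
    case True
    then show ?thesis using less.prems fin_over_refl[OF subring_gen[OF less.prems(2)]]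
        cl_incl[OF less.prems(2)] gen_incl(1) by (intro exI[of _ S]) auto
  next
    case False
    then obtain p where p: "p \<in> IP S" "ev p = \<zero>" "p \<noteq> indexed_const \<zero>"
      using less.prems(2) unfolding alg_indep_iff by blast
    have "\<exists>m0. m0 \<noteq> {#} \<and> p m0 \<noteq> \<zero>"
    proof (rule ccontr)
      assume "\<not> ?thesis"
      then have "p = indexed_const (p {#})" by (auto simp: indexed_const_def fun_eq_iff)
      then have "ev p = p {#}" using ev_const[of "p {#}"] IP_K[OF p(1)] by metis
      then show False using p(2,3) \<open>p = indexed_const (p {#})\<close> by simp
    qed
    then obtain m0 where m0: "m0 \<noteq> {#}" "p m0 \<noteq> \<zero>" by blast
    obtain S' where S': "finite S'" "S' \<subseteq> gen S" "card S' < card S"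
      "fin_over (gen (insert (ev p) S')) (gen S)" "S \<subseteq> cl (insert (ev p) S')"
      using nagata[OF less.prems p(1) m0] .
    have S'c: "S' \<subseteq> carrier R" using S'(2) gen_carrier[OF less.prems(2)] by blast
    have eq: "gen (insert \<zero> S') = gen S'"
    proof
      show "gen (insert \<zero> S') \<subseteq> gen S'"
        using gen_incl subringE(2)[OF subring_gen[OF S'c]] by (intro gen_min subring_gen[OF S'c]) auto
    qed (rule gen_mono, use S'c in auto)
    obtain Y where Y: "finite Y" "Y \<subseteq> gen S'" "ai Y" "card Y \<le> card S'" "fin_over (gen Y) (gen S')" "S' \<subseteq> cl Y"
      using less.hyps[OF S'(3,1) S'c] by blast
    have Yc: "Y \<subseteq> carrier R" using Y(3) ai_carrier by blast
    have "gen S' \<subseteq> gen S"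
      using S'(2) gen_incl(2) by (intro gen_min subring_gen[OF less.prems(2)]) auto
    moreover have "fin_over (gen Y) (gen S)"
      using fin_over_trans[OF subring_gen[OF Yc] subring_gen[OF S'c] Y(5)] S'(4) p(2) eq by simp
    moreover have "S \<subseteq> cl Y"
    proof -
      have "insert \<zero> S' \<subseteq> cl Y" using Y(6) subringE(2)[OF subfieldE(1)[OF subfield_cl[OF Yc]]] by auto
      then have "cl (insert \<zero> S') \<subseteq> cl Y" by (rule cl_least[OF Yc])
      then show ?thesis using S'(5) p(2) by auto
    qed
    ultimately show ?thesis using Y S'(3) by (intro exI[of _ Y]) auto
  qed
qed

end

lemma (in field) affine_fieldI: "subfield K R \<Longrightarrow> affine_field R K"
  by (simp add: affine_field_def affine_field_axioms_def field_subI subfieldE(1))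

section \<open>Completely integrally closed subrings\<close>

text \<open>Complete integral closedness: \<open>c\<close> is a common denominator of all powers of
  \<open>u\<close>. This form passes to polynomial rings by comparing leading coefficients, and its
  premise comes from \<open>denominators_bounded\<close>.\<close>

definition (in ring) cic :: "'a set \<Rightarrow> bool" where
  "cic A \<longleftrightarrow> (\<forall>u\<in>frac A. \<forall>c\<in>A. c \<noteq> \<zero> \<longrightarrow> (\<forall>n::nat. c \<otimes> u [^] n \<in> A) \<longrightarrow> u \<in> A)"

lemma (in domain) nat_pow_nonzero:
  assumes "a \<in> carrier R" "a \<noteq> \<zero>" shows "a [^] (n::nat) \<noteq> \<zero>"
  using assms by (induction n) (auto simp: integral_iff)

context cring_sub
begin

definition lead :: "nat \<Rightarrow> 'a \<Rightarrow> 'a \<Rightarrow> bool" where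
  "lead n a y \<longleftrightarrow> a \<in> A \<and> a \<noteq> \<zero> \<and> (\<exists>w\<in>pw A x n. y = a \<otimes> x [^] n \<oplus> w)"

lemma lead_exists:
  assumes "y \<in> pw A x N" "y \<noteq> \<zero>" obtains n a where "n < N" "lead n a y"
  using lead_ex[OF assms] unfolding lead_def by blast

lemma lead_unique:
  assumes t: "trans_over A x" and l: "lead n a y" "lead m b y"
  shows "n = m \<and> a = b"
proof -
  have aux: "\<not> i < j" if "lead i a' y" "lead j b' y" for i j a' b'
  proof
    assume "i < j"
    from that obtain v w where v: "v \<in> pw A x i" "y = a' \<otimes> x [^] i \<oplus> v" "a' \<in> A"
      and w: "w \<in> pw A x j" "y = b' \<otimes> x [^] j \<oplus> w" "b' \<in> A" "b' \<noteq> \<zero>"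
      unfolding lead_def by blast
    have "y \<in> pw A x (Suc i)" unfolding pw_Suc using v by blast
    then have "b' \<otimes> x [^] j \<oplus> w \<in> pw A x j" using pw_mono[of y "Suc i" j] \<open>i < j\<close> w(2) by simp
    then show False using lead_trans[OF t w(3,1)] w(4) by blast
  qed
  have nm: "n = m" using aux[OF l] aux[OF l(2,1)] by linarith
  from l obtain v w where v: "v \<in> pw A x n" "y = a \<otimes> x [^] n \<oplus> v" "a \<in> A"
      and w: "w \<in> pw A x n" "y = b \<otimes> x [^] n \<oplus> w" "b \<in> A"
      unfolding lead_def nm by blast
  have car: "a \<in> carrier R" "b \<in> carrier R" "v \<in> carrier R" "w \<in> carrier R" "x [^] n \<in> carrier R"
    using v w by auto
  have "(a \<ominus> b) \<otimes> x [^] n \<oplus> \<zero> = ((a \<otimes> x [^] n \<oplus> v) \<ominus> (b \<otimes> x [^] n \<oplus> w)) \<oplus> (w \<ominus> v)"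
    using car by algebra
  also have "\<dots> = w \<ominus> v" using v(2) w(2) car by (simp add: minus_eq r_neg)
  finally have "(a \<ominus> b) \<otimes> x [^] n \<oplus> \<zero> \<in> pw A x n" using v w by simp
  moreover have "a \<ominus> b \<in> A" using v w by (simp add: minus_eq)
  ultimately have "a \<ominus> b = \<zero>" using lead_trans[OF t, of "a \<ominus> b" \<zero> n] by simp
  then show ?thesis using nm car by simp
qed

end

lemma (in field) aint_shift:
  assumes A: "subring A R" and u: "u \<in> carrier R" and a: "a \<in> A" and c: "c \<in> carrier R" "\<And>n::nat. c \<otimes> u [^] n \<in> A"
  shows "c \<otimes> (u \<ominus> a) [^] (n::nat) \<in> A"
proof -
  have ac: "a \<in> carrier R" using a subringE(1)[OF A] by auto
  \<comment> \<open>Strengthened by a power of \<open>u\<close>: one more factor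
    \<open>u \<ominus> a\<close> then splits the claim into two instances for \<open>m\<close>, and
    no binomial expansion is needed.\<close>
  have "c \<otimes> (u \<ominus> a) [^] m \<otimes> u [^] k \<in> A" for m k :: nat
  proof (induction m arbitrary: k)
    case 0
    then show ?case using c u by simp
  next
    case (Suc m)
    have "c \<otimes> (u \<ominus> a) [^] Suc m \<otimes> u [^] k = c \<otimes> (u \<ominus> a) [^] m \<otimes> u [^] Suc k \<ominus> a \<otimes> (c \<otimes> (u \<ominus> a) [^] m \<otimes> u [^] k)"
    proof -
      have "\<And>p q. p \<in> carrier R \<Longrightarrow> q \<in> carrier R \<Longrightarrow>
        c \<otimes> (p \<otimes> (u \<ominus> a)) \<otimes> q = c \<otimes> p \<otimes> (q \<otimes> u) \<ominus> a \<otimes> (c \<otimes> p \<otimes> q)"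
        using ac u c(1) by algebra
      then show ?thesis using ac u by simp
    qed
    moreover have "a \<otimes> (c \<otimes> (u \<ominus> a) [^] m \<otimes> u [^] k) \<in> A" using subringE(6)[OF A a Suc.IH] .
    ultimately show ?case using Suc.IH[of "Suc k"] subringE(5,7)[OF A] by (simp add: minus_eq)
  qed
  from this[of n 0] show ?thesis using c u ac by simp
qed

locale field_trans = field R for R (structure) + fixes A x
  assumes subring_A: "subring A R" and x_closed: "x \<in> carrier R" and trans: "trans_over A x"

sublocale field_trans \<subseteq> A: cring_sub R A x
  by (rule pw_cring_sub[OF subring_A x_closed])

context field_trans
begin

lemma subfield_F: "subfield (frac A) R"
  by (rule subfield_frac[OF subring_A])

lemma subring_F: "subring (frac A) R"
  by (rule subfieldE(1)[OF subfield_F])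

sublocale F: cring_sub R "frac A" x
  by (rule pw_cring_sub[OF subring_F x_closed])

lemma F_trans: "trans_over (frac A) x"
  using trans trans_over_frac[OF subring_A x_closed] by simp

lemma F_inv: "a \<in> frac A \<Longrightarrow> a \<noteq> \<zero> \<Longrightarrow> inv a \<in> frac A"
  using subfield_m_inv(1)[OF subfield_F] by auto

lemma pw_A_F: "pw A x n \<subseteq> pw (frac A) x n"
  unfolding pw_def using frac_incl[OF subring_A] by blast

lemma lead_A_F: "A.lead n a y \<Longrightarrow> F.lead n a y"
  unfolding A.lead_def F.lead_def using pw_A_F frac_incl[OF subring_A] by blast

lemma lead_mult:
  assumes "F.lead m a y" "F.lead n b z" shows "F.lead (m + n) (a \<otimes> b) (y \<otimes> z)"
proof -
  obtain v w where v: "v \<in> pw (frac A) x m" "y = a \<otimes> x [^] m \<oplus> v" "a \<in> frac A" "a \<noteq> \<zero>"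
      and w: "w \<in> pw (frac A) x n" "z = b \<otimes> x [^] n \<oplus> w" "b \<in> frac A" "b \<noteq> \<zero>"
    using assms unfolding F.lead_def by blast
  obtain u where "u \<in> pw (frac A) x (m + n)" "y \<otimes> z = (a \<otimes> b) \<otimes> x [^] (m + n) \<oplus> u"
    using F.lead_mult[OF v(3) w(3) v(1) w(1)] v(2) w(2) by auto
  moreover have "a \<otimes> b \<in> frac A" "a \<otimes> b \<noteq> \<zero>" using v w F.A_closed(4) by (auto simp: integral_iff)
  ultimately show ?thesis unfolding F.lead_def by blast
qed

lemma lead_one: "F.lead 0 \<one> \<one>"
  unfolding F.lead_def using F.A_closed(2) by (auto intro!: bexI[of _ \<zero>])

lemma lead_pow:
  assumes "F.lead m a y" shows "F.lead (n * m) (a [^] n) (y [^] n)"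
proof (induction n)
  case 0
  then show ?case using lead_one by simp
next
  case (Suc n)
  have "F.lead (n * m + m) (a [^] n \<otimes> a) (y [^] n \<otimes> y)" by (rule lead_mult[OF Suc assms])
  then show ?case by (simp add: add.commute)
qed

lemma division:
  assumes g: "F.lead e b g" and f: "f \<in> pw (frac A) x N"
  shows "\<exists>q\<in>adj (frac A) x. f \<ominus> q \<otimes> g \<in> pw (frac A) x e"
proof -
  have gc: "g \<in> carrier R" using g unfolding F.lead_def by auto
  have small: "\<exists>q\<in>adj (frac A) x. f \<ominus> q \<otimes> g \<in> pw (frac A) x e" if f: "f \<in> pw (frac A) x N" "N \<le> e" for f N
  proof -
    have "\<zero> \<in> adj (frac A) x" by (rule F.adjI[OF F.pw_zero])
    moreover have "f \<ominus> \<zero> \<otimes> g \<in> pw (frac A) x e" using F.pw_mono[OF f] gc by (simp add: minus_eq)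
    ultimately show ?thesis by blast
  qed
  show ?thesis
  using f
proof (induction N arbitrary: f)
  case 0
  then show ?case using small by blast
next
  case (Suc N)
  show ?case
  proof (cases "Suc N \<le> e")
    case True
    then show ?thesis using small Suc.prems by blast
  next
    case False
    obtain w where w: "w \<in> pw (frac A) x e" "g = b \<otimes> x [^] e \<oplus> w" "b \<in> frac A" "b \<noteq> \<zero>"
      using g unfolding F.lead_def by blast
    obtain a v where a: "a \<in> frac A" "v \<in> pw (frac A) x N" "f = a \<otimes> x [^] N \<oplus> v"
      using Suc.prems unfolding F.pw_Suc by blast
    let ?k = "a \<otimes> inv b" and ?d = "N - e"
    have d: "e + ?d = N" using False by simp
    have k: "?k \<in> frac A" using a F_inv[OF w(3,4)] by simp
    have car: "a \<in> carrier R" "b \<in> carrier R" "inv b \<in> carrier R" "v \<in> carrier R" "w \<in> carrier R"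
      "x [^] e \<in> carrier R" "x [^] ?d \<in> carrier R" "?k \<in> carrier R"
      using a w k F_inv[OF w(3,4)] by auto
    let ?q = "?k \<otimes> x [^] ?d"
    have q: "?q \<in> adj (frac A) x" by (rule F.adjI[OF F.pw_pow[OF lessI k]])
    have kb: "?k \<otimes> b = a" using car w(4) by (simp add: m_assoc)
    have xN: "x [^] e \<otimes> x [^] ?d = x [^] N" using d by (simp add: nat_pow_mult)
    have "?q \<otimes> g = (?k \<otimes> b) \<otimes> (x [^] e \<otimes> x [^] ?d) \<oplus> ?k \<otimes> (w \<otimes> x [^] ?d)"
    proof -
      have "\<And>k p. k \<in> carrier R \<Longrightarrow> p \<in> carrier R \<Longrightarrow> (k \<otimes> p) \<otimes> (b \<otimes> x [^] e \<oplus> w) = (k \<otimes> b) \<otimes> (x [^] e \<otimes> p) \<oplus> k \<otimes> (w \<otimes> p)"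
        using car(2,5,6) by algebra
      then show ?thesis using car w(2) by simp
    qed
    then have gq: "?q \<otimes> g = a \<otimes> x [^] N \<oplus> ?k \<otimes> (w \<otimes> x [^] ?d)" using kb xN by simp
    have eq: "f \<ominus> ?q \<otimes> g = v \<ominus> ?k \<otimes> (w \<otimes> x [^] ?d)"
    proof -
      have "(s \<oplus> v) \<ominus> (s \<oplus> t) = v \<ominus> t" if st: "s \<in> carrier R" "t \<in> carrier R" for s t
      proof -
        have "(s \<oplus> v) \<ominus> (s \<oplus> t) = (v \<oplus> s) \<oplus> (\<ominus> s \<oplus> \<ominus> t)"
          using st car(4) by (simp add: minus_eq minus_add a_comm[of s v])
        also have "\<dots> = v \<ominus> t" using st car(4) by (simp add: minus_eq a_assoc r_neg2)
        finally show ?thesis .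
      qed
      then show ?thesis unfolding gq a(3) using car by simp
    qed
    have "w \<otimes> x [^] ?d \<in> pw (frac A) x N" using F.pw_mult_pow[OF w(1), of ?d] d by simp
    then have "f \<ominus> ?q \<otimes> g \<in> pw (frac A) x N" unfolding eq using a k by simp
    then obtain q' where q': "q' \<in> adj (frac A) x" "(f \<ominus> ?q \<otimes> g) \<ominus> q' \<otimes> g \<in> pw (frac A) x e"
      using Suc.IH by blast
    have sF: "subring (adj (frac A) x) R" by (rule F.subring_adj)
    have "q' \<in> carrier R" "?q \<in> carrier R" "f \<in> carrier R" "g \<in> carrier R"
      using q q' subringE(1)[OF sF] a w car by auto
    then have "(f \<ominus> ?q \<otimes> g) \<ominus> q' \<otimes> g = f \<ominus> (?q \<oplus> q') \<otimes> g"
      by (simp add: minus_eq l_distr minus_add a_assoc)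
    then show ?thesis using q q' subringE(7)[OF sF] by metis
  qed
qed
qed

text \<open>Polynomials over a field: after division, a denominator of large degree would contradict that
  all the multiples \<open>c u ^ n\<close> have nonnegative degree.\<close>

lemma cic_field_case:
  assumes u: "u \<in> carrier R" and g: "g \<in> adj (frac A) x" "g \<noteq> \<zero>" "g \<otimes> u \<in> adj (frac A) x"
    and c: "c \<in> adj (frac A) x" "c \<noteq> \<zero>" "\<And>n::nat. c \<otimes> u [^] n \<in> adj (frac A) x"
  shows "u \<in> adj (frac A) x"
proof -
  let ?P = "adj (frac A) x"
  have sP: "subring ?P R" by (rule F.subring_adj)
  note Pc = subringE(1)[OF sP, THEN subsetD]
  obtain N where "g \<in> pw (frac A) x N" using g(1) by (rule F.adjE)
  then obtain e b where gl: "F.lead e b g" using F.lead_exists g(2) by metis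
  obtain N' where "g \<otimes> u \<in> pw (frac A) x N'" using g(3) by (rule F.adjE)
  then obtain q where q: "q \<in> ?P" "g \<otimes> u \<ominus> q \<otimes> g \<in> pw (frac A) x e" using division[OF gl] by blast
  \<comment> \<open>Division by \<open>g\<close> leaves the proper fraction \<open>?v\<close>, the
    quotient of \<open>?r\<close> by \<open>g\<close>. It differs from \<open>u\<close> by a
    polynomial, so \<open>c\<close> is still a denominator of all its powers.\<close>
  let ?v = "u \<ominus> q" and ?r = "g \<otimes> u \<ominus> q \<otimes> g"
  have car: "q \<in> carrier R" "g \<in> carrier R" "c \<in> carrier R" "?v \<in> carrier R" using q g c u Pc by auto
  have cv: "c \<otimes> ?v [^] n \<in> ?P" for n :: nat by (rule aint_shift[OF sP u q(1) car(3) c(3)])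
  have r: "?r = g \<otimes> ?v" using car u by algebra
  have "?r = \<zero>"
  proof (rule ccontr)
    assume r0: "?r \<noteq> \<zero>"
    obtain d \<rho> where d: "d < e" "F.lead d \<rho> ?r" using F.lead_exists[OF q(2) r0] .
    obtain N'' where "c \<in> pw (frac A) x N''" using c(1) by (rule F.adjE)
    then obtain k \<gamma> where cl: "F.lead k \<gamma> c" using F.lead_exists c(2) by metis
    \<comment> \<open>Comparing degrees will give \<open>k + n * d = n * e + j\<close> with
      \<open>d < e\<close>, hence \<open>n \<le> k\<close>. The choice \<open>Suc k\<close> refutes
      this.\<close>
    define n where "n = Suc k"
    have v0: "?v \<noteq> \<zero>" using r r0 car by auto
    have y0: "c \<otimes> ?v [^] n \<noteq> \<zero>"
      using c(2) car(3,4) v0 nat_pow_nonzero by (simp add: integral_iff)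
    obtain M where "c \<otimes> ?v [^] n \<in> pw (frac A) x M" using cv by (rule F.adjE)
    then obtain j \<eta> where yl: "F.lead j \<eta> (c \<otimes> ?v [^] n)" using F.lead_exists y0 by metis
    have "c \<otimes> ?r [^] n = g [^] n \<otimes> (c \<otimes> ?v [^] n)"
      unfolding r using car by (simp add: nat_pow_distrib m_lcomm)
    then have "k + n * d = n * e + j"
      using F.lead_unique[OF F_trans] lead_mult[OF cl lead_pow[OF d(2), of n]] lead_mult[OF lead_pow[OF gl, of n] yl]
      by metis
    moreover have "n * d + n \<le> n * e" using d(1) by (metis Suc_leI add.commute mult_Suc_right mult_le_mono2)
    ultimately show False by (simp add: n_def)
  qed
  then have "?v = \<zero>" using r car g(2) integral by metis
  then show ?thesis using q(1) car u by simp
qed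

text \<open>Over the fractions of \<open>A\<close> the element \<open>u\<close> is a polynomial by
  \<open>cic_field_case\<close>. Its leading coefficient \<open>l\<close> has bounded denominators,
  because \<open>\<gamma> \<otimes> l [^] n\<close> is the leading coefficient of
  \<open>c \<otimes> u [^] n\<close>; so \<open>l\<close> lies in \<open>A\<close>. Subtracting the
  leading term lowers the degree and keeps the denominator \<open>c\<close>.\<close>

theorem cic_adj:
  assumes "cic A"
  shows "cic (adj A x)"
  unfolding cic_def
proof (intro ballI impI)
  let ?P = "adj A x" and ?PF = "adj (frac A) x"
  have sP: "subring ?P R" by (rule A.subring_adj)
  note Pc = subringE(1)[OF sP, THEN subsetD]
  have PF: "?P \<subseteq> ?PF" unfolding adj_def using pw_A_F by blast
  fix u c assume u: "u \<in> frac ?P" and c: "c \<in> ?P" "c \<noteq> \<zero>" "\<forall>n::nat. c \<otimes> u [^] n \<in> ?P"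
  obtain f g where fg: "g \<in> ?P" "g \<noteq> \<zero>" "g \<otimes> u \<in> ?P" "u \<in> carrier R"
    using fracE[OF u] subringE(1)[OF sP] by metis
  have "u \<in> ?PF" by (rule cic_field_case[OF fg(4) _ fg(2) _ _ c(2)]) (use fg c PF in auto)
  then obtain N where uN: "u \<in> pw (frac A) x N" by (rule F.adjE)
  obtain M where "c \<in> pw A x M" using c(1) by (rule A.adjE)
  then obtain k \<gamma> where cl: "A.lead k \<gamma> c" using A.lead_exists c(2) by metis
  have cc: "c \<in> carrier R" using Pc c(1) by blast
  have "u \<in> pw (frac A) x N \<Longrightarrow> (\<forall>n::nat. c \<otimes> u [^] n \<in> ?P) \<Longrightarrow> u \<in> ?P" for u N
  proof (induction N arbitrary: u rule: less_induct)
    case (less N)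
    show ?case
    proof (cases "u = \<zero>")
      case True
      then show ?thesis using subringE(2)[OF sP] by simp
    next
      case False
      obtain d l where d: "d < N" "F.lead d l u" using F.lead_exists[OF less.prems(1) False] .
      have uc: "u \<in> carrier R" using less.prems(1) by simp
      obtain w where w: "l \<in> frac A" "w \<in> pw (frac A) x d" "u = l \<otimes> x [^] d \<oplus> w"
        using d(2) unfolding F.lead_def by blast
      have "\<gamma> \<otimes> l [^] n \<in> A" for n :: nat
      proof -
        have y: "c \<otimes> u [^] n \<in> ?P" "c \<otimes> u [^] n \<noteq> \<zero>"
          using less.prems(2) c(2) cc uc False nat_pow_nonzero by (auto simp: integral_iff)
        obtain M where "c \<otimes> u [^] n \<in> pw A x M" using y(1) by (rule A.adjE)
        then obtain j \<alpha> where j: "A.lead j \<alpha> (c \<otimes> u [^] n)" using A.lead_exists y(2) by metis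
        have "F.lead (k + n * d) (\<gamma> \<otimes> l [^] n) (c \<otimes> u [^] n)"
          by (rule lead_mult[OF lead_A_F[OF cl] lead_pow[OF d(2)]])
        then have "\<gamma> \<otimes> l [^] n = \<alpha>" using F.lead_unique[OF F_trans _ lead_A_F[OF j]] by blast
        then show ?thesis using j unfolding A.lead_def by simp
      qed
      moreover have "\<gamma> \<in> A" "\<gamma> \<noteq> \<zero>" using cl unfolding A.lead_def by auto
      ultimately have lA: "l \<in> A" using assms w(1) unfolding cic_def by blast
      let ?a = "l \<otimes> x [^] d"
      have aP: "?a \<in> ?P" by (rule A.adjI[OF A.pw_pow[OF lessI lA]])
      have ac: "?a \<in> carrier R" using Pc aP by blast
      have wc: "w \<in> carrier R" using w(2) by simp
      have uw: "u \<ominus> ?a = w"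
      proof -
        have "u \<ominus> ?a = (w \<oplus> ?a) \<ominus> ?a" using w(3) ac wc by (simp add: a_comm)
        also have "\<dots> = w" using ac wc by (simp add: minus_eq a_assoc r_neg)
        finally show ?thesis .
      qed
      have "\<forall>n::nat. c \<otimes> (u \<ominus> ?a) [^] n \<in> ?P"
        using aint_shift[OF sP uc aP cc] less.prems(2) by blast
      then have "w \<in> ?P" using less.IH[OF d(1) w(2)] uw by simp
      then show ?thesis using w(3) aP subringE(7)[OF sP] by simp
    qed
  qed
  then show "u \<in> ?P" using uN c(3) by blast
qed

end

context affine_field
begin

lemma frac_K: "frac K = K"
  using frac_min[OF subring_K subfield_K] frac_incl[OF subring_K] by auto

lemma cic_K: "cic K"
  unfolding cic_def frac_K by blast

theorem cic_gen:
  assumes "finite Y" "ai Y" shows "cic (gen Y)"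
  using assms
proof (induction Y)
  case empty
  then show ?case using cic_K gen_empty by simp
next
  case (insert y Y)
  have c: "y \<in> carrier R" "Y \<subseteq> carrier R" using ai_carrier[OF insert.prems] by auto
  have ai: "ai Y" "trans_over (gen Y) y"
    using insert.prems alg_indep_insert[OF insert.hyps(2) c] by auto
  interpret field_trans R "gen Y" y
    by (intro field_trans.intro field_axioms field_trans_axioms.intro subring_gen c ai(2))
  show ?case unfolding gen_insert[OF c(2,1)] by (rule cic_adj[OF insert.IH[OF ai(1)]])
qed

end

text \<open>Induction on the generators. If some nonzero multiple of \<open>w\<close> lies in
  \<open>V\<close> plus the span of the others, \<open>w\<close> is eliminated at the cost of one
  more factor. Otherwise an element with a multiple in \<open>V\<close> has coefficient zero at
  \<open>w\<close>. So finite generation alone gives one denominator for all such elements.\<close>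

lemma (in domain) denominators_bounded:
  assumes A: "subring A R" and ws: "set ws \<subseteq> carrier R"
    and V: "V \<subseteq> carrier R" "\<zero> \<in> V" "\<And>u v. u \<in> V \<Longrightarrow> v \<in> V \<Longrightarrow> u \<oplus> v \<in> V" "\<And>a v. a \<in> A \<Longrightarrow> v \<in> V \<Longrightarrow> a \<otimes> v \<in> V"
  shows "\<exists>c\<in>A. c \<noteq> \<zero> \<and> (\<forall>v\<in>msp A ws. (\<exists>d\<in>A. d \<noteq> \<zero> \<and> d \<otimes> v \<in> V) \<longrightarrow> c \<otimes> v \<in> V)"
  using ws
proof (induction ws)
  case Nil
  then show ?case using subringE(3)[OF A] V(2) by (intro bexI[of _ \<one>]) auto
next
  interpret A: subring_in R A by (rule subring_inI[OF A])
  note Ac = A.A_carrier[THEN subsetD]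
  note cl = A.A_closed
  have Vm: "u \<ominus> v \<in> V" if "u \<in> V" "v \<in> V" for u v
  proof -
    have "\<ominus> v = (\<ominus> \<one>) \<otimes> v" using that V(1) by (auto simp: l_minus)
    moreover have "\<ominus> \<one> \<in> A" using cl by blast
    ultimately show ?thesis using V(3)[OF that(1)] V(4) that(2) by (simp add: minus_eq)
  qed
  case (Cons w ws)
  then obtain c where c: "c \<in> A" "c \<noteq> \<zero>"
    and cV: "\<And>v. v \<in> msp A ws \<Longrightarrow> (\<exists>d\<in>A. d \<noteq> \<zero> \<and> d \<otimes> v \<in> V) \<Longrightarrow> c \<otimes> v \<in> V" by auto
  have wsc: "set ws \<subseteq> carrier R" and wc: "w \<in> carrier R" using Cons.prems by auto
  note mc = A.msp_carrier[OF wsc, THEN subsetD]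
  show ?case
  proof (cases "\<exists>d\<in>A. d \<noteq> \<zero> \<and> (\<exists>v0\<in>V. \<exists>w0\<in>msp A ws. d \<otimes> w = v0 \<oplus> w0)")
    case True
    then obtain d v0 w0 where d: "d \<in> A" "d \<noteq> \<zero>" "v0 \<in> V" "w0 \<in> msp A ws" "d \<otimes> w = v0 \<oplus> w0" by blast
    have "c \<otimes> d \<otimes> v \<in> V" if v: "v \<in> msp A (w # ws)" "\<exists>e\<in>A. e \<noteq> \<zero> \<and> e \<otimes> v \<in> V" for v
    proof -
      obtain e where e: "e \<in> A" "e \<noteq> \<zero>" "e \<otimes> v \<in> V" using v(2) by blast
      obtain a w' where a: "a \<in> A" "w' \<in> msp A ws" "v = a \<otimes> w \<oplus> w'" using v(1) by auto
      have car: "a \<in> carrier R" "w' \<in> carrier R" "d \<in> carrier R" "e \<in> carrier R" "c \<in> carrier R" "v0 \<in> carrier R" "w0 \<in> carrier R"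
        using a d e c Ac mc V(1) by auto
      \<comment> \<open>What remains of \<open>d \<otimes> v\<close> modulo \<open>V\<close> after
        \<open>d \<otimes> w\<close> has been replaced by \<open>v0 \<oplus> w0\<close>; it lies in
        the span of the shorter list.\<close>
      let ?y = "a \<otimes> w0 \<oplus> d \<otimes> w'"
      have y: "?y \<in> msp A ws" using A.msp_add[OF wsc] A.msp_smult[OF wsc] a d by auto
      have dv: "d \<otimes> v = a \<otimes> v0 \<oplus> ?y"
      proof -
        have "d \<otimes> v = a \<otimes> (d \<otimes> w) \<oplus> d \<otimes> w'" unfolding a(3) using car wc by algebra
        also have "\<dots> = a \<otimes> v0 \<oplus> ?y" unfolding d(5) using car by algebra
        finally show ?thesis .
      qed
      have yc: "?y \<in> carrier R" using car by simp
      have "e \<otimes> ?y = d \<otimes> (e \<otimes> v) \<ominus> (e \<otimes> a) \<otimes> v0"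
      proof -
        have vc: "v \<in> carrier R" using a(3) car wc by simp
        have "d \<otimes> (e \<otimes> v) = e \<otimes> (d \<otimes> v)" using car vc by algebra
        also have "\<dots> = e \<otimes> ?y \<oplus> (e \<otimes> a) \<otimes> v0" unfolding dv using yc car by (simp add: r_distr m_assoc a_comm)
        finally show ?thesis using yc car by (simp add: minus_eq a_assoc r_neg)
      qed
      moreover have "d \<otimes> (e \<otimes> v) \<in> V" "(e \<otimes> a) \<otimes> v0 \<in> V" using V(4) d e a cl by auto
      ultimately have "e \<otimes> ?y \<in> V" using Vm by simp
      then have "c \<otimes> ?y \<in> V" using cV[OF y] e by blast
      moreover have "c \<otimes> d \<otimes> v = (c \<otimes> a) \<otimes> v0 \<oplus> c \<otimes> ?y"
      proof -
        have "c \<otimes> d \<otimes> v = c \<otimes> (d \<otimes> v)" using car wc a(3) by (simp add: m_assoc)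
        then show ?thesis unfolding dv using yc car by (simp add: r_distr m_assoc)
      qed
      ultimately show ?thesis using V(3) V(4)[of "c \<otimes> a" v0] c a d cl by simp
    qed
    moreover have "c \<otimes> d \<in> A" "c \<otimes> d \<noteq> \<zero>" using c d cl Ac by (auto simp: integral_iff)
    ultimately show ?thesis by blast
  next
    case False
    have "c \<otimes> v \<in> V" if v: "v \<in> msp A (w # ws)" "\<exists>e\<in>A. e \<noteq> \<zero> \<and> e \<otimes> v \<in> V" for v
    proof -
      obtain e where e: "e \<in> A" "e \<noteq> \<zero>" "e \<otimes> v \<in> V" using v(2) by blast
      obtain a w' where a: "a \<in> A" "w' \<in> msp A ws" "v = a \<otimes> w \<oplus> w'" using v(1) by auto
      have car: "a \<in> carrier R" "w' \<in> carrier R" "e \<in> carrier R" using a e Ac mc by auto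
      have "a = \<zero>"
      proof (rule ccontr)
        assume "a \<noteq> \<zero>"
        then have "e \<otimes> a \<noteq> \<zero>" "e \<otimes> a \<in> A" using e car a cl by (auto simp: integral_iff)
        moreover have "(e \<otimes> a) \<otimes> w = e \<otimes> v \<oplus> (\<ominus> e) \<otimes> w'"
        proof -
          have "e \<otimes> v \<oplus> (\<ominus> e) \<otimes> w' = (e \<otimes> a) \<otimes> w \<oplus> (e \<otimes> w' \<oplus> \<ominus> (e \<otimes> w'))"
            unfolding a(3) using car wc by (simp add: r_distr l_minus m_assoc a_assoc)
          then show ?thesis using car wc by (simp add: r_neg)
        qed
        moreover have "(\<ominus> e) \<otimes> w' \<in> msp A ws" using A.msp_smult[OF wsc a(2)] e cl by auto
        ultimately show False using False e(3) by blast
      qed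
      then have "v = w'" using a(3) wc car by simp
      then show ?thesis using cV[OF a(2)] e by blast
    qed
    then show ?thesis using c by blast
  qed
qed

section \<open>Minimal polynomials over completely integrally closed subrings\<close>

lemma (in field) monic_splitted_coeffs:
  assumes B: "subring B R"
  shows "p \<in> carrier (poly_ring R) \<Longrightarrow> splitted p \<Longrightarrow> p \<noteq> [] \<Longrightarrow> lead_coeff p = \<one> \<Longrightarrow>
    (\<And>r. r \<in> carrier R \<Longrightarrow> eval p r = \<zero> \<Longrightarrow> r \<in> B) \<Longrightarrow> set p \<subseteq> B"
proof (induction "degree p" arbitrary: p rule: less_induct)
  case less
  interpret UP: domain "poly_ring R" by (rule univ_poly_is_domain[OF carrier_is_subring])
  interpret BP: ring "B[X]" by (rule univ_poly_is_ring[OF B])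
  show ?case
  proof (cases "degree p = 0")
    case True
    then have "p = [lead_coeff p]" using less.prems(3) by (cases p) auto
    then show ?thesis using less.prems(4) subringE(3)[OF B] by (metis empty_set insert_subset list.simps(15) subsetI empty_iff)
  next
    case False
    \<comment> \<open>Vieta by induction: a linear factor with root in \<open>B\<close> is split
      off, and the cofactor is again monic and split, with roots among those of
      \<open>p\<close>.\<close>
    then have "roots p \<noteq> {#}" using less.prems(2) unfolding splitted_def by auto
    then obtain a where a: "a \<in> carrier R" "a \<in># roots p" "[\<one>, \<ominus> a] \<in> carrier (poly_ring R)" "[\<one>, \<ominus> a] pdivides p"
      using less.prems(1) by blast
    then obtain q where q: "q \<in> carrier (poly_ring R)" "p = [\<one>, \<ominus> a] \<otimes>\<^bsub>poly_ring R\<^esub> q"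
      unfolding pdivides_def factor_def by blast
    have q0: "q \<noteq> []"
    proof
      assume "q = []"
      then have "p = \<zero>\<^bsub>poly_ring R\<^esub>" using q a(3) by (simp add: univ_poly_zero[symmetric, of R "carrier R"])
      then show False using less.prems(3) by (simp add: univ_poly_zero)
    qed
    have pq: "polynomial (carrier R) [\<one>, \<ominus> a]" "polynomial (carrier R) q"
      using a(3) q(1) by (auto simp: univ_poly_carrier)
    have p_eq: "p = poly_mult [\<one>, \<ominus> a] q" using q(2) by (simp add: univ_poly_mult)
    have deg: "degree p = Suc (degree q)"
      using poly_mult_degree_eq[OF carrier_is_subring pq] q0 p_eq by simp
    have lc: "lead_coeff q = \<one>"
    proof -
      have "lead_coeff p = lead_coeff [\<one>, \<ominus> a] \<otimes> lead_coeff q"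
        unfolding p_eq by (rule poly_mult_lead_coeff[OF carrier_is_subring pq]) (use q0 in auto)
      moreover have "lead_coeff q \<in> carrier R" using q(1) q0 by (cases q) (auto simp: univ_poly_def polynomial_def)
      ultimately show ?thesis using less.prems(4) by simp
    qed
    have "roots p = add_mset a (roots q)"
      using poly_mult_degree_one_monic_imp_same_roots[OF a(1) q(1) q0] q(2) by simp
    then have sq: "splitted q" using less.prems(2) deg unfolding splitted_def by simp
    have qp: "q pdivides p"
      unfolding pdivides_def using q a(3) UP.m_comm by (intro dividesI) auto
    have "set q \<subseteq> B"
    proof (rule less.hyps[OF _ q(1) sq q0 lc])
      show "degree q < degree p" using deg by simp
      show "r \<in> B" if "r \<in> carrier R" "eval q r = \<zero>" for r
        using less.prems(5)[OF that(1)] pdivides_imp_root_sharing[OF q(1) qp that] by blast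
    qed
    then have "q \<in> carrier (B[X])" using q(1) by (auto simp: univ_poly_def polynomial_def)
    moreover have "a \<in> B"
      using less.prems(5)[OF a(1)] a(2) roots_mem_iff_is_root[OF less.prems(1)] by (simp add: is_root_def)
    then have "[\<one>, \<ominus> a] \<in> carrier (B[X])"
      using subringE(3,5)[OF B] by (auto simp: univ_poly_def polynomial_def)
    ultimately have "[\<one>, \<ominus> a] \<otimes>\<^bsub>B[X]\<^esub> q \<in> carrier (B[X])" by blast
    then have "p \<in> carrier (B[X])" unfolding p_eq by (simp add: univ_poly_mult)
    then show ?thesis by (auto simp: univ_poly_def polynomial_def)
  qed
qed

lemma (in subring_in) msp_prod:
  assumes "set vs \<subseteq> carrier R" "set ws \<subseteq> carrier R" "x \<in> msp A vs" "y \<in> msp A ws"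
  shows "x \<otimes> y \<in> msp A (concat (map (\<lambda>w. map (\<lambda>v. v \<otimes> w) vs) ws))"
proof -
  \<comment> \<open>This set is in general no subring, but \<open>msp_trans\<close> only asks that
    the coefficients lie in a span.\<close>
  let ?B = "(\<lambda>a. a \<otimes> x) ` A"
  have xc: "x \<in> carrier R" using msp_carrier[OF assms(1)] assms(3) by auto
  have "?B \<subseteq> msp A vs" using msp_smult[OF assms(1,3)] by auto
  moreover have "x \<otimes> y \<in> msp ?B ws"
    using assms(2,4)
  proof (induction ws arbitrary: y)
    case (Cons w ws)
    then obtain a v where a: "a \<in> A" "v \<in> msp A ws" "y = a \<otimes> w \<oplus> v" by auto
    have "a \<in> carrier R" "v \<in> carrier R" "w \<in> carrier R"
      using a Cons.prems A_carrier msp_carrier[of ws] by auto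
    then have "x \<otimes> y = (a \<otimes> x) \<otimes> w \<oplus> x \<otimes> v" unfolding a(3) using xc by algebra
    moreover have "x \<otimes> v \<in> msp ?B ws" using Cons a by auto
    ultimately show ?case using a(1) by auto
  qed (use xc in auto)
  ultimately show ?thesis using msp_trans[OF _ assms(1,2), of ?B] by blast
qed

lemma (in cring) pe_single:
  assumes "d \<in> carrier R" "x \<in> carrier R" "n < m"
  shows "pe (\<lambda>i. if i = n then d else \<zero>) m x = d \<otimes> x [^] n"
proof -
  have "pe (\<lambda>i. if i = n then d else \<zero>) m x = pe (\<lambda>i. if i = n then d else \<zero>) (Suc n) x"
    using assms by (intro pe_pad) auto
  moreover have "pe (\<lambda>i. if i = n then d else \<zero>) n x = pe (\<lambda>_. \<zero>) n x" by (rule pe_cong) auto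
  ultimately show ?thesis using assms by (simp add: pe_zero)
qed

text \<open>The coefficients of the minimal polynomial over the fractions of \<open>A\<close> are
  polynomial expressions in its roots. Relations of \<open>s\<close> hold for every root, so the
  uniform denominator for the powers of \<open>s\<close> serves the powers of each root, and a
  product of such denominators serves the ring of all roots. The coefficients are thus almost
  integral and lie in \<open>A\<close>. The last clause of the conclusion records that the degree is
  minimal.\<close>

lemma (in field) min_poly_cic:
  assumes ac: "algebraically_closed R" and A: "subring A R" "cic A"
    and T: "subring T R" "fin_over A T" "s \<in> T" and alg: "\<not> trans_over A s"
  shows "\<exists>e a. (\<forall>i<e. a i \<in> A) \<and> s [^] e = pe a e s \<and>
    (\<forall>c. (\<forall>i<e. c i \<in> A) \<longrightarrow> pe c e s = \<zero> \<longrightarrow> (\<forall>i<e. c i = \<zero>))"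
proof -
  interpret A: subring_in R A by (rule subring_inI[OF A(1)])
  note Ac = A.A_carrier[THEN subsetD]
  let ?F = "frac A"
  have F: "subfield ?F R" by (rule subfield_frac[OF A(1)])
  have Fr: "subring ?F R" by (rule subfieldE(1)[OF F])
  have AF: "A \<subseteq> ?F" by (rule frac_incl[OF A(1)])
  have sc: "s \<in> carrier R" using T subringE(1) by blast
  have algF: "(algebraic over ?F) s"
    using alg trans_over_frac[OF A(1) sc] trans_over_iff[OF Fr sc] by (simp add: over_def)
  define f where "f = Irr ?F s"
  note f = IrrE[OF F sc algF, folded f_def]
  have f0: "f \<noteq> []"
    using f(2) univ_poly_zero[of R ?F] by (auto simp: ring_irreducible_def)
  define e where "e = degree f"
  have len: "length f = Suc e" using f0 by (simp add: e_def)
  have setf: "set f \<subseteq> ?F" using f(1) by (auto simp: univ_poly_def polynomial_def)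
  have fP: "f \<in> carrier (poly_ring R)" by (rule carrier_polynomial_shell[OF Fr f(1)])
  have coF: "coeff f i \<in> ?F" if "i \<le> e" for i
    using coeff_img_restrict[of f] setf that len by (metis imageI le_imp_less_Suc lessThan_iff subsetD)
  have coe: "coeff f e = \<one>" using lead_coeff_simp[OF f0] f(3) by (simp add: e_def)
  have evalf: "eval f x = x [^] e \<oplus> pe (coeff f) e x" if "x \<in> carrier R" for x
  proof -
    have "eval f x = eval (map (coeff f) (rev [0..<Suc e])) x" using coeff_list[of f] len by simp
    also have "\<dots> = pe (coeff f) (Suc e) x" by (rule eval_map_pe)
    finally show ?thesis using coe that by simp
  qed

  have list: "normalize (map h (rev [0..<m])) \<in> carrier (?F[X])"
    "eval (normalize (map h (rev [0..<m]))) x = pe h m x"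
    if "\<And>i. i < m \<Longrightarrow> h i \<in> ?F" "x \<in> carrier R" for h m x
  proof -
    have q: "set (map h (rev [0..<m])) \<subseteq> ?F" using that(1) by auto
    show "normalize (map h (rev [0..<m])) \<in> carrier (?F[X])"
      using normalize_gives_polynomial[OF q] by (simp add: univ_poly_def)
    show "eval (normalize (map h (rev [0..<m]))) x = pe h m x"
      using eval_normalize[of "map h (rev [0..<m])" x] q subringE(1)[OF Fr] that(2)
      by (simp add: eval_map_pe subset_iff)
  qed
  \<comment> \<open>Conjugates satisfy the same relations over the fractions of \<open>A\<close>,
    since \<open>f\<close> divides the polynomial with coefficients \<open>h\<close>.\<close>
  have transfer: "pe h m r = \<zero>"
    if h: "\<And>i. i < m \<Longrightarrow> h i \<in> ?F" "pe h m s = \<zero>" and r: "r \<in> carrier R" "eval f r = \<zero>" for h m r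
  proof -
    let ?q = "normalize (map h (rev [0..<m]))"
    have "f pdivides ?q"
      unfolding f_def using list[OF h(1) sc] h(2) by (intro Irr_minimal[OF F sc algF]) auto
    then have "eval ?q r = \<zero>" by (rule pdivides_imp_root_sharing[OF fP _ r])
    then show ?thesis using list(2)[OF h(1) r(1)] by simp
  qed
  have indep: "c i = \<zero>" if c: "\<And>i. i < e \<Longrightarrow> c i \<in> ?F" "pe c e s = \<zero>" "i < e" for c i
  proof (rule ccontr)
    assume ci: "c i \<noteq> \<zero>"
    let ?l = "map c (rev [0..<e])"
    let ?q = "normalize ?l"
    have q0: "?q \<noteq> []"
    proof
      assume "?q = []"
      then have "coeff ?l = coeff []" using normalize_coeff[of ?l] by simp
      moreover have "coeff ?l i = c i" using c(3) coeff_nth[of i ?l] by (simp add: rev_nth)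
      ultimately show False using ci by simp
    qed
    have "f pdivides ?q"
      unfolding f_def using list[OF c(1) sc] c(2) by (intro Irr_minimal[OF F sc algF]) auto
    moreover have "?q \<in> carrier (?F[X])" by (rule list(1)[OF _ sc]) (rule c(1))
    ultimately have "degree f \<le> degree ?q"
      using pdivides_imp_degree_le[OF Fr f(1) _ q0] by blast
    moreover have "length ?q \<le> e" using normalize_length_le[of ?l] by simp
    ultimately show False using q0 c(3) len by (cases ?q) auto
  qed

  interpret sF: cring_sub R ?F s by (rule pw_cring_sub[OF Fr sc])
  interpret sA: cring_sub R A s by (rule pw_cring_sub[OF A(1) sc])
  have "s [^] e \<in> pw ?F s e"
  proof -
    have "pe (coeff f) e s \<in> pw ?F s e" using coF by (intro sF.pwI) auto
    moreover have "s [^] e = \<ominus> pe (coeff f) e s"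
    proof -
      have "s [^] e \<oplus> pe (coeff f) e s = \<zero>" using evalf[OF sc] f(4) by simp
      then show ?thesis using sc coF by (intro minus_equality[symmetric]) auto
    qed
    ultimately show ?thesis by simp
  qed
  then have "adj ?F s \<subseteq> pw ?F s e" by (rule sF.adj_monic)
  moreover have "s [^] n \<in> adj ?F s" for n :: nat
    using sF.adjI[OF sF.pw_pow[OF lessI sF.A_closed(2), of n]] sc by simp
  ultimately have pwF: "s [^] n \<in> pw ?F s e" for n :: nat by blast
  obtain ws where ws: "set ws \<subseteq> carrier R" "T \<subseteq> msp A ws" using T(2) unfolding fin_over_def by blast
  have sT: "s [^] n \<in> T" for n :: nat
    using T(3) subringE(3,6)[OF T(1)] by (induction n) auto
  \<comment> \<open>All powers of \<open>s\<close> lie in the finite module containing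
    \<open>T\<close>, and each has some multiple in the span of the first \<open>e\<close> powers; a
    single denominator therefore serves them all.\<close>
  have "\<exists>c\<in>A. c \<noteq> \<zero> \<and> (\<forall>v\<in>msp A ws. (\<exists>d\<in>A. d \<noteq> \<zero> \<and> d \<otimes> v \<in> pw A s e) \<longrightarrow> c \<otimes> v \<in> pw A s e)"
    by (rule denominators_bounded[OF A(1) ws(1)]) auto
  then obtain d where d: "d \<in> A" "d \<noteq> \<zero>"
    and dV: "\<And>v. v \<in> msp A ws \<Longrightarrow> (\<exists>d\<in>A. d \<noteq> \<zero> \<and> d \<otimes> v \<in> pw A s e) \<Longrightarrow> d \<otimes> v \<in> pw A s e" by blast
  have ds: "d \<otimes> s [^] n \<in> pw A s e" for n :: nat
  proof (rule dV)
    show "s [^] n \<in> msp A ws" using sT ws(2) by blast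
    obtain c where c: "\<And>i. i < e \<Longrightarrow> c i \<in> ?F" "s [^] n = pe c e s" using pwF[of n] unfolding pw_def by auto
    obtain b where b: "b \<in> A" "b \<noteq> \<zero>" "\<forall>i<e. b \<otimes> c i \<in> A" using common_denominator[OF A(1), of e c] c(1) by blast
    have "b \<otimes> s [^] n = pe (\<lambda>i. b \<otimes> c i) e s"
      unfolding c(2) using c(1) b(1) sc Ac by (intro pe_smult[symmetric]) auto
    then have "b \<otimes> s [^] n \<in> pw A s e" using b(3) sA.pwI[of e "\<lambda>i. b \<otimes> c i"] by simp
    then show "\<exists>d\<in>A. d \<noteq> \<zero> \<and> d \<otimes> s [^] n \<in> pw A s e" using b by blast
  qed
  have dr: "d \<otimes> r [^] n \<in> pw A r e" if r: "r \<in> carrier R" "eval f r = \<zero>" for r and n :: nat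
  proof -
    interpret rA: cring_sub R A r by (rule pw_cring_sub[OF A(1) r(1)])
    obtain c where c: "\<And>i. i < e \<Longrightarrow> c i \<in> A" "d \<otimes> s [^] n = pe c e s"
      using ds[of n] unfolding pw_def by auto
    \<comment> \<open>The relation between the \<open>n\<close>-th power and the first
      \<open>e\<close> powers as one coefficient function; this length has room for both parts,
      whichever is longer.\<close>
    let ?m = "Suc (n + e)"
    let ?g = "\<lambda>i. if i = n then d else \<zero>" and ?c = "\<lambda>i. if i < e then c i else \<zero>"
    let ?h = "\<lambda>i. ?g i \<oplus> \<ominus> ?c i"
    have dc: "d \<in> carrier R" using d Ac by blast
    have hx: "pe ?h ?m x = d \<otimes> x [^] n \<oplus> \<ominus> pe c e x" if x: "x \<in> carrier R" for x
    proof -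
      have cc: "?c i \<in> carrier R" for i using c(1) Ac by auto
      have "pe ?h ?m x = pe ?g ?m x \<oplus> pe (\<lambda>i. \<ominus> ?c i) ?m x"
        by (rule pe_add) (use cc dc x in auto)
      moreover have "pe ?g ?m x = d \<otimes> x [^] n" using dc x by (intro pe_single) auto
      moreover have "pe (\<lambda>i. \<ominus> ?c i) ?m x = \<ominus> pe ?c ?m x" using pe_uminus[of ?m ?c x] cc x by blast
      moreover have "pe ?c ?m x = pe ?c e x" by (rule pe_pad) (use cc x c(1) Ac in auto)
      moreover have "pe ?c e x = pe c e x" by (rule pe_cong) auto
      ultimately show ?thesis by simp
    qed
    have "pe ?h ?m r = \<zero>"
    proof (rule transfer[OF _ _ r])
      show "?h i \<in> ?F" for i using d(1) c(1) AF sF.A_closed(1,3,5) by (auto simp: subset_eq)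
      show "pe ?h ?m s = \<zero>" unfolding hx[OF sc] c(2) using c(1) sc by (simp add: r_neg)
    qed
    then have z: "d \<otimes> r [^] n \<oplus> \<ominus> pe c e r = \<zero>" using hx[OF r(1)] by simp
    have pc: "pe c e r \<in> carrier R" using c(1) r(1) by simp
    have "d \<otimes> r [^] n = pe c e r" using z dc pc r(1) by (simp add: minus_eq[symmetric])
    then show ?thesis using c(1) by (simp add: rA.pwI)
  qed

  have finite_roots: "finite {r. r \<in> carrier R \<and> eval f r = \<zero>}"
  proof -
    have "{r. r \<in> carrier R \<and> eval f r = \<zero>} = set_mset (roots f)"
      using roots_mem_iff_is_root[OF fP] f0 by (auto simp: is_root_def)
    then show ?thesis by simp
  qed
  then obtain rs where rs: "set rs = {r. r \<in> carrier R \<and> eval f r = \<zero>}" using finite_list by blast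
  \<comment> \<open>The roots are adjoined one by one, and each adjunction multiplies the
    denominator by one more \<open>d\<close>.\<close>
  define C where "C = foldr (\<lambda>r B. adj B r) rs A"
  have C: "subring C R \<and> A \<subseteq> C \<and> set rs \<subseteq> C \<and>
    (\<exists>D vs. D \<in> A \<and> D \<noteq> \<zero> \<and> set vs \<subseteq> carrier R \<and> (\<forall>x\<in>C. D \<otimes> x \<in> msp A vs))"
  proof -
    have "set rs' \<subseteq> set rs \<Longrightarrow> (let C = foldr (\<lambda>r B. adj B r) rs' A in subring C R \<and> A \<subseteq> C \<and> set rs' \<subseteq> C \<and>
    (\<exists>D vs. D \<in> A \<and> D \<noteq> \<zero> \<and> set vs \<subseteq> carrier R \<and> (\<forall>x\<in>C. D \<otimes> x \<in> msp A vs)))" for rs'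
    proof (induction rs')
      case Nil
      have "\<one> \<otimes> x \<in> msp A [\<one>]" if "x \<in> A" for x using that A.msp_one Ac by auto
      then show ?case using A.A_closed(2) A(1) unfolding Let_def
        by (intro conjI exI[of _ \<one>] exI[of _ "[\<one>]"]) auto
    next
      case (Cons r rs')
      let ?C = "foldr (\<lambda>r B. adj B r) rs' A"
      from Cons have IH: "subring ?C R" "A \<subseteq> ?C" "set rs' \<subseteq> ?C"
        and r: "r \<in> carrier R" "eval f r = \<zero>" using rs by (auto simp: Let_def)
      from Cons obtain D vs where D: "D \<in> A" "D \<noteq> \<zero>" "set vs \<subseteq> carrier R" "\<And>x. x \<in> ?C \<Longrightarrow> D \<otimes> x \<in> msp A vs"
        by (auto simp: Let_def)
      interpret r: cring_sub R ?C r by (rule pw_cring_sub[OF IH(1) r(1)])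
      let ?ps = "map (\<lambda>i. r [^] i) (rev [0..<e])"
      let ?vs = "concat (map (\<lambda>w. map (\<lambda>v. v \<otimes> w) vs) ?ps)"
      have ps: "set ?ps \<subseteq> carrier R" using r(1) by auto
      have vsc: "set ?vs \<subseteq> carrier R" using ps D(3) by auto
      have car: "d \<in> carrier R" "D \<in> carrier R" using d D Ac by auto
      have "D \<otimes> d \<otimes> y \<in> msp A ?vs" if "y \<in> pw ?C r n" for y n
        using that
      proof (induction n arbitrary: y)
        case 0
        then show ?case using A.msp_zero[OF vsc] car by (simp add: r.pw_0)
      next
        case (Suc n)
        then obtain c w where c: "c \<in> ?C" "w \<in> pw ?C r n" "y = c \<otimes> r [^] n \<oplus> w" unfolding r.pw_Suc by blast
        have cc: "c \<in> carrier R" "w \<in> carrier R" "r [^] n \<in> carrier R" using c r(1) by auto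
        have "D \<otimes> d \<otimes> y = (D \<otimes> c) \<otimes> (d \<otimes> r [^] n) \<oplus> D \<otimes> d \<otimes> w" unfolding c(3) using car cc by algebra
        moreover have "d \<otimes> r [^] n \<in> msp A ?ps" using dr[OF r] A.pw_msp[OF r(1)] by simp
        then have "(D \<otimes> c) \<otimes> (d \<otimes> r [^] n) \<in> msp A ?vs"
          by (rule A.msp_prod[OF D(3) ps D(4)[OF c(1)]])
        ultimately show ?case using A.msp_add[OF vsc] Suc.IH[OF c(2)] by simp
      qed
      then have 1: "\<forall>y\<in>adj ?C r. D \<otimes> d \<otimes> y \<in> msp A ?vs" unfolding adj_def by blast
      have 2: "D \<otimes> d \<in> A" "D \<otimes> d \<noteq> \<zero>" using D d A.A_closed car by (auto simp: integral_iff)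
      have 3: "subring (adj ?C r) R" "A \<subseteq> adj ?C r" "set (r # rs') \<subseteq> adj ?C r"
        using r.subring_adj IH r.adj_incl r.adj_mem by auto
      have e: "foldr (\<lambda>r B. adj B r) (r # rs') A = adj ?C r" by simp
      show ?case unfolding Let_def e
        by (intro conjI exI[of _ "D \<otimes> d"] exI[of _ ?vs] 1 2 3 vsc)
    qed
    from this[of rs] show ?thesis by (simp add: Let_def C_def)
  qed
  then obtain D vs where D: "D \<in> A" "D \<noteq> \<zero>" "set vs \<subseteq> carrier R" "\<And>x. x \<in> C \<Longrightarrow> D \<otimes> x \<in> msp A vs" by blast
  \<comment> \<open>The ambient field is algebraically closed, so \<open>f\<close> splits in it and
    its coefficients lie in the ring generated by \<open>A\<close> and the roots.\<close>
  have "set f \<subseteq> C"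
    by (rule monic_splitted_coeffs[OF _ fP _ f0 f(3)])
      (use C rs algebraically_closed.roots_over_carrier[OF ac fP] in auto)
  \<comment> \<open>A second use, now with \<open>V = A\<close>: elements of the span that are
    fractions of \<open>A\<close> enter \<open>A\<close> after multiplication by one
    \<open>c\<close>. The powers of a coefficient of \<open>f\<close>, multiplied by
    \<open>D\<close>, are such elements.\<close>
  obtain c where c: "c \<in> A" "c \<noteq> \<zero>"
    and cV: "\<And>v. v \<in> msp A vs \<Longrightarrow> (\<exists>d\<in>A. d \<noteq> \<zero> \<and> d \<otimes> v \<in> A) \<Longrightarrow> c \<otimes> v \<in> A"
  proof -
    have "\<exists>c\<in>A. c \<noteq> \<zero> \<and> (\<forall>v\<in>msp A vs. (\<exists>d\<in>A. d \<noteq> \<zero> \<and> d \<otimes> v \<in> A) \<longrightarrow> c \<otimes> v \<in> A)"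
      by (rule denominators_bounded[OF A(1) D(3)]) (use A.A_carrier A.A_closed in auto)
    then show thesis using that by blast
  qed
  have setA: "\<alpha> \<in> A" if \<alpha>: "\<alpha> \<in> set f" for \<alpha>
  proof -
    have aF: "\<alpha> \<in> ?F" "\<alpha> \<in> C" using \<alpha> setf \<open>set f \<subseteq> C\<close> by auto
    have ac: "\<alpha> \<in> carrier R" using aF subringE(1)[OF Fr] by auto
    have pF: "\<alpha> [^] n \<in> ?F" for n :: nat using aF sF.A_closed by (induction n) auto
    have pC: "\<alpha> [^] n \<in> C" for n :: nat using aF C subringE(3,6)[of C R] by (induction n) auto
    have "c \<otimes> D \<otimes> \<alpha> [^] n \<in> A" for n :: nat
    proof -
      have "D \<otimes> \<alpha> [^] n \<in> ?F" using D(1) AF pF sF.A_closed(4) by auto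
      then obtain b where "b \<in> A" "b \<noteq> \<zero>" "b \<otimes> (D \<otimes> \<alpha> [^] n) \<in> A"
        using fracE[OF _ A.A_carrier] by metis
      then have "c \<otimes> (D \<otimes> \<alpha> [^] n) \<in> A" using cV[OF D(4)[OF pC]] by blast
      then show ?thesis using c D ac Ac by (simp add: m_assoc)
    qed
    moreover have "c \<otimes> D \<in> A" "c \<otimes> D \<noteq> \<zero>" using c D A.A_closed Ac by (auto simp: integral_iff)
    ultimately show ?thesis using A(2) aF(1) unfolding cic_def by blast
  qed
  have coA: "coeff f i \<in> A" if "i < e" for i
  proof -
    have "coeff f i \<in> set f" using coeff_img_restrict[of f] that len by (metis imageI lessThan_iff less_SucI)
    then show ?thesis by (rule setA)
  qed
  have "s [^] e = pe (\<lambda>i. \<ominus> coeff f i) e s"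
  proof -
    have cc: "coeff f i \<in> carrier R" if "i < e" for i using coA[OF that] Ac by blast
    have "s [^] e \<oplus> pe (coeff f) e s = \<zero>" using evalf[OF sc] f(4) by simp
    then have "s [^] e = \<ominus> pe (coeff f) e s" using sc cc by (intro minus_equality[symmetric]) auto
    then show ?thesis using pe_uminus[of e "coeff f" s] cc sc by simp
  qed
  then show ?thesis using coA A.A_closed(3) indep AF
    by (intro exI[of _ e] exI[of _ "\<lambda>i. \<ominus> coeff f i"]) (auto simp: subset_eq)
qed

section \<open>Residue fields\<close>

context cring
begin

lemma cring_subring: "subring T R \<Longrightarrow> cring (R\<lparr>carrier := T\<rparr>)"
  using subcring_iff[OF subringE(1)] subcringI' by blast

lemma inclusion_hom: "subring T R \<Longrightarrow> ring_hom_cring (R\<lparr>carrier := T\<rparr>) R (\<lambda>x. x)"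
  using cring_subring subringE(1)
  by (auto simp: ring_hom_cring_def ring_hom_cring_axioms_def is_cring ring_hom_def)

lemma subring_subring: "subring T R \<Longrightarrow> subring K R \<Longrightarrow> K \<subseteq> T \<Longrightarrow> subring K (R\<lparr>carrier := T\<rparr>)"
  using ring_hom_cring.hom_subring[OF inclusion_hom]
proof -
  assume T: "subring T R" and K: "subring K R" "K \<subseteq> T"
  interpret i: ring_hom_cring "R\<lparr>carrier := T\<rparr>" R "\<lambda>x. x" by (rule inclusion_hom[OF T])
  show ?thesis
  proof (rule i.R.subringI)
    show "K \<subseteq> carrier (R\<lparr>carrier := T\<rparr>)" using K by simp
    show "\<one>\<^bsub>R\<lparr>carrier := T\<rparr>\<^esub> \<in> K" using subringE(3)[OF K(1)] by simp
    show "\<ominus>\<^bsub>R\<lparr>carrier := T\<rparr>\<^esub> h \<in> K" if "h \<in> K" for h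
      using i.hom_a_inv[of h] that K subringE(5)[OF K(1)] by auto
  qed (use subringE(6,7)[OF K(1)] in auto)
qed

lemma generate_ring_subring:
  assumes "subring T R" "H \<subseteq> T"
  shows "generate_ring (R\<lparr>carrier := T\<rparr>) H = generate_ring R H"
  using ring_hom_cring.hom_generate_ring[OF inclusion_hom[OF assms(1)], of H] assms(2) by simp

lemma alg_indep_subring:
  assumes "subring T R" "subring K R" "K \<subseteq> T" "finite Y" "Y \<subseteq> T"
  shows "algebraically_independent (R\<lparr>carrier := T\<rparr>) K Y \<longleftrightarrow> algebraically_independent R K Y"
  using ring_hom_cring.hom_alg_indep[OF inclusion_hom[OF assms(1)] subring_subring[OF assms(1-3)] _ assms(4)] assms(5)
  by (simp add: inj_on_def)

lemma domain_quotient: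
  assumes "subring T R" "prime_of T P"
  shows "domain (R\<lparr>carrier := T\<rparr> Quot P)"
proof -
  have "primeideal P (R\<lparr>carrier := T\<rparr>)" using primeideal_iff[OF assms(1)] assms(2) by simp
  then show ?thesis by (rule primeideal.quotient_is_domain)
qed

text \<open>The composite of \<open>T\<close>, its quotient by \<open>P\<close>, the quotient field
  and an algebraic closure. The type of the target has to be spelled out, because types cannot be
  quantified existentially; it is larger than the type of \<open>R\<close>.\<close>

lemma exists_residue_hom:
  assumes T: "subring T R" and P: "prime_of T P"
  shows "\<exists>(E :: ((('a set \<times> 'a set) set list \<times> nat) multiset \<Rightarrow> ('a set \<times> 'a set) set) ring) h.
    algebraically_closed E \<and> ring_hom_cring (R\<lparr>carrier := T\<rparr>) E h \<and>
    (\<forall>t\<in>T. h t = \<zero>\<^bsub>E\<^esub> \<longleftrightarrow> t \<in> P)"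
proof -
  let ?T = "R\<lparr>carrier := T\<rparr>"
  interpret T: cring ?T by (rule cring_subring[OF T])
  interpret P: primeideal P ?T using primeideal_iff[OF T] P by simp
  interpret D: domain "?T Quot P" by (rule domain_quotient[OF assms])
  interpret Q: field "D.Q" by (rule D.field_Q)
  obtain E :: "((('a set \<times> 'a set) set list \<times> nat) multiset \<Rightarrow> ('a set \<times> 'a set) set) ring"
    where E: "algebraic_closure E (Q.indexed_const ` (carrier D.Q))" and hE: "Q.indexed_const \<in> ring_hom D.Q E"
    by (rule Q.exists_closure)
  interpret E: algebraic_closure E "Q.indexed_const ` (carrier D.Q)" by (rule E)
  define h where "h = (Q.indexed_const :: _ \<Rightarrow> (('a set \<times> 'a set) set list \<times> nat) multiset \<Rightarrow> _) \<circ> (D.emb \<circ> ((+>\<^bsub>?T\<^esub>) P))"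
  have h1: "(+>\<^bsub>?T\<^esub>) P \<in> ring_hom ?T (?T Quot P)" by (rule P.rcos_ring_hom)
  have "D.emb \<circ> ((+>\<^bsub>?T\<^esub>) P) \<in> ring_hom ?T D.Q" by (rule ring_hom_trans[OF h1 D.emb_hom])
  then have hh: "h \<in> ring_hom ?T E" unfolding h_def by (rule ring_hom_trans[OF _ hE])
  have hc: "ring_hom_cring ?T E h"
    by (simp add: ring_hom_cring_def ring_hom_cring_axioms_def T.is_cring E.is_cring hh)
  have "h t = \<zero>\<^bsub>E\<^esub> \<longleftrightarrow> t \<in> P" if t: "t \<in> T" for t
  proof -
    let ?q = "P +>\<^bsub>?T\<^esub> t"
    have inj: "inj (Q.indexed_const :: _ \<Rightarrow> (('a set \<times> 'a set) set list \<times> nat) multiset \<Rightarrow> _)"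
      by (rule Q.indexed_const_is_inj)
    have qc: "?q \<in> carrier (?T Quot P)" using ring_hom_closed[OF h1] t by simp
    have "\<zero>\<^bsub>E\<^esub> = Q.indexed_const \<zero>\<^bsub>D.Q\<^esub>"
      using ring_hom_zero[OF hE Q.ring_axioms E.ring_axioms] by simp
    then have "h t = \<zero>\<^bsub>E\<^esub> \<longleftrightarrow> D.emb ?q = \<zero>\<^bsub>D.Q\<^esub>"
      using inj unfolding h_def by (simp add: inj_eq)
    also have "\<dots> \<longleftrightarrow> ?q = \<zero>\<^bsub>?T Quot P\<^esub>"
      using D.emb_inj qc ring_hom_zero[OF D.emb_hom D.ring_axioms Q.ring_axioms] by (metis D.zero_closed inj_onD)
    also have "\<dots> \<longleftrightarrow> t \<in> P"
    proof -
      have "\<zero>\<^bsub>?T Quot P\<^esub> = P" by (simp add: FactRing_def)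
      moreover have "t \<in> carrier ?T" using t by simp
      ultimately show ?thesis
        using P.rcos_const_imp_mem[of t] T.a_rcos_zero[OF P.is_ideal, of t] by auto
    qed
    finally show ?thesis .
  qed
  then show ?thesis using hc E.algebraically_closed_axioms by blast
qed

end

section \<open>Zariski's lemma and residue fields of maximal ideals\<close>

context affine_field
begin

lemma prime_unit:
  assumes "prime_of T P" "K \<subseteq> T" "a \<in> K" "a \<noteq> \<zero>"
  shows "a \<notin> P"
proof
  assume "a \<in> P"
  then have "inv a \<otimes> a \<in> P" using ideal_ofD(4)[OF prime_ofD(1)[OF assms(1)]] K_inv[OF assms(3,4)] assms(2) by blast
  then show False using prime_ofD(2)[OF assms(1)] assms(3,4) by simp
qed

lemma gen_subset_cl_iff:
  assumes "S \<subseteq> cl Y" "Y \<subseteq> carrier R" shows "gen S \<subseteq> cl Y"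
  using assms gen_incl(2) gen_subset_cl[OF assms(2)] by (intro gen_min subfieldE(1)[OF subfield_cl]) blast+

text \<open>If a normalization had a coordinate \<open>y\<close>, its inverse would lie in the field
  \<open>gen S\<close>, which is finite over \<open>gen Y\<close>. The powers of
  \<open>inv y\<close> then have a uniform denominator, so \<open>inv y\<close> is a polynomial in
  the coordinates by complete integral closedness; the degree in \<open>y\<close> excludes
  this.\<close>

theorem zariski:
  assumes S: "finite S" "S \<subseteq> carrier R" and f: "subfield (gen S) R"
  shows "gen S \<subseteq> cl {}"
proof -
  obtain Y where Y: "finite Y" "Y \<subseteq> gen S" "ai Y" "fin_over (gen Y) (gen S)" "S \<subseteq> cl Y"
    using noether_normalization[OF S] by blast
  have Yc: "Y \<subseteq> carrier R" by (rule ai_carrier[OF Y(3)])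
  have "Y = {}"
  proof (rule ccontr)
    assume "Y \<noteq> {}"
    then obtain y where y: "y \<in> Y" by blast
    let ?Y = "Y - {y}"
    have ins: "insert y ?Y = Y" using y by auto
    have yc: "y \<in> carrier R" "?Y \<subseteq> carrier R" using y Yc by auto
    have t: "trans_over (gen ?Y) y" using alg_indep_insert[of y ?Y] yc Y(3) ins by simp
    interpret y: cring_sub R "gen ?Y" y by (rule pw_cring_sub[OF subring_gen[OF yc(2)] yc(1)])
    have A: "subring (gen Y) R" by (rule subring_gen[OF Yc])
    interpret A: subring_in R "gen Y" by (rule subring_inI[OF A])
    have y0: "y \<noteq> \<zero>" using y.trans_over_nonzero[OF t] by simp
    have iy: "inv y \<in> carrier R" "y \<otimes> inv y = \<one>" using inv_nz[OF yc(1) y0] by auto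
    have "inv y \<in> gen S" using subfield_m_inv(1)[OF f, of y] y y0 Y(2) by auto
    then have pS: "inv y [^] n \<in> gen S" for n :: nat
      using subringE(3,6)[OF subfieldE(1)[OF f]] by (induction n) auto
    obtain ws where ws: "set ws \<subseteq> carrier R" "gen S \<subseteq> msp (gen Y) ws" using Y(4) unfolding fin_over_def by blast
    obtain c where c: "c \<in> gen Y" "c \<noteq> \<zero>"
      and cV: "\<And>v. v \<in> msp (gen Y) ws \<Longrightarrow> (\<exists>d\<in>gen Y. d \<noteq> \<zero> \<and> d \<otimes> v \<in> gen Y) \<Longrightarrow> c \<otimes> v \<in> gen Y"
    proof -
      have "\<exists>c\<in>gen Y. c \<noteq> \<zero> \<and> (\<forall>v\<in>msp (gen Y) ws. (\<exists>d\<in>gen Y. d \<noteq> \<zero> \<and> d \<otimes> v \<in> gen Y) \<longrightarrow> c \<otimes> v \<in> gen Y)"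
        by (rule denominators_bounded[OF A ws(1)]) (use A.A_carrier A.A_closed in auto)
      then show thesis using that by blast
    qed
    have yY: "y \<in> gen Y" by (rule gen_incl(1)[OF y])
    have "c \<otimes> inv y [^] n \<in> gen Y" for n :: nat
    proof (rule cV)
      show "inv y [^] n \<in> msp (gen Y) ws" using pS ws(2) by blast
      have yn: "y [^] n \<in> gen Y" using yY A.A_closed by (induction n) auto
      have "y [^] n \<otimes> inv y [^] n = \<one>" using iy yc(1) by (simp add: nat_pow_distrib[symmetric])
      then show "\<exists>d\<in>gen Y. d \<noteq> \<zero> \<and> d \<otimes> inv y [^] n \<in> gen Y"
        using yn A.A_closed(2) nat_pow_nonzero[OF yc(1) y0] by (intro bexI[of _ "y [^] n"]) auto
    qed
    moreover have "inv y \<in> frac (gen Y)"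
      by (rule fracI[OF A yY y0]) (use iy A.A_closed in auto)
    ultimately have "inv y \<in> gen Y" using cic_gen[OF Y(1,3)] c unfolding cic_def by blast
    moreover have "gen Y = adj (gen ?Y) y" using gen_insert[OF yc(2,1)] unfolding ins .
    ultimately have "inv y \<in> adj (gen ?Y) y" by simp
    then obtain N where "inv y \<in> pw (gen ?Y) y N" by (rule y.adjE)
    then obtain n a where "y.lead n a (inv y)" using y.lead_exists inv_nz(4)[OF yc(1) y0] by metis
    then obtain w where w: "a \<in> gen ?Y" "a \<noteq> \<zero>" "w \<in> pw (gen ?Y) y n" "inv y = a \<otimes> y [^] n \<oplus> w"
      unfolding y.lead_def by blast
    \<comment> \<open>Multiplied by \<open>y\<close>, the polynomial that represents
      \<open>inv y\<close> has positive degree in \<open>y\<close>, but its value is one.\<close>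
    have "\<one> = a \<otimes> y [^] Suc n \<oplus> w \<otimes> y"
    proof -
      have "\<one> = inv y \<otimes> y" using inv_nz(3)[OF yc(1) y0] by simp
      also have "\<dots> = a \<otimes> y [^] Suc n \<oplus> w \<otimes> y" unfolding w(4) using w yc by (simp add: l_distr m_assoc)
      finally show ?thesis .
    qed
    moreover have "\<one> \<in> pw (gen ?Y) y (Suc n)" by simp
    ultimately have "a = \<zero>" using y.lead_trans[OF t w(1) y.pw_mult_x[OF w(3)]] by simp
    then show False using w(2) by simp
  qed
  then show ?thesis using gen_subset_cl_iff[OF Y(5) Yc] by simp
qed

lemma subring_T_K:
  assumes "S \<subseteq> carrier R"
  shows "subring K (R\<lparr>carrier := gen S\<rparr>)" "K \<subseteq> gen S"
  using subring_subring[OF subring_gen[OF assms] subring_K] gen_incl(2) by auto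

end

text \<open>The field \<open>E\<close> may be larger than the residue field of \<open>P\<close>, so
  that an algebraically closed one can be taken.\<close>

locale residue_field = affine_field R K + E: field E for R (structure) and K and E (structure) +
  fixes S h P
  assumes S_carrier: "S \<subseteq> carrier R" and prime_P: "prime_of (gen S) P"
    and hom_h: "ring_hom_cring (R\<lparr>carrier := gen S\<rparr>) E h"
    and ker_h: "\<And>t. t \<in> gen S \<Longrightarrow> h t = \<zero>\<^bsub>E\<^esub> \<longleftrightarrow> t \<in> P"
begin

abbreviation T where "T \<equiv> gen S"

sublocale h: ring_hom_cring "R\<lparr>carrier := T\<rparr>" E h
  by (rule hom_h)

lemma subring_T: "subring T R" by (rule subring_gen[OF S_carrier])
lemma T_carrier: "t \<in> T \<Longrightarrow> t \<in> carrier R" using gen_carrier[OF S_carrier] .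
lemmas T_closed = subringE(2,3)[OF subring_T] subringE(5-7)[OF subring_T]
lemma K_T: "a \<in> K \<Longrightarrow> a \<in> T" by (rule gen_incl(2))

lemma h_simps [simp]:
  "a \<in> T \<Longrightarrow> h a \<in> carrier E"
  "a \<in> T \<Longrightarrow> b \<in> T \<Longrightarrow> h (a \<oplus> b) = h a \<oplus>\<^bsub>E\<^esub> h b"
  "a \<in> T \<Longrightarrow> b \<in> T \<Longrightarrow> h (a \<otimes> b) = h a \<otimes>\<^bsub>E\<^esub> h b"
  "h \<one> = \<one>\<^bsub>E\<^esub>" "h \<zero> = \<zero>\<^bsub>E\<^esub>"
  using h.hom_closed h.hom_add h.hom_mult h.hom_one h.hom_zero by auto

lemma h_inj_K: "inj_on h K"
proof -
  have "a = \<zero>" if "a \<in> K" "h a = \<zero>\<^bsub>E\<^esub>" for a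
    using ker_h[OF K_T[OF that(1)]] that prime_unit[OF prime_P _ that(1)] K_T by blast
  then show ?thesis
    using h.inj_on_subring[OF subring_T_K(1)[OF S_carrier]] by simp
qed

lemma subfield_hK: "subfield (h ` K) E"
proof -
  have sr: "subring (h ` K) E" by (rule h.hom_subring[OF subring_T_K(1)[OF S_carrier]])
  show ?thesis
  proof (rule E.subfieldI'[OF sr])
    fix k assume "k \<in> h ` K - {\<zero>\<^bsub>E\<^esub>}"
    then obtain a where a: "a \<in> K" "k = h a" "h a \<noteq> \<zero>\<^bsub>E\<^esub>" by blast
    have a0: "a \<noteq> \<zero>" using a(3) by auto
    have "h a \<otimes>\<^bsub>E\<^esub> h (inv a) = \<one>\<^bsub>E\<^esub>"
      using a a0 K_inv[OF a(1) a0] K_T h_simps(3)[of a "inv a"] by simp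
    then have "inv\<^bsub>E\<^esub> k = h (inv a)"
      using E.comm_inv_char[of "h a" "h (inv a)"] a K_T K_inv[OF a(1) a0] by simp
    then show "inv\<^bsub>E\<^esub> k \<in> h ` K" using K_inv[OF a(1) a0] by simp
  qed
qed

sublocale E: affine_field E "h ` K"
  by (rule E.affine_fieldI[OF subfield_hK])

lemma hS_carrier: "h ` S \<subseteq> carrier E"
  using gen_incl(1) by auto

lemma hT: "E.gen (h ` S) = h ` T"
proof -
  have "h ` generate_ring (R\<lparr>carrier := T\<rparr>) (K \<union> S) = generate_ring E (h ` (K \<union> S))"
    using gen_incl by (intro h.hom_generate_ring) auto
  moreover have "generate_ring (R\<lparr>carrier := T\<rparr>) (K \<union> S) = T"
    using gen_incl by (intro generate_ring_subring[OF subring_T]) auto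
  ultimately show ?thesis by (simp add: image_Un)
qed

text \<open>The kernel of \<open>h\<close> is \<open>P\<close>, so meeting \<open>P\<close> only in
  zero is injectivity on \<open>gen Y\<close>, and \<open>hom_alg_indep\<close> applies.
  Independence modulo a prime becomes ordinary independence in a field.\<close>

lemma indm_iff:
  assumes "finite Y" "Y \<subseteq> T"
  shows "indm P Y \<longleftrightarrow> E.ai (h ` Y) \<and> inj_on h Y"
proof -
  have Yc: "Y \<subseteq> carrier R" using assms(2) T_carrier by auto
  have gY: "gen Y \<subseteq> T" using gen_incl(2) assms(2) by (intro gen_min[OF subring_T]) auto
  have "generate_ring (R\<lparr>carrier := T\<rparr>) (K \<union> Y) = gen Y"
    using gen_incl assms(2) by (intro generate_ring_subring[OF subring_T]) auto
  then have "(ai Y \<and> inj_on h (gen Y)) \<longleftrightarrow> E.ai (h ` Y) \<and> inj_on h Y"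
    using h.hom_alg_indep[OF subring_T_K(1)[OF S_carrier] h_inj_K assms(1)] assms(2)
      alg_indep_subring[OF subring_T subring_K _ assms] gen_incl(2) by auto
  moreover have "inj_on h (gen Y) \<longleftrightarrow> gen Y \<inter> P \<subseteq> {\<zero>}"
  proof -
    have "subring (gen Y) (R\<lparr>carrier := T\<rparr>)" by (rule subring_subring[OF subring_T subring_gen[OF Yc] gY])
    then have "inj_on h (gen Y) \<longleftrightarrow> (\<forall>a\<in>gen Y. h a = \<zero>\<^bsub>E\<^esub> \<longrightarrow> a = \<zero>)" using h.inj_on_subring by simp
    then show ?thesis using ker_h gY by blast
  qed
  ultimately show ?thesis unfolding indm_def by simp
qed

lemma prime_preimage:
  assumes "E.prime_of (h ` T) q"
  shows "prime_of T {t \<in> T. h t \<in> q}" "P \<subseteq> {t \<in> T. h t \<in> q}"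
proof -
  note q = E.prime_ofD[OF assms] and i = E.ideal_ofD[OF E.prime_ofD(1)[OF assms]]
  show "P \<subseteq> {t \<in> T. h t \<in> q}"
  proof
    fix x assume x: "x \<in> P"
    then have "x \<in> T" using ideal_ofD(1)[OF prime_ofD(1)[OF prime_P]] by blast
    moreover from this have "h x = \<zero>\<^bsub>E\<^esub>" using ker_h x by blast
    ultimately show "x \<in> {t \<in> T. h t \<in> q}" using i(2) by simp
  qed
  show "prime_of T {t \<in> T. h t \<in> q}"
    unfolding prime_of_def ideal_of_def
    using i(2,3,4) q(2,3) T_closed by auto
qed

end

context affine_field
begin

lemma residue_fieldI:
  assumes "S \<subseteq> carrier R" "prime_of (gen S) P"
  shows "\<exists>(E :: ((('a set \<times> 'a set) set list \<times> nat) multiset \<Rightarrow> ('a set \<times> 'a set) set) ring) h.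
    algebraically_closed E \<and> residue_field R K E S h P"
proof -
  obtain E :: "((('a set \<times> 'a set) set list \<times> nat) multiset \<Rightarrow> ('a set \<times> 'a set) set) ring" and h
    where E: "algebraically_closed E" "ring_hom_cring (R\<lparr>carrier := gen S\<rparr>) E h"
    "\<forall>t\<in>gen S. h t = \<zero>\<^bsub>E\<^esub> \<longleftrightarrow> t \<in> P"
    using exists_residue_hom[OF subring_gen[OF assms(1)] assms(2)] by blast
  have "residue_field R K E S h P"
    using E assms unfolding residue_field_def residue_field_axioms_def
    by (simp add: affine_field_axioms algebraically_closed_def)
  then show ?thesis using E(1) by blast
qed

text \<open>Maximality makes the image of \<open>gen S\<close> in the residue field a field, hence
  algebraic over the image of \<open>K\<close> by Zariski's lemma. An element of \<open>Y\<close>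
  would have a transcendental image there.\<close>

lemma maximal_indm_empty:
  assumes S: "finite S" "S \<subseteq> carrier R" and P: "prime_of (gen S) P"
    and mx: "\<And>J. ideal_of (gen S) J \<Longrightarrow> P \<subseteq> J \<Longrightarrow> \<one> \<notin> J \<Longrightarrow> J = P"
    and Y: "Y \<subseteq> gen S" "indm P Y"
  shows "Y = {}"
proof (rule ccontr)
  assume "Y \<noteq> {}"
  then obtain y where y: "y \<in> Y" by blast
  obtain E :: "((('a set \<times> 'a set) set list \<times> nat) multiset \<Rightarrow> ('a set \<times> 'a set) set) ring" and h
    where "residue_field R K E S h P" using residue_fieldI[OF S(2) P] by blast
  then interpret h: residue_field R K E S h P .
  note Pi = prime_ofD(1)[OF P]
  have "subfield (h ` gen S) E"
  proof (rule h.E.subfieldI')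
    show "subring (h ` gen S) E" using h.h.hom_subring[OF h.h.R.carrier_is_subring] by simp
    fix k assume "k \<in> h ` gen S - {\<zero>\<^bsub>E\<^esub>}"
    then obtain t where t: "t \<in> gen S" "k = h t" "h t \<noteq> \<zero>\<^bsub>E\<^esub>" by blast
    then have tP: "t \<notin> P" using h.ker_h by blast
    \<comment> \<open>The ideal generated by \<open>P\<close> and \<open>t\<close> contains one by
      maximality; reading that equation modulo \<open>P\<close> inverts \<open>h t\<close>.\<close>
    let ?J = "{p \<oplus> r \<otimes> t | p r. p \<in> P \<and> r \<in> gen S}"
    have PT: "P \<subseteq> gen S" by (rule ideal_ofD(1)[OF Pi])
    have tc: "t \<in> carrier R" by (rule h.T_carrier[OF t(1)])
    have J: "ideal_of (gen S) ?J"
      unfolding ideal_of_def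
    proof (intro conjI ballI)
      show "?J \<subseteq> gen S" using PT t h.T_closed by auto
      have "\<zero> = \<zero> \<oplus> \<zero> \<otimes> t" using tc by simp
      then show "\<zero> \<in> ?J" using ideal_ofD(2)[OF Pi] h.T_closed by blast
      fix x y assume "x \<in> ?J" "y \<in> ?J"
      then obtain m r m' r' where *: "x = m \<oplus> r \<otimes> t" "y = m' \<oplus> r' \<otimes> t" "m \<in> P" "r \<in> gen S" "m' \<in> P" "r' \<in> gen S" by blast
      then have "m \<in> carrier R" "r \<in> carrier R" "m' \<in> carrier R" "r' \<in> carrier R" using PT h.T_carrier by auto
      then have "x \<oplus> y = (m \<oplus> m') \<oplus> (r \<oplus> r') \<otimes> t" unfolding * using tc by algebra
      moreover have "m \<oplus> m' \<in> P" "r \<oplus> r' \<in> gen S" using * ideal_ofD(3)[OF Pi] h.T_closed by auto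
      ultimately show "x \<oplus> y \<in> ?J" by blast
    next
      fix b x assume b: "b \<in> gen S" and "x \<in> ?J"
      then obtain m r where *: "x = m \<oplus> r \<otimes> t" "m \<in> P" "r \<in> gen S" by blast
      then have "m \<in> carrier R" "r \<in> carrier R" "b \<in> carrier R" using PT h.T_carrier b by auto
      then have "b \<otimes> x = (b \<otimes> m) \<oplus> (b \<otimes> r) \<otimes> t" unfolding * using tc by algebra
      moreover have "b \<otimes> m \<in> P" "b \<otimes> r \<in> gen S" using * b ideal_ofD(4)[OF Pi] h.T_closed by auto
      ultimately show "b \<otimes> x \<in> ?J" by blast
    qed
    have PJ: "P \<subseteq> ?J"
    proof
      fix m assume m: "m \<in> P"
      then have "m = m \<oplus> \<zero> \<otimes> t" using PT h.T_carrier tc by auto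
      then show "m \<in> ?J" using m h.T_closed by blast
    qed
    have "t = \<zero> \<oplus> \<one> \<otimes> t" using tc by simp
    then have "t \<in> ?J" using ideal_ofD(2)[OF Pi] h.T_closed by blast
    then have "\<one> \<in> ?J" using mx[OF J PJ] tP by blast
    then obtain p r where pr: "p \<in> P" "r \<in> gen S" "\<one> = p \<oplus> r \<otimes> t" by blast
    have "h p = \<zero>\<^bsub>E\<^esub>" using h.ker_h pr(1) PT by blast
    then have "h (p \<oplus> r \<otimes> t) = h r \<otimes>\<^bsub>E\<^esub> h t" using pr PT t h.T_closed by (auto simp: subset_eq)
    then have "h r \<otimes>\<^bsub>E\<^esub> h t = \<one>\<^bsub>E\<^esub>" using pr(3) h.h_simps(4) by simp
    then have "inv\<^bsub>E\<^esub> k = h r"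
      using h.E.comm_inv_char[of "h t" "h r"] t pr by (simp add: h.E.m_comm)
    then show "inv\<^bsub>E\<^esub> k \<in> h ` gen S" using pr by simp
  qed
  then have "h.E.gen (h ` S) \<subseteq> h.E.cl {}"
    using h.E.zariski[OF _ h.hS_carrier] S(1) h.hT by simp
  then have "h y \<in> h.E.cl {}" using y Y(1) h.hT by auto
  moreover have "indm P {y}" using indm_subset[OF Y(2)] y by simp
  then have "h.E.ai (insert (h y) {})" using h.indm_iff[of "{y}"] y Y(1) by auto
  ultimately show False using h.E.ai_insert_iff[of "h y" "{}"] y Y(1) by auto
qed

end

section \<open>Going down\<close>

text \<open>Scaling the variable by \<open>u\<close> raises the coefficient of degree
  \<open>i\<close> by the factor \<open>u [^] (n - i)\<close>. It turns an equation for
  \<open>x\<close> into one for \<open>u \<otimes> x\<close> without denominators.\<close>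

lemma (in cring) pe_homogenize:
  assumes "\<And>i. i < e \<Longrightarrow> a i \<in> carrier R" "u \<in> carrier R" "x \<in> carrier R" "e \<le> n"
  shows "pe (\<lambda>i. a i \<otimes> u [^] (n - i)) e (u \<otimes> x) = u [^] n \<otimes> pe a e x"
  using assms(1,4)
proof (induction e)
  case (Suc e)
  have car: "a e \<in> carrier R" "u [^] (n - e) \<in> carrier R" "u [^] e \<in> carrier R" "x [^] e \<in> carrier R"
    "pe a e x \<in> carrier R" "u [^] n \<in> carrier R" using Suc.prems assms by auto
  have un: "u [^] (n - e) \<otimes> u [^] e = u [^] n" using assms(2) Suc.prems by (simp add: nat_pow_mult)
  have "a e \<otimes> u [^] (n - e) \<otimes> (u \<otimes> x) [^] e = (u [^] (n - e) \<otimes> u [^] e) \<otimes> (a e \<otimes> x [^] e)"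
    using car assms by (simp add: nat_pow_distrib m_ac)
  then show ?case using Suc car assms un by (simp add: r_distr)
qed (use assms in simp)

lemma (in cring) pe_scale:
  assumes "\<And>i. i < e \<Longrightarrow> a i \<in> carrier R" "u \<in> carrier R" "x \<in> carrier R"
  shows "pe a e (u \<otimes> x) = pe (\<lambda>i. a i \<otimes> u [^] i) e x"
  using assms(1)
proof (induction e)
  case (Suc e)
  then show ?case using assms(2,3) by (simp add: nat_pow_distrib m_assoc)
qed simp

text \<open>Otherwise the relation, padded with zeros to length \<open>e'\<close>, would be a
  nontrivial dependence among the first \<open>e'\<close> powers.\<close>

lemma (in domain) relation_degree:
  assumes A: "subring A R" and x: "x \<in> carrier R"
    and ind: "\<And>c i. (\<And>i. i < e' \<Longrightarrow> c i \<in> A) \<Longrightarrow> pe c e' x = \<zero> \<Longrightarrow> i < e' \<Longrightarrow> c i = \<zero>"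
    and rel: "l \<in> A" "l \<noteq> \<zero>" "\<And>i. i < e \<Longrightarrow> g i \<in> A" "l \<otimes> x [^] e = pe g e x"
  shows "e' \<le> e"
proof (rule ccontr)
  assume "\<not> e' \<le> e"
  then have lt: "e < e'" by simp
  let ?c = "\<lambda>i. if i < e then g i else if i = e then \<ominus> l else \<zero>"
  note Ac = subringE(1)[OF A, THEN subsetD]
  have cA: "?c i \<in> A" for i using rel(1,3) subringE(2,5)[OF A] by auto
  have cc: "?c i \<in> carrier R" for i using cA Ac by blast
  have "pe ?c e' x = pe ?c (Suc e) x" by (rule pe_pad) (use cc x lt in auto)
  also have "\<dots> = \<ominus> l \<otimes> x [^] e \<oplus> pe g e x" using pe_cong[of e ?c g x] by simp
  also have "\<dots> = \<zero>" unfolding rel(4)[symmetric] using rel(1) Ac x by (simp add: l_minus l_neg)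
  finally have "?c e = \<zero>" using ind[of ?c e] cA lt by blast
  then show False using rel(1,2) Ac by (metis (no_types, lifting) a_inv_closed add.inv_eq_1_iff less_irrefl minus_zero add.inv_inv)
qed

context affine_field
begin

text \<open>A basis chosen inside \<open>Y'\<close> has at least as many elements as
  \<open>Y\<close>, by exchange, and so it exhausts \<open>Y'\<close>. It serves to check that
  modified coordinates still form a transcendence basis.\<close>

lemma count_basis:
  assumes "finite Y'" "Y' \<subseteq> carrier R" "ai Y" "finite Y" "Y \<subseteq> cl Y'" "card Y' \<le> card Y"
  shows "ai Y'" "card Y' = card Y"
proof -
  obtain Z where Z: "Z \<subseteq> Y'" "ai Z" "Y' \<subseteq> cl Z" using basis_in_finite[OF assms(1,2)] by blast
  have Zc: "Z \<subseteq> carrier R" "finite Z" using Z(1) assms(1,2) finite_subset by auto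
  have "Y \<subseteq> cl Z" using cl_least[OF Zc(1) Z(3)] assms(5) by blast
  then have "card Y \<le> card Z" using exchange_card[OF Zc(2) assms(4) Zc(1) assms(3)] by blast
  moreover have "card Z \<le> card Y'" using Z(1) assms(1) by (rule card_mono[rotated])
  ultimately have "card Z = card Y'" "card Y' = card Y" using assms(6) by auto
  then show "card Y' = card Y" "ai Y'" using Z(1,2) assms(1) card_subset_eq by metis+
qed

lemma cl_not_trans: "s \<in> cl Y \<Longrightarrow> \<not> trans_over (gen Y) s"
  unfolding cl_def by blast

lemma ai_pe_nonzero:
  assumes "ai {y}" "\<And>i. i < n \<Longrightarrow> k i \<in> K" "i < n" "k i \<noteq> \<zero>"
  shows "pe k n y \<noteq> \<zero>"
proof
  assume "pe k n y = \<zero>"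
  have yc: "y \<in> carrier R" using ai_carrier[OF assms(1)] by simp
  have "trans_over (gen {}) y" using alg_indep_insert[of y "{}"] yc assms(1) by simp
  then have "k i = \<zero>" using trans_overD[of "gen {}" y k n i] \<open>pe k n y = \<zero>\<close> assms(2,3) gen_incl(2) by blast
  then show False using assms(4) by simp
qed

text \<open>A failure of algebraic independence and a nonzero element of
  \<open>gen {y} \<inter> P\<close> look alike, because \<open>\<zero> \<in> P\<close>: both are
  polynomial expressions lying in \<open>P\<close> with a nonzero coefficient.\<close>

lemma not_indm_relation:
  assumes "y \<in> T" "subring T R" "K \<subseteq> T" "prime_of T P" "\<not> indm P {y}"
  shows "\<exists>k n i. (\<forall>i<n. k i \<in> K) \<and> i < n \<and> k i \<noteq> \<zero> \<and> pe k n y \<in> P"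
proof (rule ccontr)
  assume no: "\<not> ?thesis"
  have yc: "y \<in> carrier R" using assms subringE(1) by blast
  have z: "\<zero> \<in> P" using ideal_ofD(2)[OF prime_ofD(1)[OF assms(4)]] .
  interpret y: cring_sub R "gen {}" y by (rule pw_cring_sub[OF _ yc]) (rule subring_gen, simp)
  have "trans_over (gen {}) y"
    unfolding trans_over_def
  proof (intro allI impI)
    fix c n i assume c: "\<forall>i<n. c i \<in> gen {}" "pe c n y = \<zero>" "i < (n::nat)"
    show "c i = \<zero>"
    proof (rule ccontr)
      assume "c i \<noteq> \<zero>"
      then show False using no c z unfolding gen_empty by metis
    qed
  qed
  then have "ai {y}" using alg_indep_insert[of y "{}"] yc alg_indep_empty by simp
  moreover have "gen {y} \<inter> P \<subseteq> {\<zero>}"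
  proof
    fix x assume x: "x \<in> gen {y} \<inter> P"
    then have "x \<in> adj (gen {}) y" using gen_insert[of "{}" y] yc by simp
    then obtain n where "x \<in> pw (gen {}) y n" by (rule y.adjE)
    then obtain c where c: "\<And>i. i < n \<Longrightarrow> c i \<in> K" "x = pe c n y" unfolding pw_def gen_empty by auto
    have "\<And>i. i < n \<Longrightarrow> c i = \<zero>" using no c x by blast
    then have "pe c n y = pe (\<lambda>_. \<zero>) n y" by (rule pe_cong)
    then show "x \<in> {\<zero>}" using c(2) yc by (simp add: pe_zero)
  qed
  ultimately show False using assms(5) unfolding indm_def by simp
qed

text \<open>Going down for the principal prime \<open>h\<close> of the normal ring \<open>gen Y\<close>: minimal polynomials have
  coefficients in \<open>gen Y\<close>, so divisibility by \<open>h\<close> can be read off them.\<close>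

lemma going_down:
  assumes ac: "algebraically_closed R"
    and Y: "finite Y" "ai Y" "h \<in> Y" "c \<in> gen (Y - {h})" "c \<noteq> \<zero>"
    and T: "subring T R" "fin_over (gen Y) T" "T \<subseteq> cl Y" "gen Y \<subseteq> T"
    and P: "prime_of T P" "h \<in> P"
    and s: "s \<in> T" "s \<notin> P" and t: "t \<in> T"
  shows "s \<otimes> c [^] (j::nat) \<noteq> h \<otimes> t"
proof
  assume eq: "s \<otimes> c [^] j = h \<otimes> t"
  let ?A = "gen Y" and ?Y = "Y - {h}"
  have Yc: "Y \<subseteq> carrier R" by (rule ai_carrier[OF Y(2)])
  have hc: "h \<in> carrier R" "?Y \<subseteq> carrier R" using Yc Y(3) by auto
  have ins: "insert h ?Y = Y" using Y(3) by auto
  have A: "subring ?A R" by (rule subring_gen[OF Yc])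
  note Acl = subringE(2,3)[OF A] subringE(5-7)[OF A] and Ac = subringE(1)[OF A, THEN subsetD]
  note Tc = subringE(1)[OF T(1), THEN subsetD]
  have cic: "cic ?A" by (rule cic_gen[OF Y(1,2)])
  have th: "trans_over (gen ?Y) h" using alg_indep_insert[of h ?Y] hc Y(2) ins by simp
  interpret h: cring_sub R "gen ?Y" h by (rule pw_cring_sub[OF subring_gen[OF hc(2)] hc(1)])
  have A_adj: "?A = adj (gen ?Y) h" using gen_insert[OF hc(2,1)] unfolding ins .
  have hA: "h \<in> ?A" by (rule gen_incl(1)[OF Y(3)])
  have h0: "h \<noteq> \<zero>" using h.trans_over_nonzero[OF th] by simp
  have cc: "c \<in> carrier R" using gen_carrier[OF hc(2) Y(4)] .
  have cA: "c \<in> ?A" using gen_mono[of ?Y Y] Yc Y(4) by blast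
  have cn: "c [^] n \<in> gen ?Y" for n :: nat
    using Y(4) h.A_closed by (induction n) auto
  have cnA: "c [^] n \<in> ?A" for n :: nat using cA Acl by (induction n) auto
  have hnA: "h [^] n \<in> ?A" for n :: nat using hA Acl by (induction n) auto

  \<comment> \<open>A nonzero multiple of \<open>h\<close> has positive degree in
    \<open>h\<close>.\<close>
  have no_const: "y = \<zero>" if y: "y \<in> gen ?Y" "z \<in> ?A" "y = h \<otimes> z" for y z
  proof (rule ccontr)
    assume "y \<noteq> \<zero>"
    then have "z \<noteq> \<zero>" using y(3) hc by auto
    obtain N where "z \<in> pw (gen ?Y) h N" using y(2) unfolding A_adj by (rule h.adjE)
    then obtain n a where "h.lead n a z" using h.lead_exists \<open>z \<noteq> \<zero>\<close> by metis
    then obtain w where w: "a \<in> gen ?Y" "a \<noteq> \<zero>" "w \<in> pw (gen ?Y) h n" "z = a \<otimes> h [^] n \<oplus> w"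
      unfolding h.lead_def by blast
    have "y = a \<otimes> h [^] Suc n \<oplus> w \<otimes> h"
      unfolding y(3) w(4) using w hc by (simp add: r_distr m_ac)
    moreover have "y \<in> pw (gen ?Y) h (Suc n)" using y(1) by simp
    ultimately have "a = \<zero>" using h.lead_trans[OF th w(1) h.pw_mult_x[OF w(3)]] by simp
    then show False using w(2) by simp
  qed
  \<comment> \<open>The element \<open>h\<close> is prime in \<open>gen Y\<close> and does not
    divide \<open>c\<close>. Concretely, the constant term of \<open>x\<close> with respect to
    \<open>h\<close>, multiplied by a power of \<open>c\<close>, is free of \<open>h\<close> and a
    multiple of \<open>h\<close>, hence zero.\<close>
  have cancel: "\<exists>z\<in>?A. x = h \<otimes> z" if x: "x \<in> ?A" "y \<in> ?A" "x \<otimes> c [^] n = h \<otimes> y" for x y and n :: nat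
  proof -
    obtain N where "x \<in> pw (gen ?Y) h N" using x(1) unfolding A_adj by (rule h.adjE)
    then have "x \<in> pw (gen ?Y) h (Suc N)" by (rule h.pw_mono) simp
    then obtain d where d: "\<And>i. i < Suc N \<Longrightarrow> d i \<in> gen ?Y" "x = pe d (Suc N) h" unfolding pw_def by auto
    let ?z = "pe (\<lambda>i. d (Suc i)) N h"
    have zA: "?z \<in> ?A" unfolding A_adj using d(1) by (intro h.adjI[of _ N] h.pwI) auto
    have zc: "?z \<in> carrier R" "d 0 \<in> carrier R" using Ac[OF zA] d(1)[of 0] by auto
    have xe: "x = ?z \<otimes> h \<oplus> d 0" unfolding d(2) using d(1) hc by (intro pe_Suc_shift) auto
    have yc: "y \<in> carrier R" "c [^] n \<in> carrier R" using Ac[OF x(2)] cc by auto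
    have "d 0 \<otimes> c [^] n = h \<otimes> (y \<oplus> \<ominus> (?z \<otimes> c [^] n))"
    proof -
      have "h \<otimes> y = h \<otimes> (?z \<otimes> c [^] n) \<oplus> d 0 \<otimes> c [^] n"
      proof -
        have "\<And>z d p. \<lbrakk>z \<in> carrier R; d \<in> carrier R; p \<in> carrier R\<rbrakk> \<Longrightarrow> (z \<otimes> h \<oplus> d) \<otimes> p = h \<otimes> (z \<otimes> p) \<oplus> d \<otimes> p"
          using hc(1) by algebra
        then show ?thesis unfolding x(3)[symmetric] xe using zc yc by simp
      qed
      then have "h \<otimes> (y \<oplus> \<ominus> (?z \<otimes> c [^] n)) = (h \<otimes> (?z \<otimes> c [^] n) \<oplus> d 0 \<otimes> c [^] n) \<oplus> \<ominus> (h \<otimes> (?z \<otimes> c [^] n))"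
        using zc yc hc by (simp add: r_distr r_minus)
      also have "\<dots> = d 0 \<otimes> c [^] n" using zc yc hc by (simp add: a_comm[of "h \<otimes> (?z \<otimes> c [^] n)" "d 0 \<otimes> c [^] n"] a_assoc r_neg)
      finally show ?thesis by simp
    qed
    moreover have "y \<oplus> \<ominus> (?z \<otimes> c [^] n) \<in> ?A" using Acl x(2) zA cnA by auto
    moreover have "d 0 \<otimes> c [^] n \<in> gen ?Y" using d(1)[of 0] cn h.A_closed(4) by auto
    ultimately have "d 0 \<otimes> c [^] n = \<zero>" using no_const by blast
    then have "d 0 = \<zero>" using zc(2) cc Y(5) nat_pow_nonzero by (simp add: integral_iff)
    then show ?thesis using xe zc hc zA by (intro bexI[of _ ?z]) (auto simp: m_comm)
  qed

  have sc: "s \<in> carrier R" and tc: "t \<in> carrier R" using s t Tc by auto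
  obtain e a where a: "\<And>i. i < e \<Longrightarrow> a i \<in> ?A" "s [^] e = pe a e s"
    and ia: "\<And>c i. (\<And>i. i < e \<Longrightarrow> c i \<in> ?A) \<Longrightarrow> pe c e s = \<zero> \<Longrightarrow> i < e \<Longrightarrow> c i = \<zero>"
    using min_poly_cic[OF ac A cic T(1,2) s(1) cl_not_trans] T(3) s(1) by blast
  obtain e' b where b: "\<And>i. i < e' \<Longrightarrow> b i \<in> ?A" "t [^] e' = pe b e' t"
    and ib: "\<And>c i. (\<And>i. i < e' \<Longrightarrow> c i \<in> ?A) \<Longrightarrow> pe c e' t = \<zero> \<Longrightarrow> i < e' \<Longrightarrow> c i = \<zero>"
    using min_poly_cic[OF ac A cic T(1,2) t(1) cl_not_trans] T(3) t by blast
  have acar: "\<And>i. i < e \<Longrightarrow> a i \<in> carrier R" and bcar: "\<And>i. i < e' \<Longrightarrow> b i \<in> carrier R" using a(1) b(1) Ac by auto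
  let ?u = "c [^] j"
  have uc: "?u \<in> carrier R" "?u \<in> ?A" "?u \<noteq> \<zero>" using cc cnA nat_pow_nonzero[OF cc Y(5)] by auto
  have us: "?u \<otimes> s = h \<otimes> t" using eq uc sc by (simp add: m_comm)
  have unA: "?u [^] n \<in> ?A" for n :: nat using uc(2) Acl by (induction n) auto
  let ?\<alpha> = "\<lambda>i. a i \<otimes> ?u [^] (e - i)" and ?\<beta> = "\<lambda>i. b i \<otimes> h [^] (e' - i)"
  have \<alpha>A: "\<And>i. i < e \<Longrightarrow> ?\<alpha> i \<in> ?A" and \<beta>A: "\<And>i. i < e' \<Longrightarrow> ?\<beta> i \<in> ?A"
    using a(1) b(1) unA hnA Acl by auto
  \<comment> \<open>From \<open>?u \<otimes> s = h \<otimes> t\<close>, the homogenized equation of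
    \<open>s\<close> is a relation for \<open>t\<close> of the same degree, and vice versa. Hence
    the minimal equations of \<open>s\<close> and \<open>t\<close> have equal degree.\<close>
  have rel_t: "h [^] e \<otimes> t [^] e = pe (\<lambda>i. ?\<alpha> i \<otimes> h [^] i) e t"
  proof -
    have "h [^] e \<otimes> t [^] e = (?u \<otimes> s) [^] e" using us hc tc by (simp add: nat_pow_distrib)
    also have "\<dots> = ?u [^] e \<otimes> pe a e s" using uc sc a(2) by (simp add: nat_pow_distrib)
    also have "\<dots> = pe ?\<alpha> e (?u \<otimes> s)" using acar uc sc by (intro pe_homogenize[symmetric]) auto
    also have "\<dots> = pe (\<lambda>i. ?\<alpha> i \<otimes> h [^] i) e t" unfolding us using \<alpha>A Ac hc tc by (intro pe_scale) auto
    finally show ?thesis .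
  qed
  have rel_s: "?u [^] e' \<otimes> s [^] e' = pe (\<lambda>i. ?\<beta> i \<otimes> ?u [^] i) e' s"
  proof -
    have "?u [^] e' \<otimes> s [^] e' = (h \<otimes> t) [^] e'" using us[symmetric] uc sc by (simp add: nat_pow_distrib)
    also have "\<dots> = h [^] e' \<otimes> pe b e' t" using hc tc b(2) by (simp add: nat_pow_distrib)
    also have "\<dots> = pe ?\<beta> e' (h \<otimes> t)" using bcar hc tc by (intro pe_homogenize[symmetric]) auto
    also have "\<dots> = pe (\<lambda>i. ?\<beta> i \<otimes> ?u [^] i) e' s" unfolding us[symmetric] using \<beta>A Ac uc sc by (intro pe_scale) auto
    finally show ?thesis .
  qed
  have "e' \<le> e"
  proof (rule relation_degree[OF A tc _ _ _ _ rel_t])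
    show "c i = \<zero>" if "\<And>i. i < e' \<Longrightarrow> c i \<in> ?A" "pe c e' t = \<zero>" "i < e'" for c i
      by (rule ib[of c i]) (use that in auto)
    show "h [^] e \<in> ?A" "h [^] e \<noteq> \<zero>" using hnA nat_pow_nonzero[OF hc(1) h0] by auto
    show "?\<alpha> i \<otimes> h [^] i \<in> ?A" if "i < e" for i using \<alpha>A[OF that] hnA Acl by auto
  qed
  moreover have "e \<le> e'"
  proof (rule relation_degree[OF A sc _ _ _ _ rel_s])
    show "c i = \<zero>" if "\<And>i. i < e \<Longrightarrow> c i \<in> ?A" "pe c e s = \<zero>" "i < e" for c i
      by (rule ia[of c i]) (use that in auto)
    show "?u [^] e' \<in> ?A" "?u [^] e' \<noteq> \<zero>" using unA nat_pow_nonzero[OF uc(1,3)] by auto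
    show "?\<beta> i \<otimes> ?u [^] i \<in> ?A" if "i < e'" for i using \<beta>A[OF that] unA Acl by auto
  qed
  ultimately have ee: "e' = e" by simp
  have h_dvd: "\<exists>z\<in>?A. a i = h \<otimes> z" if i: "i < e" for i
  proof -
    \<comment> \<open>The relation for \<open>t\<close> that comes from \<open>s\<close>, minus the
      minimal equation of \<open>t\<close> scaled by \<open>h [^] e\<close>. The terms of degree
      \<open>e\<close> cancel, so by minimality all coefficients agree.\<close>
    let ?g = "\<lambda>i. ?\<alpha> i \<otimes> h [^] i \<oplus> \<ominus> (h [^] e \<otimes> b i)"
    have gA: "?g i \<in> ?A" if "i < e" for i using \<alpha>A[OF that] b(1)[of i] that ee hnA Acl by auto
    have c1: "?\<alpha> i \<otimes> h [^] i \<in> carrier R" "h [^] e \<otimes> b i \<in> carrier R" if "i < e" for i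
      using \<alpha>A[OF that] bcar[of i] that ee hc Ac by auto
    have "pe ?g e t = pe (\<lambda>i. ?\<alpha> i \<otimes> h [^] i) e t \<oplus> pe (\<lambda>i. \<ominus> (h [^] e \<otimes> b i)) e t"
      using c1 tc by (intro pe_add) auto
    also have "pe (\<lambda>i. \<ominus> (h [^] e \<otimes> b i)) e t = \<ominus> pe (\<lambda>i. h [^] e \<otimes> b i) e t"
      using c1 tc by (intro pe_uminus) auto
    also have "pe (\<lambda>i. h [^] e \<otimes> b i) e t = h [^] e \<otimes> pe b e t"
      using bcar ee hc tc by (intro pe_smult) auto
    also have "pe b e t = t [^] e" using b(2) ee by simp
    also have "pe (\<lambda>i. ?\<alpha> i \<otimes> h [^] i) e t \<oplus> \<ominus> (h [^] e \<otimes> t [^] e) = \<zero>"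
      unfolding rel_t[symmetric] using hc tc by (simp add: r_neg)
    finally have "?g i = \<zero>" using ib[of ?g i] gA i ee by blast
    then have "?\<alpha> i \<otimes> h [^] i = h [^] e \<otimes> b i" using c1[OF i] by (simp add: minus_eq[symmetric])
    also have "h [^] e = h [^] (e - i) \<otimes> h [^] i" using i hc by (simp add: nat_pow_mult)
    finally have "?\<alpha> i \<otimes> h [^] i = (h [^] (e - i) \<otimes> b i) \<otimes> h [^] i"
      using hc bcar[of i] i ee by (simp add: m_ac)
    then have "?\<alpha> i = h [^] (e - i) \<otimes> b i"
      using nat_pow_nonzero[OF hc(1) h0, of i] \<alpha>A[OF i] Ac hc bcar[of i] i ee by (subst (asm) m_rcancel) auto
    \<comment> \<open>Since \<open>i < e\<close>, at least one factor \<open>h\<close> is left after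
      cancelling \<open>h [^] i\<close>.\<close>
    moreover have "h [^] (e - i) = h \<otimes> h [^] (e - i - 1)"
      using i hc by (metis Suc_diff_1 nat_pow_Suc2 zero_less_diff)
    ultimately have "a i \<otimes> ?u [^] (e - i) = h \<otimes> (h [^] (e - i - 1) \<otimes> b i)"
      using hc bcar[of i] i ee by (simp add: m_assoc)
    moreover have "?u [^] (e - i) = c [^] (j * (e - i))" using cc by (simp add: nat_pow_pow)
    moreover have "h [^] (e - i - 1) \<otimes> b i \<in> ?A" using hnA b(1)[of i] i ee Acl by auto
    ultimately show ?thesis using cancel[OF a(1)[OF i]] by metis
  qed
  then have "\<forall>i. \<exists>z. i < e \<longrightarrow> z \<in> ?A \<and> a i = h \<otimes> z" by blast
  then obtain z where z: "\<And>i. i < e \<Longrightarrow> z i \<in> ?A" "\<And>i. i < e \<Longrightarrow> a i = h \<otimes> z i" by metis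
  interpret sT: cring_sub R T s by (rule pw_cring_sub[OF T(1) sc])
  have "pe z e s \<in> T"
    using sT.pw_subset[OF T(1) order_refl s(1), of e] sT.pwI[of e z] z(1) T(4) by blast
  moreover have "s [^] e = h \<otimes> pe z e s"
  proof -
    have "pe a e s = pe (\<lambda>i. h \<otimes> z i) e s" by (rule pe_cong) (rule z(2))
    also have "\<dots> = h \<otimes> pe z e s" using z(1) Ac hc sc by (intro pe_smult) auto
    finally show ?thesis using a(2) by simp
  qed
  \<comment> \<open>All lower coefficients of the minimal equation of \<open>s\<close> are multiples
    of \<open>h\<close>, and \<open>h\<close> lies in \<open>P\<close>; primality then contradicts
    \<open>s \<notin> P\<close>.\<close>
  ultimately have "s [^] e \<in> P"
    using ideal_ofD(4)[OF prime_ofD(1)[OF P(1)], of "pe z e s" h] P(2) hc Tc by (simp add: m_comm)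
  moreover have "s [^] n \<notin> P" for n :: nat
  proof (induction n)
    case 0
    then show ?case using prime_ofD(2)[OF P(1)] by simp
  next
    case (Suc n)
    have "s [^] n \<in> T" using s(1) sT.A_closed by (induction n) auto
    then show ?case using prime_ofD(3)[OF P(1), of "s [^] n" s] Suc s by auto
  qed
  ultimately show False by blast
qed

text \<open>The constant term \<open>c\<close> of the minimal equation of \<open>g\<close> is a
  multiple of \<open>g\<close> and a nonconstant polynomial in the coordinates, so Nagata's
  substitution makes it a coordinate. Another coordinate \<open>x1\<close> is algebraic over
  \<open>K\<close> modulo \<open>P\<close> and is replaced by a polynomial \<open>h\<close> in
  \<open>x1\<close> that lies in \<open>P\<close>. This takes two coordinates, whence
  \<open>card Z \<ge> 2\<close>.\<close>

lemma adapted_normalization: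
  assumes ac: "algebraically_closed R" and S: "finite S" "S \<subseteq> carrier R"
    and P: "prime_of (gen S) P" "\<And>Y. Y \<subseteq> gen S \<Longrightarrow> indm P Y \<Longrightarrow> Y = {}"
    and g: "g \<in> P" "g \<noteq> \<zero>"
    and Z: "finite Z" "Z \<subseteq> gen S" "ai Z" "card Z \<ge> 2"
  obtains Y h c t0 where "finite Y" "ai Y" "h \<in> Y" "c \<in> gen (Y - {h})" "c \<noteq> \<zero>" "h \<in> P" "t0 \<in> gen S" "c = g \<otimes> t0"
    "gen Y \<subseteq> gen S" "fin_over (gen Y) (gen S)" "gen S \<subseteq> cl Y"
proof -
  let ?T = "gen S"
  have T: "subring ?T R" by (rule subring_gen[OF S(2)])
  note Tcl = subringE(2,3)[OF T] subringE(5-7)[OF T] and Tc = subringE(1)[OF T, THEN subsetD]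
  note Pi = ideal_ofD[OF prime_ofD(1)[OF P(1)]]
  have KT: "K \<subseteq> ?T" by (rule subsetI) (rule gen_incl(2))
  have unitP: "a \<notin> P" if "a \<in> K" "a \<noteq> \<zero>" for a using prime_unit[OF P(1) KT that] .
  have gT: "g \<in> ?T" and gc: "g \<in> carrier R" using g(1) Pi(1) Tc by auto
  obtain Y0 where Y0: "finite Y0" "Y0 \<subseteq> ?T" "ai Y0" "fin_over (gen Y0) ?T" "S \<subseteq> cl Y0"
    using noether_normalization[OF S] by blast
  have Y0c: "Y0 \<subseteq> carrier R" by (rule ai_carrier[OF Y0(3)])
  have TY0: "?T \<subseteq> cl Y0" by (rule gen_subset_cl_iff[OF Y0(5) Y0c])
  have card2: "card Y0 \<ge> 2"
  proof -
    have "Z \<subseteq> cl Y0" using Z(2) TY0 by blast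
    then have "card Z \<le> card Y0" by (rule exchange_card[OF Y0(1) Z(1) Y0c Z(3)])
    then show ?thesis using Z(4) by linarith
  qed
  let ?A0 = "gen Y0"
  have A0: "subring ?A0 R" by (rule subring_gen[OF Y0c])
  have A0T: "?A0 \<subseteq> ?T" using KT Y0(2) by (intro gen_min[OF T]) auto
  note A0c = subringE(1)[OF A0, THEN subsetD]
  obtain e a where a: "\<And>i. i < e \<Longrightarrow> a i \<in> ?A0" "g [^] e = pe a e g"
    and ia: "\<And>c i. (\<And>i. i < e \<Longrightarrow> c i \<in> ?A0) \<Longrightarrow> pe c e g = \<zero> \<Longrightarrow> i < e \<Longrightarrow> c i = \<zero>"
    using min_poly_cic[OF ac A0 cic_gen[OF Y0(1,3)] T Y0(4) gT cl_not_trans] TY0 gT by blast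
  have "e \<noteq> 0" using a(2) by (intro notI) simp
  then obtain e1 where e1: "e = Suc e1" by (cases e) auto
  have ac': "\<And>i. i < e \<Longrightarrow> a i \<in> carrier R" using a(1) A0c by blast
  let ?b = "\<lambda>i. a (Suc i)"
  let ?w = "pe ?b e1 g"
  \<comment> \<open>All terms of the minimal equation of \<open>g\<close> other than the constant
    one carry a factor \<open>g\<close>; this is the cofactor of \<open>g\<close> in the constant
    term.\<close>
  let ?t0 = "g [^] e1 \<oplus> \<ominus> ?w"
  let ?c = "a 0"
  have wT: "?w \<in> ?T"
  proof -
    interpret gT: cring_sub R ?T g by (rule pw_cring_sub[OF T gc])
    show ?thesis using gT.pw_subset[OF T order_refl gT, of e1] gT.pwI[of e1 ?b] a(1) e1 A0T by blast
  qed
  have wc: "?w \<in> carrier R" using Tc[OF wT] .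
  have gT': "g [^] n \<in> ?T" for n :: nat using gT Tcl by (induction n) auto
  have t0: "?t0 \<in> ?T" using gT' wT Tcl by auto
  have c_eq: "?c = g \<otimes> ?t0"
  proof -
    have "g [^] Suc e1 = ?w \<otimes> g \<oplus> ?c"
      using a(2) pe_Suc_shift[of e1 a g] ac' e1 gc by simp
    then have "g \<otimes> ?t0 = (?w \<otimes> g \<oplus> ?c) \<oplus> \<ominus> (?w \<otimes> g)"
      using gc wc by (simp add: r_distr r_minus m_comm)
    also have "\<dots> = ?c" using gc wc ac'[of 0] e1
      by (simp add: a_comm[of "?w \<otimes> g" ?c] a_assoc r_neg)
    finally show ?thesis by simp
  qed
  \<comment> \<open>With vanishing constant term, the equation could be divided by \<open>g\<close>,
    against the minimality of its degree.\<close>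
  have c0: "?c \<noteq> \<zero>"
  proof
    assume "?c = \<zero>"
    then have "?t0 = \<zero>" using c_eq g(2) gc Tc[OF t0] by (metis integral)
    then have ge: "g [^] e1 = ?w" using gc wc by (simp add: minus_eq[symmetric])
    let ?d = "\<lambda>i. if i = e1 then \<ominus> \<one> else ?b i"
    have "pe ?d e g = \<ominus> \<one> \<otimes> g [^] e1 \<oplus> ?w" using e1 pe_cong[of e1 ?d ?b g] by simp
    also have "\<dots> = \<zero>" using ge gc wc by (simp add: l_minus l_neg)
    finally have z: "pe ?d e g = \<zero>" .
    have dA: "?d i \<in> ?A0" if "i < e" for i using a(1)[of "Suc i"] e1 that subringE(3,5)[OF A0] by auto
    have "?d e1 = \<zero>"
    proof (rule ia[of ?d e1])
      show "?d i \<in> ?A0" if "i < e" for i by (rule dA[OF that])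
      show "pe ?d e g = \<zero>" by (rule z)
    qed (simp add: e1)
    then show False by simp
  qed
  have cP: "?c \<in> P" using c_eq Pi(4)[OF t0 g(1)] gc Tc[OF t0] by (simp add: m_comm)
  have "?c \<in> ?A0" using a(1) e1 by simp
  then obtain p where p: "p \<in> IP Y0" "?c = ev p" unfolding ev_image[OF Y0c] by blast
  \<comment> \<open>A nonzero constant of \<open>K\<close> is a unit and cannot lie in
    \<open>P\<close>, whereas \<open>?c\<close> does. So the polynomial involves a variable, as the
    substitution demands.\<close>
  have "\<exists>m0. m0 \<noteq> {#} \<and> p m0 \<noteq> \<zero>"
  proof (rule ccontr)
    assume "\<not> ?thesis"
    then have "p = indexed_const (p {#})" by (auto simp: indexed_const_def fun_eq_iff)
    then have "ev p \<in> K" using ev_const[of "p {#}"] IP_K[OF p(1)] by metis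
    then show False using unitP c0 cP p(2) by simp
  qed
  then obtain m0 where m0: "m0 \<noteq> {#}" "p m0 \<noteq> \<zero>" by blast
  obtain S' where S': "finite S'" "S' \<subseteq> gen Y0" "card S' < card Y0"
    "fin_over (gen (insert ?c S')) (gen Y0)" "Y0 \<subseteq> cl (insert ?c S')"
    using nagata[OF Y0(1) Y0c p(1) m0] p(2) by metis
  define V1 where "V1 = insert ?c S'"
  have Y1A0: "V1 \<subseteq> ?A0" using S'(2) \<open>?c \<in> ?A0\<close> unfolding V1_def by blast
  note S'45 = S'(4,5)[folded V1_def]
  have Y1c: "V1 \<subseteq> carrier R" using Y1A0 A0c by blast
  have "card V1 \<le> card Y0" unfolding V1_def using S'(1,3) card_insert_le_m1[of "card Y0" S' ?c] by (simp add: card_insert_if)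
  \<comment> \<open>The new generators are no more numerous than the basis \<open>Y0\<close> and
    span it, so they form a basis; in particular \<open>?c\<close> is not among the elements of
    \<open>S'\<close>.\<close>
  note Y1 = count_basis[OF _ Y1c Y0(3,1) S'45(2) this]
  have aiY1: "ai V1" "card V1 = card Y0" using Y1 S'(1) by (auto simp: V1_def)
  have cS': "?c \<notin> S'" using aiY1(2) S'(3) by (auto simp: insert_absorb V1_def)
  \<comment> \<open>With at least two coordinates, one is left besides \<open>?c\<close>.\<close>
  have "S' \<noteq> {}" using aiY1(2) card2 by (auto simp: V1_def)
  then obtain x1 where x1: "x1 \<in> S'" by blast
  have x1T: "x1 \<in> ?T" and x1c: "x1 \<in> carrier R" using x1 S'(2) A0T Tc by auto
  have "\<not> indm P {x1}" using P(2)[of "{x1}"] x1T by auto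
  then obtain k n i where k: "\<And>i. i < n \<Longrightarrow> k i \<in> K" "i < n" "k i \<noteq> \<zero>" "pe k n x1 \<in> P"
    using not_indm_relation[OF x1T T KT P(1)] by blast
  define h where "h = pe k n x1"
  have aix: "ai {x1}" using alg_indep_subset[OF aiY1(1), of "{x1}"] x1 by (simp add: V1_def)
  have h0: "h \<noteq> \<zero>" unfolding h_def using ai_pe_nonzero[OF aix, of n k i] k(1-3) by blast
  have hP: "h \<in> P" using k(4) by (simp add: h_def)
  have hT: "h \<in> ?T" and hc: "h \<in> carrier R" using hP Pi(1) Tc by auto
  define V2 where "V2 = insert h (V1 - {x1})"
  have Y2c: "V2 \<subseteq> carrier R" using Y1c hc by (auto simp: V2_def)
  have hV2: "h \<in> V2" by (simp add: V2_def)
  let ?B = "gen V2"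
  have B: "subring ?B R" by (rule subring_gen[OF Y2c])
  have Bh: "h \<in> ?B" by (rule gen_incl(1)[OF hV2])
  have KB: "K \<subseteq> ?B" by (rule subsetI) (rule gen_incl(2))
  interpret xK: cring_sub R K x1 by (rule pw_cring_sub[OF subring_K x1c])
  interpret xB: cring_sub R ?B x1 by (rule pw_cring_sub[OF B x1c])
  have "h \<in> pw K x1 n" unfolding h_def using k(1) by (intro xK.pwI) auto
  then obtain d l where d: "xK.lead d l h" using xK.lead_exists h0 by metis
  then obtain w where w: "l \<in> K" "l \<noteq> \<zero>" "w \<in> pw K x1 d" "h = l \<otimes> x1 [^] d \<oplus> w" unfolding xK.lead_def by blast
  \<comment> \<open>In degree zero \<open>h\<close> would be a unit of \<open>K\<close> inside
    \<open>P\<close>. Positive degree makes \<open>h = pe k n x1\<close> an integral equation for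
    \<open>x1\<close> over the new coordinates.\<close>
  have d0: "d \<noteq> 0"
  proof
    assume "d = 0"
    then have "h = l" using w by (simp add: xK.pw_0)
    then show False using unitP[OF w(1,2)] hP by simp
  qed
  have wB: "w \<in> pw ?B x1 d" using w(3) KB unfolding pw_def by blast
  have "inv l \<otimes> (h \<ominus> w) = x1 [^] d"
  proof -
    have car: "l \<in> carrier R" "inv l \<in> carrier R" "w \<in> carrier R" "inv l \<otimes> l = \<one>" using w inv_nz[of l] by auto
    have "h \<ominus> w = l \<otimes> x1 [^] d" unfolding w(4) using car x1c by (simp add: minus_eq a_assoc r_neg)
    then have "inv l \<otimes> (h \<ominus> w) = (inv l \<otimes> l) \<otimes> x1 [^] d" using car(1-3) x1c by (simp add: m_assoc)
    then show ?thesis using car x1c by simp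
  qed
  moreover have "inv l \<otimes> (h \<ominus> w) \<in> pw ?B x1 d"
  proof -
    have "h \<in> pw ?B x1 (Suc 0)" using Bh by simp
    then have "h \<in> pw ?B x1 d" by (rule xB.pw_mono) (use d0 in simp)
    then show ?thesis using wB K_inv[OF w(1,2)] KB by auto
  qed
  ultimately have xd: "x1 [^] d \<in> pw ?B x1 d" by simp
  have Y1adj: "V1 \<subseteq> adj ?B x1"
  proof
    fix y assume "y \<in> V1"
    then consider "y = x1" | "y \<in> V2" by (auto simp: V2_def)
    then show "y \<in> adj ?B x1" using xB.adj_mem xB.adj_incl gen_incl(1) by cases auto
  qed
  have gY1: "gen V1 \<subseteq> adj ?B x1"
    using KB xB.adj_incl Y1adj by (intro gen_min[OF xB.subring_adj]) auto
  have fin1: "fin_over ?B (gen V1)" using xB.adj_fin_over[OF xd] gY1 unfolding fin_over_def by blast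
  have "\<not> trans_over ?B x1"
  proof
    assume t: "trans_over ?B x1"
    have "\<one> \<otimes> x1 [^] d \<oplus> \<zero> \<in> pw ?B x1 d" using xd x1c by simp
    then show False using xB.lead_trans[OF t, of \<one> \<zero> d] by simp
  qed
  then have "x1 \<in> cl V2" unfolding cl_def using x1c by simp
  then have "adj ?B x1 \<subseteq> cl V2"
    by (intro xB.adj_min subfieldE(1)[OF subfield_cl[OF Y2c]] gen_subset_cl[OF Y2c])
  then have Y1cl: "V1 \<subseteq> cl V2" using Y1adj by blast
  have fY: "finite (V1 - {x1})" "x1 \<in> V1" "finite V1" using S'(1) x1 by (auto simp: V1_def)
  have "card V2 \<le> Suc (card (V1 - {x1}))" unfolding V2_def using fY(1) by (simp add: card_insert_if)
  also have "\<dots> = card V1" using fY by (intro card_Suc_Diff1)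
  finally have cle: "card V2 \<le> card V1" .
  have finY2: "finite V2" using fY by (simp add: V2_def)
  note Y2 = count_basis[OF finY2 Y2c aiY1(1) fY(3) Y1cl cle]
  have hn: "h \<notin> V1 - {x1}"
  proof
    assume "h \<in> V1 - {x1}"
    then have "card V2 = card (V1 - {x1})" by (simp add: insert_absorb V2_def)
    then show False using Y2(2) card_Suc_Diff1[OF fY(3,2)] by simp
  qed
  have cY: "?c \<in> V2 - {h}" using cS' x1 hn by (auto simp: V1_def V2_def)
  show thesis
  proof (rule that[of V2 h ?c ?t0])
    show "?c \<in> gen (V2 - {h})" by (rule gen_incl(1)[OF cY])
    show "gen V2 \<subseteq> gen S" using KT hT Y1A0 A0T by (intro gen_min[OF T]) (auto simp: V2_def)
    have "fin_over ?B ?A0" by (rule fin_over_trans[OF B subring_gen[OF Y1c] fin1 S'45(1)])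
    then show "fin_over (gen V2) (gen S)" by (rule fin_over_trans[OF B A0 _ Y0(4)])
    have "cl V1 \<subseteq> cl V2" by (rule cl_least[OF Y2c Y1cl])
    then have "Y0 \<subseteq> cl V2" using S'45(2) by blast
    then have "cl Y0 \<subseteq> cl V2" by (rule cl_least[OF Y2c])
    then show "gen S \<subseteq> cl V2" using TY0 by blast
  qed (use finY2 Y2 c0 hP t0 c_eq hV2 in auto)
qed

text \<open>The prime is chosen to contain \<open>h\<close> and to miss all products of an element
  outside \<open>P\<close> with a power of \<open>c\<close>. Missing the complement of
  \<open>P\<close> puts it inside \<open>P\<close>; missing \<open>c\<close>, a multiple of
  \<open>g\<close>, keeps \<open>g\<close> out. That the two demands are compatible is the content
  of \<open>going_down\<close>.\<close>

lemma smaller_prime_closed: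
  assumes ac: "algebraically_closed R" and S: "finite S" "S \<subseteq> carrier R"
    and P: "prime_of (gen S) P" "\<And>Y. Y \<subseteq> gen S \<Longrightarrow> indm P Y \<Longrightarrow> Y = {}"
    and g: "g \<in> P" "g \<noteq> \<zero>"
    and Z: "finite Z" "Z \<subseteq> gen S" "ai Z" "card Z \<ge> 2"
  shows "\<exists>Q. prime_of (gen S) Q \<and> Q \<subseteq> P \<and> g \<notin> Q \<and> (\<exists>h\<in>Q. h \<noteq> \<zero>)"
proof -
  obtain Y h c t0 where Y: "finite Y" "ai Y" "h \<in> Y" "c \<in> gen (Y - {h})" "c \<noteq> \<zero>" "h \<in> P" "t0 \<in> gen S" "c = g \<otimes> t0"
    "gen Y \<subseteq> gen S" "fin_over (gen Y) (gen S)" "gen S \<subseteq> cl Y"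
    using adapted_normalization[OF assms] by blast
  let ?T = "gen S"
  have T: "subring ?T R" by (rule subring_gen[OF S(2)])
  note Tcl = subringE(2,3)[OF T] subringE(5-7)[OF T] and Tc = subringE(1)[OF T, THEN subsetD]
  note Pi = ideal_ofD[OF prime_ofD(1)[OF P(1)]]
  have gc: "g \<in> ?T" using g(1) Pi(1) by auto
  have hT: "h \<in> ?T" using Y(6) Pi(1) by auto
  have cT: "c \<in> ?T" using Y(7,8) gc Tcl by auto
  have cnT: "c [^] n \<in> ?T" for n :: nat using cT Tcl by (induction n) auto
  have car: "g \<in> carrier R" "h \<in> carrier R" "c \<in> carrier R" "t0 \<in> carrier R" using gc hT cT Y(7) Tc by auto
  let ?I = "{h \<otimes> t | t. t \<in> ?T}" and ?M = "{s \<otimes> c [^] (j::nat) | s j. s \<in> ?T \<and> s \<notin> P}"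
  have I: "ideal_of ?T ?I"
    unfolding ideal_of_def
  proof (intro conjI ballI)
    show "?I \<subseteq> ?T" using hT Tcl by auto
    have "\<zero> = h \<otimes> \<zero>" using car by simp
    then show "\<zero> \<in> ?I" using Tcl(1) by blast
    fix x y assume "x \<in> ?I" "y \<in> ?I"
    then obtain t t' where *: "x = h \<otimes> t" "y = h \<otimes> t'" "t \<in> ?T" "t' \<in> ?T" by blast
    then have "x \<oplus> y = h \<otimes> (t \<oplus> t')" using car Tc by (simp add: r_distr)
    moreover have "t \<oplus> t' \<in> ?T" by (rule Tcl(5)[OF *(3,4)])
    ultimately show "x \<oplus> y \<in> ?I" by blast
  next
    fix a x assume a: "a \<in> ?T" and "x \<in> ?I"
    then obtain t where *: "x = h \<otimes> t" "t \<in> ?T" by blast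
    then have "a \<otimes> x = h \<otimes> (a \<otimes> t)" using car Tc a by (simp add: m_lcomm)
    moreover have "a \<otimes> t \<in> ?T" by (rule Tcl(4)[OF a *(2)])
    ultimately show "a \<otimes> x \<in> ?I" by blast
  qed
  have one: "\<one> \<in> ?M"
  proof -
    have "\<one> = \<one> \<otimes> c [^] (0::nat)" by simp
    then show ?thesis using Tcl(2) prime_ofD(2)[OF P(1)] by blast
  qed
  have mult: "x \<otimes> y \<in> ?M" if xy: "x \<in> ?M" "y \<in> ?M" for x y
  proof -
    obtain s i s' j where *: "x = s \<otimes> c [^] (i::nat)" "y = s' \<otimes> c [^] (j::nat)" "s \<in> ?T" "s \<notin> P" "s' \<in> ?T" "s' \<notin> P"
      using xy by blast
    then have "s \<in> carrier R" "s' \<in> carrier R" using Tc by auto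
    then have "x \<otimes> y = (s \<otimes> s') \<otimes> c [^] (i + j)"
      unfolding *(1,2) using car by (simp add: nat_pow_mult[symmetric] m_ac)
    moreover have "s \<otimes> s' \<in> ?T" by (rule Tcl(4)[OF *(3,5)])
    moreover have "s \<otimes> s' \<notin> P" using prime_ofD(3)[OF P(1) *(3,5)] *(4,6) by blast
    ultimately show ?thesis by blast
  qed
  have disj: "?I \<inter> ?M = {}"
    using going_down[OF ac Y(1-5) T Y(10,11,9) P(1) Y(6)] by force
  have MT: "?M \<subseteq> ?T" using cnT Tcl by auto
  obtain Q where Q: "prime_of ?T Q" "?I \<subseteq> Q" "Q \<inter> ?M = {}"
    using exists_prime_avoiding[OF T I MT one mult disj] .
  have QT: "Q \<subseteq> ?T" using ideal_ofD(1)[OF prime_ofD(1)[OF Q(1)]] .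
  have "Q \<subseteq> P"
  proof
    fix q assume q: "q \<in> Q"
    have "q = q \<otimes> c [^] (0::nat)" using q QT Tc by auto
    then have "q \<in> ?M" if "q \<notin> P" using that q QT by blast
    then show "q \<in> P" using q Q(3) by blast
  qed
  moreover have "g \<notin> Q"
  proof
    assume "g \<in> Q"
    then have "t0 \<otimes> g \<in> Q" using ideal_ofD(4)[OF prime_ofD(1)[OF Q(1)] Y(7)] by blast
    then have "c \<in> Q" using Y(8) car by (simp add: m_comm)
    moreover have "c = \<one> \<otimes> c [^] (1::nat)" using car by simp
    then have "c \<in> ?M" using Tcl(2) prime_ofD(2)[OF P(1)] by blast
    ultimately show False using Q(3) by blast
  qed
  moreover have "h \<in> Q"
  proof -
    have "h = h \<otimes> \<one>" using car by simp
    then have "h \<in> ?I" using Tcl(2) by blast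
    then show ?thesis using Q(2) by blast
  qed
  moreover have "h \<noteq> \<zero>"
  proof -
    have Yc: "Y \<subseteq> carrier R" by (rule ai_carrier[OF Y(2)])
    have ins: "insert h (Y - {h}) = Y" using Y(3) by auto
    have "trans_over (gen (Y - {h})) h" using alg_indep_insert[of h "Y - {h}"] Y(2) Yc car ins by auto
    then show ?thesis
      using cring_sub.trans_over_nonzero[OF pw_cring_sub[OF subring_gen]] Yc car by (metis Diff_subset one_not_zero order_trans)
  qed
  ultimately show ?thesis using Q(1) by blast
qed

lemma ai_card_bound:
  assumes "finite S" "S \<subseteq> carrier R" "finite Y" "ai Y" "Y \<subseteq> gen S"
  shows "card Y \<le> card S"
proof -
  obtain B where B: "B \<subseteq> S" "ai B" "S \<subseteq> cl B" using basis_in_finite[OF assms(1,2)] by blast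
  have Bc: "B \<subseteq> carrier R" "finite B" using B(1) assms(1,2) finite_subset by auto
  have "Y \<subseteq> cl B" using gen_subset_cl_iff[OF B(3) Bc(1)] assms(5) by blast
  then have "card Y \<le> card B" by (rule exchange_card[OF Bc(2) assms(3) Bc(1) assms(4)])
  also have "\<dots> \<le> card S" by (rule card_mono[OF assms(1) B(1)])
  finally show ?thesis .
qed

text \<open>Among the primes inside \<open>P\<close> that avoid \<open>g\<close>, take one with the
  least bound for its independent sets. If the bound exceeded one,
  \<open>smaller_prime_closed\<close> in an algebraically closed residue field would yield a
  strictly larger prime that still avoids \<open>g\<close>, and an element of the difference would
  lower the bound. The minimal choice stands in for a repeated passage to residue fields.\<close>

theorem dimension_one_prime:
  assumes S: "finite S" "S \<subseteq> carrier R" and P: "prime_of (gen S) P"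
    and mx: "\<And>J. ideal_of (gen S) J \<Longrightarrow> P \<subseteq> J \<Longrightarrow> \<one> \<notin> J \<Longrightarrow> J = P"
    and g: "g \<in> P" "g \<noteq> \<zero>"
  shows "\<exists>Q. prime_of (gen S) Q \<and> Q \<subseteq> P \<and> g \<notin> Q \<and> (\<forall>Y. finite Y \<longrightarrow> Y \<subseteq> gen S \<longrightarrow> indm Q Y \<longrightarrow> card Y \<le> 1)"
proof -
  let ?T = "gen S"
  have T: "subring ?T R" by (rule subring_gen[OF S(2)])
  have KT: "K \<subseteq> ?T" by (rule subsetI) (rule gen_incl(2))
  define good where "good Q \<longleftrightarrow> prime_of ?T Q \<and> Q \<subseteq> P \<and> g \<notin> Q" for Q
  define bd where "bd Q n \<longleftrightarrow> (\<forall>Y. finite Y \<longrightarrow> Y \<subseteq> ?T \<longrightarrow> indm Q Y \<longrightarrow> card Y \<le> n)" for Q n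
  have "bd Q (card S)" for Q unfolding bd_def using ai_card_bound[OF S] indm_ai by blast
  moreover have "good {\<zero>}" unfolding good_def
    using zero_prime[OF T] g ideal_ofD(2)[OF prime_ofD(1)[OF P]] by auto
  ultimately have "\<exists>n Q. good Q \<and> bd Q n" by blast
  then have ex: "\<exists>n. \<exists>Q. good Q \<and> bd Q n" .
  define n where "n = (LEAST n. \<exists>Q. good Q \<and> bd Q n)"
  have n: "\<exists>Q. good Q \<and> bd Q n" "\<And>m. (\<exists>Q. good Q \<and> bd Q m) \<Longrightarrow> n \<le> m"
    unfolding n_def by (rule LeastI_ex[OF ex]) (rule Least_le)
  then obtain Q where Q: "good Q" "bd Q n" by blast
  have "n \<le> 1"
  proof (rule ccontr)
    assume "\<not> n \<le> 1"
    have "\<not> bd Q (n - 1)"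
    proof
      assume "bd Q (n - 1)"
      then have "n \<le> n - 1" by (intro n(2)) (use Q(1) in blast)
      then show False using \<open>\<not> n \<le> 1\<close> by simp
    qed
    then obtain Y where "finite Y" "Y \<subseteq> ?T" "indm Q Y" "\<not> card Y \<le> n - 1" unfolding bd_def by blast
    then have Y: "finite Y" "Y \<subseteq> ?T" "indm Q Y" "card Y \<ge> n" by auto
    have Qp: "prime_of ?T Q" "Q \<subseteq> P" "g \<notin> Q" using Q(1) unfolding good_def by auto
    obtain E :: "((('a set \<times> 'a set) set list \<times> nat) multiset \<Rightarrow> ('a set \<times> 'a set) set) ring" and h
      where E: "algebraically_closed E" "residue_field R K E S h Q" using residue_fieldI[OF S(2) Qp(1)] by blast
    interpret h: residue_field R K E S h Q by (rule E(2))
    note Pi = ideal_ofD[OF prime_ofD(1)[OF P]]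
    have PT: "P \<subseteq> ?T" by (rule Pi(1))
    have gT: "g \<in> ?T" using g PT by auto
    \<comment> \<open>As \<open>P\<close> contains the kernel \<open>Q\<close>, it is the full
      preimage of its image; so its image is again a maximal ideal.\<close>
    have hinv: "t \<in> P" if t: "t \<in> ?T" "h t \<in> h ` P" for t
    proof -
      obtain p where p: "p \<in> P" "h t = h p" using t(2) by blast
      then have pT: "p \<in> ?T" using PT by blast
      have mp: "\<ominus> p \<in> ?T" "t \<oplus> \<ominus> p \<in> ?T" using pT t(1) h.T_closed by auto
      have "h (t \<oplus> \<ominus> p) \<oplus>\<^bsub>E\<^esub> h p = h t"
      proof -
        have "t \<oplus> \<ominus> p \<oplus> p = t" using pT t(1) h.T_carrier by (simp add: a_assoc l_neg)
        then show ?thesis using h.h_simps(2)[OF mp(2) pT] by simp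
      qed
      then have "h (t \<oplus> \<ominus> p) = \<zero>\<^bsub>E\<^esub>"
      proof -
        have "h (t \<oplus> \<ominus> p) \<oplus>\<^bsub>E\<^esub> h p = \<zero>\<^bsub>E\<^esub> \<oplus>\<^bsub>E\<^esub> h p"
          using \<open>h (t \<oplus> \<ominus> p) \<oplus>\<^bsub>E\<^esub> h p = h t\<close> p(2) h.h_simps(1)[OF pT] by simp
        then show ?thesis
          using h.h_simps(1)[OF mp(2)] h.h_simps(1)[OF pT] h.E.add.r_cancel[of "h p" "h (t \<oplus> \<ominus> p)" "\<zero>\<^bsub>E\<^esub>"]
          by simp
      qed
      then have "t \<oplus> \<ominus> p \<in> Q" using h.ker_h mp(2) by blast
      then have "t \<oplus> \<ominus> p \<oplus> p \<in> P" using Qp(2) Pi(3) p(1) by blast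
      then show ?thesis using pT t(1) h.T_carrier by (simp add: a_assoc l_neg)
    qed
    let ?T' = "h.E.gen (h ` S)" and ?P' = "h ` P"
    have T': "?T' = h ` ?T" by (rule h.hT)
    have P': "h.E.prime_of ?T' ?P'"
      unfolding h.E.prime_of_def h.E.ideal_of_def T'
    proof (intro conjI ballI impI)
      show "?P' \<subseteq> h ` ?T" using PT by auto
      show "\<zero>\<^bsub>E\<^esub> \<in> ?P'" using Pi(2) h.h_simps(5) by (metis imageI)
      show "x \<oplus>\<^bsub>E\<^esub> y \<in> ?P'" if xy: "x \<in> ?P'" "y \<in> ?P'" for x y
      proof -
        obtain p q where "p \<in> P" "q \<in> P" "x = h p" "y = h q" using xy by blast
        then show ?thesis using Pi(3) h.h_simps(2)[of p q] PT by (metis imageI subsetD)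
      qed
      show "a \<otimes>\<^bsub>E\<^esub> x \<in> ?P'" if xy: "a \<in> h ` ?T" "x \<in> ?P'" for a x
      proof -
        obtain p q where "p \<in> ?T" "q \<in> P" "a = h p" "x = h q" using xy by blast
        then show ?thesis using Pi(4) h.h_simps(3)[of p q] PT by (metis imageI subsetD)
      qed
      show "\<one>\<^bsub>E\<^esub> \<notin> ?P'" using hinv[of \<one>] h.T_closed(2) prime_ofD(2)[OF P] by auto
      fix a b assume ab: "a \<in> h ` ?T" "b \<in> h ` ?T" "a \<otimes>\<^bsub>E\<^esub> b \<in> ?P'"
      then obtain p q where pq: "p \<in> ?T" "q \<in> ?T" "a = h p" "b = h q" by blast
      then have "p \<otimes> q \<in> P" using hinv[of "p \<otimes> q"] ab(3) h.T_closed by simp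
      then show "a \<in> ?P' \<or> b \<in> ?P'" using prime_ofD(3)[OF P pq(1,2)] pq by blast
    qed
    have mx': "W = {}" if W: "W \<subseteq> ?T'" "h.E.indm ?P' W" for W
    proof (rule h.E.maximal_indm_empty[OF _ h.hS_carrier P' _ W])
      show "finite (h ` S)" using S(1) by simp
      fix J assume J: "h.E.ideal_of ?T' J" "?P' \<subseteq> J" "\<one>\<^bsub>E\<^esub> \<notin> J"
      note Ji = h.E.ideal_ofD[OF J(1)]
      let ?J = "{t \<in> ?T. h t \<in> J}"
      have "ideal_of ?T ?J" unfolding ideal_of_def using Ji(2-4) h.T_closed T' by auto
      moreover have "P \<subseteq> ?J" using J(2) PT by auto
      moreover have "\<one> \<notin> ?J" using J(3) by simp
      ultimately have JP: "?J = P" by (rule mx)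
      show "J = ?P'"
      proof (rule antisym[OF subsetI J(2)])
        fix x assume x: "x \<in> J"
        then have "x \<in> h ` ?T" using Ji(1) unfolding T' by (rule subsetD[rotated])
        then obtain t where t: "t \<in> ?T" "x = h t" by (elim imageE) simp
        then have "t \<in> P" using x JP by auto
        then show "x \<in> ?P'" using t(2) by simp
      qed
    qed
    have "h.E.ai (h ` Y)" "inj_on h Y" using h.indm_iff[OF Y(1,2)] Y(3) by auto
    moreover have "card (h ` Y) \<ge> 2" using calculation(2) Y(4) \<open>\<not> n \<le> 1\<close> by (simp add: card_image)
    moreover have "h g \<noteq> \<zero>\<^bsub>E\<^esub>" using h.ker_h[OF gT] Qp(3) by simp
    ultimately have "\<exists>Q'. h.E.prime_of ?T' Q' \<and> Q' \<subseteq> ?P' \<and> h g \<notin> Q' \<and> (\<exists>x\<in>Q'. x \<noteq> \<zero>\<^bsub>E\<^esub>)"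
      using S(1) Y(1,2) g(1) T' by (intro h.E.smaller_prime_closed[OF E(1) _ h.hS_carrier P' mx', of "h g" "h ` Y"]) auto
    then obtain Q' x where Q': "h.E.prime_of ?T' Q'" "Q' \<subseteq> ?P'" "h g \<notin> Q'" "x \<in> Q'" "x \<noteq> \<zero>\<^bsub>E\<^esub>" by blast
    \<comment> \<open>The nonzero element of \<open>Q'\<close> shows that this preimage is strictly
      larger than \<open>Q\<close>. A lift \<open>f\<close> of it enlarges every set that is
      independent modulo \<open>?Q\<close> to one that is independent modulo
      \<open>Q\<close>.\<close>
    let ?Q = "{t \<in> ?T. h t \<in> Q'}"
    have Q2: "prime_of ?T ?Q" "Q \<subseteq> ?Q" using h.prime_preimage[of Q'] Q'(1) T' by auto
    have "?Q \<subseteq> P" using hinv Q'(2) by auto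
    then have gQ: "good ?Q" unfolding good_def using Q2(1) Q'(3) by auto
    obtain f where f: "f \<in> ?T" "x = h f"
      using Q'(4) h.E.ideal_ofD(1)[OF h.E.prime_ofD(1)[OF Q'(1)]] T' by blast
    then have fQ: "f \<in> ?Q" "f \<notin> Q" using Q'(4,5) h.ker_h[OF f(1)] by auto
    have "bd ?Q (n - 1)"
      unfolding bd_def
    proof (intro allI impI)
      fix W assume W: "finite W" "W \<subseteq> ?T" "indm ?Q W"
      note * = indm_insert[OF T KT Qp(1) prime_ofD(1)[OF Q2(1)] Q2(2) W(2,3) fQ]
      have "card (insert f W) \<le> n" using Q(2) * W f(1) unfolding bd_def by auto
      then show "card W \<le> n - 1" using *(2) W(1) by simp
    qed
    then have "n \<le> n - 1" using n(2) gQ by blast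
    then show False using \<open>\<not> n \<le> 1\<close> by simp
  qed
  then have "\<forall>Y. finite Y \<longrightarrow> Y \<subseteq> ?T \<longrightarrow> indm Q Y \<longrightarrow> card Y \<le> 1" using Q(2) unfolding bd_def by (meson order_trans)
  then show ?thesis using Q(1) unfolding good_def by blast
qed

end

section \<open>Localization and chains of contracted primes\<close>

lemma (in ring) prime_of_contract:
  assumes "prime_of T P" "A \<subseteq> T" "subring A R"
  shows "prime_of A (P \<inter> A)"
  unfolding prime_of_def ideal_of_def
proof (intro conjI ballI impI)
  note P = prime_ofD[OF assms(1)] and Pi = ideal_ofD[OF prime_ofD(1)[OF assms(1)]]
  note cl = subringE(2,3,6,7)[OF assms(3)]
  show "P \<inter> A \<subseteq> A" "\<zero> \<in> P \<inter> A" "\<one> \<notin> P \<inter> A" using Pi(2) P(2) cl by auto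
  show "x \<oplus> y \<in> P \<inter> A" if "x \<in> P \<inter> A" "y \<in> P \<inter> A" for x y using that Pi(3) cl(4) by blast
  show "a \<otimes> x \<in> P \<inter> A" if "a \<in> A" "x \<in> P \<inter> A" for a x using that Pi(4) cl(3) assms(2) by blast
  show "a \<in> P \<inter> A \<or> b \<in> P \<inter> A" if "a \<in> A" "b \<in> A" "a \<otimes> b \<in> P \<inter> A" for a b
    using that P(3) assms(2) by blast
qed

locale localization = field R for R (structure) + fixes M
  assumes subring_M: "subring M R"
begin

text \<open>Localization at the nonzero elements of \<open>M\<close>, realized inside the ambient
  field and applicable to ideals as well as to rings.\<close>

definition loc :: "'a set \<Rightarrow> 'a set" where
  "loc B = {x \<in> carrier R. \<exists>d\<in>M. d \<noteq> \<zero> \<and> d \<otimes> x \<in> B}"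

lemma M_carrier: "a \<in> M \<Longrightarrow> a \<in> carrier R" using subringE(1)[OF subring_M] by blast
lemmas M_closed = subringE(2,3)[OF subring_M] subringE(5-7)[OF subring_M]

lemma M_mult: "d \<in> M \<Longrightarrow> d \<noteq> \<zero> \<Longrightarrow> e \<in> M \<Longrightarrow> e \<noteq> \<zero> \<Longrightarrow> d \<otimes> e \<in> M \<and> d \<otimes> e \<noteq> \<zero>"
  using M_closed(4) M_carrier by (auto simp: integral_iff)

lemma locE:
  assumes "x \<in> loc B" obtains d where "d \<in> M" "d \<noteq> \<zero>" "d \<otimes> x \<in> B" "x \<in> carrier R" "d \<in> carrier R"
  using assms M_carrier unfolding loc_def by blast

lemma locI: "d \<in> M \<Longrightarrow> d \<noteq> \<zero> \<Longrightarrow> d \<otimes> x \<in> B \<Longrightarrow> x \<in> carrier R \<Longrightarrow> x \<in> loc B"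
  unfolding loc_def by blast

lemma loc_incl: "B \<subseteq> carrier R \<Longrightarrow> B \<subseteq> loc B"
proof
  fix x assume "B \<subseteq> carrier R" "x \<in> B"
  then have "\<one> \<otimes> x \<in> B" "x \<in> carrier R" by auto
  then show "x \<in> loc B" using locI[OF M_closed(2)] by simp
qed

lemma loc_mono: "B \<subseteq> C \<Longrightarrow> loc B \<subseteq> loc C"
  unfolding loc_def by blast

lemma loc_add:
  assumes B: "\<And>a x. a \<in> M \<Longrightarrow> x \<in> B \<Longrightarrow> a \<otimes> x \<in> B" "\<And>x y. x \<in> B \<Longrightarrow> y \<in> B \<Longrightarrow> x \<oplus> y \<in> B"
    and "x \<in> loc B" "y \<in> loc B"
  shows "x \<oplus> y \<in> loc B"
proof -
  obtain d where d: "d \<in> M" "d \<noteq> \<zero>" "d \<otimes> x \<in> B" "x \<in> carrier R" "d \<in> carrier R" using assms(3) by (rule locE)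
  obtain e where e: "e \<in> M" "e \<noteq> \<zero>" "e \<otimes> y \<in> B" "y \<in> carrier R" "e \<in> carrier R" using assms(4) by (rule locE)
  have "(d \<otimes> e) \<otimes> (x \<oplus> y) = e \<otimes> (d \<otimes> x) \<oplus> d \<otimes> (e \<otimes> y)" using d e by algebra
  then have "(d \<otimes> e) \<otimes> (x \<oplus> y) \<in> B" using B d e by simp
  then show ?thesis using M_mult[OF d(1,2) e(1,2)] d e by (intro locI[of "d \<otimes> e"]) auto
qed

lemma loc_mult:
  assumes B: "\<And>a x. a \<in> C \<Longrightarrow> x \<in> B \<Longrightarrow> a \<otimes> x \<in> B" and "a \<in> loc C" "x \<in> loc B"
  shows "a \<otimes> x \<in> loc B"
proof -
  obtain d where d: "d \<in> M" "d \<noteq> \<zero>" "d \<otimes> a \<in> C" "a \<in> carrier R" "d \<in> carrier R" using assms(2) by (rule locE)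
  obtain e where e: "e \<in> M" "e \<noteq> \<zero>" "e \<otimes> x \<in> B" "x \<in> carrier R" "e \<in> carrier R" using assms(3) by (rule locE)
  have "(d \<otimes> e) \<otimes> (a \<otimes> x) = (d \<otimes> a) \<otimes> (e \<otimes> x)" using d e by algebra
  then have "(d \<otimes> e) \<otimes> (a \<otimes> x) \<in> B" using B d e by simp
  then show ?thesis using M_mult[OF d(1,2) e(1,2)] d e by (intro locI[of "d \<otimes> e"]) auto
qed

lemma loc_subring:
  assumes "subring B R" "M \<subseteq> B" shows "subring (loc B) R"
proof (rule subringI)
  note cl = subringE(2,3)[OF assms(1)] subringE(5-7)[OF assms(1)]
  have Bc: "B \<subseteq> carrier R" by (rule subringE(1)[OF assms(1)])
  show "loc B \<subseteq> carrier R" unfolding loc_def by blast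
  show "\<one> \<in> loc B" using loc_incl[OF Bc] cl by blast
  show "\<ominus> x \<in> loc B" if x: "x \<in> loc B" for x
  proof -
    obtain d where d: "d \<in> M" "d \<noteq> \<zero>" "d \<otimes> x \<in> B" "x \<in> carrier R" "d \<in> carrier R" using x by (rule locE)
    then have "d \<otimes> (\<ominus> x) \<in> B" using cl(3) by (simp add: r_minus)
    then show ?thesis using d by (intro locI[of d]) auto
  qed
  show "x \<otimes> y \<in> loc B" if "x \<in> loc B" "y \<in> loc B" for x y
    by (rule loc_mult[OF _ that]) (rule cl(4))
  show "x \<oplus> y \<in> loc B" if "x \<in> loc B" "y \<in> loc B" for x y
    by (rule loc_add[OF _ _ that]) (use cl(4,5) assms(2) in auto)
qed

lemma frac_subset_loc: "subring B R \<Longrightarrow> M \<subseteq> B \<Longrightarrow> frac M \<subseteq> loc B"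
proof
  fix x assume *: "subring B R" "M \<subseteq> B" "x \<in> frac M"
  obtain b where "b \<in> M" "b \<noteq> \<zero>" "b \<otimes> x \<in> M" "x \<in> carrier R"
    using fracE[OF *(3) subringE(1)[OF subring_M]] by metis
  then show "x \<in> loc B" using locI[of b x B] *(2) by blast
qed

lemma loc_ideal:
  assumes "subring B R" "M \<subseteq> B" "ideal_of B p" shows "ideal_of (loc B) (loc p)"
  unfolding ideal_of_def
proof (intro conjI ballI)
  note p = ideal_ofD[OF assms(3)]
  have "p \<subseteq> carrier R" using p(1) subringE(1)[OF assms(1)] by blast
  then show "\<zero> \<in> loc p" using loc_incl p(2) by blast
  show "loc p \<subseteq> loc B" by (rule loc_mono[OF p(1)])
  show "x \<oplus> y \<in> loc p" if "x \<in> loc p" "y \<in> loc p" for x y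
    by (rule loc_add[OF _ _ that]) (use p(3,4) assms(2) in auto)
  show "a \<otimes> x \<in> loc p" if "a \<in> loc B" "x \<in> loc p" for a x
    by (rule loc_mult[OF _ that]) (rule p(4))
qed

text \<open>Nonzero elements of \<open>M\<close> lie outside the prime and can be cancelled from
  products in it; this is the fact \<open>strip\<close> below.\<close>

lemma loc_prime:
  assumes B: "subring B R" "M \<subseteq> B" and p: "prime_of B p" "p \<inter> M \<subseteq> {\<zero>}"
  shows "prime_of (loc B) (loc p)" "loc p \<inter> B = p"
proof -
  note pi = ideal_ofD[OF prime_ofD(1)[OF p(1)]]
  have Bc: "B \<subseteq> carrier R" by (rule subringE(1)[OF B(1)])
  have strip: "b \<in> p" if "b \<in> B" "d \<in> M" "d \<noteq> \<zero>" "d \<otimes> b \<in> p" for b d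
    using prime_ofD(3)[OF p(1), of d b] that B(2) p(2) by blast
  show eq: "loc p \<inter> B = p"
  proof
    show "loc p \<inter> B \<subseteq> p" using strip by (auto elim: locE)
    show "p \<subseteq> loc p \<inter> B" using loc_incl[of p] pi(1) Bc by auto
  qed
  show "prime_of (loc B) (loc p)"
    unfolding prime_of_def
  proof (intro conjI ballI impI)
    show "ideal_of (loc B) (loc p)" by (rule loc_ideal[OF B prime_ofD(1)[OF p(1)]])
    show "\<one> \<notin> loc p" using eq subringE(3)[OF B(1)] prime_ofD(2)[OF p(1)] by blast
    fix a b assume ab: "a \<in> loc B" "b \<in> loc B" "a \<otimes> b \<in> loc p"
    obtain d where d: "d \<in> M" "d \<noteq> \<zero>" "d \<otimes> a \<in> B" "a \<in> carrier R" "d \<in> carrier R" using ab(1) by (rule locE)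
    obtain e where e: "e \<in> M" "e \<noteq> \<zero>" "e \<otimes> b \<in> B" "b \<in> carrier R" "e \<in> carrier R" using ab(2) by (rule locE)
    obtain f where f: "f \<in> M" "f \<noteq> \<zero>" "f \<otimes> (a \<otimes> b) \<in> p" "f \<in> carrier R" using ab(3) by (rule locE)
    have "f \<otimes> ((d \<otimes> a) \<otimes> (e \<otimes> b)) = (d \<otimes> e) \<otimes> (f \<otimes> (a \<otimes> b))" using d e f by algebra
    also have "\<dots> \<in> p" using pi(4) f(3) M_mult[OF d(1,2) e(1,2)] B(2) by blast
    finally have "(d \<otimes> a) \<otimes> (e \<otimes> b) \<in> p"
      using strip[OF _ f(1,2)] subringE(6)[OF B(1) d(3) e(3)] by blast
    then have "d \<otimes> a \<in> p \<or> e \<otimes> b \<in> p" using prime_ofD(3)[OF p(1) d(3) e(3)] by blast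
    then show "a \<in> loc p \<or> b \<in> loc p" using d e locI by blast
  qed
qed

text \<open>Denominators are units of the localization. Clearing one moves an element that
  distinguishes the two primes into \<open>B\<close>, where it still distinguishes them.\<close>

lemma loc_contract_strict:
  assumes B: "subring B R" "M \<subseteq> B" and q: "prime_of (loc B) q" "prime_of (loc B) q'" "q \<subset> q'"
  shows "q \<inter> B \<subset> q' \<inter> B"
proof -
  obtain x where x: "x \<in> q'" "x \<notin> q" using q(3) by blast
  have Bc: "B \<subseteq> carrier R" by (rule subringE(1)[OF B(1)])
  have xl: "x \<in> loc B" using ideal_ofD(1)[OF prime_ofD(1)[OF q(2)]] x(1) by blast
  obtain d where d: "d \<in> M" "d \<noteq> \<zero>" "d \<otimes> x \<in> B" "x \<in> carrier R" "d \<in> carrier R" using xl by (rule locE)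
  have dl: "d \<in> loc B" using loc_incl[OF Bc] B(2) d(1) by blast
  have id: "inv d \<in> loc B" using locI[OF d(1,2), of "inv d" B] inv_nz[OF d(5,2)] subringE(3)[OF B(1)] by simp
  have "d \<otimes> x \<in> q'" by (rule ideal_ofD(4)[OF prime_ofD(1)[OF q(2)] dl x(1)])
  moreover have "d \<otimes> x \<notin> q"
  proof
    assume "d \<otimes> x \<in> q"
    then have "inv d \<otimes> (d \<otimes> x) \<in> q" by (rule ideal_ofD(4)[OF prime_ofD(1)[OF q(1)] id])
    then show False using x(2) d inv_nz[OF d(5,2)] by (simp add: m_assoc[symmetric])
  qed
  ultimately show ?thesis using d(3) q(3) by blast
qed

end

context affine_field
begin

lemma relation_insert:
  assumes Y: "indm P Y" "Y \<subseteq> carrier R" and P: "\<zero> \<in> P" and r: "r \<in> carrier R" "r \<notin> Y" "\<not> indm P (insert r Y)"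
  shows "\<exists>c n i. (\<forall>i<n. c i \<in> gen Y) \<and> i < n \<and> c i \<noteq> \<zero> \<and> pe c n r \<in> P"
proof (rule ccontr)
  assume no: "\<not> ?thesis"
  interpret r: cring_sub R "gen Y" r by (rule pw_cring_sub[OF subring_gen[OF Y(2)] r(1)])
  have key: "c i = \<zero>" if "\<forall>i<n. c i \<in> gen Y" "pe c n r \<in> P" "i < n" for c n i
    using no that by blast
  have "trans_over (gen Y) r" unfolding trans_over_def using key P by metis
  then have "ai (insert r Y)" using alg_indep_insert[OF r(2,1) Y(2)] Y(1) unfolding indm_def by blast
  moreover have "gen (insert r Y) \<inter> P \<subseteq> {\<zero>}"
  proof
    fix x assume x: "x \<in> gen (insert r Y) \<inter> P"
    then have "x \<in> adj (gen Y) r" using gen_insert[OF Y(2) r(1)] by blast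
    then obtain n where "x \<in> pw (gen Y) r n" by (rule r.adjE)
    then obtain c where c: "\<forall>i<n. c i \<in> gen Y" "x = pe c n r" unfolding pw_def by auto
    have "\<And>i. i < n \<Longrightarrow> c i = \<zero>" using key[OF c(1)] c(2) x by blast
    then have "pe c n r = pe (\<lambda>_. \<zero>) n r" by (rule pe_cong)
    then show "x \<in> {\<zero>}" using c(2) r(1) by (simp add: pe_zero)
  qed
  ultimately show False using r(3) unfolding indm_def by blast
qed

text \<open>A relation modulo \<open>P\<close> whose constant term vanishes has a factor
  \<open>r\<close>; as \<open>r \<notin> P\<close>, the factor can be cancelled, until a nonzero
  constant term appears.\<close>

lemma relation_constant_term:
  assumes T: "subring T R" "prime_of T P" and r: "r \<in> T" "r \<notin> P" and Y: "gen Y \<subseteq> T"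
    and c: "\<forall>i<n. c i \<in> gen Y" "i < n" "c i \<noteq> \<zero>" "pe c n r \<in> P"
  shows "\<exists>c n. (\<forall>i<Suc n. c i \<in> gen Y) \<and> c 0 \<noteq> \<zero> \<and> pe c (Suc n) r \<in> P"
  using c
proof (induction n arbitrary: c i)
  case (Suc n)
  have rc: "r \<in> carrier R" using r(1) subringE(1)[OF T(1)] by blast
  show ?case
  proof (cases "c 0 = \<zero>")
    case True
    interpret rT: cring_sub R T r by (rule pw_cring_sub[OF T(1) rc])
    let ?w = "pe (\<lambda>i. c (Suc i)) n r"
    have w: "?w \<in> T" using rT.pw_subset[OF T(1) order_refl r(1), of n] rT.pwI[of n "\<lambda>i. c (Suc i)"] Suc.prems(1) Y by blast
    have "pe c (Suc n) r = ?w \<otimes> r \<oplus> c 0"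
      using Suc.prems(1) Y rT.A_carrier rc by (intro pe_Suc_shift) auto
    then have "?w \<otimes> r \<in> P" using Suc.prems(4) True w rT.A_carrier rc by simp
    then have wP: "?w \<in> P" using prime_ofD(3)[OF T(2) w r(1)] r(2) by blast
    obtain j where j: "i = Suc j" using Suc.prems(3) True by (cases i) auto
    show ?thesis
      by (rule Suc.IH[of "\<lambda>i. c (Suc i)" j]) (use Suc.prems j wP in auto)
  next
    case False
    then show ?thesis using Suc.prems by blast
  qed
qed simp

text \<open>Each ring generated over \<open>frac (gen Y)\<close> lies in the fractions of the
  corresponding ring over \<open>K\<close>, and transcendence over a ring passes to its
  fractions.\<close>

lemma ai_over_frac:
  assumes "finite Z" "ai (Y \<union> Z)" "Y \<inter> Z = {}"
  shows "algebraically_independent R (frac (gen Y)) Z"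
  using assms
proof (induction Z)
  have Yc: "Y \<subseteq> carrier R" using ai_carrier[OF assms(2)] by blast
  interpret F: affine_field R "frac (gen Y)" by (rule affine_fieldI[OF subfield_frac[OF subring_gen[OF Yc]]])
  case empty
  show ?case by (rule F.alg_indep_empty)
next
  have Yc: "Y \<subseteq> carrier R" using ai_carrier[OF assms(2)] by blast
  interpret F: affine_field R "frac (gen Y)" by (rule affine_fieldI[OF subfield_frac[OF subring_gen[OF Yc]]])
  case (insert z Z)
  have ins: "Y \<union> insert z Z = insert z (Y \<union> Z)" by auto
  have c: "z \<in> carrier R" "Y \<union> Z \<subseteq> carrier R" "Z \<subseteq> carrier R" using ai_carrier[OF insert.prems(1)] by auto
  have nz: "z \<notin> Y \<union> Z" using insert.hyps(2) insert.prems(2) by auto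
  have *: "ai (Y \<union> Z)" "trans_over (gen (Y \<union> Z)) z"
    using alg_indep_insert[OF nz c(1,2)] insert.prems(1) ins by auto
  have sr: "subring (gen (Y \<union> Z)) R" by (rule subring_gen[OF c(2)])
  have f: "subfield (frac (gen (Y \<union> Z))) R" by (rule subfield_frac[OF sr])
  have "frac (gen Y) \<subseteq> frac (gen (Y \<union> Z))" by (rule frac_mono[OF gen_mono[OF _ c(2)]]) auto
  moreover have "Z \<subseteq> frac (gen (Y \<union> Z))" using frac_incl[OF sr] gen_incl(1) by blast
  ultimately have "F.gen Z \<subseteq> frac (gen (Y \<union> Z))" by (rule F.gen_min[OF subfieldE(1)[OF f]])
  moreover have "trans_over (frac (gen (Y \<union> Z))) z" using trans_over_frac[OF sr c(1)] *(2) by simp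
  ultimately have "trans_over (F.gen Z) z" using trans_over_mono by blast
  moreover have "F.ai Z" using insert.IH *(1) insert.prems(2) by blast
  ultimately show ?case using F.alg_indep_insert[OF insert.hyps(2) c(1,3)] by blast
qed

text \<open>Inverting the nonzero elements of \<open>gen Y\<close> gives an algebra generated by the
  same finite set over a larger field, so the hypotheses of the induction survive the
  localization.\<close>

lemma loc_gen:
  assumes "S \<subseteq> carrier R" "Y \<subseteq> gen S"
  shows "localization.loc R (gen Y) (gen S) = generate_ring R (frac (gen Y) \<union> S)"
proof -
  have Yc: "Y \<subseteq> carrier R" using assms gen_carrier by blast
  have M: "subring (gen Y) R" by (rule subring_gen[OF Yc])
  interpret localization R "gen Y" by (simp add: localization_def localization_axioms_def M field_axioms)
  interpret F: affine_field R "frac (gen Y)" by (rule affine_fieldI[OF subfield_frac[OF M]])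
  have T: "subring (gen S) R" by (rule subring_gen[OF assms(1)])
  have MT: "gen Y \<subseteq> gen S" using assms(2) gen_incl(2) by (intro gen_min[OF T]) auto
  have sF: "subring (F.gen S) R" by (rule F.subring_gen[OF assms(1)])
  show ?thesis
  proof
    show "F.gen S \<subseteq> loc (gen S)"
    proof (rule F.gen_min[OF loc_subring[OF T MT] frac_subset_loc[OF T MT]])
      show "S \<subseteq> loc (gen S)" using loc_incl[OF subringE(1)[OF T]] gen_incl(1) by blast
    qed
    show "loc (gen S) \<subseteq> F.gen S"
    proof
      fix x assume "x \<in> loc (gen S)"
      then obtain d where d: "d \<in> gen Y" "d \<noteq> \<zero>" "d \<otimes> x \<in> gen S" "x \<in> carrier R" "d \<in> carrier R" by (rule locE)
      have "d \<in> frac (gen Y)" using frac_incl[OF M] d(1) by blast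
      then have "inv d \<in> F.gen S" using F.K_inv d(2) F.gen_incl(2) by blast
      moreover have "gen S \<subseteq> F.gen S"
        by (rule gen_min[OF sF]) (use frac_incl[OF M] gen_incl(2) F.gen_incl in blast)+
      then have "d \<otimes> x \<in> F.gen S" using d(3) by blast
      ultimately have "inv d \<otimes> (d \<otimes> x) \<in> F.gen S" by (rule subringE(6)[OF sF])
      then show "x \<in> F.gen S" using d inv_nz[OF d(5,2)] by (simp add: m_assoc[symmetric])
    qed
  qed
qed

end

text \<open>A chain of primes of \<open>A\<close> of maximal length ending at \<open>P \<inter> A\<close>. The residue field of \<open>P \<inter> A\<close> is
  made algebraic by inverting the nonzero elements of \<open>K[Y]\<close>; then one descends to a prime \<open>Q\<close> with
  one-dimensional residue ring.\<close>

theorem (in field) chain_below: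
  assumes "subfield K R" "finite S" "S \<subseteq> carrier R" "subring A R" "K \<subseteq> A" "A \<subseteq> generate_ring R (K \<union> S)"
    "prime_of (generate_ring R (K \<union> S)) P"
    "finite Y" "Y \<subseteq> A" "coeff_sub.indm R K P Y"
    "\<And>y. y \<in> A \<Longrightarrow> y \<notin> Y \<Longrightarrow> \<not> coeff_sub.indm R K P (insert y Y)"
    "finite Z" "Z \<subseteq> A" "Y \<inter> Z = {}" "algebraically_independent R K (Y \<union> Z)" "card Z = n"
  shows "\<exists>p. (\<forall>i\<le>n. prime_of A (p i)) \<and> (\<forall>i<n. p i \<subset> p (Suc i)) \<and> p n = P \<inter> A"
  using assms
proof (induction n arbitrary: K A P Y Z)
  case 0
  have "prime_of A (P \<inter> A)" by (rule prime_of_contract[OF 0(7,6,4)])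
  then show ?case by (intro exI[of _ "\<lambda>_. P \<inter> A"]) auto
next
  case (Suc n)
  note fS = Suc.prems(2) and Sc = Suc.prems(3) and A = Suc.prems(4) and KA = Suc.prems(5)
    and AT = Suc.prems(6) and P = Suc.prems(7) and fY = Suc.prems(8) and YA = Suc.prems(9)
    and indY = Suc.prems(10) and maxY = Suc.prems(11) and fZ = Suc.prems(12) and ZA = Suc.prems(13)
    and YZ = Suc.prems(14) and aiYZ = Suc.prems(15) and cZ = Suc.prems(16)
  interpret K: affine_field R K by (rule affine_fieldI[OF Suc.prems(1)])
  let ?T = "K.gen S" and ?M = "K.gen Y"
  have T: "subring ?T R" by (rule K.subring_gen[OF Sc])
  have Ac: "A \<subseteq> carrier R" by (rule subringE(1)[OF A])
  have Yc: "Y \<subseteq> carrier R" using YA Ac by blast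
  have M: "subring ?M R" by (rule K.subring_gen[OF Yc])
  have MA: "?M \<subseteq> A" by (rule K.gen_min[OF A KA YA])
  interpret localization R ?M by (simp add: localization_def localization_axioms_def M field_axioms)
  define K' where "K' = frac ?M"
  have fK': "subfield K' R" unfolding K'_def by (rule subfield_frac[OF M])
  interpret K': affine_field R K' by (rule affine_fieldI[OF fK'])
  define A' where "A' = loc A"
  let ?T' = "K'.gen S"
  have T'eq: "?T' = loc ?T" unfolding K'_def using K.loc_gen[OF Sc] YA AT by blast
  have MT: "?M \<subseteq> ?T" using MA AT by blast
  have A': "subring A' R" unfolding A'_def by (rule loc_subring[OF A MA])
  have K'A': "K' \<subseteq> A'" unfolding A'_def K'_def by (rule frac_subset_loc[OF A MA])
  have A'T': "A' \<subseteq> ?T'" unfolding A'_def T'eq by (rule loc_mono[OF AT])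
  have AA': "A \<subseteq> A'" unfolding A'_def by (rule loc_incl[OF Ac])
  have T': "subring ?T' R" by (rule K'.subring_gen[OF Sc])
  have PM: "P \<inter> ?M \<subseteq> {\<zero>}" using indY unfolding K.indm_def by blast
  have P': "prime_of ?T' (loc P)" unfolding T'eq by (rule loc_prime(1)[OF T MT P PM])
  \<comment> \<open>The localized prime need not be maximal in \<open>?T'\<close>, because
    \<open>Y\<close> was maximal only among the subsets of \<open>A\<close>. A maximal ideal above
    it is used, for which no nonempty set is independent; \<open>P2A\<close> shows that it has the
    same contraction to \<open>A'\<close>.\<close>
  obtain P2 where P2: "prime_of ?T' P2" "loc P \<subseteq> P2"
    and mx0: "\<And>J. ideal_of ?T' J \<Longrightarrow> P2 \<subseteq> J \<Longrightarrow> J \<inter> {\<one>} = {} \<Longrightarrow> J = P2"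
  proof (rule exists_prime_avoiding[OF T' prime_ofD(1)[OF P'], of "{\<one>}"])
    show "{\<one>} \<subseteq> ?T'" using subringE(3)[OF T'] by simp
    show "loc P \<inter> {\<one>} = {}" using prime_ofD(2)[OF P'] by simp
  qed (use that in auto)
  have mx: "J = P2" if "ideal_of ?T' J" "P2 \<subseteq> J" "\<one> \<notin> J" for J
    using mx0[OF that(1,2)] that(3) by simp
  note empty_max = K'.maximal_indm_empty[OF fS Sc P2(1) mx]
  define p' where "p' = loc (P \<inter> A)"
  have pA: "prime_of A (P \<inter> A)" by (rule prime_of_contract[OF P AT A])
  have pAM: "P \<inter> A \<inter> ?M \<subseteq> {\<zero>}" using PM by blast
  have p'A: "p' \<inter> A = P \<inter> A" unfolding p'_def by (rule loc_prime(2)[OF A MA pA pAM])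
  have p'prime: "prime_of A' p'" unfolding p'_def A'_def by (rule loc_prime(1)[OF A MA pA pAM])
  have unit: "a \<notin> P2" if "a \<in> ?M" "a \<noteq> \<zero>" for a
  proof (rule K'.prime_unit[OF P2(1) _ _ that(2)])
    show "K' \<subseteq> ?T'" using K'A' A'T' by blast
    show "a \<in> K'" unfolding K'_def using frac_incl[OF M] that(1) by blast
  qed
  have P2A: "P2 \<inter> A' = p'"
  proof
    have "p' \<subseteq> loc P" unfolding p'_def by (rule loc_mono) blast
    moreover have "p' \<subseteq> A'" unfolding p'_def A'_def by (rule loc_mono) blast
    ultimately show "p' \<subseteq> P2 \<inter> A'" using P2(2) by blast
    \<comment> \<open>By the maximality of \<open>Y\<close>, an element \<open>?r\<close> of
      \<open>A\<close> outside \<open>P\<close> satisfies a relation modulo \<open>P\<close> over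
      \<open>K[Y]\<close>, and the constant term may be taken nonzero. If \<open>?r\<close> were in
      \<open>P2\<close>, so would be this constant term, which is a unit.\<close>
    show "P2 \<inter> A' \<subseteq> p'"
    proof (rule subsetI, rule ccontr)
      fix x assume x: "x \<in> P2 \<inter> A'" "x \<notin> p'"
      then have "x \<in> loc A" unfolding A'_def by blast
      then obtain d where d: "d \<in> ?M" "d \<noteq> \<zero>" "d \<otimes> x \<in> A" "x \<in> carrier R" "d \<in> carrier R" by (rule locE)
      let ?r = "d \<otimes> x"
      have rP: "?r \<notin> P" using x(2) d locI[OF d(1,2)] unfolding p'_def by blast
      have dT: "d \<in> ?T'" using d(1) MA AA' A'T' by blast
      have rP2: "?r \<in> P2" using ideal_ofD(4)[OF prime_ofD(1)[OF P2(1)] dT] x(1) by blast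
      have rc: "?r \<in> carrier R" using d by simp
      have zP: "\<zero> \<in> P" by (rule ideal_ofD(2)[OF prime_ofD(1)[OF P]])
      have "?r \<noteq> \<zero>" using rP zP by auto
      then have rY: "?r \<notin> Y" using unit[of ?r] rP2 K.gen_incl(1) by blast
      obtain c m i where c: "\<forall>i<m. c i \<in> ?M" "i < m" "c i \<noteq> \<zero>" "pe c m ?r \<in> P"
        using K.relation_insert[OF indY Yc zP rc rY maxY[OF d(3) rY]] by blast
      have rT: "?r \<in> ?T" using d(3) AT by blast
      obtain c m where c: "\<forall>i<Suc m. c i \<in> ?M" "c 0 \<noteq> \<zero>" "pe c (Suc m) ?r \<in> P"
        using K.relation_constant_term[OF T P rT rP MT c] by blast
      have Mc: "?M \<subseteq> carrier R" by (rule subringE(1)[OF M])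
      have cc: "c i \<in> carrier R" if "i < Suc m" for i using c(1) that Mc by blast
      let ?w = "pe (\<lambda>i. c (Suc i)) m ?r"
      have wT: "?w \<in> ?T'"
      proof -
        interpret rT': cring_sub R ?T' ?r by (rule pw_cring_sub[OF T' rc])
        have "c (Suc i) \<in> ?T'" if "i < m" for i using c(1) that MA AA' A'T' by blast
        then have "?w \<in> pw ?T' ?r m" by (rule rT'.pwI)
        moreover have "?r \<in> ?T'" using d(3) AA' A'T' by blast
        ultimately show ?thesis using rT'.pw_subset[OF T' order_refl] by blast
      qed
      have wc: "?w \<in> carrier R" using wT subringE(1)[OF T'] by blast
      have e: "pe c (Suc m) ?r = ?w \<otimes> ?r \<oplus> c 0" using cc rc by (intro K.pe_Suc_shift) auto
      have wr: "?w \<otimes> ?r \<in> P2" by (rule ideal_ofD(4)[OF prime_ofD(1)[OF P2(1)] wT rP2])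
      have "P \<subseteq> P2" using loc_incl[of P] ideal_ofD(1)[OF prime_ofD(1)[OF P]] subringE(1)[OF T] P2(2) by blast
      then have "(?w \<otimes> ?r \<oplus> c 0) \<ominus> ?w \<otimes> ?r \<in> P2"
        using ideal_of_minus(1)[OF T' prime_ofD(1)[OF P2(1)] _ wr] c(3) e by auto
      moreover have "(?w \<otimes> ?r \<oplus> c 0) \<ominus> ?w \<otimes> ?r = c 0"
      proof -
        have cancel: "(u \<oplus> v) \<ominus> u = v" if "u \<in> carrier R" "v \<in> carrier R" for u v
        proof -
          have "(u \<oplus> v) \<ominus> u = (v \<oplus> u) \<ominus> u" using that by (simp add: a_comm)
          also have "\<dots> = v" using that by (simp add: minus_eq a_assoc r_neg)
          finally show ?thesis .
        qed
        show ?thesis using cc[of 0] wc rc by (intro cancel) auto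
      qed
      ultimately show False using unit[of "c 0"] c(1,2) by auto
    qed
  qed
  have aiZ: "K'.ai Z" unfolding K'_def by (rule K.ai_over_frac[OF fZ aiYZ YZ])
  obtain z where z: "z \<in> Z" using cZ by fastforce
  have zA': "z \<in> A'" using z ZA AA' by blast
  \<comment> \<open>A relation of \<open>z\<close> modulo \<open>P2\<close> supplies a nonzero
    element \<open>g\<close> of \<open>P2\<close> that belongs to \<open>A'\<close> and not only to
    \<open>?T'\<close>; it can therefore tell contracted primes apart.\<close>
  have "\<not> K'.indm P2 {z}" using empty_max[of "{z}"] zA' A'T' by blast
  moreover have "K' \<subseteq> ?T'" "z \<in> ?T'" using K'A' A'T' zA' by blast+
  ultimately obtain k m i where k: "\<forall>i<m. k i \<in> K'" "i < m" "k i \<noteq> \<zero>" "pe k m z \<in> P2"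
    using K'.not_indm_relation[OF _ T' _ P2(1)] by blast
  define g where "g = pe k m z"
  have "K'.ai {z}" using K'.alg_indep_subset[OF aiZ] z by blast
  then have g0: "g \<noteq> \<zero>" unfolding g_def using K'.ai_pe_nonzero[of z m k i] k by blast
  have gP2: "g \<in> P2" using k(4) by (simp add: g_def)
  have gA': "g \<in> A'"
  proof -
    have zc: "z \<in> carrier R" using zA' subringE(1)[OF A'] by blast
    interpret zA: cring_sub R A' z by (rule pw_cring_sub[OF A' zc])
    have "g \<in> pw A' z m" unfolding g_def using k(1) K'A' by (intro zA.pwI) blast
    then show ?thesis using zA.pw_subset[OF A' order_refl zA'] by blast
  qed
  have gT': "g \<in> ?T'" using gA' A'T' by blast
  obtain Q where Q: "prime_of ?T' Q" "Q \<subseteq> P2" "g \<notin> Q"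
    "\<And>Y. finite Y \<Longrightarrow> Y \<subseteq> ?T' \<Longrightarrow> K'.indm Q Y \<Longrightarrow> card Y \<le> 1"
    using K'.dimension_one_prime[OF fS Sc P2(1) mx gP2 g0] by blast
  have "K'.indm P2 {}"
    unfolding K'.indm_def K'.gen_empty using K'.alg_indep_empty K'.prime_unit[OF P2(1) \<open>K' \<subseteq> ?T'\<close>] by blast
  then have indg: "K'.indm Q {g}"
    using K'.indm_insert(1)[OF T' \<open>K' \<subseteq> ?T'\<close> Q(1) prime_ofD(1)[OF P2(1)] Q(2) _ _ gP2 Q(3), of "{}"] by blast
  \<comment> \<open>Since independent sets modulo \<open>Q\<close> have at most one element,
    \<open>{g}\<close> is a maximal one, and the induction hypothesis applies with
    \<open>{g}\<close> in the role of \<open>Y\<close>.\<close>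
  have maxg: "\<not> K'.indm Q (insert y {g})" if "y \<in> A'" "y \<notin> {g}" for y
  proof
    assume "K'.indm Q (insert y {g})"
    then have "card {y, g} \<le> 1" using Q(4)[of "{y, g}"] that(1) gT' A'T' by blast
    then show False using that(2) by simp
  qed
  have aig: "K'.ai {g}" by (rule K'.indm_ai[OF indg])
  \<comment> \<open>Completing \<open>{g}\<close> from \<open>Z\<close> uses up one element less
    than \<open>Z\<close> has, which leaves the \<open>n\<close> elements for the chain below
    \<open>Q\<close>.\<close>
  obtain W where W: "W \<subseteq> Z" "{g} \<inter> W = {}" "K'.ai ({g} \<union> W)" "card {g} + card W = card Z"
    using K'.exchange_extend[of "{g}" Z] fZ aig aiZ cZ by auto
  have "\<exists>p. (\<forall>i\<le>n. prime_of A' (p i)) \<and> (\<forall>i<n. p i \<subset> p (Suc i)) \<and> p n = Q \<inter> A'"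
  proof (rule Suc.IH[OF fK' fS Sc A' K'A' A'T' Q(1) _ _ indg maxg _ _ W(2,3)])
    show "finite W" using W(1) fZ finite_subset by blast
    show "W \<subseteq> A'" using W(1) ZA AA' by blast
    show "card W = n" using W(4) cZ by simp
  qed (use gA' in auto)
  then obtain q where q: "\<And>i. i \<le> n \<Longrightarrow> prime_of A' (q i)" "\<And>i. i < n \<Longrightarrow> q i \<subset> q (Suc i)" "q n = Q \<inter> A'" by blast
  define p where "p i = (if i \<le> n then q i \<inter> A else P \<inter> A)" for i
  have contr: "prime_of A (q i \<inter> A)" if "i \<le> n" for i by (rule prime_of_contract[OF q(1)[OF that] AA' A])
  have "prime_of A (p i)" for i unfolding p_def using contr pA by auto
  moreover have "p i \<subset> p (Suc i)" if i: "i < Suc n" for i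
  proof (cases "i = n")
    case True
    have "q n \<subseteq> p'" using q(3) Q(2) P2A by blast
    \<comment> \<open>The element that \<open>Q\<close> avoids makes the last inclusion
      strict.\<close>
    moreover have "g \<in> p'" "g \<notin> q n" using gP2 gA' P2A q(3) Q(3) by blast+
    ultimately have "q n \<subset> p'" by blast
    then have "q n \<inter> A \<subset> p' \<inter> A"
      using loc_contract_strict[OF A MA] q(1)[of n] p'prime unfolding A'_def by blast
    then show ?thesis using True p'A by (simp add: p_def)
  next
    case False
    then have "q i \<inter> A \<subset> q (Suc i) \<inter> A"
      using loc_contract_strict[OF A MA] q(1)[of i] q(1)[of "Suc i"] q(2)[of i] i unfolding A'_def by force
    then show ?thesis using False i by (simp add: p_def)
  qed
  moreover have "p (Suc n) = P \<inter> A" by (simp add: p_def)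
  ultimately show ?case by blast
qed

section \<open>Polynomial rings\<close>

lemma finite_submultisets [simp]: "finite {u. u \<subseteq># m}"
proof (induction m)
  case (add x m)
  have "{u. u \<subseteq># add_mset x m} \<subseteq> {u. u \<subseteq># m} \<union> add_mset x ` {u. u \<subseteq># m}"
  proof
    fix u assume u: "u \<in> {u. u \<subseteq># add_mset x m}"
    show "u \<in> {u. u \<subseteq># m} \<union> add_mset x ` {u. u \<subseteq># m}"
    proof (cases "x \<in># u")
      case True
      then have "u = add_mset x (u - {#x#})" by simp
      moreover have "u - {#x#} \<subseteq># m" using u by (simp add: subset_eq_diff_conv)
      ultimately show ?thesis by blast
    next
      case False
      then have "u \<subseteq># m" using u by (metis mem_Collect_eq insert_DiffM2 diff_single_trivial subset_eq_diff_conv union_single_eq_diff add_mset_remove_trivial)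
      then show ?thesis by blast
    qed
  qed
  then show ?case using add.IH finite_subset by blast
qed simp

lemma (in ring) finsum_in_ideal_of:
  assumes "ideal_of A p" "A \<subseteq> carrier R" "finite M" "\<And>x. x \<in> M \<Longrightarrow> f x \<in> p"
  shows "(\<Oplus>x\<in>M. f x) \<in> p"
  using assms(3,4)
proof (induction M)
  case (insert x M)
  then have "f ` insert x M \<subseteq> carrier R" using ideal_ofD(1)[OF assms(1)] assms(2) by blast
  then have "(\<Oplus>x\<in>insert x M. f x) = f x \<oplus> (\<Oplus>x\<in>M. f x)"
    using insert.hyps by (intro finsum_insert) auto
  then show ?case using insert ideal_ofD(3)[OF assms(1)] by auto
qed (use ideal_ofD(2)[OF assms(1)] in simp)

context cring
begin

abbreviation PS :: "'i set \<Rightarrow> ('i multiset \<Rightarrow> 'a) set" where "PS I \<equiv> indexed_pset I (carrier R)"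

lemma PS_iff:
  "p \<in> PS I \<longleftrightarrow> finite {m. p m \<noteq> \<zero>} \<and> (\<forall>m. p m \<in> carrier R) \<and> (\<forall>m. p m \<noteq> \<zero> \<longrightarrow> set_mset m \<subseteq> I)"
proof -
  interpret c: coeff_sub R "carrier R" by (rule coeff_subI[OF carrier_is_subring])
  show ?thesis using c.IP_eq[of I] unfolding c.IP_def by blast
qed

lemma PS_coeff [simp]: "p \<in> PS I \<Longrightarrow> p m \<in> carrier R"
  by (simp add: PS_iff)

definition conv :: "('i multiset \<Rightarrow> 'a) \<Rightarrow> ('i multiset \<Rightarrow> 'a) \<Rightarrow> 'i multiset \<Rightarrow> 'a" where
  "conv p q m = (\<Oplus>u\<in>{u. u \<subseteq># m}. p u \<otimes> q (m - u))"

lemma conv_comm: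
  fixes p q :: "'i multiset \<Rightarrow> 'a"
  assumes "\<And>m. p m \<in> carrier R" "\<And>m. q m \<in> carrier R"
  shows "conv p q = conv q p"
proof
  fix m :: "'i multiset"
  have b: "bij_betw (\<lambda>u. m - u) {u. u \<subseteq># m} {u. u \<subseteq># m}"
    by (rule bij_betw_byWitness[where f' = "\<lambda>u. m - u"])
      (auto simp: diff_subset_eq_self multiset_eq_iff subseteq_mset_def)
  have "conv q p m = (\<Oplus>u\<in>(\<lambda>u. m - u) ` {u. u \<subseteq># m}. q u \<otimes> p (m - u))"
    unfolding conv_def bij_betw_imp_surj_on[OF b] ..
  also have "\<dots> = (\<Oplus>u\<in>{u. u \<subseteq># m}. q (m - u) \<otimes> p (m - (m - u)))"
    using assms by (intro finsum_reindex bij_betw_imp_inj_on[OF b]) auto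
  also have "\<dots> = conv p q m"
    unfolding conv_def
  proof (rule finsum_cong')
    fix u assume "u \<in> {u. u \<subseteq># m}"
    then have "m - (m - u) = u" by (auto simp: multiset_eq_iff subseteq_mset_def)
    then show "q (m - u) \<otimes> p (m - (m - u)) = p u \<otimes> q (m - u)" using assms by (simp add: m_comm)
  qed (use assms in auto)
  finally show "conv p q m = conv q p m" ..
qed

lemma conv_padd:
  assumes "\<And>m. p m \<in> carrier R" "\<And>m. p' m \<in> carrier R" "\<And>m. q m \<in> carrier R"
  shows "conv (indexed_padd p p') q = indexed_padd (conv p q) (conv p' q)"
proof
  fix m
  have "conv (indexed_padd p p') q m = (\<Oplus>u\<in>{u. u \<subseteq># m}. p u \<otimes> q (m - u) \<oplus> p' u \<otimes> q (m - u))"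
    unfolding conv_def indexed_padd_def using assms by (intro finsum_cong') (auto simp: l_distr)
  also have "\<dots> = indexed_padd (conv p q) (conv p' q) m"
    unfolding conv_def indexed_padd_def using assms by (intro finsum_addf) auto
  finally show "conv (indexed_padd p p') q m = indexed_padd (conv p q) (conv p' q) m" .
qed

lemma conv_const:
  assumes "k \<in> carrier R" "\<And>m. q m \<in> carrier R"
  shows "conv (indexed_const k) q = (\<lambda>m. k \<otimes> q m)"
proof
  fix m
  have "conv (indexed_const k) q m = (\<Oplus>u\<in>{{#}}. k \<otimes> q (m - u))"
    unfolding conv_def indexed_const_def using assms
    by (intro add.finprod_mono_neutral_cong_right) auto
  also have "\<dots> = k \<otimes> q m" using assms by (simp add: finsum_insert)
  finally show "conv (indexed_const k) q m = k \<otimes> q m" .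
qed

text \<open>Submultisets of \<open>m\<close> that contain \<open>i\<close> correspond, by removing
  one \<open>i\<close>, to all submultisets of \<open>m - {#i#}\<close>; the others contribute
  zero.\<close>

lemma conv_pmult:
  assumes "\<And>m. p m \<in> carrier R" "\<And>m. q m \<in> carrier R"
  shows "conv (indexed_pmult p i) q = indexed_pmult (conv p q) i"
proof
  fix m
  show "conv (indexed_pmult p i) q m = indexed_pmult (conv p q) i m"
  proof (cases "i \<in># m")
    case True
    define f where "f u = (if i \<in># u then p (u - {#i#}) \<otimes> q (m - u) else \<zero>)" for u
    have sub: "add_mset i v \<subseteq># m" if "v \<subseteq># m - {#i#}" for v
      using that True by (metis insert_DiffM mset_subset_eq_add_mset_cancel)
    have "conv (indexed_pmult p i) q m = (\<Oplus>u\<in>{u. u \<subseteq># m}. f u)"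
      unfolding conv_def indexed_pmult_def f_def using assms by (intro finsum_cong') auto
    also have "\<dots> = (\<Oplus>u\<in>add_mset i ` {v. v \<subseteq># m - {#i#}}. f u)"
    proof (intro add.finprod_mono_neutral_cong_right)
      show "f u = \<zero>" if u: "u \<in> {u. u \<subseteq># m} - add_mset i ` {v. v \<subseteq># m - {#i#}}" for u
      proof -
        have "i \<notin># u"
        proof
          assume i: "i \<in># u"
          then have "u = add_mset i (u - {#i#})" by simp
          moreover have "u - {#i#} \<subseteq># m - {#i#}" using u by (auto simp: subseteq_mset_def intro: diff_le_mono)
          ultimately show False using u by blast
        qed
        then show "f u = \<zero>" by (simp add: f_def)
      qed
    qed (use sub assms in \<open>auto simp: f_def\<close>)
    also have "\<dots> = (\<Oplus>v\<in>{v. v \<subseteq># m - {#i#}}. f (add_mset i v))"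
      using assms by (intro finsum_reindex) (auto simp: f_def inj_on_def)
    also have "\<dots> = indexed_pmult (conv p q) i m"
      unfolding indexed_pmult_def conv_def using True assms by (simp add: f_def)
    finally show ?thesis .
  next
    case False
    then have "i \<notin># u" if "u \<subseteq># m" for u using that mset_subset_eqD by metis
    then have "conv (indexed_pmult p i) q m = (\<Oplus>u\<in>{u. u \<subseteq># m}. \<zero>)"
      unfolding conv_def indexed_pmult_def using assms by (intro finsum_cong') auto
    then show ?thesis using False by (simp add: indexed_pmult_def)
  qed
qed

lemma conv_PS:
  assumes "p \<in> PS I" "q \<in> PS I" shows "conv p q \<in> PS I"
  using assms(1)
proof induction
  case (indexed_const k)
  have "finite {m. k \<otimes> q m \<noteq> \<zero>}"
    by (rule finite_subset[of _ "{m. q m \<noteq> \<zero>}"]) (use assms(2) indexed_const in \<open>auto simp: PS_iff\<close>)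
  moreover have "set_mset m \<subseteq> I" if "k \<otimes> q m \<noteq> \<zero>" for m
  proof -
    have "q m \<noteq> \<zero>" using that indexed_const by auto
    then show ?thesis using assms(2) by (simp add: PS_iff)
  qed
  ultimately have "(\<lambda>m. k \<otimes> q m) \<in> PS I" using assms(2) indexed_const unfolding PS_iff by simp
  then show ?case using conv_const[OF indexed_const, of q] assms(2) by simp
next
  case (indexed_padd P Q)
  then show ?case using conv_padd[of P Q q] assms(2) by (simp add: indexed_pset.indexed_padd)
next
  case (indexed_pmult P i)
  then show ?case using conv_pmult[of P q i] assms(2) by (simp add: indexed_pset.indexed_pmult)
qed

text \<open>Convolution is additive in its first argument and commutes with multiplication by a
  variable, so induction along the generation of \<open>p\<close> avoids rearranging double sums
  over factorizations.\<close>

lemma conv_assoc: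
  assumes "p \<in> PS I" "q \<in> PS I" "r \<in> PS I"
  shows "conv (conv p q) r = conv p (conv q r)"
  using assms(1)
proof induction
  case (indexed_const k)
  have "conv (\<lambda>m. k \<otimes> q m) r = (\<lambda>m. k \<otimes> conv q r m)"
  proof
    fix m
    have "conv (\<lambda>m. k \<otimes> q m) r m = (\<Oplus>u\<in>{u. u \<subseteq># m}. k \<otimes> (q u \<otimes> r (m - u)))"
      unfolding conv_def using assms indexed_const by (intro finsum_cong') (auto simp: m_assoc)
    also have "\<dots> = k \<otimes> conv q r m"
      unfolding conv_def using assms indexed_const by (intro finsum_rdistr[symmetric]) auto
    finally show "conv (\<lambda>m. k \<otimes> q m) r m = k \<otimes> conv q r m" .
  qed
  then show ?case
    using conv_const[OF indexed_const, of q] conv_const[OF indexed_const, of "conv q r"] assms(2,3) conv_PS[OF assms(2,3)] by simp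
next
  case (indexed_padd P Q)
  then show ?case
    using conv_padd[of P Q q] conv_padd[of "conv P q" "conv Q q" r] conv_padd[of P Q "conv q r"]
      assms(2,3) conv_PS[OF assms(2,3)] conv_PS[OF indexed_padd.hyps(1) assms(2)] conv_PS[OF indexed_padd.hyps(2) assms(2)]
    by simp
next
  case (indexed_pmult P i)
  then show ?case
    using conv_pmult[of P q i] conv_pmult[of "conv P q" r i] conv_pmult[of P "conv q r" i]
      assms(2,3) conv_PS[OF assms(2,3)] conv_PS[OF indexed_pmult.hyps(1) assms(2)]
    by simp
qed

abbreviation Pl :: "'i set \<Rightarrow> ('i multiset \<Rightarrow> 'a) ring" where "Pl I \<equiv> indexed_poly_ring R I"

lemma Pl_simps [simp]:
  "carrier (Pl I) = PS I" "p \<otimes>\<^bsub>Pl I\<^esub> q = conv p q" "p \<oplus>\<^bsub>Pl I\<^esub> q = indexed_padd p q"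
  "\<one>\<^bsub>Pl I\<^esub> = indexed_const \<one>" "\<zero>\<^bsub>Pl I\<^esub> = indexed_const \<zero>"
  unfolding indexed_poly_ring_def by (auto simp: conv_def fun_eq_iff)

lemma cring_Pl: "cring (Pl I)"
proof (rule cringI)
  show "abelian_group (Pl I)"
  proof (rule abelian_groupI)
    fix x assume x: "x \<in> carrier (Pl I)"
    then have "(\<lambda>m. \<ominus> x m) \<in> carrier (Pl I)"
      by (auto simp: PS_iff elim!: finite_subset[rotated])
    moreover have "(\<lambda>m. \<ominus> x m) \<oplus>\<^bsub>Pl I\<^esub> x = \<zero>\<^bsub>Pl I\<^esub>"
      using x by (auto simp: indexed_padd_def indexed_zero_def l_neg)
    ultimately show "\<exists>y\<in>carrier (Pl I). y \<oplus>\<^bsub>Pl I\<^esub> x = \<zero>\<^bsub>Pl I\<^esub>" by blast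
    show "\<zero>\<^bsub>Pl I\<^esub> \<oplus>\<^bsub>Pl I\<^esub> x = x" using x by (auto simp: indexed_padd_def indexed_zero_def)
    fix y assume y: "y \<in> carrier (Pl I)"
    show "x \<oplus>\<^bsub>Pl I\<^esub> y \<in> carrier (Pl I)" using x y by (simp add: indexed_pset.indexed_padd)
    show "x \<oplus>\<^bsub>Pl I\<^esub> y = y \<oplus>\<^bsub>Pl I\<^esub> x" using x y by (simp add: indexed_padd_def a_comm)
    fix z assume z: "z \<in> carrier (Pl I)"
    show "x \<oplus>\<^bsub>Pl I\<^esub> y \<oplus>\<^bsub>Pl I\<^esub> z = x \<oplus>\<^bsub>Pl I\<^esub> (y \<oplus>\<^bsub>Pl I\<^esub> z)"
      using x y z by (simp add: indexed_padd_def a_assoc)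
  qed (simp add: indexed_pset.indexed_const)
  show "Group.comm_monoid (Pl I)"
  proof (rule comm_monoidI)
    fix x y assume x: "x \<in> carrier (Pl I)" and y: "y \<in> carrier (Pl I)"
    show "x \<otimes>\<^bsub>Pl I\<^esub> y = y \<otimes>\<^bsub>Pl I\<^esub> x" using x y conv_comm[of x y] by simp
    show "\<one>\<^bsub>Pl I\<^esub> \<otimes>\<^bsub>Pl I\<^esub> x = x" using x conv_const[of \<one> x] by simp
  qed (auto simp: conv_PS conv_assoc intro: indexed_pset.indexed_const)
  show "(x \<oplus>\<^bsub>Pl I\<^esub> y) \<otimes>\<^bsub>Pl I\<^esub> z = x \<otimes>\<^bsub>Pl I\<^esub> z \<oplus>\<^bsub>Pl I\<^esub> y \<otimes>\<^bsub>Pl I\<^esub> z"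
    if "x \<in> carrier (Pl I)" "y \<in> carrier (Pl I)" "z \<in> carrier (Pl I)" for x y z
    using that conv_padd[of x y z] by simp
qed

lemma const_hom: "ring_hom_cring R (Pl I) indexed_const"
proof -
  have "indexed_const \<in> ring_hom R (Pl I)"
  proof (rule ring_hom_memI)
    fix x y assume "x \<in> carrier R" "y \<in> carrier R"
    then show "indexed_const (x \<otimes> y) = indexed_const x \<otimes>\<^bsub>Pl I\<^esub> indexed_const y"
      by (subst Pl_simps, subst conv_const) (auto simp: indexed_const_def)
  qed (auto intro: indexed_pset.indexed_const simp: indexed_padd_const)
  then show ?thesis
    using cring_Pl is_cring by (simp add: ring_hom_cring_def ring_hom_cring_axioms_def)
qed

lemma const_inj: "inj indexed_const"
  by (rule injI) (metis indexed_const_def)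

lemma pmult_conv_var:
  assumes "\<And>m. p m \<in> carrier R"
  shows "indexed_pmult p i = conv (indexed_var i) p"
  using conv_pmult[of "indexed_const \<one>" p i] conv_const[of \<one> p] assms
  unfolding indexed_var_def by (simp add: indexed_const_def)

text \<open>The extension of the prime \<open>q\<close> of the coefficient ring together with the first \<open>j\<close> variables.\<close>

definition Jp :: "nat set \<Rightarrow> 'a set \<Rightarrow> nat \<Rightarrow> (nat multiset \<Rightarrow> 'a) set" where
  "Jp I q j = {p \<in> PS I. \<forall>m. set_mset m \<inter> {..<j} = {} \<longrightarrow> p m \<in> q}"

text \<open>Only finitely many coefficients lie outside \<open>q\<close>, and the multiset order is
  linear for natural numbers as variables; so there is a largest such monomial.\<close>

lemma Jp_lead:
  assumes q: "prime_of (carrier R) q" and p: "p \<in> PS I" "p \<notin> Jp I q j"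
  shows "\<exists>a. set_mset a \<inter> {..<j} = {} \<and> p a \<notin> q \<and>
    (\<forall>m. set_mset m \<inter> {..<j} = {} \<longrightarrow> a < m \<longrightarrow> p m \<in> q)"
proof -
  let ?M = "{m. set_mset m \<inter> {..<j} = {} \<and> p m \<notin> q}"
  have "\<zero> \<in> q" using ideal_ofD(2)[OF prime_ofD(1)[OF q]] .
  then have "?M \<subseteq> {m. p m \<noteq> \<zero>}" by auto
  then have fin: "finite ?M" using p(1) by (auto simp: PS_iff elim: finite_subset)
  have ne: "?M \<noteq> {}" using p by (auto simp: Jp_def)
  have "Max ?M \<in> ?M" by (rule Max_in[OF fin ne])
  moreover have "p m \<in> q" if "set_mset m \<inter> {..<j} = {}" "Max ?M < m" for m
  proof (rule ccontr)
    assume "p m \<notin> q"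
    then have "m \<le> Max ?M" using that by (intro Max_ge[OF fin]) auto
    then show False using that(2) by auto
  qed
  ultimately show ?thesis by blast
qed

text \<open>Gauss's argument: in the coefficient of the product at the sum of the two leading
  monomials, all summands but one lie in \<open>q\<close>, since the monomial order is compatible
  with addition. The restriction to monomials without the first \<open>j\<close> variables is
  harmless, as it is inherited by submultisets.\<close>

lemma Jp_prime:
  assumes q: "prime_of (carrier R) q"
  shows "primeideal (Jp I q j) (Pl I)"
proof -
  interpret P: cring "Pl I" by (rule cring_Pl)
  note qi = ideal_ofD[OF prime_ofD(1)[OF q]]
  have B: "set_mset u \<inter> {..<j} = {}" "set_mset (m - u) \<inter> {..<j} = {}"
    if "set_mset m \<inter> {..<j} = {}" "u \<subseteq># m" for m u
    using that(1) set_mset_mono[OF that(2)] set_mset_mono[OF diff_subset_eq_self[of m u]] by blast+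
  have "P.prime_of (carrier (Pl I)) (Jp I q j)"
    unfolding P.prime_of_def P.ideal_of_def
  proof (intro conjI ballI impI)
    show "Jp I q j \<subseteq> carrier (Pl I)" by (auto simp: Jp_def)
    show "\<zero>\<^bsub>Pl I\<^esub> \<in> Jp I q j"
      using qi(2) indexed_pset.indexed_const[OF zero_closed, of I] by (simp add: Jp_def indexed_zero_def)
    show "x \<oplus>\<^bsub>Pl I\<^esub> y \<in> Jp I q j" if "x \<in> Jp I q j" "y \<in> Jp I q j" for x y
      using that qi(3) by (auto simp: Jp_def indexed_padd_def[symmetric] intro: indexed_pset.indexed_padd)
        (auto simp: indexed_padd_def)
    show "r \<otimes>\<^bsub>Pl I\<^esub> p \<in> Jp I q j" if r: "r \<in> carrier (Pl I)" and p: "p \<in> Jp I q j" for r p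
    proof -
      have "conv r p m \<in> q" if "set_mset m \<inter> {..<j} = {}" for m
        unfolding conv_def
      proof (rule finsum_in_ideal_of[OF prime_ofD(1)[OF q] subset_refl])
        fix u assume "u \<in> {u. u \<subseteq># m}"
        then have "p (m - u) \<in> q" using B[OF that, of u] p by (auto simp: Jp_def)
        then show "r u \<otimes> p (m - u) \<in> q" using qi(4) r by simp
      qed simp
      then show ?thesis using r p conv_PS by (auto simp: Jp_def)
    qed
    show "\<one>\<^bsub>Pl I\<^esub> \<notin> Jp I q j"
      using prime_ofD(2)[OF q] by (auto simp: Jp_def indexed_const_def intro!: exI[of _ "{#}"])
    show "p \<in> Jp I q j \<or> p' \<in> Jp I q j"
      if p: "p \<in> carrier (Pl I)" and p': "p' \<in> carrier (Pl I)" and pp: "p \<otimes>\<^bsub>Pl I\<^esub> p' \<in> Jp I q j" for p p'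
    proof (rule ccontr)
      assume "\<not> ?thesis"
      then have np: "p \<notin> Jp I q j" "p' \<notin> Jp I q j" by auto
      have pc: "p \<in> PS I" "p' \<in> PS I" using p p' by auto
      obtain a where a: "set_mset a \<inter> {..<j} = {}" "p a \<notin> q" "\<And>m. set_mset m \<inter> {..<j} = {} \<Longrightarrow> a < m \<Longrightarrow> p m \<in> q"
        using Jp_lead[OF q pc(1) np(1)] by blast
      obtain b where b: "set_mset b \<inter> {..<j} = {}" "p' b \<notin> q" "\<And>m. set_mset m \<inter> {..<j} = {} \<Longrightarrow> b < m \<Longrightarrow> p' m \<in> q"
        using Jp_lead[OF q pc(2) np(2)] by blast
      define m where "m = a + b"
      have m: "set_mset m \<inter> {..<j} = {}" using a(1) b(1) by (auto simp: m_def)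
      define s where "s = (\<Oplus>u\<in>{u. u \<subseteq># m} - {a}. p u \<otimes> p' (m - u))"
      have sq: "s \<in> q"
        unfolding s_def
      proof (rule finsum_in_ideal_of[OF prime_ofD(1)[OF q] subset_refl])
        fix u assume u: "u \<in> {u. u \<subseteq># m} - {a}"
        then have um: "u \<subseteq># m" by simp
        then have e: "u + (m - u) = a + b" by (simp add: m_def)
        consider "a < u" | "u < a" using u by fastforce
        then show "p u \<otimes> p' (m - u) \<in> q"
        proof cases
          case 1
          then have "p u \<in> q" using a(3) B(1)[OF m um] by blast
          then have "p' (m - u) \<otimes> p u \<in> q" using qi(4) pc by simp
          then show ?thesis using pc by (simp add: m_comm)
        next
          case 2
          have "b < m - u"
          proof (rule ccontr)
            assume "\<not> b < m - u"
            then have "u + (m - u) < a + b" using 2 by (intro add_less_le_mono) auto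
            then show False using e by simp
          qed
          then have "p' (m - u) \<in> q" using b(3) B(2)[OF m um] by blast
          then show ?thesis using qi(4) pc by simp
        qed
      qed simp
      have sc: "s \<in> carrier R" using sq qi(1) by auto
      have "{u. u \<subseteq># m} = insert a ({u. u \<subseteq># m} - {a})" by (auto simp: m_def)
      then have "conv p p' m = (\<Oplus>u\<in>insert a ({u. u \<subseteq># m} - {a}). p u \<otimes> p' (m - u))"
        unfolding conv_def by simp
      also have "\<dots> = p a \<otimes> p' (m - a) \<oplus> s"
        unfolding s_def using pc by (intro finsum_insert) auto
      finally have c: "conv p p' m = p a \<otimes> p' b \<oplus> s" by (simp add: m_def)
      have "conv p p' m \<in> q" using pp m by (auto simp: Jp_def)
      then have "(p a \<otimes> p' b \<oplus> s) \<ominus> s \<in> q"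
        unfolding c using ideal_of_minus(1)[OF carrier_is_subring prime_ofD(1)[OF q]] sq by blast
      then have "p a \<otimes> p' b \<in> q" using pc sc by (simp add: minus_eq a_assoc r_neg)
      then show False using prime_ofD(3)[OF q, of "p a" "p' b"] PS_coeff[OF pc(1)] PS_coeff[OF pc(2)] a(2) b(2) by blast
    qed
  qed
  then show ?thesis using P.primeideal_iff[OF P.carrier_is_subring, of "Jp I q j"] by (simp del: Pl_simps)
qed

end

text \<open>The zero ideal is the extension of the zero prime with no variable adjoined, and
  \<open>Jp_prime\<close> says that it is prime.\<close>

lemma (in domain) domain_Pl: "domain (Pl {..<n::nat})"
proof -
  interpret P: cring "Pl {..<n}" by (rule cring_Pl)
  have "primeideal (Jp {..<n} {\<zero>} 0) (Pl {..<n})"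
    by (rule Jp_prime[OF zero_prime[OF carrier_is_subring]])
  moreover have "Jp {..<n} {\<zero>} 0 = {\<zero>\<^bsub>Pl {..<n}\<^esub>}"
    by (auto simp: Jp_def indexed_zero_def fun_eq_iff PS_iff)
  ultimately show ?thesis using P.zeroprimeideal_domainI by simp
qed

section \<open>Chains of primes in polynomial rings\<close>

lemma (in cring) indexed_var_PS: "i \<in> I \<Longrightarrow> indexed_var i \<in> PS I"
  unfolding indexed_var_def by (intro indexed_pset.indexed_pmult indexed_pset.indexed_const) auto

lemma (in cring) poly_chain_extend:
  assumes q: "\<And>i. i \<le> d \<Longrightarrow> prime_of (carrier R) (q i)" "\<And>i. i < d \<Longrightarrow> q i \<subset> q (Suc i)"
  shows "\<exists>p. prime_chain (Pl {..<n::nat}) (d + n) p"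
proof -
  \<comment> \<open>Up to index \<open>d\<close> the truncated difference \<open>i - d\<close> is
    zero and only the coefficients grow; afterwards the coefficients stay at \<open>q d\<close> and
    one variable is adjoined per step.\<close>
  define p where "p i = Jp {..<n} (q (min i d)) (i - d)" for i
  have "primeideal (p i) (Pl {..<n})" for i
    unfolding p_def by (rule Jp_prime[OF q(1)]) simp
  moreover have "p i \<subset> p (Suc i)" if i: "i < d + n" for i
  proof (cases "i < d")
    case True
    obtain x where x: "x \<in> q (Suc i)" "x \<notin> q i" using q(2)[OF True] by blast
    have xc: "x \<in> carrier R" using ideal_ofD(1)[OF prime_ofD(1)[OF q(1)[of "Suc i"]]] True x by auto
    have z: "\<zero> \<in> q (Suc i)" using ideal_ofD(2)[OF prime_ofD(1)[OF q(1)[of "Suc i"]]] True by auto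
    have e: "p i = Jp {..<n} (q i) 0" "p (Suc i) = Jp {..<n} (q (Suc i)) 0"
      using True by (auto simp: p_def min_def)
    have "p i \<subseteq> p (Suc i)" using q(2)[OF True] unfolding e Jp_def by blast
    moreover have "indexed_const x \<in> p (Suc i)"
      unfolding e Jp_def using x(1) z indexed_pset.indexed_const[OF xc] by (simp add: indexed_const_def)
    moreover have "indexed_const x \<notin> p i"
      unfolding e Jp_def using x(2) by (auto simp: indexed_const_def intro!: exI[of _ "{#}"])
    ultimately show ?thesis by blast
  next
    case False
    define j where "j = i - d"
    have j: "j < n" using i False by (auto simp: j_def)
    have e: "p i = Jp {..<n} (q d) j" "p (Suc i) = Jp {..<n} (q d) (Suc j)"
      using False by (auto simp: p_def j_def min_def Suc_diff_le)
    have z: "\<zero> \<in> q d" "\<one> \<notin> q d"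
      using ideal_ofD(2)[OF prime_ofD(1)[OF q(1)[of d]]] prime_ofD(2)[OF q(1)[of d]] by auto
    have "p i \<subseteq> p (Suc i)"
    proof
      fix g assume "g \<in> p i"
      then have g: "g \<in> PS {..<n}" "\<And>m. set_mset m \<inter> {..<j} = {} \<Longrightarrow> g m \<in> q d"
        by (simp_all add: e Jp_def)
      have "set_mset m \<inter> {..<j} = {}" if "set_mset m \<inter> {..<Suc j} = {}" for m
        using that by auto
      then show "g \<in> p (Suc i)" using g by (simp add: e Jp_def)
    qed
    moreover have "indexed_var j \<in> p (Suc i)"
      unfolding e Jp_def using indexed_var_PS[of j "{..<n}"] j z(1)
      by (auto simp: indexed_var_def indexed_pmult_def indexed_const_def)
    moreover have "indexed_var j \<notin> p i"
      unfolding e Jp_def using z(2)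
      by (auto simp: indexed_var_def indexed_pmult_def indexed_const_def intro!: exI[of _ "{#j#}"])
    ultimately show ?thesis by blast
  qed
  ultimately have "prime_chain (Pl {..<n}) (d + n) p" by (simp add: prime_chain_def)
  then show ?thesis by blast
qed

text \<open>A chain of length \<open>N\<close> produces \<open>N\<close> independent elements of the
  polynomial ring over the constants from \<open>K\<close>. In its quotient field all polynomials
  are algebraic over the image of \<open>B\<close> together with the \<open>n\<close> variables, and
  exchange compares the two sets.\<close>

lemma (in domain) poly_chain_bound:
  assumes K: "subfield K R" and B: "finite B" "B \<subseteq> carrier R" "algebraically_independent R K B"
    and max: "\<And>x. x \<in> carrier R \<Longrightarrow> x \<notin> B \<Longrightarrow> \<not> algebraically_independent R K (insert x B)"
    and p: "prime_chain (Pl {..<n::nat}) N p"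
  shows "N \<le> card B + n"
proof -
  let ?I = "{..<n}"
  let ?c = "indexed_const :: 'a \<Rightarrow> nat multiset \<Rightarrow> 'a"
  interpret P: domain "Pl ?I" by (rule domain_Pl)
  interpret c: ring_hom_cring R "Pl ?I" ?c by (rule const_hom)
  note c.hom_zero [simp del] c.hom_one [simp del]
  interpret F: field P.Q by (rule P.field_Q)
  interpret e: ring_hom_cring "Pl ?I" P.Q P.emb by (rule P.hom_emb)
  have sK: "subring K R" by (rule subfieldE(1)[OF K])
  have Kc: "K \<subseteq> carrier R" using subringE(1)[OF sK] .
  have scK: "subring (?c ` K) (Pl ?I)" by (rule c.hom_subring[OF sK])
  interpret cK: coeff_sub "Pl ?I" "?c ` K" by (rule P.coeff_subI[OF scK])
  let ?K = "P.emb ` ?c ` K"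
  interpret f: field_sub P.Q ?K by (rule F.field_subI[OF e.hom_subring[OF scK]])
  have pr: "P.prime_of (carrier (Pl ?I)) (p i)" if "i \<le> N" for i
    using p that P.primeideal_iff[OF P.carrier_is_subring, of "p i"] by (simp add: prime_chain_def del: Pl_simps)
  \<comment> \<open>Nonzero constants from the field \<open>K\<close> are units, so the empty set is
    independent modulo the top prime and can start the count.\<close>
  have pN: "cK.indm (p N) {}"
  proof -
    have "?c k = \<zero>\<^bsub>Pl ?I\<^esub>" if k: "k \<in> K" "?c k \<in> p N" for k
    proof (rule ccontr)
      assume "?c k \<noteq> \<zero>\<^bsub>Pl ?I\<^esub>"
      then have "k \<noteq> \<zero>" by auto
      then have i: "inv k \<in> K" "inv k \<otimes> k = \<one>" using subfield_m_inv[OF K, of k] k by auto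
      have "?c (inv k) \<otimes>\<^bsub>Pl ?I\<^esub> ?c k \<in> p N"
        using P.ideal_ofD(4)[OF P.prime_ofD(1)[OF pr[OF order_refl]] _ k(2), of "?c (inv k)"] c.hom_closed i(1) Kc by blast
      moreover have "?c (inv k \<otimes> k) = ?c (inv k) \<otimes>\<^bsub>Pl ?I\<^esub> ?c k"
        by (rule c.hom_mult) (use i(1) k(1) Kc in blast)+
      ultimately have "\<one>\<^bsub>Pl ?I\<^esub> \<in> p N" unfolding i(2) c.hom_one by metis
      then show False using P.prime_ofD(2)[OF pr[OF order_refl]] by contradiction
    qed
    then show ?thesis unfolding cK.indm_def using cK.alg_indep_empty cK.gen_empty by auto
  qed
  obtain Z where Z: "finite Z" "Z \<subseteq> carrier (Pl ?I)" "cK.indm (p 0) Z" "card Z = N"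
    using cK.indm_chain[OF P.carrier_is_subring subringE(1)[OF scK], of N p "{}"] pr pN p
    by (auto simp: prime_chain_def simp del: Pl_simps)
  have ej: "inj_on P.emb U" if "U \<subseteq> carrier (Pl ?I)" for U
    using P.emb_inj that by (rule inj_on_subset)
  have "cK.gen Z \<subseteq> carrier (Pl ?I)" using cK.gen_carrier[OF Z(2)] by blast
  then have aiZ: "f.ai (P.emb ` Z)"
    using e.hom_alg_indep[OF scK ej[OF subringE(1)[OF scK]] Z(1,2)] cK.indm_ai[OF Z(3)] ej by blast
  define h where "h x = P.emb (?c x)" for x
  have "h \<in> ring_hom R P.Q"
    using ring_hom_trans[OF c.homh P.emb_hom] by (simp add: h_def[abs_def] comp_def)
  then interpret h: ring_hom_cring R P.Q h
    by (simp add: ring_hom_cring_def ring_hom_cring_axioms_def is_cring F.is_cring)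
  have hj: "inj_on h (carrier R)"
    unfolding h_def by (rule inj_onI) (use P.emb_inj const_inj c.hom_closed in \<open>blast dest: inj_onD injD\<close>)
  then have hj': "inj_on h U" if "U \<subseteq> carrier R" for U using that by (rule inj_on_subset)
  have hK: "h ` K = ?K" by (auto simp: h_def)
  interpret k: coeff_sub R K by (rule coeff_subI[OF sK])
  \<comment> \<open>Otherwise the image of \<open>B\<close> could be enlarged by \<open>h x\<close>,
    and since \<open>h\<close> is injective so could \<open>B\<close> by \<open>x\<close>, against
    its maximality.\<close>
  have hR: "h x \<in> f.cl (h ` B)" if x: "x \<in> carrier R" for x
  proof (rule ccontr)
    assume n: "h x \<notin> f.cl (h ` B)"
    have hB: "h ` B \<subseteq> carrier P.Q" using B(2) by auto
    have xB: "x \<notin> B" using n f.cl_incl[OF hB] by auto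
    have "f.ai (h ` B)"
      using h.hom_alg_indep[OF sK hj'[OF Kc] B(1,2)] B(3) hj'[OF subringE(1)[OF k.subring_gen[OF B(2)]]] unfolding hK by blast
    then have "f.ai (h ` insert x B)" using f.ai_insert_iff[of "h x" "h ` B"] n hB x by auto
    moreover have i: "insert x B \<subseteq> carrier R" using B(2) x by auto
    ultimately have "algebraically_independent R K (insert x B)"
      using h.hom_alg_indep[OF sK hj'[OF Kc] _ i] B(1) hj'[OF i] unfolding hK by blast
    then show False using max[OF x xB] by blast
  qed
  let ?W = "h ` B \<union> (\<lambda>i. P.emb (indexed_var i)) ` ?I"
  have vc: "indexed_var i \<in> carrier (Pl ?I)" if "i \<in> ?I" for i
    using indexed_var_PS[OF that] by simp
  have W: "?W \<subseteq> carrier P.Q" using B(2) vc by auto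
  have sW: "subring (f.cl ?W) P.Q" by (rule subfieldE(1)[OF f.subfield_cl[OF W]])
  have all: "P.emb g \<in> f.cl ?W" if "g \<in> PS ?I" for g
    using that
  proof induction
    case (indexed_const k)
    then show ?case using hR[of k] f.cl_mono[of "h ` B" ?W] W by (auto simp: h_def)
  next
    case (indexed_padd g g')
    then show ?case using e.hom_add[of g g'] subringE(7)[OF sW] by simp
  next
    case (indexed_pmult g i)
    have "P.emb (indexed_var i) \<in> f.cl ?W" using f.cl_incl[OF W] indexed_pmult.hyps(2) by auto
    moreover have "P.emb (indexed_pmult g i) = P.emb (indexed_var i) \<otimes>\<^bsub>P.Q\<^esub> P.emb g"
      using e.hom_mult[of "indexed_var i" g] vc[OF indexed_pmult.hyps(2)] indexed_pmult.hyps(1)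
        pmult_conv_var[of g i] by simp
    ultimately show ?case using indexed_pmult.IH subringE(6)[OF sW] by simp
  qed
  have "card (P.emb ` Z) \<le> card ?W"
  proof (rule f.exchange_card)
    show "P.emb ` Z \<subseteq> f.cl ?W" using Z(2) all by auto
  qed (use B(1) Z(1) W aiZ in auto)
  moreover have "card (P.emb ` Z) = N" using Z(4) card_image[OF ej[OF Z(2)]] by simp
  moreover have "card ?W \<le> card B + n"
    using card_Un_le[of "h ` B"] card_image_le[OF B(1), of h] card_image_le[of ?I "\<lambda>i. P.emb (indexed_var i)"]
    by (metis (no_types, lifting) add_mono card_lessThan finite_lessThan le_trans)
  ultimately show ?thesis by simp
qed

section \<open>Subalgebras of affine domains\<close>

lemma finite_max_card:
  assumes "\<exists>Y. finite Y \<and> Q Y" "\<And>Y. finite Y \<Longrightarrow> Q Y \<Longrightarrow> card Y \<le> b"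
  obtains Y where "finite Y" "Q Y" "\<And>Y'. finite Y' \<Longrightarrow> Q Y' \<Longrightarrow> card Y' \<le> card Y"
proof -
  let ?N = "{n. \<exists>Y. finite Y \<and> Q Y \<and> card Y = n}"
  have f: "finite ?N" by (rule finite_subset[of _ "{..b}"]) (use assms(2) in auto)
  have "?N \<noteq> {}" using assms(1) by blast
  then obtain Y where "finite Y" "Q Y" "card Y = Max ?N" using Max_in[OF f] by blast
  moreover have "card Y' \<le> Max ?N" if "finite Y'" "Q Y'" for Y'
    using that by (intro Max_ge[OF f]) blast
  ultimately show thesis using that by simp
qed

lemma (in coeff_sub) indm_empty:
  assumes K: "subfield K R" and A: "K \<subseteq> A" and P: "prime_of A P"
  shows "indm P {}"
proof -
  have "k = \<zero>" if k: "k \<in> K" "k \<in> P" for k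
  proof (rule ccontr)
    assume "k \<noteq> \<zero>"
    then have i: "inv k \<in> K" "inv k \<otimes> k = \<one>" using subfield_m_inv[OF K, of k] k by auto
    then have "\<one> \<in> P" using ideal_ofD(4)[OF prime_ofD(1)[OF P], of "inv k" k] A k by auto
    then show False using prime_ofD(2)[OF P] by contradiction
  qed
  then show ?thesis unfolding indm_def gen_empty using alg_indep_empty by auto
qed

text \<open>A largest set \<open>Y\<close> that is independent modulo \<open>P\<close> is completed
  from \<open>Z\<close> to an independent set of size \<open>card Z\<close>. The number of added
  elements is the length of the chain from \<open>chain_below\<close>.\<close>

lemma (in affine_field) max_chain:
  assumes S: "finite S" "S \<subseteq> carrier R" and A: "subring A R" "K \<subseteq> A" "A \<subseteq> gen S"
    and P: "prime_of (gen S) P" and Z: "finite Z" "Z \<subseteq> A" "ai Z"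
    and max: "\<And>Y. finite Y \<Longrightarrow> Y \<subseteq> A \<Longrightarrow> ai Y \<Longrightarrow> card Y \<le> card Z"
  shows "\<exists>Y n p. finite Y \<and> Y \<subseteq> A \<and> indm P Y \<and> card Y + n = card Z \<and>
    (\<forall>i\<le>n. prime_of A (p i)) \<and> (\<forall>i<n. p i \<subset> p (Suc i)) \<and> p n = P \<inter> A"
proof -
  have "K \<subseteq> gen S" using gen_incl(2) by blast
  then have e: "indm P {}" by (rule indm_empty[OF subfield_K _ P])
  have "\<exists>Y. finite Y \<and> Y \<subseteq> A \<and> indm P Y" by (intro exI[of _ "{}"]) (simp add: e)
  moreover have "card Y \<le> card Z" if "finite Y" "Y \<subseteq> A \<and> indm P Y" for Y
    using max indm_ai that by blast
  ultimately obtain Y where Y: "finite Y" "Y \<subseteq> A \<and> indm P Y"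
    "\<And>Y'. finite Y' \<Longrightarrow> Y' \<subseteq> A \<and> indm P Y' \<Longrightarrow> card Y' \<le> card Y"
    using finite_max_card[of "\<lambda>Y. Y \<subseteq> A \<and> indm P Y" "card Z"] by blast
  have "ai Y" using indm_ai Y(2) by blast
  then obtain W where W: "W \<subseteq> Z" "Y \<inter> W = {}" "ai (Y \<union> W)" "card Y + card W = card Z"
    using exchange_extend[OF Y(1) Z(1) _ Z(3)] max Y by blast
  have "\<exists>p. (\<forall>i\<le>card W. prime_of A (p i)) \<and> (\<forall>i<card W. p i \<subset> p (Suc i)) \<and> p (card W) = P \<inter> A"
  proof (rule chain_below[OF subfield_K S A P Y(1)])
    show "Y \<subseteq> A" "indm P Y" using Y(2) by auto
    show "\<not> indm P (insert y Y)" if "y \<in> A" "y \<notin> Y" for y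
    proof
      assume "indm P (insert y Y)"
      then have "card (insert y Y) \<le> card Y" using Y that by (intro Y(3)) auto
      then show False using that Y(1) by simp
    qed
    show "finite W" "W \<subseteq> A" using W(1) Z(1,2) finite_subset by auto
  qed (use W in auto)
  then show ?thesis using Y W(4) by blast
qed

section \<open>Transfer from the quotient field to the domain\<close>

context domain
begin

lemma prime_of_emb:
  assumes "p \<subseteq> A" "subring A R"
  shows "ring.prime_of Q (emb ` A) (emb ` p) \<longleftrightarrow> prime_of A p"
    "ring.ideal_of Q (emb ` A) (emb ` p) \<longleftrightarrow> ideal_of A p"
proof -
  interpret F: field Q by (rule field_Q)
  interpret e: ring_hom_cring R Q emb by (rule hom_emb)
  note Ac = subringE(1)[OF assms(2), THEN subsetD]
  have m: "emb a \<in> emb ` p \<longleftrightarrow> a \<in> p" if "a \<in> carrier R" for a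
    using that assms(1) Ac emb_inj by (auto dest: inj_onD)
  have "emb \<zero> = \<zero>\<^bsub>Q\<^esub>" "emb \<one> = \<one>\<^bsub>Q\<^esub>" by auto
  then have z: "\<zero>\<^bsub>Q\<^esub> \<in> emb ` p \<longleftrightarrow> \<zero> \<in> p" "\<one>\<^bsub>Q\<^esub> \<in> emb ` p \<longleftrightarrow> \<one> \<in> p"
    using m[of \<zero>] m[of \<one>] by auto
  have pc: "x \<in> p \<Longrightarrow> x \<in> carrier R" for x using assms(1) Ac by auto
  have a: "emb x \<oplus>\<^bsub>Q\<^esub> emb y \<in> emb ` p \<longleftrightarrow> x \<oplus> y \<in> p" if "x \<in> carrier R" "y \<in> carrier R" for x y
    using m[of "x \<oplus> y"] that by simp
  have b: "emb x \<otimes>\<^bsub>Q\<^esub> emb y \<in> emb ` p \<longleftrightarrow> x \<otimes> y \<in> p" if "x \<in> carrier R" "y \<in> carrier R" for x y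
    using m[of "x \<otimes> y"] that by simp
  have s: "emb ` p \<subseteq> emb ` A" "p \<subseteq> A" using assms(1) by auto
  show i: "F.ideal_of (emb ` A) (emb ` p) \<longleftrightarrow> ideal_of A p"
    unfolding F.ideal_of_def ideal_of_def ball_simps using s z(1) a b Ac pc by simp
  show "F.prime_of (emb ` A) (emb ` p) \<longleftrightarrow> prime_of A p"
    unfolding F.prime_of_def prime_of_def i ball_simps using z(2) b m Ac by simp
qed

lemma indm_emb:
  assumes K: "subring K R" and Y: "finite Y" "Y \<subseteq> carrier R" and P: "P \<subseteq> carrier R"
  shows "coeff_sub.indm Q (emb ` K) (emb ` P) (emb ` Y) \<longleftrightarrow> coeff_sub.indm R K P Y"
    "algebraically_independent Q (emb ` K) (emb ` Y) \<longleftrightarrow> algebraically_independent R K Y"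
proof -
  interpret F: field Q by (rule field_Q)
  interpret e: ring_hom_cring R Q emb by (rule hom_emb)
  interpret k: coeff_sub R K by (rule coeff_subI[OF K])
  interpret f: field_sub Q "emb ` K" by (rule F.field_subI[OF e.hom_subring[OF K]])
  have j: "inj_on emb U" if "U \<subseteq> carrier R" for U using emb_inj that by (rule inj_on_subset)
  have gc: "k.gen Y \<subseteq> carrier R" using subringE(1)[OF k.subring_gen[OF Y(2)]] .
  show ai: "f.ai (emb ` Y) \<longleftrightarrow> k.ai Y"
    using e.hom_alg_indep[OF K j[OF subringE(1)[OF K]] Y] j[OF gc] j[OF Y(2)] by blast
  have "f.gen (emb ` Y) = emb ` k.gen Y"
    using e.hom_generate_ring[of "K \<union> Y"] subringE(1)[OF K] Y(2) by (simp add: image_Un)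
  then have "f.gen (emb ` Y) \<inter> emb ` P = emb ` (k.gen Y \<inter> P)"
    using inj_on_image_Int[OF emb_inj gc P] by simp
  moreover have "emb ` U \<subseteq> {\<zero>\<^bsub>Q\<^esub>} \<longleftrightarrow> U \<subseteq> {\<zero>}" if "U \<subseteq> carrier R" for U
  proof -
    have "emb u = \<zero>\<^bsub>Q\<^esub> \<longleftrightarrow> u = \<zero>" if "u \<in> carrier R" for u
      using e.hom_zero inj_onD[OF emb_inj, of u \<zero>] that by auto
    then show ?thesis using that by blast
  qed
  moreover have "k.gen Y \<inter> P \<subseteq> carrier R" using gc by blast
  ultimately show "f.indm (emb ` P) (emb ` Y) \<longleftrightarrow> k.indm P Y"
    unfolding f.indm_def k.indm_def ai by simp
qed

text \<open>Transfer along the embedding into the quotient field.\<close>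

lemma affine_chain:
  assumes K: "subfield K R" and S: "finite S" "S \<subseteq> carrier R" "generate_ring R (K \<union> S) = carrier R"
    and A: "subring A R" "K \<subseteq> A"
  shows "\<exists>Z. finite Z \<and> Z \<subseteq> A \<and> algebraically_independent R K Z \<and>
    (\<forall>Y. finite Y \<longrightarrow> Y \<subseteq> A \<longrightarrow> algebraically_independent R K Y \<longrightarrow> card Y \<le> card Z) \<and>
    (\<forall>P. prime_of (carrier R) P \<longrightarrow>
      (\<exists>Y n p. finite Y \<and> Y \<subseteq> A \<and> coeff_sub.indm R K P Y \<and> card Y + n = card Z \<and>
        (\<forall>i\<le>n. prime_of A (p i)) \<and> (\<forall>i<n. p i \<subset> p (Suc i)) \<and> p n = P \<inter> A)) \<and>
    (\<forall>P Y. prime_of (carrier R) P \<longrightarrow> (\<forall>J. ideal_of (carrier R) J \<longrightarrow> P \<subseteq> J \<longrightarrow> \<one> \<notin> J \<longrightarrow> J = P) \<longrightarrow>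
      finite Y \<longrightarrow> Y \<subseteq> carrier R \<longrightarrow> coeff_sub.indm R K P Y \<longrightarrow> Y = {})"
proof -
  interpret F: field Q by (rule field_Q)
  interpret e: ring_hom_cring R Q emb by (rule hom_emb)
  have sK: "subring K R" by (rule subfieldE(1)[OF K])
  have ne: "\<one>\<^bsub>Q\<^esub> \<noteq> \<zero>\<^bsub>Q\<^esub>" by (rule F.one_not_zero)
  have eh: "ring_hom_ring R Q emb"
    by (rule ring_hom_ringI2[OF ring_axioms F.ring_axioms emb_hom])
  interpret f: affine_field Q "emb ` K"
    by (rule F.affine_fieldI[OF ring_hom_ring.img_is_subfield(2)[OF eh K ne]])
  have gS: "f.gen (emb ` S) = emb ` carrier R"
    using e.hom_generate_ring[of "K \<union> S"] subringE(1)[OF sK] S by (simp add: image_Un)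
  have Ac: "A \<subseteq> carrier R" using subringE(1)[OF A(1)] .
  have eS: "finite (emb ` S)" "emb ` S \<subseteq> carrier Q" using S(1,2) by auto
  have ai: "f.ai (emb ` Y) \<longleftrightarrow> algebraically_independent R K Y" if "finite Y" "Y \<subseteq> carrier R" for Y
    using indm_emb(2)[OF sK that subset_refl] .
  have j: "inj_on emb U" if "U \<subseteq> carrier R" for U using emb_inj that by (rule inj_on_subset)
  have lift: "\<exists>Y\<subseteq>A. finite Y \<and> card Y = card V \<and> V = emb ` Y" if "V \<subseteq> emb ` A" "finite V" for V
  proof -
    obtain Y where Y: "Y \<subseteq> A" "V = emb ` Y" using \<open>V \<subseteq> emb ` A\<close> by (rule subset_imageE)
    have i: "inj_on emb Y" by (rule j[OF order_trans[OF Y(1) Ac]])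
    have "finite Y" using finite_imageD[OF _ i] \<open>finite V\<close> Y(2) by simp
    then show ?thesis using Y card_image[OF i] by auto
  qed
  have bnd: "card Y \<le> card (emb ` S)"
    if "finite Y" "Y \<subseteq> A \<and> algebraically_independent R K Y" for Y
  proof -
    have Yc: "Y \<subseteq> carrier R" using that Ac by blast
    have "card (emb ` Y) \<le> card (emb ` S)"
    proof (rule f.ai_card_bound[OF eS])
      show "f.ai (emb ` Y)" using ai[OF that(1) Yc] that(2) by blast
      show "emb ` Y \<subseteq> f.gen (emb ` S)" unfolding gS using Yc by blast
    qed (use that in simp)
    then show ?thesis using card_image[OF j[OF Yc]] by simp
  qed
  have "\<exists>Y. finite Y \<and> Y \<subseteq> A \<and> algebraically_independent R K Y"
    using coeff_sub.alg_indep_empty[OF coeff_subI[OF sK]] by (intro exI[of _ "{}"]) simp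
  then obtain Z where Z: "finite Z" "Z \<subseteq> A \<and> algebraically_independent R K Z"
    "\<And>Y. finite Y \<Longrightarrow> Y \<subseteq> A \<and> algebraically_independent R K Y \<Longrightarrow> card Y \<le> card Z"
    using finite_max_card[of "\<lambda>Y. Y \<subseteq> A \<and> algebraically_independent R K Y"] bnd by blast
  have Zc: "Z \<subseteq> carrier R" using Z(2) Ac by blast
  show ?thesis
  proof (rule exI[of _ Z], intro conjI allI impI)
    show "finite Z" "Z \<subseteq> A" "algebraically_independent R K Z" using Z(1,2) by auto
    show "card Y \<le> card Z" if "finite Y" "Y \<subseteq> A" "algebraically_independent R K Y" for Y
      using Z(3) that by blast
  next
    fix P assume P: "prime_of (carrier R) P"
    have Pc: "P \<subseteq> carrier R" using ideal_ofD(1)[OF prime_ofD(1)[OF P]] .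
    have "\<exists>Y n p. finite Y \<and> Y \<subseteq> emb ` A \<and> f.indm (emb ` P) Y \<and> card Y + n = card (emb ` Z) \<and>
      (\<forall>i\<le>n. F.prime_of (emb ` A) (p i)) \<and> (\<forall>i<n. p i \<subset> p (Suc i)) \<and> p n = emb ` P \<inter> emb ` A"
    proof (rule f.max_chain[OF eS])
      show "subring (emb ` A) Q" by (rule e.hom_subring[OF A(1)])
      show "emb ` K \<subseteq> emb ` A" by (rule image_mono[OF A(2)])
      show "emb ` A \<subseteq> f.gen (emb ` S)" unfolding gS by (rule image_mono[OF Ac])
      show "F.prime_of (f.gen (emb ` S)) (emb ` P)"
        unfolding gS using prime_of_emb(1)[OF Pc carrier_is_subring] P by simp
      show "finite (emb ` Z)" "emb ` Z \<subseteq> emb ` A" "f.ai (emb ` Z)" using Z(1,2) ai[OF Z(1) Zc] by auto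
      show "card V \<le> card (emb ` Z)" if V: "finite V" "V \<subseteq> emb ` A" "f.ai V" for V
      proof -
        obtain Y where Y: "Y \<subseteq> A" "finite Y" "card Y = card V" "V = emb ` Y" using lift[OF V(2,1)] by blast
        then have "algebraically_independent R K Y" using ai[of Y] V(3) Ac by auto
        then show ?thesis using Z(3)[of Y] Y card_image[OF j[OF Zc]] by simp
      qed
    qed
    then obtain V n p where V: "finite V" "V \<subseteq> emb ` A" "f.indm (emb ` P) V" "card V + n = card (emb ` Z)"
      and p': "\<forall>i\<le>n. F.prime_of (emb ` A) (p i)" "\<forall>i<n. p i \<subset> p (Suc i)" "p n = emb ` P \<inter> emb ` A"
      by (elim exE conjE)
    note p = p'(1,2)[rule_format] p'(3)
    obtain Y where Y: "Y \<subseteq> A" "finite Y" "card Y = card V" "V = emb ` Y" using lift[OF V(2,1)] by blast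
    have Yc: "Y \<subseteq> carrier R" using Y(1) Ac by blast
    \<comment> \<open>Preimages taken inside \<open>A\<close>; \<open>emb\<close> maps them onto the
      sets \<open>p i\<close>, because these lie in the image of \<open>A\<close>.\<close>
    define q where "q i = {x \<in> A. emb x \<in> p i}" for i
    have qA: "q i \<subseteq> A" for i by (auto simp: q_def)
    have pA: "p i \<subseteq> emb ` A" if "i \<le> n" for i using F.ideal_ofD(1)[OF F.prime_ofD(1)[OF p(1)[OF that]]] .
    have qp: "emb ` q i = p i" if "i \<le> n" for i using pA[OF that] by (auto simp: q_def)
    have "prime_of A (q i)" if "i \<le> n" for i
      using prime_of_emb(1)[OF qA A(1), of i] qp[OF that] p(1)[OF that] by simp
    moreover have "q i \<subset> q (Suc i)" if "i < n" for i
    proof -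
      have "q i \<subseteq> q (Suc i)" using p(2)[OF that] by (auto simp: q_def)
      moreover have "q i \<noteq> q (Suc i)" using qp[of i] qp[of "Suc i"] that p(2)[OF that] by auto
      ultimately show ?thesis by blast
    qed
    moreover have "q n = P \<inter> A"
      using p(3) Pc Ac emb_inj by (auto simp: q_def dest: inj_onD)
    moreover have "coeff_sub.indm R K P Y" using indm_emb(1)[OF sK Y(2) Yc Pc] V(3) Y(4) by simp
    moreover have "card Y + n = card Z" using V(4) Y(3) card_image[OF j[OF Zc]] by simp
    ultimately show "\<exists>Y n p. finite Y \<and> Y \<subseteq> A \<and> coeff_sub.indm R K P Y \<and> card Y + n = card Z \<and>
        (\<forall>i\<le>n. prime_of A (p i)) \<and> (\<forall>i<n. p i \<subset> p (Suc i)) \<and> p n = P \<inter> A"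
      using Y(1,2) by (intro exI[of _ Y] exI[of _ n] exI[of _ q] conjI) auto
  next
    fix P Y assume P: "prime_of (carrier R) P"
      and mx: "\<forall>J. ideal_of (carrier R) J \<longrightarrow> P \<subseteq> J \<longrightarrow> \<one> \<notin> J \<longrightarrow> J = P"
      and Y: "finite Y" "Y \<subseteq> carrier R" "coeff_sub.indm R K P Y"
    have Pc: "P \<subseteq> carrier R" using ideal_ofD(1)[OF prime_ofD(1)[OF P]] .
    have "emb ` Y = {}"
    proof (rule f.maximal_indm_empty[OF eS])
      show "F.prime_of (f.gen (emb ` S)) (emb ` P)"
        unfolding gS using prime_of_emb(1)[OF Pc carrier_is_subring] P by simp
      show "emb ` Y \<subseteq> f.gen (emb ` S)" unfolding gS using Y(2) by blast
      show "f.indm (emb ` P) (emb ` Y)" using indm_emb(1)[OF sK Y(1,2) Pc] Y(3) by simp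
      show "J = emb ` P" if J: "F.ideal_of (f.gen (emb ` S)) J" "emb ` P \<subseteq> J" "\<one>\<^bsub>Q\<^esub> \<notin> J" for J
      proof -
        define I where "I = {x \<in> carrier R. emb x \<in> J}"
        have "J \<subseteq> emb ` carrier R" using F.ideal_ofD(1)[OF J(1)] unfolding gS .
        then have IJ: "emb ` I = J" by (auto simp: I_def)
        have Ic: "I \<subseteq> carrier R" by (auto simp: I_def)
        have "ideal_of (carrier R) I"
          using prime_of_emb(2)[OF Ic carrier_is_subring] J(1) unfolding gS IJ by simp
        moreover have "P \<subseteq> I" using J(2) Pc by (auto simp: I_def)
        moreover have "\<one> \<notin> I" using J(3) e.hom_one by (simp add: I_def)
        ultimately show ?thesis using mx IJ by blast
      qed
    qed
    then show "Y = {}" by simp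
  qed
qed

end

section \<open>Evaluating dimension, height and transcendence degree\<close>

lemma SUP_enat_max: "x \<in> F \<Longrightarrow> (\<And>y. y \<in> F \<Longrightarrow> f y \<le> f x) \<Longrightarrow> (SUP y\<in>F. enat (f y)) = enat (f x)"
  by (intro antisym SUP_least SUP_upper) auto

lemma (in cring) prime_chain_subring:
  assumes "subring A R"
  shows "prime_chain (R\<lparr>carrier := A\<rparr>) n p \<longleftrightarrow> (\<forall>i\<le>n. prime_of A (p i)) \<and> (\<forall>i<n. p i \<subset> p (Suc i))"
  unfolding prime_chain_def primeideal_iff[OF assms] ..

lemma (in cring) primeideal_carrier: "primeideal p R \<longleftrightarrow> prime_of (carrier R) p"
  using primeideal_iff[OF carrier_is_subring] by simp

text \<open>Scalar multiplication does not enter the construction of fractions, so the algebra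
  structure on the quotient can be forgotten.\<close>

lemma quotient_field_quotient_algebra:
  "quotient_field (quotient_algebra D J) = quotient_field (D Quot J)"
  "fraction (quotient_algebra D J) = fraction (D Quot J)"
proof -
  have r: "fraction_rel (quotient_algebra D J) = fraction_rel (D Quot J)"
    by (simp add: fraction_rel_def quotient_algebra_def ring.defs)
  show f: "fraction (quotient_algebra D J) = fraction (D Quot J)"
    by (intro ext) (simp add: fraction_def r)
  show "quotient_field (quotient_algebra D J) = quotient_field (D Quot J)"
    unfolding quotient_field_def r f by (simp add: quotient_algebra_def ring.defs)
qed

text \<open>The representatives of the coset of one have scalar multiples that differ by elements of
  \<open>J\<close>, so the union in the definition is a single coset.\<close>

lemma scalars_quotient_algebra:
  assumes "cring D" "ideal J D" and k: "\<And>c x. c \<in> carrier k \<Longrightarrow> x \<in> carrier D \<Longrightarrow>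
    c \<odot>\<^bsub>D\<^esub> x = (c \<odot>\<^bsub>D\<^esub> \<one>\<^bsub>D\<^esub>) \<otimes>\<^bsub>D\<^esub> x" "\<And>c. c \<in> carrier k \<Longrightarrow> c \<odot>\<^bsub>D\<^esub> \<one>\<^bsub>D\<^esub> \<in> carrier D"
  shows "scalars k (quotient_algebra D J) = (\<lambda>x. J +>\<^bsub>D\<^esub> x) ` scalars k D"
proof -
  interpret D: cring D by fact
  interpret J: ideal J D by fact
  have "(\<Union>u\<in>J +>\<^bsub>D\<^esub> \<one>\<^bsub>D\<^esub>. J +>\<^bsub>D\<^esub> (c \<odot>\<^bsub>D\<^esub> u)) = J +>\<^bsub>D\<^esub> (c \<odot>\<^bsub>D\<^esub> \<one>\<^bsub>D\<^esub>)" if c: "c \<in> carrier k" for c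
  proof -
    let ?s = "c \<odot>\<^bsub>D\<^esub> \<one>\<^bsub>D\<^esub>"
    have s: "?s \<in> carrier D" by (rule k(2)[OF c])
    have "J +>\<^bsub>D\<^esub> (c \<odot>\<^bsub>D\<^esub> u) = J +>\<^bsub>D\<^esub> ?s" if ux: "u \<in> J +>\<^bsub>D\<^esub> \<one>\<^bsub>D\<^esub>" for u
    proof -
      obtain j where j: "j \<in> J" "u = j \<oplus>\<^bsub>D\<^esub> \<one>\<^bsub>D\<^esub>" using ux unfolding a_r_coset_def' by blast
      have jc: "j \<in> carrier D" using j(1) J.Icarr by blast
      have u: "c \<odot>\<^bsub>D\<^esub> u = ?s \<otimes>\<^bsub>D\<^esub> j \<oplus>\<^bsub>D\<^esub> ?s"
        using k(1)[OF c, of u] s jc j(2) by (simp add: D.r_distr)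
      have sj: "?s \<otimes>\<^bsub>D\<^esub> j \<in> J" by (rule J.I_l_closed[OF j(1) s])
      then have "(c \<odot>\<^bsub>D\<^esub> u) \<ominus>\<^bsub>D\<^esub> ?s \<in> J"
        unfolding u using s jc by (simp add: D.minus_eq D.a_assoc D.r_neg)
      then show ?thesis
        using D.quotient_eq_iff_same_a_r_cos[OF J.ideal_axioms, of "c \<odot>\<^bsub>D\<^esub> u" ?s] s jc u by simp
    qed
    moreover have "\<one>\<^bsub>D\<^esub> \<in> J +>\<^bsub>D\<^esub> \<one>\<^bsub>D\<^esub>"
      using J.zero_closed unfolding a_r_coset_def' by (auto intro!: bexI[of _ "\<zero>\<^bsub>D\<^esub>"])
    ultimately show ?thesis by (intro UN_constant_eq[of "\<one>\<^bsub>D\<^esub>"]) blast+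
  qed
  then show ?thesis
    unfolding scalars_def image_image
    by (intro image_cong refl) (simp add: quotient_algebra_def ring.defs module.defs FactRing_def)
qed

context domain
begin

lemma transcendence_degree_subring:
  assumes A: "subring A R" and K: "subring K R" "K \<subseteq> A"
    and Z: "finite Z" "Z \<subseteq> A" "algebraically_independent R K Z"
    and max: "\<And>Y. finite Y \<Longrightarrow> Y \<subseteq> A \<Longrightarrow> algebraically_independent R K Y \<Longrightarrow> card Y \<le> card Z"
  shows "transcendence_degree (quotient_field (R\<lparr>carrier := A\<rparr>))
    ((\<lambda>x. fraction (R\<lparr>carrier := A\<rparr>) x \<one>) ` K) = enat (card Z)"
proof -
  let ?D = "R\<lparr>carrier := A\<rparr>"
  interpret D: domain ?D by (rule subring_is_domain[OF A])
  have Yc: "Y \<subseteq> A" if "algebraically_independent ?D K Y" for Y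
    using that unfolding algebraically_independent_def by simp
  have "transcendence_degree D.Q (D.emb ` K) = (SUP S\<in>{S. finite S \<and> algebraically_independent ?D K S}. enat (card S))"
    by (rule D.transcendence_degree_Q[OF subring_subring[OF A K]])
  also have "\<dots> = enat (card Z)"
  proof (rule SUP_enat_max)
    show "Z \<in> {S. finite S \<and> algebraically_independent ?D K S}"
      using Z alg_indep_subring[OF A K Z(1,2)] by simp
    show "card Y \<le> card Z" if "Y \<in> {S. finite S \<and> algebraically_independent ?D K S}" for Y
      using that alg_indep_subring[OF A K, of Y] Yc[of Y] max[of Y] by simp
  qed
  finally show ?thesis by (simp add: D.emb_def[abs_def])
qed

text \<open>By \<open>hom_alg_indep\<close>, sets independent modulo \<open>p\<close> are exactly
  those that reduce injectively to independent sets of residue classes. Every independent set of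
  residue classes arises so, by a choice of representatives.\<close>

lemma transcendence_degree_quotient:
  assumes A: "subring A R" and K: "subfield K R" "K \<subseteq> A" and p: "prime_of A p"
    and Y: "finite Y" "Y \<subseteq> A" "coeff_sub.indm R K p Y"
    and max: "\<And>Y'. finite Y' \<Longrightarrow> Y' \<subseteq> A \<Longrightarrow> coeff_sub.indm R K p Y' \<Longrightarrow> card Y' \<le> card Y"
  defines "D \<equiv> R\<lparr>carrier := A\<rparr>"
  shows "transcendence_degree (quotient_field (D Quot p))
    ((\<lambda>x. fraction (D Quot p) x \<one>\<^bsub>D Quot p\<^esub>) ` (\<lambda>x. p +>\<^bsub>D\<^esub> x) ` K) = enat (card Y)"
proof -
  interpret D: domain D unfolding D_def by (rule subring_is_domain[OF A])
  have Dc: "carrier D = A" by (simp add: D_def)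
  interpret p: primeideal p D using primeideal_iff[OF A] p by (simp add: D_def)
  interpret q: domain "D Quot p" by (rule p.quotient_is_domain)
  have zq: "\<zero>\<^bsub>D Quot p\<^esub> = p" by (simp add: FactRing_def)
  have cq: "carrier (D Quot p) = (\<lambda>x. p +>\<^bsub>D\<^esub> x) ` A" using Dc by (auto simp: FactRing_def A_RCOSETS_def')
  interpret h: ring_hom_cring D "D Quot p" "(+>\<^bsub>D\<^esub>) p" by (rule p.rcos_ring_hom_cring)
  have sK: "subring K R" by (rule subfieldE(1)[OF K(1)])
  have sKD: "subring K D" unfolding D_def by (rule subring_subring[OF A sK K(2)])
  interpret k: coeff_sub R K by (rule coeff_subI[OF sK])
  let ?h = "(+>\<^bsub>D\<^esub>) p"
  have ker: "?h a = \<zero>\<^bsub>D Quot p\<^esub> \<longleftrightarrow> a \<in> p" if a: "a \<in> A" for a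
  proof -
    have "a \<in> carrier D" using a Dc by simp
    then show ?thesis
      unfolding zq using p.rcos_const_imp_mem[of a] D.a_rcos_zero[OF p.is_ideal, of a] by auto
  qed
  have zD: "\<zero>\<^bsub>D\<^esub> = \<zero>" by (simp add: D_def)
  have inj: "inj_on ?h U \<longleftrightarrow> U \<inter> p \<subseteq> {\<zero>}" if U: "subring U D" for U
  proof -
    have "U \<subseteq> A" using subringE(1)[OF U] Dc by simp
    then have "\<forall>a\<in>U. ?h a = \<zero>\<^bsub>D Quot p\<^esub> \<longleftrightarrow> a \<in> p" using ker by blast
    then show ?thesis unfolding h.inj_on_subring[OF U] zD by auto
  qed
  have "k.gen {} \<inter> p \<subseteq> {\<zero>}" using k.indm_empty[OF K p] unfolding k.indm_def by blast
  then have jK: "inj_on ?h K" using inj[OF sKD] unfolding k.gen_empty by blast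
  let ?ai = "algebraically_independent (D Quot p) (?h ` K)"
  have iff: "?ai (?h ` Y') \<and> inj_on ?h Y' \<longleftrightarrow> k.indm p Y'" if Y': "finite Y'" "Y' \<subseteq> A" for Y'
  proof -
    have KY: "K \<union> Y' \<subseteq> carrier D" using K(2) Y'(2) Dc by simp
    have g: "generate_ring D (K \<union> Y') = k.gen Y'"
      unfolding D_def by (rule generate_ring_subring[OF A]) (use KY Dc in simp)
    have "algebraically_independent D K Y' \<longleftrightarrow> k.ai Y'"
      unfolding D_def by (rule alg_indep_subring[OF A sK K(2) Y'])
    moreover have "inj_on ?h (k.gen Y') \<longleftrightarrow> k.gen Y' \<inter> p \<subseteq> {\<zero>}"
      by (rule inj) (use D.generate_ring_is_subring[OF KY] g in simp)
    ultimately show ?thesis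
      using h.hom_alg_indep[OF sKD jK Y'(1), unfolded Dc, OF Y'(2), unfolded g] unfolding k.indm_def by simp
  qed
  have "transcendence_degree q.Q (q.emb ` ?h ` K) = (SUP S\<in>{S. finite S \<and> ?ai S}. enat (card S))"
    by (rule q.transcendence_degree_Q[OF h.hom_subring[OF sKD]])
  also have "\<dots> = enat (card (?h ` Y))"
  proof (rule SUP_enat_max)
    have "?ai (?h ` Y) \<and> inj_on ?h Y" using iff[OF Y(1,2)] Y(3) by blast
    then show "?h ` Y \<in> {S. finite S \<and> ?ai S}" using Y(1) by simp
    show "card S \<le> card (?h ` Y)" if S: "S \<in> {S. finite S \<and> ?ai S}" for S
    proof -
      have "S \<subseteq> carrier (D Quot p)" using S unfolding algebraically_independent_def by simp
      \<comment> \<open>One representative for each residue class, so the lifted set has the same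
        size.\<close>
      then obtain Y' where Y': "Y' \<subseteq> A" "inj_on ?h Y'" "S = ?h ` Y'"
        unfolding cq subset_image_inj by blast
      have f: "finite Y'" using finite_imageD[OF _ Y'(2)] S Y'(3) by simp
      have "k.indm p Y'" using iff[OF f Y'(1)] S Y' by simp
      then have "card Y' \<le> card Y" by (rule max[OF f Y'(1)])
      moreover have "card (?h ` Y) = card Y"
        using iff[OF Y(1,2)] Y(3) by (intro card_image) blast
      ultimately show ?thesis using Y'(3) card_image[OF Y'(2)] by simp
    qed
  qed
  also have "card (?h ` Y) = card Y" using iff[OF Y(1,2)] Y(3) by (intro card_image) blast
  finally show ?thesis by (simp add: q.emb_def[abs_def])
qed

end

theorem corollary3p3:
  fixes k :: "('k, 'c) ring_scheme"
    and T :: "('k, 'a, 'b) module_scheme"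
    and R :: "'a set"
  assumes "field k"
    and "affine_domain k T"
    and "is_subalgebra k R T"
  shows "(krull_dim (T\<lparr>carrier := R\<rparr>) = td k (T\<lparr>carrier := R\<rparr>) \<and>
          jaffard_domain (T\<lparr>carrier := R\<rparr>)) \<and>
         (\<forall>P. primeideal P T \<longrightarrow>
           krull_dim (T\<lparr>carrier := R\<rparr>) =
             height (T\<lparr>carrier := R\<rparr>) (P \<inter> R) +
             td k (quotient_algebra (T\<lparr>carrier := R\<rparr>) (P \<inter> R))) \<and>
         (\<forall>M. maximalideal M (T\<lparr>carrier := R\<rparr>) \<and> survives M T \<longrightarrow>
           krull_dim (T\<lparr>carrier := R\<rparr>) = height (T\<lparr>carrier := R\<rparr>) M)"
proof -
  interpret k: field k by fact
  interpret T: domain T using assms(2) by (simp add: affine_domain_def)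
  obtain S where al: "algebra k T" and S: "finite S" "S \<subseteq> carrier T"
    "generate_ring T (scalars k T \<union> S) = carrier T"
    using assms(2) unfolding affine_domain_def finitely_generated_algebra_def by blast
  interpret al: algebra k T by (rule al)
  define K where "K = scalars k T"
  define D where "D = T\<lparr>carrier := R\<rparr>"
  have A: "subring R T" and sm: "submodule R k T" using assms(3) unfolding is_subalgebra_def by auto
  have smul: "c \<odot>\<^bsub>T\<^esub> x = (c \<odot>\<^bsub>T\<^esub> \<one>\<^bsub>T\<^esub>) \<otimes>\<^bsub>T\<^esub> x" if "c \<in> carrier k" "x \<in> carrier T" for c x
    using al.smult_assoc2[of c "\<one>\<^bsub>T\<^esub>" x] that by simp
  \<comment> \<open>The structure map goes from a field to a nonzero ring, so its image
    \<open>K\<close> is a subfield of \<open>T\<close>.\<close>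
  have "(\<lambda>c. c \<odot>\<^bsub>T\<^esub> \<one>\<^bsub>T\<^esub>) \<in> ring_hom k T"
  proof (rule ring_hom_memI)
    fix c d assume c: "c \<in> carrier k" and d: "d \<in> carrier k"
    show "(c \<otimes>\<^bsub>k\<^esub> d) \<odot>\<^bsub>T\<^esub> \<one>\<^bsub>T\<^esub> = (c \<odot>\<^bsub>T\<^esub> \<one>\<^bsub>T\<^esub>) \<otimes>\<^bsub>T\<^esub> (d \<odot>\<^bsub>T\<^esub> \<one>\<^bsub>T\<^esub>)"
      using c d smul[of c "d \<odot>\<^bsub>T\<^esub> \<one>\<^bsub>T\<^esub>"] by (simp add: al.smult_assoc1)
  qed (auto simp: al.smult_l_distr)
  then have "ring_hom_ring k T (\<lambda>c. c \<odot>\<^bsub>T\<^esub> \<one>\<^bsub>T\<^esub>)"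
    by (rule ring_hom_ringI2[OF k.ring_axioms T.ring_axioms])
  then have K: "subfield K T"
    unfolding K_def scalars_def
    by (rule ring_hom_ring.img_is_subfield(2)[OF _ k.carrier_is_subfield T.one_not_zero])
  have sK: "subring K T" by (rule subfieldE(1)[OF K])
  have KR: "K \<subseteq> R"
    unfolding K_def scalars_def using submodule.smult_closed[OF sm] subringE(3)[OF A] by auto
  have KD: "scalars k D = K" by (simp add: K_def scalars_def D_def)
  interpret K: coeff_sub T K by (rule T.coeff_subI[OF sK])
  interpret D: domain D unfolding D_def by (rule T.subring_is_domain[OF A])
  have Dc: "carrier D = R" by (simp add: D_def)
  have Rc: "R \<subseteq> carrier T" by (rule subringE(1)[OF A])
  obtain Z where Z: "finite Z" "Z \<subseteq> R" "K.ai Z"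
    and max': "\<forall>Y. finite Y \<longrightarrow> Y \<subseteq> R \<longrightarrow> K.ai Y \<longrightarrow> card Y \<le> card Z"
    and chain': "\<forall>P. T.prime_of (carrier T) P \<longrightarrow>
      (\<exists>Y n p. finite Y \<and> Y \<subseteq> R \<and> K.indm P Y \<and> card Y + n = card Z \<and>
        (\<forall>i\<le>n. T.prime_of R (p i)) \<and> (\<forall>i<n. p i \<subset> p (Suc i)) \<and> p n = P \<inter> R)"
    and mx: "\<forall>P Y. T.prime_of (carrier T) P \<longrightarrow>
      (\<forall>J. T.ideal_of (carrier T) J \<longrightarrow> P \<subseteq> J \<longrightarrow> \<one>\<^bsub>T\<^esub> \<notin> J \<longrightarrow> J = P) \<longrightarrow>
      finite Y \<longrightarrow> Y \<subseteq> carrier T \<longrightarrow> K.indm P Y \<longrightarrow> Y = {}"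
    using T.affine_chain[OF K S[folded K_def] A KR] by (elim exE conjE)
  note max = max'[rule_format] and chain = chain'[rule_format]
  have chainD: "prime_chain D n p \<longleftrightarrow> (\<forall>i\<le>n. T.prime_of R (p i)) \<and> (\<forall>i<n. p i \<subset> p (Suc i))" for n p
    unfolding D_def by (rule T.prime_chain_subring[OF A])
  \<comment> \<open>With \<open>Y\<close> empty this bounds the dimension; with a given
    \<open>Y\<close> it bounds the height of \<open>p n\<close>; and with a given chain it bounds
    the sets that are independent modulo \<open>p n\<close>.\<close>
  have bound: "card Y + n \<le> card Z"
    if p: "prime_chain D n p" and Y: "finite Y" "Y \<subseteq> R" "K.indm (p n) Y" for n p Y
  proof -
    have "\<exists>Z. finite Z \<and> Z \<subseteq> R \<and> K.indm (p 0) Z \<and> card Z = card Y + n"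
      by (rule K.indm_chain[OF A KR]) (use p Y chainD in auto)
    then show ?thesis using max K.indm_ai by metis
  qed
  have contract: "T.prime_of R (P \<inter> R)" if "T.prime_of (carrier T) P" for P
    by (rule T.prime_of_contract[OF that Rc A])
  \<comment> \<open>The ring \<open>K.gen Y\<close> lies in \<open>R\<close>, so it meets
    \<open>P\<close> and its contraction in the same elements.\<close>
  have indm_contract: "K.indm (P \<inter> R) Y \<longleftrightarrow> K.indm P Y" if "Y \<subseteq> R" for P Y
  proof -
    have "K.gen Y \<subseteq> R" by (rule K.gen_min[OF A KR that])
    then show ?thesis unfolding K.indm_def by blast
  qed
  \<comment> \<open>The equation \<open>card Y + n = card Z\<close> makes both bounds sharp at once:
    the chain shows that \<open>Y\<close> is largest, and \<open>Y\<close> shows that the chain is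
    longest.\<close>
  have main: "height D (P \<inter> R) = enat n"
    "td k (quotient_algebra D (P \<inter> R)) = enat (card Y)"
    if P: "T.prime_of (carrier T) P" and Y: "finite Y" "Y \<subseteq> R" "K.indm P Y" "card Y + n = card Z"
      and p: "prime_chain D n p" "p n = P \<inter> R" for P Y n p
  proof -
    have iY: "K.indm (P \<inter> R) Y" using indm_contract[OF Y(2)] Y(3) by blast
    have "(SUP n\<in>{n. \<exists>p. prime_chain D n p \<and> p n = P \<inter> R}. enat (id n)) = enat (id n)"
    proof (rule SUP_enat_max)
      show "n \<in> {n. \<exists>p. prime_chain D n p \<and> p n = P \<inter> R}" using p by blast
      show "id m \<le> id n" if m: "m \<in> {n. \<exists>p. prime_chain D n p \<and> p n = P \<inter> R}" for m
      proof -
        obtain q where q: "prime_chain D m q" "q m = P \<inter> R" using m by blast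
        have "card Y + m \<le> card Z" by (rule bound[OF q(1) Y(1,2)]) (simp add: q(2) iY)
        then show ?thesis using Y(4) by simp
      qed
    qed
    then show "height D (P \<inter> R) = enat n" by (simp add: height_def)
    have id: "ideal (P \<inter> R) D"
      using T.primeideal_iff[OF A, of "P \<inter> R"] contract[OF P] by (simp add: D_def primeideal.axioms(1))
    have sc: "scalars k (quotient_algebra D (P \<inter> R)) = (\<lambda>x. (P \<inter> R) +>\<^bsub>D\<^esub> x) ` K"
      unfolding KD[symmetric]
    proof (rule scalars_quotient_algebra[OF D.is_cring id])
      show "c \<odot>\<^bsub>D\<^esub> x = c \<odot>\<^bsub>D\<^esub> \<one>\<^bsub>D\<^esub> \<otimes>\<^bsub>D\<^esub> x" if "c \<in> carrier k" "x \<in> carrier D" for c x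
        using smul[of c x] that Rc by (auto simp: D_def)
      show "c \<odot>\<^bsub>D\<^esub> \<one>\<^bsub>D\<^esub> \<in> carrier D" if "c \<in> carrier k" for c
        using submodule.smult_closed[OF sm that] subringE(3)[OF A] by (simp add: D_def)
    qed
    have one: "\<one>\<^bsub>quotient_algebra D (P \<inter> R)\<^esub> = \<one>\<^bsub>D Quot (P \<inter> R)\<^esub>"
      by (simp add: quotient_algebra_def ring.defs)
    show "td k (quotient_algebra D (P \<inter> R)) = enat (card Y)"
      unfolding td_def quotient_field_quotient_algebra sc one
      unfolding D_def
    proof (rule T.transcendence_degree_quotient[OF A K KR contract[OF P] Y(1,2) iY])
      show "card Y' \<le> card Y" if "finite Y'" "Y' \<subseteq> R" "K.indm (P \<inter> R) Y'" for Y'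
        using bound[OF p(1) that(1,2)] that(3) p(2) Y(4) by simp
    qed
  qed
  have "T.ideal_of (carrier T) {\<zero>\<^bsub>T\<^esub>}" using T.prime_ofD(1)[OF T.zero_prime[OF T.carrier_is_subring]] .
  \<comment> \<open>Modulo a maximal ideal of \<open>T\<close> only the empty set is independent, so
    nothing is subtracted from the length of the chain.\<close>
  have maxchain: "\<exists>p. prime_chain D (card Z) p \<and> p (card Z) = P \<inter> R"
    if P: "T.prime_of (carrier T) P"
      and PJ: "\<forall>J. T.ideal_of (carrier T) J \<longrightarrow> P \<subseteq> J \<longrightarrow> \<one>\<^bsub>T\<^esub> \<notin> J \<longrightarrow> J = P" for P
  proof -
    obtain Y n p where *: "finite Y \<and> Y \<subseteq> R \<and> K.indm P Y \<and> card Y + n = card Z \<and>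
        (\<forall>i\<le>n. T.prime_of R (p i)) \<and> (\<forall>i<n. p i \<subset> p (Suc i)) \<and> p n = P \<inter> R"
      using chain[OF P] by (elim exE)
    then have "finite Y" "Y \<subseteq> carrier T" "K.indm P Y" using Rc by auto
    then have "Y = {}" using mx P PJ by blast
    then show ?thesis using * chainD by auto
  qed
  have exmax: "\<exists>P. T.prime_of (carrier T) P \<and> I \<subseteq> P \<and>
      (\<forall>J. T.ideal_of (carrier T) J \<longrightarrow> P \<subseteq> J \<longrightarrow> \<one>\<^bsub>T\<^esub> \<notin> J \<longrightarrow> J = P)"
    if I: "T.ideal_of (carrier T) I" "\<one>\<^bsub>T\<^esub> \<notin> I" for I
    by (rule T.exists_prime_avoiding[OF T.carrier_is_subring I(1), of "{\<one>\<^bsub>T\<^esub>}"]) (use I(2) in auto)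
  have empty: "K.indm (p n) {}" if "prime_chain D n p" for n p
    by (rule K.indm_empty[OF K KR]) (use that chainD in blast)
  have ub: "n \<le> card Z" if "prime_chain D n p" for n p
    using bound[OF that finite.emptyI empty_subsetI empty[OF that]] by simp
  have kd: "krull_dim D = enat (card Z)"
  proof -
    obtain P where "T.prime_of (carrier T) P"
      "\<forall>J. T.ideal_of (carrier T) J \<longrightarrow> P \<subseteq> J \<longrightarrow> \<one>\<^bsub>T\<^esub> \<notin> J \<longrightarrow> J = P"
      using exmax[OF T.prime_ofD(1,2)[OF T.zero_prime[OF T.carrier_is_subring]]] by blast
    then have "\<exists>p. prime_chain D (card Z) p" using maxchain by blast
    then have "(SUP n\<in>{n. \<exists>p. prime_chain D n p}. enat (id n)) = enat (id (card Z))"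
      by (intro SUP_enat_max) (use ub in auto)
    then show ?thesis by (simp add: krull_dim_def)
  qed
  have t: "td k D = enat (card Z)"
    unfolding td_def KD unfolding D_def
    using T.transcendence_degree_subring[OF A sK KR Z max] by simp
  have "jaffard_domain D"
    unfolding jaffard_domain_def
  proof (intro conjI allI impI)
    show "domain D" by (rule D.domain_axioms)
    show "krull_dim D \<noteq> \<infinity>" unfolding kd by simp
    fix n :: nat assume "1 \<le> n"
    obtain P where "T.prime_of (carrier T) P"
      "\<forall>J. T.ideal_of (carrier T) J \<longrightarrow> P \<subseteq> J \<longrightarrow> \<one>\<^bsub>T\<^esub> \<notin> J \<longrightarrow> J = P"
      using exmax[OF T.prime_ofD(1,2)[OF T.zero_prime[OF T.carrier_is_subring]]] by blast
    then obtain q where q: "prime_chain D (card Z) q" using maxchain by blast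
    have "\<exists>p. prime_chain (indexed_poly_ring D {..<n}) (card Z + n) p"
      by (rule D.poly_chain_extend[of _ q]) (use q in \<open>auto simp: prime_chain_def D.primeideal_carrier\<close>)
    \<comment> \<open>A largest independent subset of \<open>R\<close> cannot be enlarged by any
      element, which is the form of maximality asked for by the bound for polynomial rings.\<close>
    moreover have "N \<le> card Z + n" if "prime_chain (indexed_poly_ring D {..<n}) N p" for N p
    proof (rule D.poly_chain_bound[OF _ Z(1) _ _ _ that])
      have aiD: "algebraically_independent D K Y \<longleftrightarrow> K.ai Y" if "finite Y" "Y \<subseteq> R" for Y
        unfolding D_def by (rule T.alg_indep_subring[OF A sK KR that])
      show "subfield K D"
        by (rule D.subfield_iff(1)) (use T.subfield_iff(2)[OF K] KR in \<open>auto simp: D_def\<close>)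
      show "Z \<subseteq> carrier D" "algebraically_independent D K Z" using Z aiD Dc by auto
      show "\<not> algebraically_independent D K (insert x Z)" if "x \<in> carrier D" "x \<notin> Z" for x
        using max[of "insert x Z"] aiD[of "insert x Z"] Z that Dc by auto
    qed
    ultimately have "(SUP n\<in>{N. \<exists>p. prime_chain (indexed_poly_ring D {..<n}) N p}. enat (id n)) = enat (id (card Z + n))"
      by (intro SUP_enat_max) auto
    then show "krull_dim (indexed_poly_ring D {..<n}) = enat n + krull_dim D"
      unfolding kd by (simp add: krull_dim_def add.commute)
  qed
  moreover have "krull_dim D = height D (P \<inter> R) + td k (quotient_algebra D (P \<inter> R))"
    if "primeideal P T" for P
  proof -
    have P: "T.prime_of (carrier T) P" using that T.primeideal_carrier by blast
    obtain Y n p where *: "finite Y \<and> Y \<subseteq> R \<and> K.indm P Y \<and> card Y + n = card Z \<and>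
        (\<forall>i\<le>n. T.prime_of R (p i)) \<and> (\<forall>i<n. p i \<subset> p (Suc i)) \<and> p n = P \<inter> R"
      using chain[OF P] by (elim exE)
    then have "prime_chain D n p" using chainD by blast
    then show ?thesis using main[OF P, of Y n p] * unfolding kd by (simp add: add.commute)
  qed
  moreover have "krull_dim D = height D M" if M: "maximalideal M D" "survives M T" for M
  proof -
    interpret M: maximalideal M D by (rule M(1))
    have MR: "M \<subseteq> R" using M.Icarr Dc by blast
    then have Mc: "M \<subseteq> carrier T" using Rc by blast
    interpret I: ideal "Idl\<^bsub>T\<^esub> M" T by (rule T.genideal_ideal[OF Mc])
    \<comment> \<open>Survival makes the ideal generated by \<open>M\<close> proper, so it lies in a
      maximal ideal of \<open>T\<close>. The contraction of the latter is a prime containing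
      \<open>M\<close>, hence it is \<open>M\<close>.\<close>
    have n1: "\<one>\<^bsub>T\<^esub> \<notin> Idl\<^bsub>T\<^esub> M" using M(2) I.one_imp_carrier by (auto simp: survives_def)
    have "T.ideal_of (carrier T) (Idl\<^bsub>T\<^esub> M)"
      unfolding T.ideal_of_def using I.a_subset I.I_l_closed by auto
    then obtain P where P: "T.prime_of (carrier T) P" "Idl\<^bsub>T\<^esub> M \<subseteq> P"
      and PJ: "\<forall>J. T.ideal_of (carrier T) J \<longrightarrow> P \<subseteq> J \<longrightarrow> \<one>\<^bsub>T\<^esub> \<notin> J \<longrightarrow> J = P"
      using exmax n1 by blast
    have pP: "primeideal (P \<inter> R) D"
      using T.primeideal_iff[OF A] contract[OF P(1)] by (simp add: D_def)
    have "M \<subseteq> P \<inter> R" using T.genideal_self[OF Mc] P(2) MR by blast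
    then have "P \<inter> R = M \<or> P \<inter> R = carrier D"
      using M.I_maximal[of "P \<inter> R"] primeideal.axioms(1)[OF pP] Dc by auto
    then have PM: "P \<inter> R = M" using primeideal.I_notcarr[OF pP] by blast
    obtain p where p: "prime_chain D (card Z) p" "p (card Z) = P \<inter> R"
      using maxchain[OF P(1) PJ] by blast
    have "K.indm P {}" by (rule K.indm_empty[OF K _ P(1)]) (use KR Rc in blast)
    then have "height D (P \<inter> R) = enat (card Z)"
      using main(1)[OF P(1), of "{}" "card Z" p] p by simp
    then show ?thesis unfolding kd PM by simp
  qed
  ultimately show ?thesis using kd t unfolding D_def by auto
qed

end
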